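(* Let $\Omega$ be a Lipschitz cone in $\mathbb{R}^n$, $n\ge2$, with cross-section $\Sigma$, and let $\mu\le\mu_0$. Then the equation $P_\mu u=0$ in $\Omega$ admits positive solutions of the form $$u_\pm(x)=|x|^{\gamma_\pm}\phi_\mu\Big(\frac{x}{|x|}\Big),$$ where $\phi_\mu$ is a positive solution of the equation $$\Big(-\Delta_S-\frac{\mu}{\delta_\Omega^2(\omega)}\Big)\phi_\mu=\sigma(\mu)\phi_\mu\qquad\text{in }\Sigma,$$ $$-\frac{(n-2)^2}{4}\le\sigma(\mu):=\lambda_0\Big(-\Delta_S-\frac{\mu}{\delta_\Omega^2},\mathbf{1},\Sigma\Big),$$ and $$\gamma_\pm:=\frac{2-n\pm\sqrt{(n-2)^2+4\sigma(\mu)}}{2}.$$ Moreover, if $\sigma(\mu)>-(n-2)^2/4$, then there are two linearly independent positive solutions of the equation $P_\mu u=0$ in $\Omega$ of the form $u_\pm(x)=|x|^{\gamma_\pm}\phi_\mu(x/|x|)$, and $P_\mu$ is subcritical in $\Omega$. In particular, for any $\mu\le\mu_0$ we have $\sigma(\mu)>-\infty$.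
   Context: A Lipschitz cone is a set $\Omega=\{x\in\mathbb{R}^n : |x|>0,\ x/|x|\in\Sigma\}$, where $\Sigma$ is a Lipschitz domain (open, connected) in the unit sphere $\mathbb{S}^{n-1}$, $n\ge2$. $\delta_\Omega(x)=\mathrm{dist}(x,\partial\Omega)$, and $P_\mu:=-\Delta-\mu\,\delta_\Omega^{-2}$. $\Delta_S$ is the Laplace–Beltrami operator on $\mathbb{S}^{n-1}$; on $\Sigma\subset\Omega$, $\delta_\Omega(\omega)$ is the restriction of $\delta_\Omega$. For a symmetric second-order elliptic operator $P$ on a domain $D$ (of $\mathbb{R}^n$ or of $\mathbb{S}^{n-1}$), $P\ge0$ in $D$ means that $Pu=0$ admits a positive (super)solution in $D$; equivalently, the quadratic form of $P$ is nonnegative on $C_0^\infty(D)$. For $W\ge 0$, $W\ne0$, $\lambda_0(P,W,D):=\sup\{\lambda\in\mathbb{R}: P-\lambda W\ge0\text{ in }D\}$ (with $\sup\emptyset=-\infty$). $\mu_0:=\lambda_0(-\Delta,\delta_\Omega^{-2},\Omega)$. A nonnegative operator $P$ with quadratic form $q$ is subcritical in $D$ if there is a nonnegative function $W\ne0$ with $q(\varphi)\ge\int_DW|\varphi|^2$ for all $\varphi\in C_0^\infty(D)$. *)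

theory Defs
  imports "HOL-Analysis.Analysis"
begin

section \<open>Differential operators on Euclidean space\<close>

definition gradient :: "('a::euclidean_space \<Rightarrow> real) \<Rightarrow> 'a \<Rightarrow> 'a" where
  "gradient u x = (\<Sum>b\<in>Basis. frechet_derivative u (at x) b *\<^sub>R b)"

definition divergence :: "('a::euclidean_space \<Rightarrow> 'a) \<Rightarrow> 'a \<Rightarrow> real" where
  "divergence F x = (\<Sum>b\<in>Basis. frechet_derivative F (at x) b \<bullet> b)"

definition laplacian :: "('a::euclidean_space \<Rightarrow> real) \<Rightarrow> 'a \<Rightarrow> real" where
  "laplacian u = divergence (gradient u)"

text \<open>\<open>Ck_on k u D\<close> is meant for open \<open>D\<close>; the vector \<open>v\<close> ranges over all directions.\<close>

primrec Ck_on :: "nat \<Rightarrow> ('a::euclidean_space \<Rightarrow> real) \<Rightarrow> 'a set \<Rightarrow> bool" where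
  "Ck_on 0 u D \<longleftrightarrow> continuous_on D u"
| "Ck_on (Suc k) u D \<longleftrightarrow>
     (\<forall>x\<in>D. u differentiable (at x)) \<and>
     (\<forall>v. Ck_on k (\<lambda>x. frechet_derivative u (at x) v) D)"

definition smooth_on :: "('a::euclidean_space \<Rightarrow> real) \<Rightarrow> 'a set \<Rightarrow> bool" where
  "smooth_on u D \<longleftrightarrow> (\<forall>k. Ck_on k u D)"

definition test_functions :: "'a::euclidean_space set \<Rightarrow> ('a \<Rightarrow> real) set" where
  "test_functions D =
     {\<phi>. smooth_on \<phi> UNIV \<and> (\<exists>K. compact K \<and> K \<subseteq> D \<and> (\<forall>x. x \<notin> K \<longrightarrow> \<phi> x = 0))}"


section \<open>Calculus on the unit sphere\<close>

text \<open>
  A function on (a subset of) the unit sphere is represented by a function on the ambient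
  space of which only the values on the sphere matter. It is extended to the punctured
  space as a function that is constant along rays; note that \<open>sgn x = x /\<^sub>R norm x\<close>.
  Since the derivative of the extension in the radial direction vanishes, its gradient at a
  point of the sphere is the tangential (Riemannian) gradient. For the same reason the trace of
  the derivative of an extended tangential field is its trace over the tangent space, which is
  the Riemannian divergence.
\<close>

definition radial_ext :: "('a::euclidean_space \<Rightarrow> 'b) \<Rightarrow> 'a \<Rightarrow> 'b" where
  "radial_ext f x = f (sgn x)"

definition sphere_gradient :: "('a::euclidean_space \<Rightarrow> real) \<Rightarrow> 'a \<Rightarrow> 'a" where
  "sphere_gradient f = gradient (radial_ext f)"

definition sphere_divergence :: "('a::euclidean_space \<Rightarrow> 'a) \<Rightarrow> 'a \<Rightarrow> real" where
  "sphere_divergence F = divergence (radial_ext F)"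

definition laplace_beltrami :: "('a::euclidean_space \<Rightarrow> real) \<Rightarrow> 'a \<Rightarrow> real" where
  "laplace_beltrami f = sphere_divergence (sphere_gradient f)"

text \<open>
  The surface measure given by polar coordinates: the measure of a Borel subset \<open>A\<close> of the unit
  sphere is the dimension times the Lebesgue measure of the part of the unit ball over \<open>A\<close>.
\<close>

definition sphere_measure :: "'a::euclidean_space measure" where
  "sphere_measure =
     scale_measure (of_nat DIM('a)) (distr (restrict_space lborel (ball 0 1)) borel sgn)"

definition cone_over :: "'a::euclidean_space set \<Rightarrow> 'a set" where
  "cone_over S = {x. norm x > 0 \<and> x /\<^sub>R norm x \<in> S}"

definition sphere_C2_on :: "('a::euclidean_space \<Rightarrow> real) \<Rightarrow> 'a set \<Rightarrow> bool" where
  "sphere_C2_on f S \<longleftrightarrow> Ck_on 2 (radial_ext f) (cone_over S)"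

definition sphere_test_functions :: "'a::euclidean_space set \<Rightarrow> ('a \<Rightarrow> real) set" where
  "sphere_test_functions S =
     {\<phi>. smooth_on (radial_ext \<phi>) (- {0}) \<and>
         (\<exists>K. compact K \<and> K \<subseteq> S \<and> (\<forall>w\<in>sphere 0 1. w \<notin> K \<longrightarrow> \<phi> w = 0))}"


section \<open>Lipschitz domains in the sphere\<close>

text \<open>
  Near a boundary point \<open>w\<close>, the set \<open>S\<close> is, in the smooth chart \<open>v \<mapsto> (w + v) / |w + v|\<close> defined on
  the hyperplane orthogonal to \<open>w\<close>, the region strictly above a Lipschitz graph in some
  direction \<open>e\<close> of that hyperplane. The notion does not depend on the choice of the chart.
\<close>

definition lipschitz_boundary_at :: "'a::euclidean_space set \<Rightarrow> 'a \<Rightarrow> bool" where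
  "lipschitz_boundary_at S w \<longleftrightarrow>
     (\<exists>e g L r. r > 0 \<and> norm e = 1 \<and> e \<bullet> w = 0 \<and>
        L-lipschitz_on {z. z \<bullet> w = 0 \<and> z \<bullet> e = 0} (g :: 'a \<Rightarrow> real) \<and>
        (\<forall>v. v \<bullet> w = 0 \<and> norm v < r \<longrightarrow>
           ((w + v) /\<^sub>R norm (w + v) \<in> S \<longleftrightarrow> g (v - (v \<bullet> e) *\<^sub>R e) < v \<bullet> e)))"

text \<open>As the sphere is closed, \<open>closure S - S\<close> is the boundary of \<open>S\<close> relative to the sphere.\<close>

definition lipschitz_domain_in_sphere :: "'a::euclidean_space set \<Rightarrow> bool" where
  "lipschitz_domain_in_sphere S \<longleftrightarrow>
     S \<noteq> {} \<and> openin (top_of_set (sphere 0 1)) S \<and> connected S \<and>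
     (\<forall>w\<in>closure S - S. lipschitz_boundary_at S w)"

definition bdist :: "'a::euclidean_space set \<Rightarrow> 'a \<Rightarrow> real" where
  "bdist D x = infdist x (frontier D)"


section \<open>Schroedinger operators and their quadratic forms\<close>

text \<open>An operator \<open>- \<Delta> + V\<close> or \<open>- \<Delta>\<^sub>S + V\<close> is represented by its potential \<open>V\<close>.\<close>

definition schroedinger :: "('a::euclidean_space \<Rightarrow> real) \<Rightarrow> ('a \<Rightarrow> real) \<Rightarrow> 'a \<Rightarrow> real" where
  "schroedinger V u x = - laplacian u x + V x * u x"

definition schroedinger_sphere :: "('a::euclidean_space \<Rightarrow> real) \<Rightarrow> ('a \<Rightarrow> real) \<Rightarrow> 'a \<Rightarrow> real" where
  "schroedinger_sphere V u w = - laplace_beltrami u w + V w * u w"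

definition form :: "('a::euclidean_space \<Rightarrow> real) \<Rightarrow> 'a set \<Rightarrow> ('a \<Rightarrow> real) \<Rightarrow> real" where
  "form V D \<phi> = (LINT x:D|lborel. (norm (gradient \<phi> x))\<^sup>2 + V x * (\<phi> x)\<^sup>2)"

definition form_sphere :: "('a::euclidean_space \<Rightarrow> real) \<Rightarrow> 'a set \<Rightarrow> ('a \<Rightarrow> real) \<Rightarrow> real" where
  "form_sphere V S \<phi> =
     (LINT w:S|sphere_measure. (norm (sphere_gradient \<phi> w))\<^sup>2 + V w * (\<phi> w)\<^sup>2)"

definition nonneg_op :: "'a::euclidean_space set \<Rightarrow> ('a \<Rightarrow> real) \<Rightarrow> bool" where
  "nonneg_op D V \<longleftrightarrow> (\<forall>\<phi>\<in>test_functions D. 0 \<le> form V D \<phi>)"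

definition nonneg_op_sphere :: "'a::euclidean_space set \<Rightarrow> ('a \<Rightarrow> real) \<Rightarrow> bool" where
  "nonneg_op_sphere S V \<longleftrightarrow> (\<forall>\<phi>\<in>sphere_test_functions S. 0 \<le> form_sphere V S \<phi>)"

text \<open>Here \<open>N\<close> is \<open>nonneg_op D\<close> or \<open>nonneg_op_sphere S\<close>; in \<open>ereal\<close> the supremum of \<open>{}\<close> is \<open>- \<infinity>\<close>.\<close>

definition lambda0 :: "(('a \<Rightarrow> real) \<Rightarrow> bool) \<Rightarrow> ('a \<Rightarrow> real) \<Rightarrow> ('a \<Rightarrow> real) \<Rightarrow> ereal" where
  "lambda0 N V W = Sup {ereal l | l. N (\<lambda>x. V x - l * W x)}"

definition subcritical :: "'a::euclidean_space set \<Rightarrow> ('a \<Rightarrow> real) \<Rightarrow> bool" where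
  "subcritical D V \<longleftrightarrow> nonneg_op D V \<and>
     (\<exists>W. set_borel_measurable lborel D W \<and> (\<forall>x\<in>D. 0 \<le> W x) \<and>
        \<not> (AE x in lborel. x \<in> D \<longrightarrow> W x = 0) \<and>
        (\<forall>\<phi>\<in>test_functions D.
           set_integrable lborel D (\<lambda>x. W x * (\<phi> x)\<^sup>2) \<and>
           (LINT x:D|lborel. W x * (\<phi> x)\<^sup>2) \<le> form V D \<phi>))"

definition positive_solution :: "'a::euclidean_space set \<Rightarrow> ('a \<Rightarrow> real) \<Rightarrow> ('a \<Rightarrow> real) \<Rightarrow> bool" where
  "positive_solution D V u \<longleftrightarrow>
     Ck_on 2 u D \<and> (\<forall>x\<in>D. 0 < u x) \<and> (\<forall>x\<in>D. schroedinger V u x = 0)"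


section \<open>The Hardy operator of a cone\<close>

text \<open>The potential of \<open>P\<^sub>\<mu>\<close>. Its restriction to \<open>S\<close>, when \<open>D = cone_over S\<close>, is the
  potential of the operator on the cross-section.\<close>

definition hardy_potential :: "'a::euclidean_space set \<Rightarrow> real \<Rightarrow> 'a \<Rightarrow> real" where
  "hardy_potential D \<mu> x = - \<mu> / (bdist D x)\<^sup>2"

definition hardy_const :: "'a::euclidean_space set \<Rightarrow> ereal" where
  "hardy_const D = lambda0 (nonneg_op D) (\<lambda>x. 0) (\<lambda>x. 1 / (bdist D x)\<^sup>2)"

definition sigma_const :: "'a::euclidean_space set \<Rightarrow> real \<Rightarrow> ereal" where
  "sigma_const S \<mu> = lambda0 (nonneg_op_sphere S) (hardy_potential (cone_over S) \<mu>) (\<lambda>w. 1)"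

end

theory Submission
  imports Defs "HOL-Complex_Analysis.Great_Picard"
begin

text \<open>
  Trial functions \<open>|x| powr ((2 - n) / 2) \<eta>(ln |x|) f(x / |x|)\<close> with slowly varying \<open>\<eta>\<close> turn \<open>P\<^sub>\<mu> \<ge> 0\<close> on the
  cone into \<open>\<sigma>(\<mu>) \<ge> - (n - 2)\<^sup>2 / 4\<close>. The eigenfunction \<open>\<phi>\<close> is a limit of positive polynomials on the
  whole sphere: the potential is replaced near the boundary of the cross-section by a continuous one for which
  the bottom of the spectrum tends to \<open>\<sigma>(\<mu>)\<close>; approximate eigenfunctions of the new operator exist among
  polynomials since \<open>- \<Delta>\<^sub>S + c\<close> is invertible on them; Harnack's inequality and interior gradient
  estimates give locally uniform convergence, and the limit equation is recovered by elementary regularity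
  theory. As \<open>\<gamma> (\<gamma> + n - 2) = \<sigma>\<close> for \<open>\<gamma> = \<gamma>\<^sub>\<plusminus>\<close>, the functions \<open>|x| powr \<gamma> \<phi>(x / |x|)\<close> are solutions. For \<open>\<gamma> = (2 - n) / 2\<close> the
  same function solves the equation with the potential decreased by \<open>(\<sigma> + (n - 2)\<^sup>2 / 4) / |x|\<^sup>2\<close>, and Picone's
  inequality turns it into the Hardy weight that makes \<open>P\<^sub>\<mu>\<close> subcritical.
\<close>

section \<open>Functions of class \<open>C\<^sup>k\<close>\<close>

text \<open>All derivatives are classical, so two substitutes for Hilbert space methods are needed.
  With a variable potential, polynomials solve an equation only up to a small uniform error;
  solutions therefore appear as uniform limits of C^2 functions whose Laplacians converge uniformly
  too (\<open>conv_pair\<close>), and a gradient bound obtained from the maximum principle alone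
  makes such limits C^2. Secondly, polynomials do not vanish on the boundary of the cross-section,
  where the potential may explode. Localising with 1 - \<zeta>^2 bounds the potential but keeps the
  bottom of the spectrum at least \<sigma>; as nothing changes on a compact K, test functions
  supported in K bound it from above, and exhausting the cross-section squeezes it to \<sigma>. The
  number (n - 2)^2 / 4 is the maximum of - a (a + n - 2), attained at a = (2 - n) / 2, the midpoint
  of the two exponents \<gamma>. With this a all terms of the form carry the weight |x|^(-n),
  invariant under dilations, so that only the length of the cut-off in ln |x| remains as a
  parameter.\<close>

abbreviation dd :: "'a::euclidean_space \<Rightarrow> ('a \<Rightarrow> real) \<Rightarrow> 'a \<Rightarrow> real" where
  "dd v u \<equiv> (\<lambda>x. frechet_derivative u (at x) v)"

lemma dd_eq: "(u has_derivative u') (at x) \<Longrightarrow> dd v u x = u' v"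
  using frechet_derivative_at by metis

lemma dd_bounded_linear:
  "u differentiable (at x) \<Longrightarrow> bounded_linear (\<lambda>v. dd v u x)"
  using frechet_derivative_works has_derivative_bounded_linear by blast

lemma frechet_derivative_cong_open:
  assumes "open D" "x \<in> D" "\<And>y. y \<in> D \<Longrightarrow> u y = v y"
  shows "frechet_derivative u (at x) = frechet_derivative v (at x)"
proof -
  have "(u has_derivative f') (at x) \<longleftrightarrow> (v has_derivative f') (at x)" for f'
    using has_derivative_transform_within_open[OF _ assms(1,2)] assms(3) by metis
  then show ?thesis by (simp add: frechet_derivative_def)
qed

lemma differentiable_cong_open:
  assumes "open D" "x \<in> D" "\<And>y. y \<in> D \<Longrightarrow> u y = v y" "u differentiable (at x)"
  shows "v differentiable (at x)"
  using assms has_derivative_transform_within_open unfolding differentiable_def by metis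

lemma Ck_on_SucD: "Ck_on (Suc k) u D \<Longrightarrow> Ck_on k u D"
  by (induction k arbitrary: u)
    (auto intro!: continuous_at_imp_continuous_on differentiable_imp_continuous_within)

lemma Ck_on_le: "Ck_on k u D \<Longrightarrow> j \<le> k \<Longrightarrow> Ck_on j u D"
  by (induction k) (auto simp: le_Suc_eq simp del: Ck_on.simps dest: Ck_on_SucD)

lemma Ck_on_subset: "Ck_on k u D \<Longrightarrow> E \<subseteq> D \<Longrightarrow> Ck_on k u E"
  by (induction k arbitrary: u) (auto intro: continuous_on_subset)

lemma Ck_on_cong:
  assumes "open D" "\<And>x. x \<in> D \<Longrightarrow> u x = v x" "Ck_on k u D"
  shows "Ck_on k v D"
  using assms(2,3)
proof (induction k arbitrary: u v)
  case 0
  then show ?case using continuous_on_cong by auto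
next
  case (Suc k)
  have diff: "v differentiable (at x)" if "x \<in> D" for x
    using differentiable_cong_open[OF assms(1) that] Suc.prems that by auto
  have "dd w u x = dd w v x" if "x \<in> D" for w x
    using frechet_derivative_cong_open[OF assms(1) that, of u v] Suc.prems(1) by simp
  then have "Ck_on k (dd w v) D" for w
    using Suc.IH[of "dd w u" "dd w v"] Suc.prems(2) by simp
  with diff show ?case by simp
qed

lemma Ck_on_Un:
  assumes "open D" "open E" "Ck_on k u D" "Ck_on k u E"
  shows "Ck_on k u (D \<union> E)"
  using assms(3,4)
  by (induction k arbitrary: u) (use assms(1,2) continuous_on_open_Un in \<open>auto\<close>)

lemma Ck_on_const: "Ck_on k (\<lambda>x. c) D"
  by (induction k arbitrary: c) (auto simp: dd_eq[OF has_derivative_const])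

lemma Ck_on_bounded_linear:
  assumes "bounded_linear f" shows "Ck_on k f D"
proof (cases k)
  case 0
  then show ?thesis using assms linear_continuous_on by auto
next
  case (Suc j)
  have "(f has_derivative f) (at x)" for x
    using assms by (simp add: bounded_linear_imp_has_derivative)
  then have "f differentiable (at x)" "dd v f x = f v" for x v
    by (auto simp: dd_eq differentiable_def)
  then show ?thesis using Suc Ck_on_const by auto
qed

lemma Ck_on_inner: "Ck_on k (\<lambda>x. x \<bullet> b) D"
  by (rule Ck_on_bounded_linear) (rule bounded_linear_inner_left)

lemma dd_add:
  assumes "u differentiable (at x)" "v differentiable (at x)"
  shows "dd w (\<lambda>x. u x + v x) x = dd w u x + dd w v x"
  using assms has_derivative_add[of u _ "at x" v] dd_eq
  unfolding frechet_derivative_works by metis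

lemma dd_mult:
  assumes "u differentiable (at x)" "v differentiable (at x)"
  shows "dd w (\<lambda>x. u x * v x) x = u x * dd w v x + dd w u x * v x"
  using assms has_derivative_mult[of u _ x UNIV v] dd_eq[of "\<lambda>x. u x * v x"]
  unfolding frechet_derivative_works by metis

lemma dd_const: "dd w (\<lambda>x. c) x = 0"
  by (simp add: dd_eq[OF has_derivative_const])

lemma dd_inner: "dd w (\<lambda>x. x \<bullet> b) x = w \<bullet> b"
  by (intro dd_eq[THEN trans, of _ "\<lambda>w. w \<bullet> b"]) (auto intro!: derivative_eq_intros)

lemma dd_cmult:
  assumes "u differentiable (at x)"
  shows "dd w (\<lambda>x. c * u x) x = c * dd w u x"
  using dd_mult[of "\<lambda>_. c" x u w] assms by (simp add: dd_const)

lemma dd_diff: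
  assumes "u differentiable (at x)" "v differentiable (at x)"
  shows "dd w (\<lambda>x. u x - v x) x = dd w u x - dd w v x"
  using assms has_derivative_diff[of u _ "at x" v] dd_eq
  unfolding frechet_derivative_works by metis

lemma dd_compose_real:
  assumes g: "g differentiable (at x)" and h: "h differentiable (at (g x))"
  shows "dd v (\<lambda>x. h (g x)) x = dd v g x * dd 1 h (g x)"
proof -
  have "((\<lambda>x. h (g x)) has_derivative (\<lambda>v. frechet_derivative h (at (g x)) (dd v g x))) (at x)"
    using has_derivative_compose[OF g[unfolded frechet_derivative_works] h[unfolded frechet_derivative_works]] .
  then have "dd v (\<lambda>x. h (g x)) x = frechet_derivative h (at (g x)) (dd v g x *\<^sub>R 1)"
    by (simp add: dd_eq)
  also have "\<dots> = dd v g x * dd 1 h (g x)"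
    using linear.scaleR[OF linear_frechet_derivative[OF h], of "dd v g x" 1] by simp
  finally show ?thesis .
qed

lemma dd_real: "(h has_real_derivative h') (at t) \<Longrightarrow> dd v h t = v * h'"
  by (simp add: dd_eq[OF has_field_derivative_imp_has_derivative] mult.commute)

lemma Ck_on_add:
  assumes "open D" "Ck_on k u D" "Ck_on k v D"
  shows "Ck_on k (\<lambda>x. u x + v x) D"
  using assms(2,3)
proof (induction k arbitrary: u v)
  case 0
  then show ?case by (auto intro: continuous_on_add)
next
  case (Suc k)
  have "Ck_on k (dd w (\<lambda>x. u x + v x)) D" for w
    by (rule Ck_on_cong[OF assms(1) _ Suc.IH[of "dd w u" "dd w v"]])
      (use Suc.prems dd_add in \<open>auto simp: dd_add\<close>)
  then show ?case using Suc.prems by auto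
qed

lemma Ck_on_mult:
  assumes "open D" "Ck_on k u D" "Ck_on k v D"
  shows "Ck_on k (\<lambda>x. u x * v x) D"
  using assms(2,3)
proof (induction k arbitrary: u v)
  case 0
  then show ?case by (auto intro: continuous_on_mult)
next
  case (Suc k)
  have "Ck_on k u D" "Ck_on k v D" using Suc.prems Ck_on_SucD by blast+
  then have "Ck_on k (\<lambda>x. u x * dd w v x + dd w u x * v x) D" for w
    using Suc.prems by (intro Ck_on_add[OF assms(1)] Suc.IH) auto
  then have "Ck_on k (dd w (\<lambda>x. u x * v x)) D" for w
    by (rule Ck_on_cong[OF assms(1), rotated]) (use Suc.prems in \<open>auto simp: dd_mult\<close>)
  then show ?case using Suc.prems by auto
qed

lemma Ck_on_cmult: "open D \<Longrightarrow> Ck_on k u D \<Longrightarrow> Ck_on k (\<lambda>x. c * u x) D"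
  using Ck_on_mult[OF _ Ck_on_const] by blast

lemma Ck_on_diff: "open D \<Longrightarrow> Ck_on k u D \<Longrightarrow> Ck_on k v D \<Longrightarrow> Ck_on k (\<lambda>x. u x - v x) D"
  using Ck_on_add[OF _ _ Ck_on_cmult[where c="-1"]] by fastforce

lemma Ck_on_sum:
  assumes "open D" "\<And>i. i \<in> I \<Longrightarrow> Ck_on k (u i) D"
  shows "Ck_on k (\<lambda>x. \<Sum>i\<in>I. u i x) D"
  using assms(2) by (induction I rule: infinite_finite_induct)
    (auto intro!: Ck_on_add[OF assms(1)] Ck_on_const)

text \<open>The induction varies \<open>h\<close> alone: the derivative of \<open>h (g x)\<close> is
  a derivative of \<open>g\<close> times \<open>dd 1 h\<close> at \<open>g x\<close>, again a
  composition with the same \<open>g\<close>.\<close>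

lemma Ck_on_compose_real:
  assumes "open D" "Ck_on k g D" "open T" "Ck_on k h T" "g ` D \<subseteq> T"
  shows "Ck_on k (\<lambda>x. h (g x)) D"
  using assms(2,4)
proof (induction k arbitrary: h)
  case 0
  then show ?case using continuous_on_compose2[of T h D g] assms(5) by simp
next
  case (Suc k)
  have "Ck_on k g D" by (rule Ck_on_SucD) (rule Suc.prems)
  then have 1: "Ck_on k (\<lambda>x. dd v g x * dd 1 h (g x)) D" for v
    using Suc.prems by (intro Ck_on_mult[OF assms(1)] Suc.IH[of "dd 1 h"]) simp_all
  have 2: "dd v g x * dd 1 h (g x) = dd v (\<lambda>x. h (g x)) x" if "x \<in> D" for v x
    using Suc.prems that assms(5) by (intro dd_compose_real[symmetric]) auto
  have "Ck_on k (dd v (\<lambda>x. h (g x))) D" for v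
    using Ck_on_cong[OF assms(1) 2 1] .
  moreover have "(\<lambda>x. h (g x)) differentiable (at x)" if "x \<in> D" for x
    using differentiable_chain_at[of g x h] Suc.prems that assms(5) by (auto simp: o_def)
  ultimately show ?case by auto
qed

lemma Ck_on_SucI_real:
  fixes h :: "real \<Rightarrow> real"
  assumes "open T" "\<And>t. t \<in> T \<Longrightarrow> (h has_real_derivative h' t) (at t)" "Ck_on k h' T"
  shows "Ck_on (Suc k) h T"
proof -
  have "Ck_on k (dd v h) T" for v
    by (rule Ck_on_cong[OF assms(1) _ Ck_on_cmult[OF assms(1,3), of v]])
      (rule dd_real[OF assms(2), symmetric])
  moreover have "h differentiable (at t)" if "t \<in> T" for t
    using assms(2)[OF that] by (meson differentiable_def has_field_derivative_imp_has_derivative)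
  ultimately show ?thesis by auto
qed

lemma Ck_on_powr: "Ck_on k (\<lambda>t::real. t powr a) {0<..}"
proof (induction k arbitrary: a)
  case 0
  then show ?case by (auto intro!: continuous_intros)
next
  case (Suc k)
  show ?case
    by (rule Ck_on_SucI_real[where h'="\<lambda>t. a * t powr (a - 1)"])
      (auto intro!: Suc.IH Ck_on_cmult has_real_derivative_powr)
qed

lemma Ck_on_ln: "Ck_on k (\<lambda>t::real. ln t) {0<..}"
proof (cases k)
  case 0
  then show ?thesis by (auto intro!: continuous_intros)
next
  case (Suc j)
  show ?thesis unfolding Suc
  proof (rule Ck_on_SucI_real[where h'="\<lambda>t. t powr (-1)"])
    show "(ln has_real_derivative t powr (-1)) (at t)" if "t \<in> {0<..}" for t :: real
      using that by (auto intro!: derivative_eq_intros simp: powr_minus field_simps)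
  qed (simp_all only: Ck_on_powr open_greaterThan)
qed

lemma Ck_on_compose_powr:
  assumes "open D" "Ck_on k g D" "\<And>x. x \<in> D \<Longrightarrow> 0 < g x"
  shows "Ck_on k (\<lambda>x. g x powr a) D"
  by (rule Ck_on_compose_real[OF assms(1,2), of "{0<..}"]) (use assms(3) Ck_on_powr in auto)

lemma Ck_on_inverse:
  assumes "open D" "Ck_on k g D" "\<And>x. x \<in> D \<Longrightarrow> 0 < g x"
  shows "Ck_on k (\<lambda>x. inverse (g x)) D"
  by (rule Ck_on_cong[OF assms(1) _ Ck_on_compose_powr[OF assms, of "-1"]])
    (use assms(3) in \<open>auto simp: powr_minus less_imp_le\<close>)

lemma Ck_on_divide:
  assumes "open D" "Ck_on k u D" "Ck_on k g D" "\<And>x. x \<in> D \<Longrightarrow> 0 < g x"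
  shows "Ck_on k (\<lambda>x. u x / g x) D"
  unfolding divide_inverse by (intro Ck_on_mult Ck_on_inverse assms)

text \<open>Away from 0, \<open>norm x powr a\<close> is the power \<open>a/2\<close> of the
  polynomial |x|^2, which is positive there.\<close>

lemma Ck_on_norm_powr: "Ck_on k (\<lambda>x::'a::euclidean_space. norm x powr a) (-{0})"
proof -
  have "Ck_on k (\<lambda>x::'a. (\<Sum>b\<in>Basis. (x \<bullet> b) * (x \<bullet> b)) powr (a/2)) (-{0})"
    by (intro Ck_on_compose_powr Ck_on_sum Ck_on_mult Ck_on_inner)
      (auto simp: euclidean_inner[symmetric])
  moreover have "(\<Sum>b\<in>Basis. (x \<bullet> b) * (x \<bullet> b)) powr (a/2) = norm x powr a" if "x \<in> -{0}" for x :: 'a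
    using that by (simp add: euclidean_inner[symmetric] power2_norm_eq_inner[symmetric] powr_powr
        flip: powr_numeral)
  ultimately show ?thesis by (metis (no_types, lifting) Ck_on_cong open_delete open_UNIV Compl_eq_Diff_UNIV)
qed

section \<open>Smooth step functions\<close>

definition bump_part :: "nat \<Rightarrow> real \<Rightarrow> real" where
  "bump_part m t = (if t > 0 then (1/t)^m * exp (- (1/t)) else 0)"

text \<open>Derivatives of t^(-m) exp(-1/t) are combinations of members of the same family; this
  closure allows an induction on the order of differentiability for all \<open>m\<close> at
  once.\<close>

lemma bump_part_deriv:
  "(bump_part m has_real_derivative (bump_part (m+2) t - real m * bump_part (m+1) t)) (at t)"
proof -
  consider "t > 0" | "t < 0" | "t = 0" by linarith
  then show ?thesis
  proof cases
    case 1
    have "((\<lambda>t. (1/t)^m * exp (- (1/t))) has_real_derivative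
       (bump_part (m+2) t - real m * bump_part (m+1) t)) (at t)"
    proof (cases m)
      case 0
      then show ?thesis using 1 unfolding bump_part_def
        by (auto intro!: derivative_eq_intros simp: field_simps power2_eq_square)
    next
      case (Suc j)
      have "((\<lambda>t. (1/t)^m) has_real_derivative (real m * (1/t)^j * (- (1/t^2)))) (at t)"
      proof -
        have "((\<lambda>t. 1/t) has_real_derivative - (1/t^2)) (at t)"
          using 1 by (auto intro!: derivative_eq_intros simp: power2_eq_square divide_inverse)
        from DERIV_power[OF this, of m] show ?thesis by (rule DERIV_cong) (simp add: Suc)
      qed
      moreover have "((\<lambda>t. exp (- (1/t))) has_real_derivative exp (- (1/t)) * (1/t^2)) (at t)"
        using 1 by (auto intro!: derivative_eq_intros simp: power2_eq_square divide_inverse)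
      ultimately show ?thesis
        by (rule DERIV_cong[OF DERIV_mult])
          (use 1 Suc in \<open>auto simp: bump_part_def power2_eq_square divide_inverse algebra_simps\<close>)
    qed
    then show ?thesis
      by (rule has_field_derivative_transform_within_open[of _ _ _ "{0<..}"]) (use 1 in \<open>auto simp: bump_part_def\<close>)
  next
    case 2
    have "((\<lambda>t. 0) has_real_derivative 0) (at t)" by simp
    then have "(bump_part m has_real_derivative 0) (at t)"
      by (rule has_field_derivative_transform_within_open[of _ _ _ "{..<0}"]) (use 2 in \<open>auto simp: bump_part_def\<close>)
    then show ?thesis using 2 by (simp add: bump_part_def)
  next
    case 3
    \<comment> \<open>The difference quotient of \<open>bump_part m\<close> at 0 is
      \<open>bump_part (m+1)\<close>; its limit from the right is found with s = 1/t, and from the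
      left it is 0.\<close>
    have "((\<lambda>s::real. s ^ (m+1) / exp s) \<longlongrightarrow> 0) at_top"
      by (rule tendsto_power_div_exp_0)
    then have "((\<lambda>t::real. (1/t) ^ (m+1) * exp (-(1/t))) \<longlongrightarrow> 0) (at_right 0)"
      using filterlim_compose[OF _ filterlim_inverse_at_top_right]
      by (fastforce simp: exp_minus field_simps)
    then have R: "((\<lambda>t::real. bump_part (m+1) t) \<longlongrightarrow> 0) (at_right 0)"
      by (rule Lim_transform_eventually) (auto simp: bump_part_def eventually_at_right_less eventually_mono[OF eventually_at_right_less])
    have L: "((\<lambda>t::real. bump_part (m+1) t) \<longlongrightarrow> 0) (at_left 0)"
      by (rule Lim_transform_eventually[OF tendsto_const])
        (auto simp: bump_part_def eventually_at_filter)
    have "((\<lambda>h. (bump_part m (0+h) - bump_part m 0) / h) \<longlongrightarrow> 0) (at 0)"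
      by (rule Lim_transform_eventually[OF filterlim_split_at[OF L R]])
        (auto simp: bump_part_def eventually_at_filter)
    then show ?thesis using 3 by (simp add: DERIV_def bump_part_def)
  qed
qed

lemma Ck_on_bump_part: "Ck_on k (bump_part m) UNIV"
proof (induction k arbitrary: m)
  case 0
  have "isCont (bump_part m) t" for t using bump_part_deriv DERIV_isCont by blast
  then show ?case by (simp add: continuous_at_imp_continuous_on)
next
  case (Suc k)
  show ?case
    by (rule Ck_on_SucI_real[OF open_UNIV bump_part_deriv])
      (intro Ck_on_diff Ck_on_cmult Suc.IH open_UNIV)
qed

definition smooth_step :: "real \<Rightarrow> real" where
  "smooth_step t = bump_part 0 t / (bump_part 0 t + bump_part 0 (1 - t))"

lemma smooth_step_denominator: "0 < bump_part 0 t + bump_part 0 (1 - t)"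
  by (auto simp: bump_part_def add_pos_pos)

lemma Ck_on_smooth_step: "Ck_on k smooth_step UNIV"
proof -
  have "Ck_on k (\<lambda>t::real. 1 - t) UNIV"
    by (intro Ck_on_diff Ck_on_const Ck_on_bounded_linear) auto
  then have "Ck_on k (\<lambda>t. bump_part 0 (1 - t)) UNIV"
    using Ck_on_compose_real[OF open_UNIV _ open_UNIV Ck_on_bump_part] by blast
  then have "Ck_on k (\<lambda>t. bump_part 0 t / (bump_part 0 t + bump_part 0 (1 - t))) UNIV"
    by (intro Ck_on_divide Ck_on_add Ck_on_bump_part) (use smooth_step_denominator in auto)
  then show ?thesis by (simp add: smooth_step_def[abs_def])
qed

lemma smooth_step_bounds: "0 \<le> smooth_step t" "smooth_step t \<le> 1"
  using smooth_step_denominator[of t] by (auto simp: smooth_step_def bump_part_def)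

lemma smooth_step_eq_0: "t \<le> 0 \<Longrightarrow> smooth_step t = 0"
  by (simp add: smooth_step_def bump_part_def)

lemma smooth_step_eq_1: "t \<ge> 1 \<Longrightarrow> smooth_step t = 1"
  by (simp add: smooth_step_def bump_part_def)

section \<open>Gradient and Laplacian\<close>

lemma gradient_component: "b \<in> Basis \<Longrightarrow> gradient u x \<bullet> b = dd b u x"
  by (simp add: gradient_def inner_sum_left inner_Basis if_distrib sum.delta cong: if_cong)

lemma gradient_inner:
  assumes "u differentiable (at x)"
  shows "gradient u x \<bullet> v = dd v u x"
proof -
  interpret bounded_linear "\<lambda>v. dd v u x" using assms dd_bounded_linear by blast
  have "dd v u x = dd (\<Sum>b\<in>Basis. (v \<bullet> b) *\<^sub>R b) u x" by (simp add: euclidean_representation)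
  also have "\<dots> = (\<Sum>b\<in>Basis. (v \<bullet> b) * dd b u x)" by (simp add: sum scaleR)
  finally show ?thesis
    by (simp only: gradient_def inner_sum_left inner_scaleR_left inner_commute[of v] mult.commute)
qed

lemma gradient_cong_open:
  assumes "open D" "x \<in> D" "\<And>y. y \<in> D \<Longrightarrow> u y = v y"
  shows "gradient u x = gradient v x"
  using frechet_derivative_cong_open[OF assms] by (simp add: gradient_def)

lemma gradient_inner_gradient:
  "gradient u x \<bullet> gradient v x = (\<Sum>b\<in>Basis. dd b u x * dd b v x)"
  by (subst euclidean_inner) (simp add: gradient_component)

lemma gradient_mult:
  assumes "u differentiable (at x)" "v differentiable (at x)"
  shows "gradient (\<lambda>x. u x * v x) x = u x *\<^sub>R gradient v x + v x *\<^sub>R gradient u x"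
  by (rule euclidean_eqI) (simp add: gradient_component dd_mult[OF assms] inner_left_distrib)

lemma gradient_add:
  assumes "u differentiable (at x)" "v differentiable (at x)"
  shows "gradient (\<lambda>x. u x + v x) x = gradient u x + gradient v x"
  by (rule euclidean_eqI) (simp add: gradient_component dd_add[OF assms] inner_left_distrib)

lemma C1D:
  assumes "Ck_on (Suc 0) u D"
  shows "x \<in> D \<Longrightarrow> u differentiable (at x)" "continuous_on D (dd v u)" "continuous_on D u"
  using assms Ck_on_SucD[OF assms] by auto

lemma C2D:
  assumes "Ck_on 2 u D"
  shows "x \<in> D \<Longrightarrow> u differentiable (at x)" "x \<in> D \<Longrightarrow> dd v u differentiable (at x)"
    "continuous_on D (dd w (dd v u))" "continuous_on D (dd v u)" "continuous_on D u"
    "Ck_on (Suc 0) u D" "Ck_on (Suc 0) (dd v u) D"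
proof -
  have 2: "Ck_on (Suc (Suc 0)) u D" using assms by (simp add: numeral_2_eq_2 del: Ck_on.simps)
  show 1: "Ck_on (Suc 0) u D" using 2 Ck_on_SucD by blast
  show "x \<in> D \<Longrightarrow> u differentiable (at x)" "continuous_on D (dd v u)" "continuous_on D u"
    using C1D[OF 1] by auto
  show "x \<in> D \<Longrightarrow> dd v u differentiable (at x)"  "continuous_on D (dd w (dd v u))"
    "Ck_on (Suc 0) (dd v u) D"
    using 2 by auto
qed

lemma C2I:
  assumes "\<And>x. x \<in> D \<Longrightarrow> u differentiable (at x)"
    "\<And>v x. x \<in> D \<Longrightarrow> dd v u differentiable (at x)"
    "\<And>v w. continuous_on D (dd w (dd v u))"
  shows "Ck_on 2 u D"
  using assms by (simp add: numeral_2_eq_2)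

lemma laplacian_eq:
  assumes "Ck_on 2 u D" "x \<in> D"
  shows "laplacian u x = (\<Sum>b\<in>Basis. dd b (dd b u) x)"
proof -
  have "(gradient u has_derivative (\<lambda>v. \<Sum>b\<in>Basis. dd v (dd b u) x *\<^sub>R b)) (at x)"
    unfolding gradient_def[abs_def]
    by (intro has_derivative_sum has_derivative_scaleR_left
        C2D(2)[OF assms, unfolded frechet_derivative_works])
  then have "frechet_derivative (gradient u) (at x) = (\<lambda>v. \<Sum>b\<in>Basis. dd v (dd b u) x *\<^sub>R b)"
    by (rule frechet_derivative_at[symmetric])
  then show ?thesis
    by (simp add: laplacian_def divergence_def inner_sum_left inner_Basis if_distrib sum.delta
        cong: if_cong)
qed

lemma laplacian_cong_open:
  assumes "open D" "\<And>x. x \<in> D \<Longrightarrow> u x = v x" "Ck_on 2 u D" "x \<in> D"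
  shows "laplacian u x = laplacian v x"
proof -
  have "dd b u y = dd b v y" if "y \<in> D" for b y
    using frechet_derivative_cong_open[OF assms(1) that assms(2)] by simp
  then have "dd b (dd b u) x = dd b (dd b v) x" for b
    using frechet_derivative_cong_open[OF assms(1,4), of "dd b u" "dd b v"] by simp
  then show ?thesis
    using laplacian_eq[OF assms(3,4)] laplacian_eq[OF Ck_on_cong[OF assms(1-3)] assms(4)] by simp
qed

lemma continuous_on_laplacian:
  assumes "Ck_on 2 u D" shows "continuous_on D (laplacian u)"
proof -
  have "continuous_on D (\<lambda>x. \<Sum>b\<in>Basis. dd b (dd b u) x)"
    by (intro continuous_on_sum C2D(3)[OF assms])
  then show ?thesis by (rule continuous_on_eq) (simp add: laplacian_eq[OF assms])
qed

lemma laplacian_add: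
  assumes "open D" "Ck_on 2 u D" "Ck_on 2 v D" "x \<in> D"
  shows "laplacian (\<lambda>x. u x + v x) x = laplacian u x + laplacian v x"
proof -
  have "dd b (dd b (\<lambda>x. u x + v x)) x = dd b (\<lambda>x. dd b u x + dd b v x) x" for b
    by (rule fun_cong[OF frechet_derivative_cong_open[OF assms(1,4)]])
      (rule dd_add[OF C2D(1)[OF assms(2)] C2D(1)[OF assms(3)]])
  then show ?thesis
    using assms by (simp add: laplacian_eq[OF Ck_on_add[OF assms(1-3)]] laplacian_eq dd_add C2D
        sum.distrib)
qed

lemma laplacian_mult:
  assumes "open D" "Ck_on 2 u D" "Ck_on 2 v D" "x \<in> D"
  shows "laplacian (\<lambda>x. u x * v x) x =
    u x * laplacian v x + 2 * (gradient u x \<bullet> gradient v x) + laplacian u x * v x"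
proof -
  note d = C2D(1,2)[OF assms(2)] C2D(1,2)[OF assms(3)]
  have "dd b (dd b (\<lambda>x. u x * v x)) x = dd b (\<lambda>x. u x * dd b v x + dd b u x * v x) x" for b
    by (rule fun_cong[OF frechet_derivative_cong_open[OF assms(1,4)]]) (rule dd_mult[OF d(1,3)])
  also have "dd b (\<lambda>x. u x * dd b v x + dd b u x * v x) x =
    u x * dd b (dd b v) x + 2 * (dd b u x * dd b v x) + dd b (dd b u) x * v x" for b
    using d[OF assms(4)] by (subst dd_add) (auto simp: dd_mult)
  finally show ?thesis
    by (simp add: laplacian_eq[OF Ck_on_mult[OF assms(1-3)] assms(4)] laplacian_eq[OF assms(2,4)]
        laplacian_eq[OF assms(3,4)] gradient_inner_gradient sum.distrib sum_distrib_left
        sum_distrib_right)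
qed

lemma laplacian_const: "laplacian (\<lambda>x. c) x = 0"
  by (simp add: laplacian_eq[OF Ck_on_const UNIV_I] dd_const)

lemma laplacian_cmult:
  assumes "open D" "Ck_on 2 u D" "x \<in> D"
  shows "laplacian (\<lambda>x. c * u x) x = c * laplacian u x"
proof -
  have "gradient (\<lambda>x. c) x = 0" by (simp add: gradient_def dd_const)
  then show ?thesis
    using laplacian_mult[OF assms(1) Ck_on_const assms(2,3), of c] by (simp add: laplacian_const)
qed

lemma laplacian_diff:
  assumes "open D" "Ck_on 2 u D" "Ck_on 2 v D" "x \<in> D"
  shows "laplacian (\<lambda>x. u x - v x) x = laplacian u x - laplacian v x"
  using laplacian_add[OF assms(1,2) Ck_on_cmult[OF assms(1,3), of "-1"] assms(4)]
    laplacian_cmult[OF assms(1,3,4), of "-1"] by simp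

lemma laplacian_sum:
  assumes "open D" "\<And>i. i \<in> I \<Longrightarrow> Ck_on 2 (u i) D" "x \<in> D"
  shows "laplacian (\<lambda>x. \<Sum>i\<in>I. u i x) x = (\<Sum>i\<in>I. laplacian (u i) x)"
  using assms(2) by (induction I rule: infinite_finite_induct)
    (auto simp: laplacian_const laplacian_add[OF assms(1) _ Ck_on_sum[OF assms(1)] assms(3)])

lemma laplacian_inner: "laplacian (\<lambda>x. x \<bullet> b) x = 0"
  by (simp add: laplacian_eq[OF Ck_on_inner UNIV_I] dd_inner dd_const)

section \<open>Affine substitutions and second derivatives at extrema\<close>

lemma dd_affine:
  assumes L: "bounded_linear L" and u: "u differentiable (at (a + L y))"
  shows "(\<lambda>y. u (a + L y)) differentiable (at y)" "dd v (\<lambda>y. u (a + L y)) y = dd (L v) u (a + L y)"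
proof -
  have 1: "((\<lambda>y. a + L y) has_derivative L) (at y)"
    using has_derivative_add[OF has_derivative_const bounded_linear_imp_has_derivative[OF L]]
    by simp
  have "((\<lambda>y. u (a + L y)) has_derivative (\<lambda>v. dd (L v) u (a + L y))) (at y)"
    using has_derivative_compose[OF 1 u[unfolded frechet_derivative_works]] .
  then show "(\<lambda>y. u (a + L y)) differentiable (at y)"
    "dd v (\<lambda>y. u (a + L y)) y = dd (L v) u (a + L y)"
    by (auto simp: dd_eq differentiable_def)
qed

lemma open_affine_vimage:
  fixes L :: "'a::real_normed_vector \<Rightarrow> 'b::real_normed_vector"
  assumes "bounded_linear L" "open D"
  shows "open {y. a + L y \<in> D}"
proof -
  have "continuous_on UNIV (\<lambda>y. a + L y)"
    using assms(1) linear_continuous_on by (intro continuous_intros) blast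
  then show ?thesis
    using open_vimage[OF assms(2), of "\<lambda>y. a + L y"] by (simp add: vimage_def)
qed

lemma Ck_on_affine:
  assumes L: "bounded_linear L" and D: "open D" and "Ck_on k u D"
  shows "Ck_on k (\<lambda>y. u (a + L y)) {y. a + L y \<in> D}"
  using assms(3)
proof (induction k arbitrary: u)
  case 0
  have "continuous_on {y. a + L y \<in> D} (\<lambda>y. a + L y)"
    using L linear_continuous_on by (intro continuous_intros) blast
  then show ?case using 0 continuous_on_compose2[of D u _ "\<lambda>y. a + L y"] by auto
next
  case (Suc k)
  have "Ck_on k (dd v (\<lambda>y. u (a + L y))) {y. a + L y \<in> D}" for v
    by (rule Ck_on_cong[OF open_affine_vimage[OF L D] _ Suc.IH[of "dd (L v) u"]])
      (use Suc.prems dd_affine(2)[OF L] in auto)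
  then show ?case using Suc.prems dd_affine(1)[OF L] by auto
qed

lemma line_has_derivative:
  assumes "u differentiable (at (x + t *\<^sub>R v))"
  shows "((\<lambda>s. u (x + s *\<^sub>R v)) has_real_derivative dd v u (x + t *\<^sub>R v)) (at t)"
proof -
  have "(\<lambda>s. u (x + s *\<^sub>R v)) differentiable (at t)"
    and 1: "dd 1 (\<lambda>s. u (x + s *\<^sub>R v)) t = dd v u (x + t *\<^sub>R v)"
    using dd_affine[OF bounded_linear_scaleR_left assms] by auto
  then obtain d where d: "((\<lambda>s. u (x + s *\<^sub>R v)) has_real_derivative d) (at t)"
    by (auto simp: real_differentiable_def)
  with dd_real[OF d, of 1] 1 show ?thesis by simp
qed

text \<open>On the line x + s v the first derivative vanishes at s = 0. A positive second derivative
  would make it positive just to the right, and by the mean value theorem \<open>u\<close> would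
  exceed its maximum.\<close>

lemma second_derivative_nonpos_at_max:
  assumes "open D" "Ck_on 2 u D" "x \<in> D" "\<And>y. y \<in> D \<Longrightarrow> u y \<le> u x"
  shows "dd v (dd v u) x \<le> 0"
proof (rule ccontr)
  assume "\<not> dd v (dd v u) x \<le> 0"
  then have c: "dd v (dd v u) x > 0" by simp
  have "open {s. x + s *\<^sub>R v \<in> D}"
    using open_affine_vimage[OF bounded_linear_scaleR_left assms(1)] .
  then obtain e where e: "e > 0" "ball 0 e \<subseteq> {s. x + s *\<^sub>R v \<in> D}"
    by (rule openE[where x=0]) (use assms(3) in simp)
  then have e: "e > 0" "\<And>s. \<bar>s\<bar> < e \<Longrightarrow> x + s *\<^sub>R v \<in> D"
    by (auto simp: subset_eq dist_real_def)
  let ?g = "\<lambda>s. u (x + s *\<^sub>R v)" and ?h = "\<lambda>s. dd v u (x + s *\<^sub>R v)"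
  have g: "(?g has_real_derivative ?h s) (at s)" if "\<bar>s\<bar> < e" for s
    using line_has_derivative C2D(1)[OF assms(2) e(2)[OF that]] by blast
  have h: "(?h has_real_derivative dd v (dd v u) x) (at 0)"
    using line_has_derivative[of "dd v u" x 0 v] C2D(2)[OF assms(2,3)] by simp
  have h0: "?h 0 = 0"
    using DERIV_local_max[OF g[of 0] e(1)] e assms(4) by simp
  obtain d where d: "d > 0" "\<And>s. 0 < s \<Longrightarrow> s < d \<Longrightarrow> ?h 0 < ?h s"
    using DERIV_pos_inc_right[OF h c] by auto
  define t where "t = min e d / 2"
  have t: "0 < t" "t < e" "t < d" using e d by (auto simp: t_def)
  have "(?g has_real_derivative ?h s) (at s)" if "0 \<le> s" "s \<le> t" for s
    by (rule g) (use that t in simp)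
  then obtain z where z: "0 < z" "z < t" "?g t - ?g 0 = (t - 0) * ?h z"
    using MVT2[OF t(1), of ?g ?h] by metis
  have "?h z > 0" using d(2)[of z] z t h0 by simp
  then have "?g t > ?g 0" using z(3) mult_pos_pos[OF t(1), of "?h z"] by simp
  then show False using assms(4)[OF e(2)[of t]] t by simp
qed

lemma laplacian_nonpos_at_max:
  assumes "open D" "Ck_on 2 u D" "x \<in> D" "\<And>y. y \<in> D \<Longrightarrow> u y \<le> u x"
  shows "laplacian u x \<le> 0"
  unfolding laplacian_eq[OF assms(2,3)]
  by (intro sum_nonpos second_derivative_nonpos_at_max[OF assms])

lemma laplacian_nonneg_at_min:
  assumes "open D" "Ck_on 2 u D" "x \<in> D" "\<And>y. y \<in> D \<Longrightarrow> u y \<ge> u x"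
  shows "laplacian u x \<ge> 0"
  using laplacian_nonpos_at_max[OF assms(1) Ck_on_cmult[OF assms(1,2), of "-1"] assms(3)]
    laplacian_cmult[OF assms(1-3), of "-1"] assms(4) by simp

section \<open>The interior gradient estimate\<close>

text \<open>The factor on a basis vector may change sign from one vector to the next, only its
  square is fixed: this covers translations, dilations and the reflection in a coordinate
  hyperplane.\<close>

lemma laplacian_affine:
  fixes L :: "'a::euclidean_space \<Rightarrow> 'a"
  assumes L: "bounded_linear L" and D: "open D" and u: "Ck_on 2 u D"
    and s: "\<And>c. c \<in> Basis \<Longrightarrow> \<exists>s. L c = s *\<^sub>R c \<and> s\<^sup>2 = k"
    and y: "a + L y \<in> D"
  shows "laplacian (\<lambda>y. u (a + L y)) y = k * laplacian u (a + L y)"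
proof -
  let ?D = "{y. a + L y \<in> D}"
  have oD: "open ?D" by (rule open_affine_vimage[OF L D])
  have "dd c (dd c (\<lambda>y. u (a + L y))) y = k * dd c (dd c u) (a + L y)" if c: "c \<in> Basis" for c
  proof -
    obtain s where s: "L c = s *\<^sub>R c" "s\<^sup>2 = k" using assms(4)[OF c] by blast
    have 1: "dd c (\<lambda>y. u (a + L y)) z = s * dd c u (a + L z)" if "z \<in> ?D" for z
    proof -
      have "u differentiable (at (a + L z))" using C2D(1)[OF u] that by simp
      then show ?thesis
        using dd_affine(2)[OF L, of u a z c] linear.scaleR[OF linear_frechet_derivative, of u _ s c]
        by (simp add: s)
    qed
    have d: "dd c u differentiable (at (a + L y))" using C2D(2)[OF u y] .
    have "dd c (dd c (\<lambda>y. u (a + L y))) y = dd c (\<lambda>z. s * dd c u (a + L z)) y"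
      using frechet_derivative_cong_open[OF oD _ 1] y by simp
    also have "\<dots> = s * dd c (\<lambda>z. dd c u (a + L z)) y"
      by (rule dd_cmult[OF dd_affine(1)[OF L d]])
    also have "\<dots> = s * dd (s *\<^sub>R c) (dd c u) (a + L y)"
      using dd_affine(2)[OF L d, of c] by (simp add: s)
    also have "\<dots> = k * dd c (dd c u) (a + L y)"
      using linear.scaleR[OF linear_frechet_derivative[OF d], of s c] s(2)
      by (simp add: power2_eq_square)
    finally show ?thesis .
  qed
  then show ?thesis
    using laplacian_eq[OF Ck_on_affine[OF L D u], of y a] laplacian_eq[OF u y] y
    by (simp add: sum_distrib_left)
qed

lemma Ck_on_inner_shift: "Ck_on k (\<lambda>y. y \<bullet> b - c) D"
  by (rule Ck_on_subset[OF Ck_on_diff[OF open_UNIV Ck_on_inner Ck_on_const]]) simp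

lemma laplacian_inner_shift: "laplacian (\<lambda>y. y \<bullet> b - c) y = 0"
  using laplacian_diff[OF open_UNIV Ck_on_inner Ck_on_const UNIV_I, of b c y]
  by (simp add: laplacian_inner laplacian_const)

lemma gradient_inner_shift: "gradient (\<lambda>y. y \<bullet> b - c) y = b"
proof (rule euclidean_eqI)
  fix a :: 'a assume "a \<in> Basis"
  then show "gradient (\<lambda>y. y \<bullet> b - c) y \<bullet> a = b \<bullet> a"
    using dd_diff[of "\<lambda>y. y \<bullet> b" y "\<lambda>_. c" a] C2D(1)[OF Ck_on_inner]
    by (simp add: gradient_component dd_inner dd_const inner_commute[of a b])
qed

lemma laplacian_inner_shift_sq:
  "laplacian (\<lambda>y. (y \<bullet> b - c) * (y \<bullet> b - c)) y = 2 * (b \<bullet> b)"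
  using laplacian_mult[OF open_UNIV Ck_on_inner_shift Ck_on_inner_shift UNIV_I, of b c b c y]
  by (simp add: laplacian_inner_shift gradient_inner_shift)

lemma dist_sq_sum:
  "(norm (y - x))\<^sup>2 = (\<Sum>c\<in>Basis. (y \<bullet> c - x \<bullet> c) * (y \<bullet> c - x \<bullet> c))"
  by (subst power2_norm_eq_inner, subst euclidean_inner) (simp add: inner_diff_left)

lemma Ck_on_dist_sq: "Ck_on k (\<lambda>y. (norm (y - x))\<^sup>2) D"
  unfolding dist_sq_sum
  by (rule Ck_on_subset[OF Ck_on_sum[OF open_UNIV Ck_on_mult[OF open_UNIV]]])
    (auto intro: Ck_on_inner_shift)

lemma laplacian_dist_sq:
  "laplacian (\<lambda>y. (norm (y - x))\<^sup>2) (y::'a::euclidean_space) = 2 * real DIM('a)"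
  unfolding dist_sq_sum
  by (subst laplacian_sum[OF open_UNIV])
    (auto intro!: Ck_on_mult Ck_on_inner_shift simp: laplacian_inner_shift_sq)

text \<open>Half of the odd part of \<open>u\<close> in the direction \<open>b\<close> is compared on a half ball with an
  explicit quadratic barrier.\<close>

lemma gradient_bound_aux:
  fixes u :: "'a::euclidean_space \<Rightarrow> real"
  assumes U: "open U" and u: "Ck_on 2 u U" and sub: "cball x d \<subseteq> U" and d: "d > 0"
    and A: "\<And>y. y \<in> cball x d \<Longrightarrow> \<bar>u y\<bar> \<le> A"
    and N: "\<And>y. y \<in> cball x d \<Longrightarrow> \<bar>laplacian u y\<bar> \<le> N" and "N > 0"
    and b: "b \<in> Basis"
  shows "dd b u x \<le> real DIM('a) * A / d + N * d"
proof -
  define n where "n = real DIM('a)"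
  have n1: "n \<ge> 1" using DIM_positive[where 'a='a] by (simp add: n_def Suc_le_eq)
  have A0: "A \<ge> 0" using A[of x] d by force
  \<comment> \<open>The map taking \<open>y\<close> to \<open>a + L y\<close> is the reflection in
    the hyperplane through \<open>x\<close> orthogonal to \<open>b\<close>; it preserves balls about
    \<open>x\<close> and the Laplacian.\<close>
  define a where "a = (2 * (x \<bullet> b)) *\<^sub>R b"
  define L where "L = (\<lambda>y::'a. y - (2 * (y \<bullet> b)) *\<^sub>R b)"
  have L: "bounded_linear L"
    unfolding L_def
    by (intro bounded_linear_sub bounded_linear_ident bounded_linear_scaleR_const
        bounded_linear_mult_const bounded_linear_const_mult bounded_linear_inner_left)
  have bb: "b \<bullet> b = 1" using b by simp
  have R: "a + L y = y - (2 * (y \<bullet> b - x \<bullet> b)) *\<^sub>R b" for y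
    by (simp add: a_def L_def algebra_simps)
  have Ld: "norm (a + L y - x) = norm (y - x)" for y
  proof -
    have *: "a + L y - x = (y - x) - (2 * ((y - x) \<bullet> b)) *\<^sub>R b"
      by (simp add: R inner_diff_left)
    have "(z - (2 * (z \<bullet> b)) *\<^sub>R b) \<bullet> (z - (2 * (z \<bullet> b)) *\<^sub>R b) = z \<bullet> z" for z
      by (simp add: inner_diff_left inner_diff_right bb inner_commute[of b z])
    then show ?thesis unfolding * norm_eq_sqrt_inner by simp
  qed
  have Lc: "\<exists>s. L c = s *\<^sub>R c \<and> s\<^sup>2 = 1" if "c \<in> Basis" for c
  proof (cases "c = b")
    case True
    then have "L c = (-1) *\<^sub>R c" using bb by (simp add: L_def algebra_simps scaleR_2)
    then show ?thesis by (intro exI[of _ "-1"]) simp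
  next
    case False
    then have "L c = 1 *\<^sub>R c" using that b by (simp add: L_def inner_Basis)
    then show ?thesis by (intro exI[of _ 1]) simp
  qed
  define D where "D = U \<inter> {y. a + L y \<in> U}"
  have D: "open D" using U open_affine_vimage[OF L U] by (auto simp: D_def)
  have cD: "cball x d \<subseteq> D"
    using sub Ld by (auto simp: D_def dist_norm subset_eq norm_minus_commute)
  have uL: "Ck_on 2 (\<lambda>y. u (a + L y)) D" "Ck_on 2 u D"
    unfolding D_def by (rule Ck_on_subset[OF Ck_on_affine[OF L U u]], simp)
      (rule Ck_on_subset[OF u], simp)
  define f where "f = (\<lambda>y. 1/2 * (u y - u (a + L y)))"
  have f: "Ck_on 2 f D" unfolding f_def by (intro Ck_on_cmult Ck_on_diff uL D)
  have lf: "laplacian f y = 1/2 * (laplacian u y - laplacian u (a + L y))" if "y \<in> D" for y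
    unfolding f_def
    using laplacian_cmult[OF D Ck_on_diff[OF D uL(2,1)] that, of "1/2"]
      laplacian_diff[OF D uL(2,1) that] laplacian_affine[OF L U u Lc] that
    by (simp add: D_def)
  define t where "t = (\<lambda>y. y \<bullet> b - x \<bullet> b)"
  \<comment> \<open>The coefficient of \<open>t y * t y\<close> makes the Laplacian of
    \<open>p\<close> equal to \<open>- 2 * N\<close>; that of \<open>t y\<close> is
    \<open>- d\<close> times as large, so that these two terms together are nonnegative for 0 \<le>
    t \<le> d. Hence \<open>p\<close> is at least \<open>A\<close> on the spherical part and at
    least 0 on the flat part of the boundary of the half ball.\<close>
  define p where "p = (\<lambda>y. (A/d\<^sup>2) * (norm (y - x))\<^sup>2 + ((n * A / d + N * d) * t y
     + (- (n * A / d\<^sup>2) - N) * (t y * t y)))"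
  have tC: "Ck_on 2 t D" unfolding t_def by (rule Ck_on_inner_shift)
  have p: "Ck_on 2 p D" unfolding p_def
    by (intro Ck_on_add Ck_on_cmult Ck_on_mult Ck_on_dist_sq tC D)
  have lp: "laplacian p y = - 2 * N" if "y \<in> D" for y
  proof -
    have tl: "laplacian t y = 0" "laplacian (\<lambda>y. t y * t y) y = 2"
      by (simp_all add: t_def laplacian_inner_shift laplacian_inner_shift_sq bb)
    have "laplacian (\<lambda>y. a0 * (norm (y - x))\<^sup>2 + (a1 * t y + a2 * (t y * t y))) y =
      a0 * (2 * n) + (a1 * 0 + a2 * 2)" for a0 a1 a2
      unfolding n_def
      by (simp add: laplacian_add[OF D _ _ that] laplacian_cmult[OF D _ that]
          Ck_on_add[OF D] Ck_on_cmult[OF D] Ck_on_mult[OF D] Ck_on_dist_sq tC laplacian_dist_sq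
          tl)
    from this[of "A/d\<^sup>2" "n * A / d + N * d" "- (n * A / d\<^sup>2) - N"] show ?thesis
      unfolding p_def by (simp add: algebra_simps)
  qed
  define g where "g = (\<lambda>y. f y - p y)"
  have g: "Ck_on 2 g D" unfolding g_def by (intro Ck_on_diff f p D)
  \<comment> \<open>The Laplacian of \<open>f\<close> is at least \<open>- N\<close>, that of
    \<open>p\<close> is \<open>- 2 * N\<close>. Strictness, which excludes an interior maximum, is
    the reason for assuming \<open>N > 0\<close>.\<close>
  have lg: "laplacian g y > 0" if "y \<in> cball x d" for y
  proof -
    have "y \<in> D" using that cD by auto
    then have "laplacian g y = 1/2 * (laplacian u y - laplacian u (a + L y)) + 2 * N"
      unfolding g_def using laplacian_diff[OF D f p] lf lp by simp
    moreover have "a + L y \<in> cball x d"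
      using that Ld[of y] by (simp add: dist_norm norm_minus_commute)
    moreover from this have "\<bar>laplacian u (a + L y)\<bar> \<le> N" by (rule N)
    ultimately show ?thesis using N[OF that] \<open>N > 0\<close> unfolding abs_le_iff by (simp add: field_simps)
  qed
  define K where "K = cball x d \<inter> {y. t y \<ge> 0}"
  have tcont: "continuous_on UNIV t" unfolding t_def by (intro continuous_intros)
  have "closed {y. t y \<ge> 0}"
    using closed_Collect_le[OF continuous_on_const[of _ 0] tcont] .
  then have K: "compact K" unfolding K_def by (rule compact_Int_closed[OF compact_cball])
  have "x \<in> K" using d by (simp add: K_def t_def)
  then have "K \<noteq> {}" by blast
  moreover have "continuous_on K g"
    using C2D(5)[OF g] cD K_def continuous_on_subset by blast
  ultimately obtain z where z: "z \<in> K" "\<And>y. y \<in> K \<Longrightarrow> g y \<le> g z"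
    using continuous_attains_sup[OF K] by blast
  have tle: "\<bar>t y\<bar> \<le> norm (y - x)" for y
    using Basis_le_norm[OF b, of "y - x"] by (simp add: t_def inner_diff_left)
  have "g z \<le> 0"
  proof (rule ccontr)
    assume gz: "\<not> g z \<le> 0"
    have tz: "t z \<ge> 0" "norm (z - x) \<le> d" using z(1) by (auto simp: K_def dist_norm norm_minus_commute)
    consider "t z = 0" | "t z > 0" "norm (z - x) = d" | "t z > 0" "norm (z - x) < d"
      using tz by linarith
    then show False
    proof cases
      case 1
      then have "a + L z = z" by (simp add: R t_def)
      then have "f z = 0" by (simp add: f_def)
      moreover have "p z \<ge> 0" using 1 A0 by (simp add: p_def)
      ultimately show False using gz by (simp add: g_def)
    next
      case 2
      have zc: "z \<in> cball x d" "a + L z \<in> cball x d"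
        using 2 Ld[of z] by (simp_all add: dist_norm norm_minus_commute)
      have "f z \<le> A" using A[OF zc(1)] A[OF zc(2)] unfolding f_def abs_le_iff by (simp add: field_simps)
      have "p z = A + (n * A / d\<^sup>2 + N) * (t z * (d - t z))"
        using 2 d by (simp add: p_def field_simps power2_eq_square)
      moreover have "\<dots> \<ge> A"
        using tle[of z] 2 A0 n1 \<open>N > 0\<close> by simp
      ultimately show False using gz \<open>f z \<le> A\<close> by (simp add: g_def)
    next
      case 3
      let ?D = "ball x d \<inter> {y. t y > 0}"
      have "open {y. t y > 0}"
        using open_Collect_less[OF continuous_on_const[of _ 0] tcont] .
      then have "open ?D" by auto
      moreover have "?D \<subseteq> K" by (auto simp: K_def)
      moreover from this have "Ck_on 2 g ?D" using g cD Ck_on_subset K_def by blast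
      moreover have "z \<in> ?D" using 3 by (simp add: dist_norm norm_minus_commute)
      ultimately have "laplacian g z \<le> 0"
        using laplacian_nonpos_at_max[of ?D g z] z(2) by blast
      then show False using lg[of z] z(1) K_def by force
    qed
  qed
  then have gK: "g y \<le> 0" if "y \<in> K" for y using z(2)[OF that] by linarith
  define C where "C = n * A / d + N * d"
  \<comment> \<open>Half the odd difference of \<open>u\<close> along \<open>b\<close> minus the
    linear majorant left over from \<open>p\<close>. It vanishes at 0, is nonpositive to the right,
    and has derivative \<open>dd b u x - C\<close> at 0.\<close>
  define k where "k = (\<lambda>s. 1/2 * (u (x + s *\<^sub>R b) - u (x + (-s) *\<^sub>R b)) - s * C)"
  have kle: "k s \<le> 0" if s: "0 \<le> s" "s \<le> d" for s
  proof -
    let ?y = "x + s *\<^sub>R b"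
    have ty: "t ?y = s" by (simp add: t_def inner_add_left bb)
    have ny: "norm (?y - x) = s" using s b by simp
    have "?y \<in> K" using s ty ny by (simp add: K_def dist_norm b)
    from gK[OF this] have "f ?y \<le> p ?y" by (simp add: g_def)
    moreover have "a + L ?y = x + (-s) *\<^sub>R b"
      by (simp add: R inner_add_left bb algebra_simps flip: scaleR_left.add)
    moreover have "p ?y = s * C - (A * (n - 1) / d\<^sup>2 + N) * (s * s)"
      unfolding p_def ty ny C_def using d by (simp add: field_simps power2_eq_square)
    moreover have "(A * (n - 1) / d\<^sup>2 + N) * (s * s) \<ge> 0"
      using A0 n1 s \<open>N > 0\<close> by (intro mult_nonneg_nonneg add_nonneg_nonneg divide_nonneg_nonneg) auto
    ultimately show ?thesis by (simp add: k_def f_def)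
  qed
  have xU: "x \<in> U" using sub d by auto
  have u': "u differentiable (at (x + 0 *\<^sub>R b))" "u differentiable (at (x + 0 *\<^sub>R (-b)))"
    using C2D(1)[OF u xU] by auto
  have "dd (-b) u x = - dd b u x"
    using linear.scaleR[OF linear_frechet_derivative[of u "at x"], of "-1" b] u' by simp
  then have "(k has_real_derivative (dd b u x - C)) (at 0)"
    using line_has_derivative[OF u'(1)] line_has_derivative[OF u'(2)] unfolding k_def
    by (auto intro!: derivative_eq_intros)
  show ?thesis
  proof (rule ccontr)
    assume "\<not> ?thesis"
    then have "dd b u x - C > 0" by (simp add: C_def n_def)
    from DERIV_pos_inc_right[OF \<open>(k has_real_derivative (dd b u x - C)) (at 0)\<close> this]
    obtain e where e: "e > 0" "\<And>h. 0 < h \<Longrightarrow> h < e \<Longrightarrow> k 0 < k h" by auto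
    define h where "h = min e d / 2"
    have h: "0 < h" "h < e" "h \<le> d" using e(1) d by (auto simp: h_def min_def)
    have "k 0 = 0" by (simp add: k_def)
    then show False using e(2)[OF h(1,2)] kle[of h] h by simp
  qed
qed

text \<open>Applied to \<open>u\<close> and to \<open>- u\<close>, the one-sided estimate bounds the
  absolute value. As it needs a positive bound on the Laplacian, \<open>N\<close> is raised by
  \<open>e / d\<close>, which costs \<open>e\<close>.\<close>

lemma gradient_bound:
  fixes u :: "'a::euclidean_space \<Rightarrow> real"
  assumes U: "open U" and u: "Ck_on 2 u U" and sub: "cball x d \<subseteq> U" and d: "d > 0"
    and A: "\<And>y. y \<in> cball x d \<Longrightarrow> \<bar>u y\<bar> \<le> A"
    and N: "\<And>y. y \<in> cball x d \<Longrightarrow> \<bar>laplacian u y\<bar> \<le> N"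
    and b: "b \<in> Basis"
  shows "\<bar>dd b u x\<bar> \<le> real DIM('a) * A / d + N * d"
proof (rule field_le_epsilon)
  fix e :: real assume e: "e > 0"
  have xd: "x \<in> cball x d" using d by simp
  have N0: "N \<ge> 0" using N[OF xd] by linarith
  define M where "M = N + e / d"
  have M: "M > 0" "N \<le> M" using N0 e d by (simp_all add: M_def add_nonneg_pos)
  have "dd b u x \<le> real DIM('a) * A / d + M * d"
    by (rule gradient_bound_aux[OF U u sub d A _ M(1) b]) (use N M(2) in force)+
  moreover have "dd b (\<lambda>y. (-1) * u y) x \<le> real DIM('a) * A / d + M * d"
  proof (rule gradient_bound_aux[OF U Ck_on_cmult[OF U u] sub d _ _ M(1) b])
    fix y assume y: "y \<in> cball x d"
    then have "y \<in> U" using sub by auto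
    then show "\<bar>laplacian (\<lambda>y. -1 * u y) y\<bar> \<le> M"
      using laplacian_cmult[OF U u, of y "-1"] N[OF y] M(2) by simp
    show "\<bar>-1 * u y\<bar> \<le> A" using A[OF y] by simp
  qed
  moreover have "dd b (\<lambda>y. (-1) * u y) x = - dd b u x"
    using dd_cmult[OF C2D(1)[OF u], of x "-1" b] subsetD[OF sub xd] by simp
  moreover have "M * d = N * d + e" using d by (simp add: M_def field_simps)
  ultimately show "\<bar>dd b u x\<bar> \<le> real DIM('a) * A / d + N * d + e" by linarith
qed

section \<open>Regularity of uniform limits\<close>

lemma abs_sum_inner_le:
  fixes h :: "'a::euclidean_space"
  shows "\<bar>\<Sum>b\<in>Basis. (h \<bullet> b) * f b\<bar> \<le> norm h * (\<Sum>b\<in>Basis. \<bar>f b\<bar>)"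
proof -
  have "\<bar>\<Sum>b\<in>Basis. (h \<bullet> b) * f b\<bar> \<le> (\<Sum>b\<in>Basis. \<bar>h \<bullet> b\<bar> * \<bar>f b\<bar>)"
    using sum_abs[of "\<lambda>b. (h \<bullet> b) * f b" Basis] by (simp add: abs_mult)
  also have "\<dots> \<le> (\<Sum>b\<in>Basis. norm h * \<bar>f b\<bar>)"
    by (intro sum_mono mult_right_mono Basis_le_norm) auto
  finally show ?thesis by (simp add: sum_distrib_left)
qed

lemma dd_Basis_sum:
  assumes "u differentiable (at x)"
  shows "dd v u x = (\<Sum>b\<in>Basis. (v \<bullet> b) * dd b u x)"
  using gradient_inner[OF assms, of v] by (subst (asm) euclidean_inner)
    (simp add: gradient_component mult.commute)

text \<open>Going from \<open>x\<close> to \<open>x + h\<close> one coordinate at a time, the mean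
  value estimate bounds the deviation of each increment from its linear part by the oscillation of a
  continuous partial derivative.\<close>

lemma has_derivative_partials:
  fixes f :: "'a::euclidean_space \<Rightarrow> real"
  assumes r: "r > 0"
    and der: "\<And>b y. b \<in> Basis \<Longrightarrow> y \<in> ball x r \<Longrightarrow>
      ((\<lambda>s. f (y + s *\<^sub>R b)) has_real_derivative H b y) (at 0)"
    and cont: "\<And>b. b \<in> Basis \<Longrightarrow> continuous_on (ball x r) (H b)"
  shows "(f has_derivative (\<lambda>h. \<Sum>b\<in>Basis. (h \<bullet> b) * H b x)) (at x)"
proof -
  define n where "n = real DIM('a)"
  have n: "n > 0" by (simp add: n_def)
  have line: "((\<lambda>s. f (y + s *\<^sub>R b)) has_real_derivative H b (y + s *\<^sub>R b)) (at s)"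
    if "b \<in> Basis" "y + s *\<^sub>R b \<in> ball x r" for b y s
  proof -
    have "((\<lambda>t. f (y + (s + t) *\<^sub>R b)) has_real_derivative H b (y + s *\<^sub>R b)) (at 0)"
      using der[OF that] by (simp add: algebra_simps)
    then show ?thesis using DERIV_shift[of "\<lambda>t. f (y + t *\<^sub>R b)" "H b (y + s *\<^sub>R b)" 0 s]
      by (simp add: add.commute)
  qed
  have main: "\<exists>d>0. \<forall>h. norm h < d \<longrightarrow>
      \<bar>f (x + h) - f x - (\<Sum>b\<in>Basis. (h \<bullet> b) * H b x)\<bar> \<le> e * norm h" if e: "e > 0" for e
  proof -
    define e' where "e' = e / n"
    have e': "e' > 0" using e n by (simp add: e'_def)
    have "\<exists>d>0. d \<le> r \<and> (\<forall>b\<in>Basis. \<forall>y\<in>ball x d. \<bar>H b y - H b x\<bar> \<le> e')"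
    proof -
      have "\<forall>\<^sub>F y in at x. \<bar>H b y - H b x\<bar> \<le> e'" if "b \<in> Basis" for b
      proof -
        have "isCont (H b) x"
          using cont[OF that] r by (simp add: continuous_on_eq_continuous_at)
        then have "\<forall>\<^sub>F y in at x. dist (H b y) (H b x) < e'"
          using e' by (simp add: isCont_def tendsto_iff)
        then show ?thesis by eventually_elim (simp add: dist_real_def)
      qed
      then have "\<forall>\<^sub>F y in at x. \<forall>b\<in>Basis. \<bar>H b y - H b x\<bar> \<le> e'"
        by (simp add: eventually_ball_finite)
      then obtain d where d: "d > 0"
        "\<And>y. y \<noteq> x \<Longrightarrow> dist y x < d \<Longrightarrow> \<forall>b\<in>Basis. \<bar>H b y - H b x\<bar> \<le> e'"
        unfolding eventually_at by auto
      then show ?thesis using r e'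
        by (intro exI[of _ "min d r"]) (auto simp: dist_commute, metis abs_zero diff_self dist_commute less_imp_le)
    qed
    then obtain d where d: "d > 0" "d \<le> r"
      "\<And>b y. b \<in> Basis \<Longrightarrow> y \<in> ball x d \<Longrightarrow> \<bar>H b y - H b x\<bar> \<le> e'" by blast
    \<comment> \<open>For \<open>norm h < d / n\<close> all intermediate points stay in
      \<open>ball x d\<close>, because the absolute values of the coordinates of \<open>h\<close>
      add up to at most n |h|.\<close>
    have step: "\<bar>f (x + (\<Sum>b\<in>S. (h \<bullet> b) *\<^sub>R b)) - f x - (\<Sum>b\<in>S. (h \<bullet> b) * H b x)\<bar>
        \<le> (\<Sum>b\<in>S. e' * \<bar>h \<bullet> b\<bar>)" if "S \<subseteq> Basis" "norm h < d / n" for S h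
      using finite_subset[OF that(1) finite_Basis] that(1)
    proof (induction S rule: finite_induct)
      case empty
      then show ?case by simp
    next
      case (insert c S)
      let ?y = "x + (\<Sum>b\<in>S. (h \<bullet> b) *\<^sub>R b)"
      have c: "c \<in> Basis" using insert by simp
      have seg: "?y + s *\<^sub>R c \<in> ball x d" if "\<bar>s\<bar> \<le> \<bar>h \<bullet> c\<bar>" for s
      proof -
        have "norm ((\<Sum>b\<in>S. (h \<bullet> b) *\<^sub>R b) + s *\<^sub>R c) \<le>
            norm (\<Sum>b\<in>S. (h \<bullet> b) *\<^sub>R b) + norm (s *\<^sub>R c)" by (rule norm_triangle_ineq)
        also have "norm (s *\<^sub>R c) \<le> \<bar>h \<bullet> c\<bar>" using that c by simp
        also have "norm (\<Sum>b\<in>S. (h \<bullet> b) *\<^sub>R b) \<le> (\<Sum>b\<in>S. \<bar>h \<bullet> b\<bar>)"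
          by (rule order_trans[OF norm_sum]) (use insert in \<open>auto intro!: sum_mono\<close>)
        also have "(\<Sum>b\<in>S. \<bar>h \<bullet> b\<bar>) + \<bar>h \<bullet> c\<bar> = (\<Sum>b\<in>insert c S. \<bar>h \<bullet> b\<bar>)"
          using insert by simp
        also have "\<dots> \<le> (\<Sum>b\<in>Basis. \<bar>h \<bullet> b\<bar>)" using insert by (intro sum_mono2) auto
        also have "\<dots> \<le> (\<Sum>b\<in>(Basis::'a set). norm h)" by (intro sum_mono Basis_le_norm)
        also have "\<dots> = n * norm h" by (simp add: n_def)
        also have "\<dots> < d" using \<open>norm h < d / n\<close> n by (simp add: field_simps)
        finally have "norm ((\<Sum>b\<in>S. (h \<bullet> b) *\<^sub>R b) + s *\<^sub>R c) < d" by simp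
        moreover have "dist x (?y + s *\<^sub>R c) = norm ((\<Sum>b\<in>S. (h \<bullet> b) *\<^sub>R b) + s *\<^sub>R c)"
          using norm_minus_cancel[of "(\<Sum>b\<in>S. (h \<bullet> b) *\<^sub>R b) + s *\<^sub>R c"]
          by (simp add: dist_norm add.assoc)
        ultimately show ?thesis by simp
      qed
      let ?k = "\<lambda>s. f (?y + s *\<^sub>R c) - s * H c x"
      have "\<bar>?k (h \<bullet> c) - ?k 0\<bar> \<le> e' * \<bar>h \<bullet> c - 0\<bar>"
      proof (rule field_differentiable_bound[of "{- \<bar>h \<bullet> c\<bar>..\<bar>h \<bullet> c\<bar>}" ?k
            "\<lambda>s. H c (?y + s *\<^sub>R c) - H c x", unfolded real_norm_def])
        fix s assume s: "s \<in> {- \<bar>h \<bullet> c\<bar>..\<bar>h \<bullet> c\<bar>}"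
        then have "?y + s *\<^sub>R c \<in> ball x d" by (intro seg) auto
        then have "?y + s *\<^sub>R c \<in> ball x r" using d(2) by auto
        from line[OF c this]
        have "(?k has_real_derivative H c (?y + s *\<^sub>R c) - H c x) (at s)"
          by (auto intro!: derivative_eq_intros)
        then show "(?k has_real_derivative H c (?y + s *\<^sub>R c) - H c x) (at s within {- \<bar>h \<bullet> c\<bar>..\<bar>h \<bullet> c\<bar>})"
          by (rule DERIV_subset) simp
        show "\<bar>H c (?y + s *\<^sub>R c) - H c x\<bar> \<le> e'"
          using d(3)[OF c \<open>?y + s *\<^sub>R c \<in> ball x d\<close>] .
      qed auto
      then have "\<bar>f (?y + (h \<bullet> c) *\<^sub>R c) - f ?y - (h \<bullet> c) * H c x\<bar> \<le> e' * \<bar>h \<bullet> c\<bar>" by simp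
      moreover have "\<bar>f ?y - f x - (\<Sum>b\<in>S. (h \<bullet> b) * H b x)\<bar> \<le> (\<Sum>b\<in>S. e' * \<bar>h \<bullet> b\<bar>)"
        using insert by simp
      moreover have eq: "x + (\<Sum>b\<in>insert c S. (h \<bullet> b) *\<^sub>R b) = ?y + (h \<bullet> c) *\<^sub>R c"
        using insert by (simp add: algebra_simps)
      ultimately show ?case
        unfolding eq unfolding sum.insert[OF insert(1,2)] by linarith
    qed
    have "\<bar>f (x + h) - f x - (\<Sum>b\<in>Basis. (h \<bullet> b) * H b x)\<bar> \<le> e * norm h"
      if "norm h < d / n" for h
    proof -
      have "(\<Sum>b\<in>Basis. e' * \<bar>h \<bullet> b\<bar>) \<le> (\<Sum>b\<in>(Basis::'a set). e' * norm h)"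
        using e' by (intro sum_mono mult_left_mono Basis_le_norm) auto
      also have "\<dots> = e * norm h" using n by (simp add: n_def e'_def)
      finally show ?thesis using step[OF subset_refl that] by (simp add: euclidean_representation)
    qed
    then show ?thesis using d n by (intro exI[of _ "d / n"]) auto
  qed
  have "bounded_linear (\<lambda>h. \<Sum>b\<in>Basis. (h \<bullet> b) * H b x)"
    by (intro bounded_linear_sum bounded_linear_mult_const bounded_linear_inner_left)
  then show ?thesis
    unfolding has_derivative_at_alt
  proof (intro conjI allI impI)
    fix e :: real assume "e > 0"
    from main[OF this] obtain d where d: "d > 0"
      "\<And>h. norm h < d \<Longrightarrow> \<bar>f (x + h) - f x - (\<Sum>b\<in>Basis. (h \<bullet> b) * H b x)\<bar> \<le> e * norm h"
      by blast
    show "\<exists>d>0. \<forall>y. norm (y - x) < d \<longrightarrow>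
      norm (f y - f x - (\<Sum>b\<in>Basis. ((y - x) \<bullet> b) * H b x)) \<le> e * norm (y - x)"
      using d(1) d(2)[of "y - x" for y] by (intro exI[of _ d]) auto
  qed
qed

text \<open>The weak form of the equation \<Delta>u = F used here. Nothing is demanded of
  \<open>u\<close> itself; it is approximated by C^2 functions whose Laplacians approximate
  \<open>F\<close>.\<close>

definition conv_pair ::
  "(nat \<Rightarrow> 'a::euclidean_space \<Rightarrow> real) \<Rightarrow> ('a \<Rightarrow> real) \<Rightarrow> ('a \<Rightarrow> real) \<Rightarrow> 'a set \<Rightarrow> bool" where
  "conv_pair us u F U \<longleftrightarrow> (\<forall>j. Ck_on 2 (us j) U) \<and> uniform_limit U us u sequentially \<and>
     uniform_limit U (\<lambda>j. laplacian (us j)) F sequentially"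

lemma conv_pair_subset: "conv_pair us u F U \<Longrightarrow> V \<subseteq> U \<Longrightarrow> conv_pair us u F V"
  unfolding conv_pair_def using Ck_on_subset uniform_limit_on_subset by blast

lemma conv_pair_translate:
  assumes "open U" "conv_pair us u F U"
  shows "conv_pair (\<lambda>j y. us j (a + y)) (\<lambda>y. u (a + y)) (\<lambda>y. F (a + y)) {y. a + y \<in> U}"
proof -
  have C: "Ck_on 2 (us j) U" for j using assms by (simp add: conv_pair_def)
  have l: "laplacian (\<lambda>y. us j (a + y)) y = laplacian (us j) (a + y)" if "a + y \<in> U" for j y
    using laplacian_affine[OF bounded_linear_ident assms(1) C, of 1 a y] that
    by (force intro: exI[of _ "1::real"])
  have *: "uniform_limit {y. a + y \<in> U} (\<lambda>j y. g j (a + y)) (\<lambda>y. h (a + y)) sequentially"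
    if "uniform_limit U g h sequentially" for g :: "nat \<Rightarrow> 'a \<Rightarrow> real" and h
    using that unfolding uniform_limit_iff by (auto elim!: eventually_mono)
  have "uniform_limit {y. a + y \<in> U} (\<lambda>j. laplacian (\<lambda>y. us j (a + y))) (\<lambda>y. F (a + y)) sequentially
    \<longleftrightarrow> uniform_limit {y. a + y \<in> U} (\<lambda>j y. laplacian (us j) (a + y)) (\<lambda>y. F (a + y)) sequentially"
    by (rule uniform_limit_cong) (auto simp: l)
  then show ?thesis
    using Ck_on_affine[OF bounded_linear_ident assms(1) C] * assms(2)
    unfolding conv_pair_def by auto
qed

lemma conv_pair_cmult:
  assumes "open U" "conv_pair us u F U"
  shows "conv_pair (\<lambda>j y. c * us j y) (\<lambda>y. c * u y) (\<lambda>y. c * F y) U"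
proof -
  have C: "Ck_on 2 (us j) U" for j using assms by (simp add: conv_pair_def)
  have "uniform_limit U (\<lambda>j. laplacian (\<lambda>y. c * us j y)) (\<lambda>y. c * F y) sequentially
    \<longleftrightarrow> uniform_limit U (\<lambda>j y. c * laplacian (us j) y) (\<lambda>y. c * F y) sequentially"
    by (rule uniform_limit_cong) (auto simp: laplacian_cmult[OF assms(1) C])
  then show ?thesis
    using Ck_on_cmult[OF assms(1) C] assms(2) unfolding conv_pair_def
    by (auto intro!: bounded_linear.uniform_limit[OF bounded_linear_mult_right])
qed

lemma conv_pair_diff:
  assumes "open U" "conv_pair us u F U" "conv_pair vs v G U"
  shows "conv_pair (\<lambda>j y. us j y - vs j y) (\<lambda>y. u y - v y) (\<lambda>y. F y - G y) U"
proof -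
  have C: "Ck_on 2 (us j) U" "Ck_on 2 (vs j) U" for j using assms by (simp_all add: conv_pair_def)
  have "uniform_limit U (\<lambda>j. laplacian (\<lambda>y. us j y - vs j y)) (\<lambda>y. F y - G y) sequentially
    \<longleftrightarrow> uniform_limit U (\<lambda>j y. laplacian (us j) y - laplacian (vs j) y) (\<lambda>y. F y - G y) sequentially"
    by (rule uniform_limit_cong) (auto simp: laplacian_diff[OF assms(1) C])
  then show ?thesis
    using Ck_on_diff[OF assms(1) C] assms(2,3) unfolding conv_pair_def
    by (auto intro!: uniform_limit_intros)
qed

text \<open>\<open>gradient_bound\<close> is applied to \<open>us m - us n\<close> on balls of
  radius \<open>r/2\<close>: both of its terms are multiples of uniform distances that tend to
  0.\<close>

lemma conv_pair_uniformly_Cauchy_dd: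
  fixes u :: "'a::euclidean_space \<Rightarrow> real"
  assumes U: "open U" and c: "conv_pair us u F U" and r: "r > 0" and sub: "ball x (2*r) \<subseteq> U"
    and b: "b \<in> Basis"
  shows "uniformly_Cauchy_on (ball x r) (\<lambda>j. dd b (us j))"
  unfolding uniformly_Cauchy_on_def
proof (intro allI impI)
  fix e :: real assume e: "e > 0"
  have C: "Ck_on 2 (us j) U" for j using c by (simp add: conv_pair_def)
  define K where "K = real DIM('a) / (r/2) + r/2"
  have K: "K > 0" using r by (simp add: K_def add_pos_pos)
  define h where "h = e / (4 * K)"
  have h: "h > 0" using e K by (simp add: h_def)
  have "uniformly_Cauchy_on U us" "uniformly_Cauchy_on U (\<lambda>j. laplacian (us j))"
    using c unfolding conv_pair_def
    by (auto intro!: uniformly_convergent_Cauchy uniformly_convergentI)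
  then obtain M1 M2 where
    M1: "\<And>y m n. y \<in> U \<Longrightarrow> m \<ge> M1 \<Longrightarrow> n \<ge> M1 \<Longrightarrow> dist (us m y) (us n y) < h" and
    M2: "\<And>y m n. y \<in> U \<Longrightarrow> m \<ge> M2 \<Longrightarrow> n \<ge> M2 \<Longrightarrow> dist (laplacian (us m) y) (laplacian (us n) y) < h"
    using h unfolding uniformly_Cauchy_on_def by meson
  show "\<exists>M. \<forall>y\<in>ball x r. \<forall>m\<ge>M. \<forall>n\<ge>M. dist (dd b (us m) y) (dd b (us n) y) < e"
  proof (intro exI[of _ "max M1 M2"] ballI allI impI)
    fix y m n assume y: "y \<in> ball x r" and mn: "max M1 M2 \<le> m" "max M1 M2 \<le> n"
    have yr: "cball y (r/2) \<subseteq> ball x (2*r)"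
      using y r by (auto simp: subset_eq dist_norm) (smt (verit) dist_norm dist_triangle norm_minus_commute field_sum_of_halves)
    have yU: "cball y (r/2) \<subseteq> U" using yr sub by blast
    have "\<bar>dd b (\<lambda>y. us m y - us n y) y\<bar> \<le> real DIM('a) * h / (r/2) + h * (r/2)"
    proof (rule gradient_bound[OF U Ck_on_diff[OF U C C] yU _ _ _ b])
      fix z assume "z \<in> cball y (r/2)"
      then have z: "z \<in> U" using yU by blast
      show "\<bar>us m z - us n z\<bar> \<le> h" using M1[OF z] mn by (simp add: dist_real_def less_imp_le)
      show "\<bar>laplacian (\<lambda>y. us m y - us n y) z\<bar> \<le> h"
        using M2[OF z] mn laplacian_diff[OF U C C z] by (simp add: dist_real_def less_imp_le)
    qed (use r in simp)
    also have "\<dots> = h * K" by (simp add: K_def algebra_simps)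
    also have "\<dots> < e" using e K by (simp add: h_def)
    also have "dd b (\<lambda>y. us m y - us n y) y = dd b (us m) y - dd b (us n) y"
      using yU r by (intro dd_diff C2D(1)[OF C]) auto
    finally show "dist (dd b (us m) y) (dd b (us n) y) < e" by (simp add: dist_real_def)
  qed
qed

lemma conv_pair_derivative:
  fixes u :: "'a::euclidean_space \<Rightarrow> real"
  assumes U: "open U" and c: "conv_pair us u F U" and r: "r > 0" and sub: "ball x (2*r) \<subseteq> U"
  shows "\<And>y. y \<in> ball x r \<Longrightarrow> u differentiable (at y)"
    and "\<And>v. continuous_on (ball x r) (dd v u)"
    and "\<And>y b. y \<in> ball x r \<Longrightarrow> b \<in> Basis \<Longrightarrow> (\<lambda>j. dd b (us j) y) \<longlonglongrightarrow> dd b u y"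
proof -
  let ?S = "ball x r"
  have SU: "?S \<subseteq> U" using sub r by (auto simp: subset_eq)
  have C: "Ck_on 2 (us j) U" for j using c by (simp add: conv_pair_def)
  have ul: "uniform_limit U us u sequentially" using c by (simp add: conv_pair_def)
  have "\<exists>G. uniform_limit ?S (\<lambda>j. dd b (us j)) G sequentially" if "b \<in> Basis" for b
    using conv_pair_uniformly_Cauchy_dd[OF U c r sub that] Cauchy_uniformly_convergent
    unfolding uniformly_convergent_on_def by blast
  then obtain G where G: "\<And>b. b \<in> Basis \<Longrightarrow> uniform_limit ?S (\<lambda>j. dd b (us j)) (G b) sequentially"
    by metis
  have Gc: "continuous_on ?S (G b)" if "b \<in> Basis" for b
    by (rule uniform_limit_theorem[OF _ G[OF that]])
      (auto intro!: always_eventually continuous_on_subset[OF C2D(4)[OF C] SU])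
  have "\<exists>g. \<forall>y\<in>?S. (\<lambda>n. us n y) \<longlonglongrightarrow> g y \<and>
      (g has_derivative (\<lambda>h. \<Sum>b\<in>Basis. (h \<bullet> b) * G b y)) (at y within ?S)"
  proof (rule has_derivative_sequence[where f'="\<lambda>n y h. dd h (us n) y"])
    show "convex ?S" by simp
    show "x \<in> ?S" using r by simp
    show "(\<lambda>n. us n x) \<longlonglongrightarrow> u x" using tendsto_uniform_limitI[OF ul subsetD[OF SU]] r by simp
    show "(us n has_derivative (\<lambda>h. dd h (us n) y)) (at y within ?S)" if "y \<in> ?S" for n y
    proof -
      have "us n differentiable (at y)" using C2D(1)[OF C] that SU by blast
      then show ?thesis unfolding frechet_derivative_works by (rule has_derivative_at_withinI)
    qed
    fix e :: real assume e: "e > 0"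
    define e' where "e' = e / real DIM('a)"
    have e': "e' > 0" using e by (simp add: e'_def)
    have "\<forall>\<^sub>F n in sequentially. \<forall>y\<in>?S. dist (dd b (us n) y) (G b y) < e'" if "b \<in> Basis" for b
      using uniform_limitD[OF G[OF that] e'] .
    then have "\<forall>\<^sub>F n in sequentially. \<forall>b\<in>Basis. \<forall>y\<in>?S. dist (dd b (us n) y) (G b y) < e'"
      by (simp add: eventually_ball_finite)
    then show "\<forall>\<^sub>F n in sequentially. \<forall>y\<in>?S. \<forall>h.
        norm (dd h (us n) y - (\<Sum>b\<in>Basis. (h \<bullet> b) * G b y)) \<le> e * norm h"
    proof eventually_elim
      case (elim n)
      show ?case
      proof (intro ballI allI)
        fix y h assume y: "y \<in> ?S"
        have "us n differentiable (at y)" using C2D(1)[OF C] y SU by blast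
        then have "dd h (us n) y - (\<Sum>b\<in>Basis. (h \<bullet> b) * G b y) =
            (\<Sum>b\<in>Basis. (h \<bullet> b) * (dd b (us n) y - G b y))"
          by (simp add: dd_Basis_sum[of "us n" y h] algebra_simps sum_subtractf)
        then have "\<bar>dd h (us n) y - (\<Sum>b\<in>Basis. (h \<bullet> b) * G b y)\<bar> \<le>
            norm h * (\<Sum>b\<in>Basis. \<bar>dd b (us n) y - G b y\<bar>)"
          using abs_sum_inner_le[of h "\<lambda>b. dd b (us n) y - G b y"] by simp
        also have "\<dots> \<le> norm h * (\<Sum>b\<in>(Basis::'a set). e')"
          using elim y by (intro mult_left_mono sum_mono) (auto simp: dist_real_def less_imp_le)
        also have "\<dots> = e * norm h" by (simp add: e'_def)
        finally show "norm (dd h (us n) y - (\<Sum>b\<in>Basis. (h \<bullet> b) * G b y)) \<le> e * norm h" by simp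
      qed
    qed
  qed
  then obtain g where g: "\<And>y. y \<in> ?S \<Longrightarrow> (\<lambda>n. us n y) \<longlonglongrightarrow> g y"
    "\<And>y. y \<in> ?S \<Longrightarrow> (g has_derivative (\<lambda>h. \<Sum>b\<in>Basis. (h \<bullet> b) * G b y)) (at y within ?S)"
    by blast
  have gu: "g y = u y" if "y \<in> ?S" for y
    using LIMSEQ_unique[OF g(1)[OF that]] tendsto_uniform_limitI[OF ul] SU that by blast
  have du: "(u has_derivative (\<lambda>h. \<Sum>b\<in>Basis. (h \<bullet> b) * G b y)) (at y)" if "y \<in> ?S" for y
  proof -
    have "(g has_derivative (\<lambda>h. \<Sum>b\<in>Basis. (h \<bullet> b) * G b y)) (at y)"
      using g(2)[OF that] unfolding at_within_open[OF that open_ball] .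
    then show ?thesis
      by (rule has_derivative_transform_within_open[OF _ open_ball that]) (use gu in simp)
  qed
  then show "\<And>y. y \<in> ?S \<Longrightarrow> u differentiable (at y)" by (auto simp: differentiable_def)
  have dv: "dd v u y = (\<Sum>b\<in>Basis. (v \<bullet> b) * G b y)" if "y \<in> ?S" for v y
    using dd_eq[OF du[OF that]] .
  have "continuous_on ?S (\<lambda>y. \<Sum>b\<in>Basis. (v \<bullet> b) * G b y)" for v
    by (intro continuous_intros Gc)
  then show "continuous_on ?S (dd v u)" for v
    by (rule continuous_on_eq) (simp add: dv)
  show "(\<lambda>j. dd b (us j) y) \<longlonglongrightarrow> dd b u y" if "y \<in> ?S" "b \<in> Basis" for y b
  proof -
    have "dd b u y = G b y"
      using that by (simp add: dv inner_Basis if_distrib[of "\<lambda>t. t * _"] sum.delta' cong: if_cong)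
    then show ?thesis using tendsto_uniform_limitI[OF G[OF that(2)] that(1)] by simp
  qed
qed

lemma conv_pair_C1:
  assumes U: "open U" and c: "conv_pair us u F U"
  shows "Ck_on (Suc 0) u U"
    and "\<And>y b. y \<in> U \<Longrightarrow> b \<in> Basis \<Longrightarrow> (\<lambda>j. dd b (us j) y) \<longlonglongrightarrow> dd b u y"
proof -
  have ex: "\<exists>r>0. ball x (2*r) \<subseteq> U" if "x \<in> U" for x
  proof -
    obtain e where "e > 0" "ball x e \<subseteq> U" using U \<open>x \<in> U\<close> open_contains_ball by blast
    then show ?thesis by (intro exI[of _ "e/2"]) auto
  qed
  have "u differentiable (at x)" if x: "x \<in> U" for x
  proof -
    obtain r where r: "r > 0" "ball x (2*r) \<subseteq> U" using ex[OF x] by blast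
    show ?thesis by (rule conv_pair_derivative(1)[OF U c r]) (use r in simp)
  qed
  moreover have "continuous_on U (dd v u)" for v
  proof (rule continuous_at_imp_continuous_on, rule ballI)
    fix x assume x: "x \<in> U"
    obtain r where r: "r > 0" "ball x (2*r) \<subseteq> U" using ex[OF x] by blast
    then show "isCont (dd v u) x"
      using conv_pair_derivative(2)[OF U c r, of v] by (simp add: continuous_on_eq_continuous_at)
  qed
  ultimately show "Ck_on (Suc 0) u U" by simp
  show "(\<lambda>j. dd b (us j) y) \<longlonglongrightarrow> dd b u y" if "y \<in> U" "b \<in> Basis" for y b
  proof -
    obtain r where r: "r > 0" "ball y (2*r) \<subseteq> U" using ex[OF \<open>y \<in> U\<close>] by blast
    show ?thesis by (rule conv_pair_derivative(3)[OF U c r _ \<open>b \<in> Basis\<close>]) (use r in simp)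
  qed
qed

text \<open>The estimate holds for \<open>us j\<close> with \<open>A\<close> and \<open>N\<close>
  enlarged by a small \<open>h\<close>, and it passes to the limit since the partial derivatives
  converge pointwise.\<close>

lemma conv_pair_gradient_bound:
  fixes u :: "'a::euclidean_space \<Rightarrow> real"
  assumes U: "open U" and c: "conv_pair us u F U" and sub: "cball x d \<subseteq> U" and d: "d > 0"
    and A: "\<And>y. y \<in> cball x d \<Longrightarrow> \<bar>u y\<bar> \<le> A"
    and N: "\<And>y. y \<in> cball x d \<Longrightarrow> \<bar>F y\<bar> \<le> N"
    and b: "b \<in> Basis"
  shows "\<bar>dd b u x\<bar> \<le> real DIM('a) * A / d + N * d"
proof (rule field_le_epsilon)
  fix e :: real assume e: "e > 0"
  have C: "Ck_on 2 (us j) U" for j using c by (simp add: conv_pair_def)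
  define K where "K = real DIM('a) / d + d"
  have K: "K > 0" using d by (simp add: K_def add_pos_pos)
  define h where "h = e / K"
  have h: "h > 0" using e K by (simp add: h_def)
  have "\<forall>\<^sub>F j in sequentially. \<forall>y\<in>U. dist (us j y) (u y) < h"
    "\<forall>\<^sub>F j in sequentially. \<forall>y\<in>U. dist (laplacian (us j) y) (F y) < h"
    using c uniform_limitD h unfolding conv_pair_def by blast+
  then have ev: "\<forall>\<^sub>F j in sequentially. \<bar>dd b (us j) x\<bar> \<le> real DIM('a) * A / d + N * d + e"
  proof eventually_elim
    case (elim j)
    have "\<bar>dd b (us j) x\<bar> \<le> real DIM('a) * (A + h) / d + (N + h) * d"
    proof (rule gradient_bound[OF U C sub d _ _ b])
      fix y assume y: "y \<in> cball x d"
      then have "y \<in> U" using sub by blast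
      then have "\<bar>us j y - u y\<bar> < h" "\<bar>laplacian (us j) y - F y\<bar> < h"
        using elim by (auto simp: dist_real_def)
      then show "\<bar>us j y\<bar> \<le> A + h" "\<bar>laplacian (us j) y\<bar> \<le> N + h"
        using A[OF y] N[OF y] by linarith+
    qed
    also have "\<dots> = real DIM('a) * A / d + N * d + h * K"
      using d by (simp add: K_def field_simps)
    finally show ?case using K by (simp add: h_def)
  qed
  have "x \<in> U" using sub d by auto
  then have "(\<lambda>j. \<bar>dd b (us j) x\<bar>) \<longlonglongrightarrow> \<bar>dd b u x\<bar>"
    by (intro tendsto_rabs conv_pair_C1(2)[OF U c _ b])
  then show "\<bar>dd b u x\<bar> \<le> real DIM('a) * A / d + N * d + e"
    using ev by (rule tendsto_upperbound) simp
qed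

text \<open>If \<open>F x\<close> exceeded \<Delta>u at \<open>x\<close>, then for large
  \<open>j\<close> the function \<open>us j - u\<close> minus a small paraboloid would have positive
  Laplacian near \<open>x\<close>, although its boundary values lie below its value at the centre.
  Convergence of second derivatives does not enter.\<close>

lemma conv_pair_laplacian_le:
  fixes u :: "'a::euclidean_space \<Rightarrow> real"
  assumes U: "open U" and c: "conv_pair us u F U" and u: "Ck_on 2 u U"
    and F: "continuous_on U F" and x: "x \<in> U"
  shows "F x \<le> laplacian u x"
proof (rule ccontr)
  assume "\<not> F x \<le> laplacian u x"
  define n where "n = real DIM('a)"
  have n: "n > 0" by (simp add: n_def)
  define H where "H = (\<lambda>y. F y - laplacian u y)"
  define k where "k = H x / 2"
  have k: "k > 0" using \<open>\<not> F x \<le> laplacian u x\<close> by (simp add: k_def H_def)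
  have "continuous_on U H"
    unfolding H_def by (intro continuous_intros F continuous_on_laplacian[OF u])
  then have "isCont H x" using U x by (simp add: continuous_on_eq_continuous_at)
  then have "\<forall>\<^sub>F y in nhds x. H y > k"
    using order_tendstoD(1)[of H "H x" "at x" k] k unfolding isCont_def
    by (simp add: eventually_nhds_conv_at k_def)
  then obtain e where e: "e > 0" "\<And>y. dist y x < e \<Longrightarrow> H y > k"
    unfolding eventually_nhds_metric by blast
  obtain r0 where r0: "r0 > 0" "cball x r0 \<subseteq> U" using U x open_contains_cball by blast
  define r where "r = min r0 (e/2)"
  have r: "r > 0" "cball x r \<subseteq> U" "\<And>y. y \<in> cball x r \<Longrightarrow> H y > k"
    using r0 e by (auto simp: r_def dist_commute subset_eq)
  have C: "Ck_on 2 (us j) U" for j using c by (simp add: conv_pair_def)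
  \<comment> \<open>The paraboloid with coefficient \<open>k / (4 * n)\<close> has Laplacian k/2, so
    an error k/4 still leaves a positive Laplacian. Its height at distance \<open>r\<close> is four
    times the second bound, more than the errors in \<open>u\<close> can make up for.\<close>
  define h where "h = min (k/4) (k * r\<^sup>2 / (16 * n))"
  have h: "h > 0" "h \<le> k/4" "h \<le> k * r\<^sup>2 / (16 * n)" using k r n by (auto simp: h_def)
  have "\<forall>\<^sub>F j in sequentially. \<forall>y\<in>U. dist (us j y) (u y) < h"
    "\<forall>\<^sub>F j in sequentially. \<forall>y\<in>U. dist (laplacian (us j) y) (F y) < h"
    using c uniform_limitD h(1) unfolding conv_pair_def by blast+
  then have "\<forall>\<^sub>F j in sequentially. (\<forall>y\<in>U. dist (us j y) (u y) < h) \<and>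
     (\<forall>y\<in>U. dist (laplacian (us j) y) (F y) < h)" by (rule eventually_conj)
  then obtain j where j: "\<And>y. y \<in> U \<Longrightarrow> \<bar>us j y - u y\<bar> < h"
    "\<And>y. y \<in> U \<Longrightarrow> \<bar>laplacian (us j) y - F y\<bar> < h"
    unfolding eventually_sequentially dist_real_def by blast
  define w where "w = (\<lambda>y. us j y - u y - (k / (4 * n)) * (norm (y - x))\<^sup>2)"
  have w: "Ck_on 2 w U"
    unfolding w_def by (intro Ck_on_diff Ck_on_cmult Ck_on_dist_sq U C u)
  have lw: "laplacian w y > 0" if y: "y \<in> cball x r" for y
  proof -
    have yU: "y \<in> U" using r y by blast
    have "laplacian w y = laplacian (us j) y - laplacian u y - k/(4*n) * (2*n)"
      unfolding w_def n_def
      by (simp add: laplacian_diff[OF U _ _ yU] laplacian_cmult[OF U _ yU] Ck_on_diff[OF U]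
          Ck_on_cmult[OF U] C u Ck_on_dist_sq laplacian_dist_sq del: times_divide_eq_left)
    also have "k/(4*n) * (2*n) = k/2" using n by simp
    finally show ?thesis using j(2)[OF yU] r(3)[OF y] h k by (simp add: H_def)
  qed
  have "continuous_on (cball x r) w" using C2D(5)[OF w] r(2) continuous_on_subset by blast
  then obtain z where z: "z \<in> cball x r" "\<And>y. y \<in> cball x r \<Longrightarrow> w y \<le> w z"
    using continuous_attains_sup[of "cball x r" w] r(1) by force
  have "dist x z = r"
  proof (rule ccontr)
    assume "dist x z \<noteq> r"
    then have zb: "z \<in> ball x r" using z(1) by simp
    have "laplacian w z \<le> 0"
      using laplacian_nonpos_at_max[of "ball x r" w z] Ck_on_subset[OF w, of "ball x r"] r(2) zb z(2)
      by (auto simp: subset_eq)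
    then show False using lw[OF z(1)] by simp
  qed
  then have "w z < h - k / (4*n) * r\<^sup>2"
    using j(1)[of z] z(1) r(2) by (auto simp: w_def dist_norm norm_minus_commute)
  moreover have "w x > - h" using j(1)[OF x] by (simp add: w_def)
  moreover have "w x \<le> w z" using z(2)[of x] r(1) by simp
  moreover have "k / (4*n) * r\<^sup>2 = 4 * (k * r\<^sup>2 / (16 * n))" by simp
  moreover have "k * r\<^sup>2 / (16 * n) > 0" using k r n by simp
  ultimately show False using h by linarith
qed

lemma conv_pair_laplacian_eq:
  assumes U: "open U" and c: "conv_pair us u F U" and u: "Ck_on 2 u U"
    and F: "continuous_on U F" and x: "x \<in> U"
  shows "laplacian u x = F x"
proof -
  have "(-1) * F x \<le> laplacian (\<lambda>y. (-1) * u y) x"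
    by (rule conv_pair_laplacian_le[OF U conv_pair_cmult[OF U c, of "-1"]])
      (intro Ck_on_cmult u U continuous_intros F x)+
  then show ?thesis
    using conv_pair_laplacian_le[OF assms] laplacian_cmult[OF U u x, of "-1"] by simp
qed

text \<open>Difference quotients \<open>D\<^sub>s\<close> of \<open>u\<close> have Laplacians bounded by the Lipschitz constant of \<open>F\<close>,
  and \<open>D\<^sub>s - D\<^sub>t\<close> is uniformly small. Hence the gradient bound on balls of a small
  radius shows that the gradients of \<open>D\<^sub>s\<close> are uniformly Cauchy as \<open>s \<longrightarrow> 0\<close>.\<close>

lemma conv_pair_C2_local:
  fixes u :: "'a::euclidean_space \<Rightarrow> real"
  assumes U: "open U" and c: "conv_pair us u F U"
    and F: "\<And>x y. x \<in> U \<Longrightarrow> y \<in> U \<Longrightarrow> \<bar>F x - F y\<bar> \<le> L * norm (x - y)" and L: "L \<ge> 0"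
    and rho: "\<rho> > 0" and sub: "cball x0 (3 * \<rho>) \<subseteq> U"
  shows "Ck_on 2 u (ball x0 \<rho>)"
proof -
  define n where "n = real DIM('a)"
  have n: "n > 0" by (simp add: n_def)
  note C1 = C1D[OF conv_pair_C1(1)[OF U c]]
  \<comment> \<open>Second derivatives are found as limits of difference quotients of first ones:
    \<open>q a b s\<close> is the derivative along \<open>a\<close> of the quotient
    \<open>D s\<close> taken in direction \<open>b\<close> below.\<close>
  define q where "q = (\<lambda>a b s x. (dd a u (x + s *\<^sub>R b) - dd a u x) / s)"
  have Cauchy: "\<exists>\<eta>>0. \<forall>s t. 0 < \<bar>s\<bar> \<and> \<bar>s\<bar> < \<eta> \<and> 0 < \<bar>t\<bar> \<and> \<bar>t\<bar> < \<eta> \<longrightarrow>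
      (\<forall>x\<in>ball x0 \<rho>. \<bar>q a b s x - q a b t x\<bar> \<le> e)"
    if a: "a \<in> Basis" and b: "b \<in> Basis" and e: "e > 0" for a b :: 'a and e :: real
  proof -
    define d where "d = min \<rho> (e / (4 * (L + 1)))"
    have d: "d > 0" "d \<le> \<rho>" using rho e L by (auto simp: d_def)
    have "d \<le> e / (4 * (L + 1))" by (simp add: d_def)
    then have "d * (4 * (L + 1)) \<le> e" using L by (simp add: pos_le_divide_eq)
    moreover have "L * d \<ge> 0" using L d by simp
    ultimately have Ld: "2 * L * d \<le> e / 2" using d by (simp add: algebra_simps)
    \<comment> \<open>With \<open>2 * L * d \<le> e / 2\<close> secured by the radius, this
      \<open>A\<close> makes the remaining term n A / d of the gradient bound equal to e /
      2.\<close>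
    define A where "A = e * d / (2 * n)"
    have A: "A > 0" using e d n by (simp add: A_def)
    have "uniformly_continuous_on (cball x0 (3 * \<rho>)) (dd b u)"
      by (intro compact_uniformly_continuous continuous_on_subset[OF C1(2) sub] compact_cball)
    then obtain h where h: "h > 0" "\<And>y z. y \<in> cball x0 (3*\<rho>) \<Longrightarrow> z \<in> cball x0 (3*\<rho>) \<Longrightarrow>
        dist z y < h \<Longrightarrow> dist (dd b u z) (dd b u y) < A / 2"
      unfolding uniformly_continuous_on_def using A by (meson half_gt_zero)
    define \<eta> where "\<eta> = min h \<rho>"
    have eta: "\<eta> > 0" using h rho by (simp add: \<eta>_def)
    have in3: "y + s *\<^sub>R b \<in> cball x0 (3*\<rho>)" if "y \<in> ball x0 (2*\<rho>)" "\<bar>s\<bar> < \<eta>" for y s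
    proof -
      have "dist x0 (y + s *\<^sub>R b) \<le> dist x0 y + dist y (y + s *\<^sub>R b)" by (rule dist_triangle)
      moreover have "dist y (y + s *\<^sub>R b) = \<bar>s\<bar>" using b by (simp add: dist_norm)
      ultimately show ?thesis using that by (simp add: \<eta>_def)
    qed
    define D where "D = (\<lambda>s y. (1/s) * (u (s *\<^sub>R b + y) - u y))"
    have Dq: "\<bar>D s y - dd b u y\<bar> \<le> A / 2" if s: "0 < \<bar>s\<bar>" "\<bar>s\<bar> < \<eta>" and y: "y \<in> ball x0 (2*\<rho>)" for s y
    proof -
      have yr: "((\<lambda>t. u (y + t *\<^sub>R b)) has_real_derivative dd b u (y + t *\<^sub>R b)) (at t)"
        if "\<bar>t\<bar> \<le> \<bar>s\<bar>" for t
        using in3[OF y, of t] that s sub by (intro line_has_derivative C1(1)) auto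
      have "\<exists>z. \<bar>z\<bar> \<le> \<bar>s\<bar> \<and> u (y + s *\<^sub>R b) - u y = s * dd b u (y + z *\<^sub>R b)"
      proof (cases "s > 0")
        case True
        have "(\<And>t. 0 \<le> t \<Longrightarrow> t \<le> s \<Longrightarrow>
          ((\<lambda>t. u (y + t *\<^sub>R b)) has_real_derivative dd b u (y + t *\<^sub>R b)) (at t))"
          by (rule yr) simp
        from MVT2[OF True this] show ?thesis by force
      next
        case False
        then have s0: "s < 0" using s by simp
        have "(\<And>t. s \<le> t \<Longrightarrow> t \<le> 0 \<Longrightarrow>
          ((\<lambda>t. u (y + t *\<^sub>R b)) has_real_derivative dd b u (y + t *\<^sub>R b)) (at t))"
          by (rule yr) simp
        from MVT2[OF s0 this] obtain z where "s < z" "z < 0"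
          "u (y + 0 *\<^sub>R b) - u (y + s *\<^sub>R b) = (0 - s) * dd b u (y + z *\<^sub>R b)" by blast
        then show ?thesis by (intro exI[of _ z]) (auto simp: algebra_simps)
      qed
      then obtain z where z: "\<bar>z\<bar> \<le> \<bar>s\<bar>" "u (y + s *\<^sub>R b) - u y = s * dd b u (y + z *\<^sub>R b)"
        by blast
      have "D s y = dd b u (y + z *\<^sub>R b)" using z(2) s by (simp add: D_def add.commute)
      moreover have "dist (dd b u (y + z *\<^sub>R b)) (dd b u y) < A / 2"
      proof (rule h(2))
        show "y \<in> cball x0 (3 * \<rho>)" using y rho by auto
        show "y + z *\<^sub>R b \<in> cball x0 (3 * \<rho>)" using in3[OF y, of z] z s by simp
        show "dist (y + z *\<^sub>R b) y < h" using z s b by (simp add: dist_norm \<eta>_def)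
      qed
      ultimately show ?thesis by (simp add: dist_real_def)
    qed
    have "\<bar>q a b s x - q a b t x\<bar> \<le> e"
      if s: "0 < \<bar>s\<bar>" "\<bar>s\<bar> < \<eta>" and t: "0 < \<bar>t\<bar>" "\<bar>t\<bar> < \<eta>" and x: "x \<in> ball x0 \<rho>" for s t x
    proof -
      let ?V = "ball x0 (2*\<rho>)"
      have VU: "?V \<subseteq> U" using sub rho by (auto simp: subset_eq)
      have Vs: "?V \<subseteq> {y. s *\<^sub>R b + y \<in> U}" "?V \<subseteq> {y. t *\<^sub>R b + y \<in> U}"
        using in3 s t sub by (auto simp: add.commute)
      obtain ws where ws: "conv_pair ws (\<lambda>y. D s y - D t y)
          (\<lambda>y. (1/s) * (F (s *\<^sub>R b + y) - F y) - (1/t) * (F (t *\<^sub>R b + y) - F y)) ?V"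
        unfolding D_def
        using conv_pair_diff[OF _
            conv_pair_cmult[OF _ conv_pair_diff[OF _
              conv_pair_subset[OF conv_pair_translate[OF U c] Vs(1)] conv_pair_subset[OF c VU]]]
            conv_pair_cmult[OF _ conv_pair_diff[OF _
              conv_pair_subset[OF conv_pair_translate[OF U c] Vs(2)] conv_pair_subset[OF c VU]]],
            OF open_ball open_ball open_ball open_ball open_ball]
        by blast
      have xV: "cball x d \<subseteq> ?V"
      proof
        fix y assume "y \<in> cball x d"
        then show "y \<in> ?V" using x d dist_triangle[of x0 y x] by simp
      qed
      have FL: "\<bar>(1/s) * (F (s *\<^sub>R b + y) - F y)\<bar> \<le> L" if "0 < \<bar>s\<bar>" "\<bar>s\<bar> < \<eta>" "y \<in> ?V" for s y
      proof -
        have "y + s *\<^sub>R b \<in> U" "y \<in> U" using in3[OF that(3,2)] VU sub that by auto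
        then have "\<bar>F (y + s *\<^sub>R b) - F y\<bar> \<le> L * \<bar>s\<bar>" using F b by fastforce
        then show ?thesis using that by (simp add: abs_mult field_simps)
      qed
      have "\<bar>dd a (\<lambda>y. D s y - D t y) x\<bar> \<le> real DIM('a) * A / d + 2 * L * d"
      proof (rule conv_pair_gradient_bound[OF open_ball ws xV d(1) _ _ a])
        fix y assume "y \<in> cball x d"
        then have y: "y \<in> ?V" using xV by blast
        show "\<bar>D s y - D t y\<bar> \<le> A" using Dq[OF s y] Dq[OF t y] by linarith
        show "\<bar>(1/s) * (F (s *\<^sub>R b + y) - F y) - (1/t) * (F (t *\<^sub>R b + y) - F y)\<bar> \<le> 2 * L"
          using FL[OF s y] FL[OF t y] by linarith
      qed
      also have "\<dots> \<le> e / 2 + e / 2"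
        using Ld n d by (intro add_mono) (auto simp: A_def n_def)
      finally have "\<bar>dd a (\<lambda>y. D s y - D t y) x\<bar> \<le> e" by simp
      have xs: "x \<in> U" using x VU rho by (auto simp: subset_eq)
      have DD: "D s differentiable (at x)" "dd a (D s) x = q a b s x" if "0 < \<bar>s\<bar>" "\<bar>s\<bar> < \<eta>" for s
      proof -
        have "x + s *\<^sub>R b \<in> U" using in3[of x s] x that rho sub by auto
        then have u': "u differentiable (at (s *\<^sub>R b + x))" by (intro C1(1)) (simp add: add.commute)
        note dt = dd_affine[OF bounded_linear_ident u']
        have 1: "(\<lambda>y. u (s *\<^sub>R b + y) - u y) differentiable (at x)"
          by (intro derivative_intros dt(1) C1(1) xs)
        show "D s differentiable (at x)"
          unfolding D_def by (intro derivative_intros 1)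
        show "dd a (D s) x = q a b s x"
          unfolding D_def q_def dd_cmult[OF 1] dd_diff[OF dt(1) C1(1)[OF xs]] dt(2)
          by (simp add: add.commute)
      qed
      have "dd a (\<lambda>y. D s y - D t y) x = q a b s x - q a b t x"
        using dd_diff[OF DD(1)[OF s] DD(1)[OF t]] DD(2)[OF s] DD(2)[OF t] by simp
      with \<open>\<bar>dd a (\<lambda>y. D s y - D t y) x\<bar> \<le> e\<close> show ?thesis by simp
    qed
    then show ?thesis using eta by blast
  qed
  have "\<exists>H. continuous_on (ball x0 \<rho>) H \<and> (\<forall>x\<in>ball x0 \<rho>.
      ((\<lambda>s. dd a u (x + s *\<^sub>R b)) has_real_derivative H x) (at 0))"
    if a: "a \<in> Basis" and b: "b \<in> Basis" for a b :: 'a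
  proof -
    \<comment> \<open>Along a sequence of step sizes the quotients have a uniform, hence continuous,
      limit \<open>H\<close>; the Cauchy estimate then extends the convergence to all
      \<open>s\<close> tending to 0.\<close>
    define S where "S = (\<lambda>k. \<rho> / real (Suc k))"
    have S: "S k > 0" for k using rho by (simp add: S_def)
    have S0: "S \<longlonglongrightarrow> 0" unfolding S_def
      using tendsto_mult[OF tendsto_const[of \<rho>] LIMSEQ_inverse_real_of_nat] by (simp add: divide_inverse)
    have Sk: "\<forall>\<^sub>F k in sequentially. \<bar>S k\<bar> < \<eta>" if "\<eta> > 0" for \<eta>
      using tendstoD[OF S0 that] by (simp add: dist_real_def)
    have "uniformly_Cauchy_on (ball x0 \<rho>) (\<lambda>k. q a b (S k))"
    proof (rule uniformly_Cauchy_onI)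
      fix e :: real assume e: "e > 0"
      obtain \<eta> where eta: "\<eta> > 0" "\<And>s t x. 0 < \<bar>s\<bar> \<Longrightarrow> \<bar>s\<bar> < \<eta> \<Longrightarrow> 0 < \<bar>t\<bar> \<Longrightarrow> \<bar>t\<bar> < \<eta> \<Longrightarrow>
          x \<in> ball x0 \<rho> \<Longrightarrow> \<bar>q a b s x - q a b t x\<bar> \<le> e / 2"
        using Cauchy[OF a b, of "e/2"] e by (metis half_gt_zero)
      obtain M where M: "\<And>k. k \<ge> M \<Longrightarrow> \<bar>S k\<bar> < \<eta>" using Sk[OF eta(1)] eventually_sequentially by auto
      have "dist (q a b (S k) x) (q a b (S l) x) < e" if "x \<in> ball x0 \<rho>" "k \<ge> M" "l \<ge> M" for x k l
        using eta(2)[of "S k" "S l" x] M[OF that(2)] M[OF that(3)] S[of k] S[of l] that(1) e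
        by (simp add: dist_real_def)
      then show "\<exists>M. \<forall>x\<in>ball x0 \<rho>. \<forall>m\<ge>M. \<forall>n\<ge>M. dist (q a b (S m) x) (q a b (S n) x) < e" by blast
    qed
    then obtain H where H: "uniform_limit (ball x0 \<rho>) (\<lambda>k. q a b (S k)) H sequentially"
      using Cauchy_uniformly_convergent unfolding uniformly_convergent_on_def by blast
    have "continuous_on (ball x0 \<rho>) H"
    proof (rule uniform_limit_theorem[OF _ H])
      have "continuous_on (ball x0 \<rho>) (q a b (S k))" if "\<bar>S k\<bar> < \<rho>" for k
      proof -
        have 1: "x + S k *\<^sub>R b \<in> U" if "x \<in> ball x0 \<rho>" for x
        proof -
          have "dist x0 (x + S k *\<^sub>R b) \<le> dist x0 x + dist x (x + S k *\<^sub>R b)" by (rule dist_triangle)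
          then show ?thesis using that \<open>\<bar>S k\<bar> < \<rho>\<close> b sub rho by (auto simp: dist_norm)
        qed
        have "continuous_on (ball x0 \<rho>) (\<lambda>x. dd a u (x + S k *\<^sub>R b))"
          by (rule continuous_on_compose2[OF C1(2)[of a]]) (use 1 in \<open>auto intro!: continuous_intros\<close>)
        moreover have "ball x0 \<rho> \<subseteq> U" using sub rho by (auto simp: subset_eq)
        then have "continuous_on (ball x0 \<rho>) (dd a u)" using C1(2) continuous_on_subset by blast
        ultimately show ?thesis unfolding q_def using S[of k] by (intro continuous_intros) auto
      qed
      then show "\<forall>\<^sub>F k in sequentially. continuous_on (ball x0 \<rho>) (q a b (S k))"
        using Sk[OF rho] by (auto elim: eventually_mono)
    qed simp
    moreover have "((\<lambda>s. dd a u (x + s *\<^sub>R b)) has_real_derivative H x) (at 0)" if x: "x \<in> ball x0 \<rho>" for x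
    proof -
      have "((\<lambda>s. q a b s x) \<longlongrightarrow> H x) (at 0)"
      proof (rule tendstoI)
        fix e :: real assume e: "e > 0"
        obtain \<eta> where eta: "\<eta> > 0" "\<And>s t x. 0 < \<bar>s\<bar> \<Longrightarrow> \<bar>s\<bar> < \<eta> \<Longrightarrow> 0 < \<bar>t\<bar> \<Longrightarrow> \<bar>t\<bar> < \<eta> \<Longrightarrow>
            x \<in> ball x0 \<rho> \<Longrightarrow> \<bar>q a b s x - q a b t x\<bar> \<le> e / 2"
          using Cauchy[OF a b, of "e/2"] e by (metis half_gt_zero)
        have "\<bar>q a b s x - H x\<bar> < e" if s: "0 < \<bar>s\<bar>" "\<bar>s\<bar> < \<eta>" for s
        proof -
          have "(\<lambda>k. \<bar>q a b s x - q a b (S k) x\<bar>) \<longlonglongrightarrow> \<bar>q a b s x - H x\<bar>"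
            by (intro tendsto_intros tendsto_uniform_limitI[OF H x])
          moreover have "\<forall>\<^sub>F k in sequentially. \<bar>q a b s x - q a b (S k) x\<bar> \<le> e / 2"
            using Sk[OF eta(1)]
          proof eventually_elim
            case (elim k)
            show ?case by (rule eta(2)[OF s _ elim x]) (use S[of k] in simp)
          qed
          ultimately have "\<bar>q a b s x - H x\<bar> \<le> e / 2" by (rule tendsto_upperbound) simp
          then show ?thesis using e by simp
        qed
        then show "\<forall>\<^sub>F s in at 0. dist (q a b s x) (H x) < e"
          unfolding eventually_at using eta(1)
          by (intro exI[of _ \<eta>]) (auto simp: dist_real_def)
      qed
      then show ?thesis by (simp add: DERIV_def q_def)
    qed
    ultimately show ?thesis by blast
  qed
  then obtain H where Hc: "\<And>a b. a \<in> Basis \<Longrightarrow> b \<in> Basis \<Longrightarrow> continuous_on (ball x0 \<rho>) (H a b)"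
    and Hd: "\<And>a b x. a \<in> Basis \<Longrightarrow> b \<in> Basis \<Longrightarrow> x \<in> ball x0 \<rho> \<Longrightarrow>
      ((\<lambda>s. dd a u (x + s *\<^sub>R b)) has_real_derivative H a b x) (at 0)"
    by metis
  have BU: "ball x0 \<rho> \<subseteq> U" using sub rho by (auto simp: subset_eq)
  have part: "(dd a u has_derivative (\<lambda>h. \<Sum>b\<in>Basis. (h \<bullet> b) * H a b x)) (at x)"
    if a: "a \<in> Basis" and x: "x \<in> ball x0 \<rho>" for a x
  proof -
    obtain r where r: "r > 0" "ball x r \<subseteq> ball x0 \<rho>"
      using openE[OF open_ball x] by blast
    show ?thesis
      by (rule has_derivative_partials[OF r(1)])
        (use Hd[OF a] r(2) continuous_on_subset[OF Hc[OF a] r(2)] in auto)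
  qed
  have dv: "dd v u x = (\<Sum>a\<in>Basis. (v \<bullet> a) * dd a u x)" if "x \<in> ball x0 \<rho>" for v x
    using that BU by (intro dd_Basis_sum C1(1)) auto
  have 2: "(dd v u has_derivative (\<lambda>h. \<Sum>a\<in>Basis. (v \<bullet> a) * (\<Sum>b\<in>Basis. (h \<bullet> b) * H a b x))) (at x)"
    if x: "x \<in> ball x0 \<rho>" for v x
  proof -
    have "((\<lambda>x. \<Sum>a\<in>Basis. (v \<bullet> a) * dd a u x) has_derivative
        (\<lambda>h. \<Sum>a\<in>Basis. (v \<bullet> a) * (\<Sum>b\<in>Basis. (h \<bullet> b) * H a b x))) (at x)"
      by (intro has_derivative_sum has_derivative_mult_right part x)
    then show ?thesis
      by (rule has_derivative_transform_within_open[OF _ open_ball x]) (simp add: dv)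
  qed
  show ?thesis
  proof (rule C2I)
    show "u differentiable (at x)" if "x \<in> ball x0 \<rho>" for x using C1(1) that BU by blast
    show "dd v u differentiable (at x)" if "x \<in> ball x0 \<rho>" for v x
      using 2[OF that] by (auto simp: differentiable_def)
    have "continuous_on (ball x0 \<rho>) (\<lambda>x. \<Sum>a\<in>Basis. (v \<bullet> a) * (\<Sum>b\<in>Basis. (w \<bullet> b) * H a b x))" for v w
      by (intro continuous_intros Hc)
    then show "continuous_on (ball x0 \<rho>) (dd w (dd v u))" for v w
      by (rule continuous_on_eq) (simp add: dd_eq[OF 2])
  qed
qed

lemma Ck_on_local:
  assumes "\<And>x. x \<in> D \<Longrightarrow> \<exists>E. open E \<and> x \<in> E \<and> Ck_on k u E"
  shows "Ck_on k u D"
  using assms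
proof (induction k arbitrary: u)
  case 0
  then show ?case
    by (auto intro!: continuous_at_imp_continuous_on simp: continuous_on_eq_continuous_at)
      (metis continuous_on_eq_continuous_at)
next
  case (Suc k)
  have "Ck_on k (dd v u) D" for v
    by (rule Suc.IH) (use Suc.prems in fastforce)
  moreover have "u differentiable (at x)" if "x \<in> D" for x
    using Suc.prems[OF that] by auto
  ultimately show ?case by simp
qed

text \<open>Both claims are local, so the approximating sequence may depend on the point. The radius
  \<open>e/3\<close> fits the ball of triple radius demanded by
  \<open>conv_pair_C2_local\<close>.\<close>

theorem conv_pair_regularity:
  fixes u :: "'a::euclidean_space \<Rightarrow> real"
  assumes "\<And>x. x \<in> U \<Longrightarrow> \<exists>V us L. open V \<and> x \<in> V \<and> conv_pair us u F V \<and> 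
     (\<forall>y\<in>V. \<forall>z\<in>V. \<bar>F y - F z\<bar> \<le> L * norm (y - z))"
  shows "Ck_on 2 u U" "\<And>x. x \<in> U \<Longrightarrow> laplacian u x = F x"
proof -
  have "\<exists>E. open E \<and> x \<in> E \<and> Ck_on 2 u E \<and> laplacian u x = F x" if x: "x \<in> U" for x
  proof -
    obtain V us L where V: "open V" "x \<in> V" "conv_pair us u F V"
      and L: "\<And>y z. y \<in> V \<Longrightarrow> z \<in> V \<Longrightarrow> \<bar>F y - F z\<bar> \<le> L * norm (y - z)"
      using assms[OF x] by blast
    have L': "\<bar>F y - F z\<bar> \<le> \<bar>L\<bar> * norm (y - z)" if "y \<in> V" "z \<in> V" for y z
      by (rule order_trans[OF L[OF that] mult_right_mono]) auto
    obtain e where e: "e > 0" "cball x e \<subseteq> V" using V open_contains_cball by blast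
    have C: "Ck_on 2 u (ball x (e/3))"
      by (rule conv_pair_C2_local[OF V(1,3) L']) (use e in auto)
    have sub: "ball x (e/3) \<subseteq> V" using e by (auto simp: subset_eq)
    have "continuous_on (ball x (e/3)) F"
    proof (rule continuous_on_subset[OF _ sub])
      have "\<bar>L\<bar>-lipschitz_on V F"
        by (rule lipschitz_onI) (use L' in \<open>auto simp: dist_real_def dist_norm\<close>)
      then show "continuous_on V F" by (rule lipschitz_on_continuous_on)
    qed
    then have "laplacian u x = F x"
      using conv_pair_laplacian_eq[OF open_ball conv_pair_subset[OF V(3) sub] C] e by simp
    then show ?thesis using C e by (intro exI[of _ "ball x (e/3)"]) auto
  qed
  then show "Ck_on 2 u U" "\<And>x. x \<in> U \<Longrightarrow> laplacian u x = F x"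
    using Ck_on_local[of U 2 u] by blast+
qed

section \<open>Weighted means and the local Harnack inequality\<close>

lemma integrable_compact_support:
  fixes f :: "'a::euclidean_space \<Rightarrow> real"
  assumes "continuous_on UNIV f" "compact K" "\<And>x. x \<notin> K \<Longrightarrow> f x = 0"
  shows "integrable lborel f"
proof -
  have "integrable lborel (\<lambda>x. indicator K x *\<^sub>R f x)"
    using borel_integrable_compact[OF assms(2) continuous_on_subset[OF assms(1)]] by simp
  moreover have "(\<lambda>x. indicator K x *\<^sub>R f x) = f" using assms(3) by (auto simp: indicator_def fun_eq_iff)
  ultimately show ?thesis by simp
qed

lemma lborel_integral_affine:
  fixes g :: "'a::euclidean_space \<Rightarrow> real"
  assumes "c \<noteq> 0" and [measurable]: "g \<in> borel_measurable borel"
  shows "(\<integral>z. g z \<partial>lborel) = \<bar>c\<bar> ^ DIM('a) * (\<integral>z. g (a + c *\<^sub>R z) \<partial>lborel)"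
  by (subst lborel_affine[OF assms(1), of a]) (simp add: integral_density integral_distr)

lemma lborel_integrable_affine:
  fixes g :: "'a::euclidean_space \<Rightarrow> real"
  assumes "c \<noteq> 0" and g: "integrable lborel g"
  shows "integrable lborel (\<lambda>z. g (a + c *\<^sub>R z))"
proof -
  have [measurable]: "g \<in> borel_measurable borel" using g borel_measurable_integrable by fastforce
  have "integrable (distr lborel borel (\<lambda>z. a + c *\<^sub>R z)) g"
    using g assms(1) by (subst (asm) lborel_affine[OF assms(1), of a]) (simp add: integrable_density)
  then show ?thesis by (simp add: integrable_distr_eq)
qed

lemma lborel_integral_translate:
  fixes g :: "'a::euclidean_space \<Rightarrow> real"
  assumes "g \<in> borel_measurable borel"
  shows "(\<integral>z. g (a + z) \<partial>lborel) = (\<integral>z. g z \<partial>lborel)"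
  using lborel_integral_affine[of 1 g a] assms by simp

lemma compact_subset_cube:
  assumes "compact (K::'a::euclidean_space set)"
  obtains M where "M > 0" "\<And>x y. x \<in> K \<Longrightarrow> norm y \<le> 1 \<Longrightarrow> x + y \<in> cbox (- M *\<^sub>R One) (M *\<^sub>R One)"
proof -
  obtain B where B: "\<And>x. x \<in> K \<Longrightarrow> norm x \<le> B" using compact_imp_bounded[OF assms] bounded_iff by blast
  have "x + y \<in> cbox (- (\<bar>B\<bar> + 1) *\<^sub>R One) ((\<bar>B\<bar> + 1) *\<^sub>R One)" if "x \<in> K" "norm y \<le> 1" for x y
  proof -
    have "norm (x + y) \<le> \<bar>B\<bar> + 1" using norm_triangle_ineq[of x y] B[OF that(1)] that(2) by linarith
    then have "\<bar>(x + y) \<bullet> b\<bar> \<le> \<bar>B\<bar> + 1" if "b \<in> Basis" for b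
      using Basis_le_norm[OF that, of "x + y"] by linarith
    then show ?thesis by (auto simp: mem_box abs_le_iff) (smt (verit, best))+
  qed
  then show thesis by (intro that[of "\<bar>B\<bar> + 1"]) simp_all
qed

lemma AE_notin_open:
  fixes U :: "'a::euclidean_space set"
  assumes "open U" "AE x in lborel. x \<notin> U"
  shows "U = {}"
proof (rule ccontr)
  assume "U \<noteq> {}"
  then obtain x r where r: "r > 0" "ball x r \<subseteq> U" using assms(1) open_contains_ball by blast
  have "AE y in lborel. y \<notin> ball x r" using assms(2) by eventually_elim (use r in auto)
  then have "emeasure lborel (ball x r) = 0"
    using AE_iff_null_sets[of "ball x r" lborel] by auto
  then show False using content_ball_pos[OF r(1), of x] by (simp add: measure_def)
qed

text \<open>By translation invariance the integral of f(x + t b) does not depend on t;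
  differentiating under the integral at t = 0 gives the claim. The cube is large enough to contain
  the supports of all translates with |t| < 1.\<close>

lemma integral_dd_eq_0:
  fixes f :: "'a::euclidean_space \<Rightarrow> real"
  assumes d: "\<And>x. f differentiable (at x)" and c: "continuous_on UNIV (dd b f)"
    and K: "compact K" "\<And>x. x \<notin> K \<Longrightarrow> f x = 0" and b: "norm b \<le> 1"
  shows "integrable lborel (dd b f)" "(\<integral>x. dd b f x \<partial>lborel) = 0"
proof -
  have fc: "continuous_on UNIV f"
    using d by (intro continuous_at_imp_continuous_on ballI differentiable_imp_continuous_within)
  have fb: "f \<in> borel_measurable borel" by (rule borel_measurable_continuous_onI[OF fc])
  have dK: "dd b f x = 0" if "x \<notin> K" for x
  proof -
    have "dd b f x = dd b (\<lambda>_. 0) x"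
      by (rule fun_cong[OF frechet_derivative_cong_open[of "-K"]])
        (use that K compact_imp_closed in auto)
    then show ?thesis by (simp add: dd_const)
  qed
  show int: "integrable lborel (dd b f)" using integrable_compact_support[OF c K(1) dK] .
  obtain M where M: "M > 0" "\<And>x y. x \<in> K \<Longrightarrow> norm y \<le> 1 \<Longrightarrow> x + y \<in> cbox (- M *\<^sub>R One) (M *\<^sub>R One)"
    using compact_subset_cube[OF K(1)] by blast
  let ?B = "cbox (- M *\<^sub>R One) (M *\<^sub>R One) :: 'a set"
  have eq: "integral ?B (\<lambda>x. f (x + t *\<^sub>R b)) = (\<integral>x. f x \<partial>lborel)" if "\<bar>t\<bar> < 1" for t
  proof -
    have z: "f (x + t *\<^sub>R b) = 0" if "x \<notin> ?B" for x
    proof (rule ccontr)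
      assume "f (x + t *\<^sub>R b) \<noteq> 0"
      then have "x + t *\<^sub>R b \<in> K" using K(2) by blast
      moreover have "norm (- (t *\<^sub>R b)) \<le> 1"
        using \<open>\<bar>t\<bar> < 1\<close> b mult_mono[of "\<bar>t\<bar>" 1 "norm b" 1] by simp
      ultimately show False using M(2)[of "x + t *\<^sub>R b" "- (t *\<^sub>R b)"] that by simp
    qed
    have cc: "continuous_on UNIV (\<lambda>x. f (x + t *\<^sub>R b))"
      by (rule continuous_on_compose2[OF fc]) (auto intro!: continuous_intros)
    have "integral ?B (\<lambda>x. f (x + t *\<^sub>R b)) = integral UNIV (\<lambda>x. f (x + t *\<^sub>R b))"
    proof (rule integral_spike_set)
      have "{x \<in> UNIV - ?B. f (x + t *\<^sub>R b) \<noteq> 0} = {}" using z by blast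
      then show "negligible {x \<in> UNIV - ?B. f (x + t *\<^sub>R b) \<noteq> 0}" by (simp only: negligible_empty)
    qed simp
    also have "\<dots> = (\<integral>x. f (x + t *\<^sub>R b) \<partial>lborel)"
      using integrable_compact_support[OF cc compact_cbox z] by (simp add: integral_lborel)
    also have "\<dots> = (\<integral>x. f x \<partial>lborel)"
      using lborel_integral_translate[OF fb, of "t *\<^sub>R b"] by (simp add: add.commute)
    finally show ?thesis .
  qed
  have "((\<lambda>t. integral ?B (\<lambda>x. f (x + t *\<^sub>R b))) has_field_derivative
      integral ?B (\<lambda>x. dd b f (x + 0 *\<^sub>R b))) (at 0 within {-1<..<1})"
  proof (rule leibniz_rule_field_derivative)
    show "((\<lambda>t. f (x + t *\<^sub>R b)) has_field_derivative dd b f (x + t *\<^sub>R b)) (at t within {-1<..<1})" for x t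
      by (rule DERIV_subset[OF line_has_derivative[OF d]]) simp
    show "(\<lambda>x. f (x + t *\<^sub>R b)) integrable_on ?B" for t
      by (intro integrable_continuous continuous_on_compose2[OF fc]) (auto intro!: continuous_intros)
    show "continuous_on ({- 1<..<1} \<times> ?B) (\<lambda>(t, x). dd b f (x + t *\<^sub>R b))"
      unfolding split_beta
      by (rule continuous_on_compose2[OF c]) (auto intro!: continuous_intros)
  qed auto
  then have "((\<lambda>t. integral ?B (\<lambda>x. f (x + t *\<^sub>R b))) has_real_derivative
      integral ?B (dd b f)) (at 0)"
    by (simp add: at_within_open[of 0 "{-1<..<1}"])
  then have "((\<lambda>t. \<integral>x. f x \<partial>lborel) has_real_derivative integral ?B (dd b f)) (at 0)"
    by (rule has_field_derivative_transform_within_open[of _ _ _ "{-1<..<1}"]) (use eq in auto)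
  then have "integral ?B (dd b f) = 0" using DERIV_unique DERIV_const by blast
  moreover have "integral ?B (dd b f) = integral UNIV (dd b f)"
  proof (rule integral_spike_set)
    have "{x \<in> UNIV - ?B. dd b f x \<noteq> 0} = {}" using dK M(2)[of _ 0] by force
    then show "negligible {x \<in> UNIV - ?B. dd b f x \<noteq> 0}" by (simp only: negligible_empty)
  qed auto
  ultimately show "(\<integral>x. dd b f x \<partial>lborel) = 0" using int by (simp add: integral_lborel)
qed

section \<open>Weighted means over balls\<close>

text \<open>The weight \<open>mean_wt\<close> is chosen such that \<open>- 2 y mean_wt y\<close> is the gradient of
  \<open>y \<mapsto> bump_part 0 (1 - |y|\<^sup>2)\<close>, a function below \<open>mean_wt\<close>.\<close>

definition mean_wt :: "'a::euclidean_space \<Rightarrow> real" where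
  "mean_wt y = bump_part 2 (1 - (norm y)\<^sup>2)"

definition mean_wt' :: "'a::euclidean_space \<Rightarrow> real" where
  "mean_wt' y = bump_part 0 (1 - (norm y)\<^sup>2)"

lemma bump_part_nonneg: "0 \<le> bump_part m t"
  by (simp add: bump_part_def)

lemma mean_wt_nonneg: "0 \<le> mean_wt y" "0 \<le> mean_wt' y"
  by (simp_all add: mean_wt_def mean_wt'_def bump_part_nonneg)

lemma mean_wt_eq_0: "norm y \<ge> 1 \<Longrightarrow> mean_wt y = 0" "norm y \<ge> 1 \<Longrightarrow> mean_wt' y = 0"
  using one_le_power[of "norm y" 2]
  by (simp_all add: mean_wt_def mean_wt'_def bump_part_def not_less del: one_le_power)

lemma mean_wt'_le: "mean_wt' y \<le> mean_wt y"
proof (cases "1 - (norm y)\<^sup>2 > 0")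
  case True
  let ?s = "1 - (norm y)\<^sup>2"
  have "?s\<^sup>2 \<le> 1" using True by (simp add: power_le_one)
  then have "1 \<le> (1 / ?s)\<^sup>2" using True by (simp add: power_divide)
  then show ?thesis using True by (simp add: mean_wt_def mean_wt'_def bump_part_def)
qed (simp add: mean_wt_def mean_wt'_def bump_part_def)

lemma Ck_on_mean_wt:
  "Ck_on k (mean_wt :: 'a::euclidean_space \<Rightarrow> real) UNIV"
  "Ck_on k (mean_wt' :: 'a::euclidean_space \<Rightarrow> real) UNIV"
proof -
  have "Ck_on k (\<lambda>y::'a. 1 - (norm (y - 0))\<^sup>2) UNIV"
    by (intro Ck_on_diff Ck_on_const Ck_on_dist_sq) auto
  then have "Ck_on k (\<lambda>y::'a. bump_part m (1 - (norm y)\<^sup>2)) UNIV" for m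
    using Ck_on_compose_real[OF open_UNIV _ open_UNIV Ck_on_bump_part] by auto
  then show "Ck_on k (mean_wt :: 'a \<Rightarrow> _) UNIV" "Ck_on k (mean_wt' :: 'a \<Rightarrow> _) UNIV"
    by (simp_all add: mean_wt_def[abs_def] mean_wt'_def[abs_def])
qed

lemma continuous_on_mean_wt: "continuous_on A mean_wt" "continuous_on A mean_wt'"
  using Ck_on_mean_wt[of 0] continuous_on_subset by auto

lemma dd_dist_sq: "dd b (\<lambda>y. (norm (y - x))\<^sup>2) y = 2 * ((y - x) \<bullet> b)"
proof -
  have "((\<lambda>y. (y - x) \<bullet> (y - x)) has_derivative (\<lambda>h. 2 * ((y - x) \<bullet> h))) (at y)"
    by (auto intro!: derivative_eq_intros simp: inner_commute)
  from dd_eq[OF this, of b] show ?thesis by (simp add: power2_norm_eq_inner)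
qed

lemma dd_mean_wt': "dd b mean_wt' y = - 2 * (y \<bullet> b) * mean_wt y"
proof -
  have 1: "(\<lambda>y. 1 - (norm (y - 0))\<^sup>2) differentiable (at y)" for y :: 'a
    using C2D(1)[OF Ck_on_diff[OF open_UNIV Ck_on_const Ck_on_dist_sq]] by blast
  have 2: "bump_part 0 differentiable (at t)" for t
    using bump_part_deriv real_differentiable_def by blast
  have "dd b (\<lambda>y. 1 - (norm (y - 0))\<^sup>2) y = 0 - 2 * ((y - 0) \<bullet> b)"
    using dd_diff[of "\<lambda>_. 1" y "\<lambda>y. (norm (y - 0))\<^sup>2" b] C2D(1)[OF Ck_on_dist_sq]
    unfolding dd_const dd_dist_sq by simp
  moreover have "dd 1 (bump_part 0) t = bump_part 2 t" for t
    using dd_real[OF bump_part_deriv[of 0 t], of 1] by (simp add: numeral_2_eq_2)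
  ultimately show ?thesis
    using dd_compose_real[OF 1 2, where v=b and x=y]
    unfolding mean_wt'_def[abs_def] mean_wt_def by simp
qed

lemma exp_ge_sq_half: "0 \<le> t \<Longrightarrow> t\<^sup>2 / 2 \<le> exp (t::real)"
  using exp_lower_Taylor_quadratic[of t] by simp

lemma mean_wt_le_2: "mean_wt y \<le> 2"
proof (cases "1 - (norm y)\<^sup>2 > 0")
  case True
  define t where "t = 1 / (1 - (norm y)\<^sup>2)"
  have "t\<^sup>2 \<le> 2 * exp t" using exp_ge_sq_half[of t] True by (simp add: t_def)
  then have "t\<^sup>2 * exp (- t) \<le> 2" by (simp add: exp_minus field_simps)
  then show ?thesis using True by (simp add: mean_wt_def bump_part_def t_def)
qed (simp add: mean_wt_def bump_part_def)

text \<open>16/7 is 1 / (1 - (3/4)^2); the radius 3/4 is the one that occurs in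
  \<open>mean_wt_compare\<close>.\<close>

lemma mean_wt_ge: "norm y \<le> 3/4 \<Longrightarrow> exp (- (16/7)) \<le> mean_wt y"
proof -
  assume "norm y \<le> 3/4"
  then have "(norm y)\<^sup>2 \<le> (3/4)\<^sup>2" by (intro power_mono) auto
  then have s: "1 - (norm y)\<^sup>2 \<ge> 7/16" by (simp add: power2_eq_square)
  define t where "t = 1 / (1 - (norm y)\<^sup>2)"
  have t: "1 \<le> t" "t \<le> 16/7" using s by (auto simp: t_def field_simps)
  have "1 * exp (- (16/7)) \<le> t\<^sup>2 * exp (- t)"
    using t by (intro mult_mono) auto
  then show ?thesis using s by (simp add: mean_wt_def bump_part_def t_def)
qed

text \<open>Dominates a mean over radius \<open>r\<close> about \<open>y\<close> by one over radius
  \<open>2*r\<close> about \<open>x\<close>. The argument on the right is the point y + r z in the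
  coordinates of the larger ball; for |z| < 1 its norm is at most 1/4 + 1/2, where the weight has a
  positive lower bound.\<close>

lemma mean_wt_compare:
  assumes r: "r > 0" and y: "norm (y - x) \<le> r / 2"
  shows "mean_wt z \<le> 2 * exp (16/7) * mean_wt ((1 / (2*r)) *\<^sub>R (y - x) + (1/2) *\<^sub>R z)"
proof (cases "norm z < 1")
  case True
  let ?v = "(1 / (2*r)) *\<^sub>R (y - x) + (1/2) *\<^sub>R z"
  have "norm ?v \<le> norm (y - x) / (2*r) + norm z / 2"
    using norm_triangle_ineq[of "(1 / (2*r)) *\<^sub>R (y - x)" "(1/2) *\<^sub>R z"] r by simp
  also have "norm (y - x) / (2*r) \<le> 1/4" using r y by (simp add: field_simps)
  finally have "norm ?v \<le> 3/4" using True by simp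
  from mean_wt_ge[OF this] have "2 * exp (16/7) * exp (- (16/7)) \<le> 2 * exp (16/7) * mean_wt ?v"
    by (intro mult_left_mono) auto
  moreover have "2 * exp (16/7) * exp (- (16/7)) = (2::real)" by (simp flip: exp_add)
  ultimately show ?thesis using mean_wt_le_2[of z] by linarith
next
  case False
  then show ?thesis using mean_wt_nonneg(1)[of "(1 / (2*r)) *\<^sub>R (y - x) + (1/2) *\<^sub>R z"]
    by (simp add: mean_wt_eq_0)
qed

lemma integrable_mean_wt_mult:
  fixes g :: "'a::euclidean_space \<Rightarrow> real"
  assumes "continuous_on (cball 0 1) g"
  shows "integrable lborel (\<lambda>y. mean_wt y * g y)" "integrable lborel (\<lambda>y. mean_wt' y * g y)"
proof -
  have "integrable lborel (\<lambda>y. indicator (cball 0 1) y *\<^sub>R (mean_wt y * g y))"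
    "integrable lborel (\<lambda>y. indicator (cball 0 1) y *\<^sub>R (mean_wt' y * g y))"
    by (intro borel_integrable_compact compact_cball continuous_on_mult assms continuous_on_mean_wt)+
  moreover have "(\<lambda>y. indicator (cball 0 1) y *\<^sub>R (mean_wt y * g y)) = (\<lambda>y. mean_wt y * g y)"
    "(\<lambda>y. indicator (cball 0 1) y *\<^sub>R (mean_wt' y * g y)) = (\<lambda>y. mean_wt' y * g y)"
    by (auto simp: indicator_def fun_eq_iff mean_wt_eq_0)
  ultimately show "integrable lborel (\<lambda>y. mean_wt y * g y)" "integrable lborel (\<lambda>y. mean_wt' y * g y)"
    by simp_all
qed

lemma integral_mean_wt_pos: "(\<integral>y. mean_wt (y::'a::euclidean_space) \<partial>lborel) > 0"
proof -
  have i: "integrable lborel (mean_wt :: 'a \<Rightarrow> real)"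
    using integrable_mean_wt_mult(1)[of "\<lambda>_. 1"] by simp
  have "(\<integral>y. mean_wt (y::'a) \<partial>lborel) \<noteq> 0"
  proof
    assume "(\<integral>y. mean_wt (y::'a) \<partial>lborel) = 0"
    then have "AE y in lborel. mean_wt (y::'a) = 0"
      using integral_nonneg_eq_0_iff_AE[OF i always_eventually] by (simp add: mean_wt_nonneg)
    then have "AE y in lborel. (y::'a) \<notin> ball 0 (3/4)"
    proof eventually_elim
      case (elim y)
      then show ?case using mean_wt_ge[of y] exp_gt_zero[of "- (16/7)"]
        by (auto simp del: exp_gt_zero)
    qed
    then have "ball (0::'a) (3/4) = {}" by (rule AE_notin_open[OF open_ball])
    then show False by simp
  qed
  moreover have "(\<integral>y. mean_wt (y::'a) \<partial>lborel) \<ge> 0"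
    by (intro integral_nonneg_AE always_eventually allI mean_wt_nonneg)
  ultimately show ?thesis by linarith
qed

lemma Ck_on_extend_zero:
  assumes "open A" "Ck_on k f A" "compact K" "K \<subseteq> A" "\<And>x. x \<notin> K \<Longrightarrow> f x = 0"
  shows "Ck_on k f UNIV"
proof -
  have oK: "open (-K)" using assms(3) compact_imp_closed by auto
  have "Ck_on k f (-K)"
    by (rule Ck_on_cong[OF oK _ Ck_on_const[of k 0]]) (use assms(5) in simp)
  from Ck_on_Un[OF assms(1) oK assms(2) this] show ?thesis
    using assms(4) by (metis Compl_subset_Compl_iff Un_absorb1 Compl_partition sup.absorb_iff2 sup_commute
        Un_UNIV_left compl_sup_top sup_mono top.extremum_uniqueI order_refl)
qed

lemma integral_dd_eq_0_compact_support:
  fixes f :: "'a::euclidean_space \<Rightarrow> real"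
  assumes "open A" "Ck_on (Suc 0) f A" "compact K" "K \<subseteq> A" "\<And>x. x \<notin> K \<Longrightarrow> f x = 0" "b \<in> Basis"
  shows "integrable lborel (dd b f)" "(\<integral>x. dd b f x \<partial>lborel) = 0"
proof -
  note C = C1D[OF Ck_on_extend_zero[OF assms(1-5)]]
  show "integrable lborel (dd b f)" "(\<integral>x. dd b f x \<partial>lborel) = 0"
    using integral_dd_eq_0[OF C(1) C(2) assms(3,5)] assms(6) by auto
qed

lemma cbox_One_bounds:
  fixes y :: "'a::euclidean_space"
  assumes "y \<in> cbox (- One) One" shows "norm y \<le> real DIM('a)"
proof -
  have "norm y \<le> (\<Sum>b\<in>Basis. \<bar>y \<bullet> b\<bar>)" by (rule norm_le_l1)
  also have "\<dots> \<le> (\<Sum>b\<in>(Basis::'a set). 1)"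
    using assms by (intro sum_mono) (auto simp: mem_box abs_le_iff)
  finally show ?thesis by simp
qed

lemma cball_subset_cbox_One: "cball (0::'a::euclidean_space) 1 \<subseteq> cbox (- One) One"
proof
  fix y :: 'a assume "y \<in> cball 0 1"
  then have "\<bar>y \<bullet> b\<bar> \<le> 1" if "b \<in> Basis" for b
    using Basis_le_norm[OF that, of y] by simp
  then show "y \<in> cbox (- One) One" by (fastforce simp: mem_box abs_le_iff)
qed

lemma integral_cbox_mean_wt:
  fixes g :: "'a::euclidean_space \<Rightarrow> real"
  assumes "continuous_on (cball 0 1) g"
  shows "integral (cbox (- One) One) (\<lambda>y. mean_wt y * g y) = (\<integral>y. mean_wt y * g y \<partial>lborel)"
proof -
  have "integral (cbox (- One) One) (\<lambda>y. mean_wt y * g y) = integral UNIV (\<lambda>y. mean_wt y * g y)"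
  proof (rule integral_spike_set)
    have "{y \<in> UNIV - cbox (- One) One. mean_wt y * g y \<noteq> 0} = {}"
      using cball_subset_cbox_One mean_wt_eq_0 by force
    then show "negligible {y \<in> UNIV - cbox (- One) One. mean_wt y * g y \<noteq> 0}"
      by (simp only: negligible_empty)
  qed simp
  then show ?thesis using integrable_mean_wt_mult(1)[OF assms] by (simp add: integral_lborel)
qed

text \<open>Differentiating under the integral gives the integral of y \<bullet> \<nabla>u against
  \<open>mean_wt\<close>. As y \<open>mean_wt\<close> y is -1/2 times the gradient of
  \<open>mean_wt'\<close>, integration by parts turns this into a mean of the Laplacian. The
  dimension in the hypothesis on \<open>r\<close> comes from integrating over the cube around the
  unit ball, whose points have norm at most n.\<close>

lemma mean_deriv:
  fixes u :: "'a::euclidean_space \<Rightarrow> real"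
  assumes u: "Ck_on 2 u (ball x R)" and r: "real DIM('a) * \<bar>r\<bar> < R"
  shows "((\<lambda>r. \<integral>y. mean_wt y * u (x + r *\<^sub>R y) \<partial>lborel) has_real_derivative
     (r / 2) * (\<integral>y. mean_wt' y * laplacian u (x + r *\<^sub>R y) \<partial>lborel)) (at r)"
proof -
  define n where "n = real DIM('a)"
  have n: "n \<ge> 1" using DIM_positive[where 'a='a] by (simp add: n_def Suc_le_eq)
  let ?B = "cbox (- One) One :: 'a set"
  define \<rho> where "\<rho> = R / n"
  have rho: "t \<in> {- \<rho><..<\<rho>} \<longleftrightarrow> n * \<bar>t\<bar> < R" for t
  proof -
    have "t \<in> {- \<rho><..<\<rho>} \<longleftrightarrow> \<bar>t\<bar> < R / n" by (auto simp: \<rho>_def)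
    then show ?thesis using n by (simp add: pos_less_divide_eq mult.commute)
  qed
  have inR: "x + t *\<^sub>R y \<in> ball x R" if "t \<in> {- \<rho><..<\<rho>}" "y \<in> ?B" for t y
  proof -
    have "\<bar>t\<bar> * norm y \<le> \<bar>t\<bar> * n" using cbox_One_bounds[OF that(2)] by (simp add: n_def mult_left_mono)
    then show ?thesis using that(1) unfolding rho by (simp add: dist_norm mult.commute)
  qed
  have inc: "x + t *\<^sub>R y \<in> ball x R" if "t \<in> {- \<rho><..<\<rho>}" "norm y \<le> 1" for t y
    using inR[OF that(1)] that(2) cball_subset_cbox_One by auto
  have rr: "r \<in> {- \<rho><..<\<rho>}" unfolding rho n_def by (rule r)
  have comp: "continuous_on T (\<lambda>p. f (x + s p *\<^sub>R v p))"
    if "continuous_on (ball x R) f" "continuous_on T s" "continuous_on T v"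
      "\<And>p. p \<in> T \<Longrightarrow> x + s p *\<^sub>R v p \<in> ball x R" for f :: "'a \<Rightarrow> real" and T :: "'c::topological_space set" and s v
    by (rule continuous_on_compose2[OF that(1)]) (use that in \<open>auto intro!: continuous_intros\<close>)
  have ddy: "dd y u (x + t *\<^sub>R y) = (\<Sum>b\<in>Basis. (y \<bullet> b) * dd b u (x + t *\<^sub>R y))"
    if "x + t *\<^sub>R y \<in> ball x R" for t y
    by (rule dd_Basis_sum[OF C2D(1)[OF u that]])
  have "((\<lambda>r. integral ?B (\<lambda>y. mean_wt y * u (x + r *\<^sub>R y))) has_field_derivative
      integral ?B (\<lambda>y. mean_wt y * (\<Sum>b\<in>Basis. (y \<bullet> b) * dd b u (x + r *\<^sub>R y)))) (at r within {- \<rho><..<\<rho>})"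
  proof (rule leibniz_rule_field_derivative)
    fix t y assume t: "t \<in> {- \<rho><..<\<rho>}" and y: "y \<in> ?B"
    have "((\<lambda>t. u (x + t *\<^sub>R y)) has_real_derivative dd y u (x + t *\<^sub>R y)) (at t)"
      by (rule line_has_derivative[OF C2D(1)[OF u inR[OF t y]]])
    then have "((\<lambda>t. mean_wt y * u (x + t *\<^sub>R y)) has_real_derivative mean_wt y * dd y u (x + t *\<^sub>R y)) (at t)"
      by (rule DERIV_cmult)
    then show "((\<lambda>t. mean_wt y * u (x + t *\<^sub>R y)) has_field_derivative
        mean_wt y * (\<Sum>b\<in>Basis. (y \<bullet> b) * dd b u (x + t *\<^sub>R y))) (at t within {- \<rho><..<\<rho>})"
      unfolding ddy[OF inR[OF t y]] by (rule DERIV_subset) simp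
  next
    fix t assume t: "t \<in> {- \<rho><..<\<rho>}"
    show "(\<lambda>y. mean_wt y * u (x + t *\<^sub>R y)) integrable_on ?B"
      by (intro integrable_continuous continuous_on_mult continuous_on_mean_wt comp[OF C2D(5)[OF u]])
        (use inR[OF t] in \<open>auto intro!: continuous_intros\<close>)
  next
    have "continuous_on ({- \<rho><..<\<rho>} \<times> ?B) (\<lambda>p. mean_wt (snd p) *
      (\<Sum>b\<in>Basis. (snd p \<bullet> b) * dd b u (x + fst p *\<^sub>R snd p)))"
      by (intro continuous_on_mult continuous_on_sum comp[OF C2D(4)[OF u]]
          continuous_on_compose2[OF continuous_on_mean_wt(1)[of UNIV]])
        (use inR in \<open>auto intro!: continuous_intros\<close>)
    then show "continuous_on ({- \<rho><..<\<rho>} \<times> ?B) (\<lambda>(t, y). mean_wt y *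
      (\<Sum>b\<in>Basis. (y \<bullet> b) * dd b u (x + t *\<^sub>R y)))" by (simp add: split_beta)
  qed (use rr in auto)
  then have D: "((\<lambda>r. integral ?B (\<lambda>y. mean_wt y * u (x + r *\<^sub>R y))) has_real_derivative
      integral ?B (\<lambda>y. mean_wt y * (\<Sum>b\<in>Basis. (y \<bullet> b) * dd b u (x + r *\<^sub>R y)))) (at r)"
    using rr by (simp add: at_within_open[of r "{- \<rho><..<\<rho>}"])
  have D2: "((\<lambda>r. \<integral>y. mean_wt y * u (x + r *\<^sub>R y) \<partial>lborel) has_real_derivative
      integral ?B (\<lambda>y. mean_wt y * (\<Sum>b\<in>Basis. (y \<bullet> b) * dd b u (x + r *\<^sub>R y)))) (at r)"
  proof (rule has_field_derivative_transform_within_open[OF D _ rr])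
    fix t assume t: "t \<in> {- \<rho><..<\<rho>}"
    show "integral ?B (\<lambda>y. mean_wt y * u (x + t *\<^sub>R y)) = (\<integral>y. mean_wt y * u (x + t *\<^sub>R y) \<partial>lborel)"
      by (rule integral_cbox_mean_wt, rule comp[OF C2D(5)[OF u]])
        (use inc[OF t] in \<open>auto intro!: continuous_intros\<close>)
  qed simp
  have cg: "continuous_on (cball 0 1) (\<lambda>y. \<Sum>b\<in>Basis. (y \<bullet> b) * dd b u (x + r *\<^sub>R y))"
    by (intro continuous_on_mult continuous_on_sum comp[OF C2D(4)[OF u]])
      (use inc[OF rr] in \<open>auto intro!: continuous_intros\<close>)
  have cl: "continuous_on (cball 0 1) (\<lambda>y. laplacian u (x + r *\<^sub>R y))"
    by (intro comp[OF continuous_on_laplacian[OF u]])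
      (use inc[OF rr] in \<open>auto intro!: continuous_intros\<close>)
  define A where "A = {y. x + r *\<^sub>R y \<in> ball x R}"
  have bl: "bounded_linear ((*\<^sub>R) r :: 'a \<Rightarrow> 'a)" by (rule bounded_linear_scaleR_right)
  have A: "open A" unfolding A_def by (rule open_affine_vimage[OF bl open_ball])
  have cA: "cball 0 1 \<subseteq> A" using inc[OF rr] by (auto simp: A_def)
  define f where "f = (\<lambda>b y. mean_wt' y * dd b u (x + r *\<^sub>R y))"
  have fC: "Ck_on (Suc 0) (f b) A" for b
    unfolding f_def A_def
    by (intro Ck_on_mult Ck_on_subset[OF Ck_on_mean_wt(2)] Ck_on_affine[OF bl open_ball C2D(7)[OF u]]
        open_affine_vimage[OF bl open_ball]) simp
  have f0: "f b y = 0" if "y \<notin> cball 0 1" for b y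
    using that mean_wt_eq_0(2)[of y] by (simp add: f_def)
  note fi = integral_dd_eq_0_compact_support[OF A fC compact_cball cA f0]
  have fd: "(\<Sum>b\<in>Basis. dd b (f b) y) = r * (mean_wt' y * laplacian u (x + r *\<^sub>R y))
      - 2 * (mean_wt y * (\<Sum>b\<in>Basis. (y \<bullet> b) * dd b u (x + r *\<^sub>R y)))" for y
  proof (cases "y \<in> A")
    case True
    then have yR: "x + r *\<^sub>R y \<in> ball x R" by (simp add: A_def)
    have "dd b (f b) y = r * (mean_wt' y * dd b (dd b u) (x + r *\<^sub>R y))
        - 2 * (mean_wt y * ((y \<bullet> b) * dd b u (x + r *\<^sub>R y)))" for b
    proof -
      have d: "dd b u differentiable (at (x + r *\<^sub>R y))" using C2D(2)[OF u yR] .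
      have "dd (r *\<^sub>R b) (dd b u) (x + r *\<^sub>R y) = r * dd b (dd b u) (x + r *\<^sub>R y)"
        using linear.scaleR[OF linear_frechet_derivative[OF d]] by simp
      then show ?thesis
        unfolding f_def
        using dd_mult[OF C2D(1)[OF Ck_on_mean_wt(2) UNIV_I] dd_affine(1)[OF bl d], where w=b]
          dd_affine(2)[OF bl d, of b] by (simp add: dd_mean_wt' algebra_simps)
    qed
    then show ?thesis
      by (simp add: sum_subtractf laplacian_eq[OF u yR] sum_distrib_left)
  next
    case False
    then have "y \<in> - cball 0 1" using cA by auto
    then have "dd b (f b) y = 0" for b
      using frechet_derivative_cong_open[OF open_Compl[OF closed_cball[of 0 1]], of y "f b" "\<lambda>_. 0"] f0
      by (simp add: dd_const)
    moreover have "mean_wt y = 0" "mean_wt' y = 0" using False cA mean_wt_eq_0[of y] by force+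
    ultimately show ?thesis by simp
  qed
  have "0 = (\<Sum>b\<in>Basis. \<integral>y. dd b (f b) y \<partial>lborel)" using fi(2) by simp
  also have "\<dots> = (\<integral>y. (\<Sum>b\<in>Basis. dd b (f b) y) \<partial>lborel)"
    using fi(1) by simp
  also have "\<dots> = r * (\<integral>y. mean_wt' y * laplacian u (x + r *\<^sub>R y) \<partial>lborel)
      - 2 * (\<integral>y. mean_wt y * (\<Sum>b\<in>Basis. (y \<bullet> b) * dd b u (x + r *\<^sub>R y)) \<partial>lborel)"
    unfolding fd using integrable_mean_wt_mult(1)[OF cg] integrable_mean_wt_mult(2)[OF cl] by simp
  finally have "integral ?B (\<lambda>y. mean_wt y * (\<Sum>b\<in>Basis. (y \<bullet> b) * dd b u (x + r *\<^sub>R y))) =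
      (r / 2) * (\<integral>y. mean_wt' y * laplacian u (x + r *\<^sub>R y) \<partial>lborel)"
    using integral_cbox_mean_wt[OF cg] by simp
  with D2 show ?thesis by (rule DERIV_cong)
qed

text \<open>The weighted mean \<open>m(r)\<close> of a positive \<open>u\<close> with \<open>|\<Delta>u| \<le> C u\<close> satisfies \<open>|m'| \<le> C r m / 2\<close>.\<close>

lemma mean_bounds:
  fixes u :: "'a::euclidean_space \<Rightarrow> real"
  assumes u: "Ck_on 2 u (ball x R)"
    and lap: "\<And>y. y \<in> ball x R \<Longrightarrow> \<bar>laplacian u y\<bar> \<le> C * u y" and C: "C \<ge> 0"
    and r: "r \<ge> 0" "real DIM('a) * r < R"
  shows "(\<integral>y. mean_wt y * u (x + r *\<^sub>R y) \<partial>lborel) \<le> exp (C * r\<^sup>2 / 4) * u x * (\<integral>y. mean_wt (y::'a) \<partial>lborel)"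
    and "u x * (\<integral>y. mean_wt (y::'a) \<partial>lborel) \<le> exp (C * r\<^sup>2 / 4) * (\<integral>y. mean_wt y * u (x + r *\<^sub>R y) \<partial>lborel)"
proof -
  define m where "m = (\<lambda>r. \<integral>y. mean_wt y * u (x + r *\<^sub>R y) \<partial>lborel)"
  define m' where "m' = (\<lambda>r. (r / 2) * (\<integral>y. mean_wt' y * laplacian u (x + r *\<^sub>R y) \<partial>lborel))"
  have n: "real DIM('a) \<ge> 1" using DIM_positive[where 'a='a] by (simp add: Suc_le_eq)
  have m': "(m has_real_derivative m' t) (at t)" and b: "\<bar>m' t\<bar> \<le> C * t / 2 * m t"
    if t: "0 \<le> t" "t \<le> r" for t
  proof -
    have tR: "real DIM('a) * \<bar>t\<bar> < R"
    proof -
      have "real DIM('a) * t \<le> real DIM('a) * r" by (intro mult_left_mono t) simp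
      then show ?thesis using t r(2) by (simp only: abs_of_nonneg[OF t(1)])
    qed
    show "(m has_real_derivative m' t) (at t)"
      unfolding m_def m'_def by (rule mean_deriv[OF u tR])
    have inR: "x + t *\<^sub>R y \<in> ball x R" if "y \<in> cball 0 1" for y
    proof -
      have "t * norm y \<le> t * 1" using that t by (intro mult_left_mono) auto
      also have "\<dots> \<le> real DIM('a) * \<bar>t\<bar>" using n t mult_right_mono[OF n t(1)] by simp
      finally show ?thesis using tR t by (simp add: dist_norm)
    qed
    have comp: "continuous_on (cball 0 1) (\<lambda>y. f (x + t *\<^sub>R y))"
      if "continuous_on (ball x R) f" for f :: "'a \<Rightarrow> real"
      by (rule continuous_on_compose2[OF that]) (use inR in \<open>auto intro!: continuous_intros\<close>)
    note i = integrable_mean_wt_mult[OF comp[OF C2D(5)[OF u]]]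
      integrable_mean_wt_mult[OF comp[OF continuous_on_laplacian[OF u]]]
    have le: "\<bar>mean_wt' y * laplacian u (x + t *\<^sub>R y)\<bar> \<le> C * (mean_wt y * u (x + t *\<^sub>R y))" for y
    proof (cases "norm y < 1")
      case True
      then have y: "x + t *\<^sub>R y \<in> ball x R" by (intro inR) simp
      have "mean_wt' y * \<bar>laplacian u (x + t *\<^sub>R y)\<bar> \<le> mean_wt y * (C * u (x + t *\<^sub>R y))"
        using mean_wt'_le[of y] mean_wt_nonneg lap[OF y] by (intro mult_mono) auto
      then show ?thesis using mean_wt_nonneg(2)[of y] by (simp add: abs_mult algebra_simps)
    next
      case False
      then show ?thesis by (simp add: mean_wt_eq_0)
    qed
    have "\<bar>\<integral>y. mean_wt' y * laplacian u (x + t *\<^sub>R y) \<partial>lborel\<bar>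
        \<le> (\<integral>y. C * (mean_wt y * u (x + t *\<^sub>R y)) \<partial>lborel)"
      using le i by (intro order_trans[OF integral_abs_bound] integral_mono) auto
    also have "\<dots> = C * m t" by (simp add: m_def)
    finally show "\<bar>m' t\<bar> \<le> C * t / 2 * m t"
      using t(1) mult_left_mono[of "\<bar>\<integral>y. mean_wt' y * laplacian u (x + t *\<^sub>R y) \<partial>lborel\<bar>" "C * m t" "t/2"]
      by (simp add: m'_def abs_mult algebra_simps)
  qed
  have e: "((\<lambda>t. exp (k * t\<^sup>2 / 4)) has_real_derivative exp (k * t\<^sup>2 / 4) * (k * t / 2)) (at t)" for k t
    by (auto intro!: derivative_eq_intros)
  have m0: "m 0 = u x * (\<integral>y. mean_wt (y::'a) \<partial>lborel)" by (simp add: m_def mult.commute)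
  \<comment> \<open>Integrating factors: by |m'| \<le> C t m / 2 the product of m with exp(- C t^2 /
    4) does not increase and the product with exp(C t^2 / 4) does not decrease. Each is compared at
    0 and \<open>r\<close>.\<close>
  have "exp (- C * r\<^sup>2 / 4) * m r \<le> exp (- C * 0\<^sup>2 / 4) * m 0"
  proof (rule DERIV_nonpos_imp_nonincreasing[OF r(1)])
    fix t assume t: "0 \<le> t" "t \<le> r"
    have "((\<lambda>t. exp (- C * t\<^sup>2 / 4) * m t) has_real_derivative
        exp (- C * t\<^sup>2 / 4) * (m' t - C * t / 2 * m t)) (at t)"
      by (rule DERIV_cong[OF DERIV_mult[OF e[of "-C"] m'[OF t]]]) (simp add: algebra_simps)
    moreover have "exp (- C * t\<^sup>2 / 4) * (m' t - C * t / 2 * m t) \<le> 0"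
      using b[OF t] by (intro mult_nonneg_nonpos) auto
    ultimately show "\<exists>y. ((\<lambda>t. exp (- C * t\<^sup>2 / 4) * m t) has_real_derivative y) (at t) \<and> y \<le> 0" by blast
  qed
  then have A1: "exp (C * r\<^sup>2 / 4) * (exp (- C * r\<^sup>2 / 4) * m r) \<le> exp (C * r\<^sup>2 / 4) * m 0"
    by (intro mult_left_mono) auto
  have A2: "exp (C * r\<^sup>2 / 4) * (exp (- C * r\<^sup>2 / 4) * m r) = m r"
    unfolding mult.assoc[symmetric] exp_add[symmetric] by simp
  have "m r \<le> exp (C * r\<^sup>2 / 4) * m 0" using A1 unfolding A2 .
  then show "(\<integral>y. mean_wt y * u (x + r *\<^sub>R y) \<partial>lborel) \<le> exp (C * r\<^sup>2 / 4) * u x * (\<integral>y. mean_wt (y::'a) \<partial>lborel)"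
    unfolding m0 by (simp only: m_def mult.assoc)
  have "exp (C * 0\<^sup>2 / 4) * m 0 \<le> exp (C * r\<^sup>2 / 4) * m r"
  proof (rule DERIV_nonneg_imp_nondecreasing[OF r(1)])
    fix t assume t: "0 \<le> t" "t \<le> r"
    have "((\<lambda>t. exp (C * t\<^sup>2 / 4) * m t) has_real_derivative
        exp (C * t\<^sup>2 / 4) * (m' t + C * t / 2 * m t)) (at t)"
      by (rule DERIV_cong[OF DERIV_mult[OF e[of C] m'[OF t]]]) (simp add: algebra_simps)
    moreover have "0 \<le> exp (C * t\<^sup>2 / 4) * (m' t + C * t / 2 * m t)"
      using b[OF t] by (intro mult_nonneg_nonneg) auto
    ultimately show "\<exists>y. ((\<lambda>t. exp (C * t\<^sup>2 / 4) * m t) has_real_derivative y) (at t) \<and> 0 \<le> y" by blast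
  qed
  then show "u x * (\<integral>y. mean_wt (y::'a) \<partial>lborel) \<le> exp (C * r\<^sup>2 / 4) * (\<integral>y. mean_wt y * u (x + r *\<^sub>R y) \<partial>lborel)"
    by (simp add: m0 m_def mult.commute)
qed

text \<open>u(y) is controlled by the mean over radius \<open>r\<close> about \<open>y\<close>, this
  by the mean over radius \<open>2*r\<close> about \<open>x\<close>, and the latter by u(x). The
  factor 2 exp(16/7) compares the weights, 2^n is the Jacobian of the change of coordinates, and
  exp(C r^2 / 4) exp(C r^2) is bounded by exp(2 C r^2).\<close>

lemma harnack_local:
  fixes u :: "'a::euclidean_space \<Rightarrow> real"
  assumes u: "Ck_on 2 u (ball x R)" and pos: "\<And>y. y \<in> ball x R \<Longrightarrow> 0 < u y"
    and lap: "\<And>y. y \<in> ball x R \<Longrightarrow> \<bar>laplacian u y\<bar> \<le> C * u y" and C: "C \<ge> 0"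
    and r: "r > 0" "2 * real DIM('a) * r < R" and y: "y \<in> cball x (r / 2)"
  shows "u y \<le> 2 * exp (16/7) * 2 ^ DIM('a) * exp (2 * C * r\<^sup>2) * u x"
proof -
  define I where "I = (\<integral>y. mean_wt (y::'a) \<partial>lborel)"
  have I: "I > 0" unfolding I_def by (rule integral_mean_wt_pos)
  have n: "real DIM('a) \<ge> 1" using DIM_positive[where 'a='a] by (simp add: Suc_le_eq)
  have nr: "r \<le> real DIM('a) * r" using mult_right_mono[OF n, of r] r by simp
  have nr': "real DIM('a) * r < R - r / 2" using r nr by linarith
  have yx: "norm (y - x) \<le> r / 2" using y by (simp add: dist_norm norm_minus_commute)
  have sub: "ball y (R - r / 2) \<subseteq> ball x R"
  proof
    fix z assume "z \<in> ball y (R - r / 2)"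
    then show "z \<in> ball x R"
      using dist_triangle[of x z y] y by simp
  qed
  have 1: "u y * I \<le> exp (C * r\<^sup>2 / 4) * (\<integral>z. mean_wt z * u (y + r *\<^sub>R z) \<partial>lborel)"
    unfolding I_def
    by (rule mean_bounds(2)[OF Ck_on_subset[OF u sub]])
      (use subsetD[OF sub] pos lap C r(1) nr' in auto)
  have 2: "(\<integral>z. mean_wt z * u (x + (2*r) *\<^sub>R z) \<partial>lborel) \<le> exp (C * (2*r)\<^sup>2 / 4) * u x * I"
    unfolding I_def by (rule mean_bounds(1)[OF u lap C]) (use r in auto)
  define g where "g = (\<lambda>z. mean_wt z * u (x + (2*r) *\<^sub>R z))"
  have comp: "continuous_on (cball 0 1) (\<lambda>z. u (w + t *\<^sub>R z))"
    if "\<And>z. norm z \<le> 1 \<Longrightarrow> w + t *\<^sub>R z \<in> ball x R" for w t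
    by (rule continuous_on_compose2[OF C2D(5)[OF u]]) (use that in \<open>auto intro!: continuous_intros\<close>)
  have x2r: "x + (2*r) *\<^sub>R z \<in> ball x R" if "norm z \<le> 1" for z
  proof -
    have "r * norm z \<le> r" using that r by (simp add: mult_left_le)
    then have "2 * r * norm z < R" using r nr by linarith
    then show ?thesis using r by (simp add: dist_norm)
  qed
  have yr: "y + r *\<^sub>R z \<in> ball x R" if "norm z \<le> 1" for z
  proof -
    have "r * norm z \<le> r" using that r by (simp add: mult_left_le)
    moreover have "norm (x - y - r *\<^sub>R z) \<le> norm (x - y) + norm (r *\<^sub>R z)" by (rule norm_triangle_ineq4)
    moreover have "norm (r *\<^sub>R z) = r * norm z" using r by simp
    ultimately have "norm (x - y - r *\<^sub>R z) < R"
      using r nr yx norm_minus_commute[of x y] by linarith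
    then show ?thesis by (simp add: dist_norm diff_diff_eq)
  qed
  have ig: "integrable lborel g" unfolding g_def by (rule integrable_mean_wt_mult(1)[OF comp[OF x2r]])
  then have gm: "g \<in> borel_measurable borel" by (simp add: borel_measurable_integrable)
  define a where "a = (1 / (2*r)) *\<^sub>R (y - x)"
  have aff: "(\<integral>z. g (a + (1/2) *\<^sub>R z) \<partial>lborel) = 2 ^ DIM('a) * (\<integral>z. g z \<partial>lborel)"
    using lborel_integral_affine[OF _ gm, of "1/2" a] by (simp add: power_divide)
  have le: "mean_wt z * u (y + r *\<^sub>R z) \<le> 2 * exp (16/7) * g (a + (1/2) *\<^sub>R z)" for z
  proof (cases "norm z \<le> 1")
    case True
    have "x + (2*r) *\<^sub>R (a + (1/2) *\<^sub>R z) = y + r *\<^sub>R z"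
      using r by (simp add: a_def scaleR_add_right)
    then have "g (a + (1/2) *\<^sub>R z) = mean_wt (a + (1/2) *\<^sub>R z) * u (y + r *\<^sub>R z)"
      by (simp add: g_def)
    moreover have "u (y + r *\<^sub>R z) > 0" by (rule pos[OF yr[OF True]])
    ultimately show ?thesis
      using mult_right_mono[OF mean_wt_compare[OF r(1) yx, of z], of "u (y + r *\<^sub>R z)"]
      by (simp add: a_def mult.assoc)
  next
    case False
    have "g w \<ge> 0" for w
    proof (cases "norm w \<le> 1")
      case True
      then show ?thesis using pos[OF x2r[OF True]] mean_wt_nonneg(1)[of w] by (simp add: g_def)
    qed (simp add: g_def mean_wt_eq_0)
    then show ?thesis using False by (simp add: mean_wt_eq_0)
  qed
  have ia: "integrable lborel (\<lambda>z. g (a + (1/2) *\<^sub>R z))"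
    by (rule lborel_integrable_affine[OF _ ig]) simp
  have "(\<integral>z. mean_wt z * u (y + r *\<^sub>R z) \<partial>lborel) \<le> (\<integral>z. 2 * exp (16/7) * g (a + (1/2) *\<^sub>R z) \<partial>lborel)"
    by (rule integral_mono[OF integrable_mean_wt_mult(1)[OF comp[OF yr]] integrable_mult_right[OF ia] le])
  also have "\<dots> = 2 * exp (16/7) * 2 ^ DIM('a) * (\<integral>z. g z \<partial>lborel)" using aff by simp
  also have "\<dots> \<le> 2 * exp (16/7) * 2 ^ DIM('a) * (exp (C * (2*r)\<^sup>2 / 4) * u x * I)"
    using 2 by (intro mult_left_mono) (auto simp: g_def)
  finally have "u y * I \<le> exp (C * r\<^sup>2 / 4) * (2 * exp (16/7) * 2 ^ DIM('a) * (exp (C * (2*r)\<^sup>2 / 4) * u x * I))"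
    using 1 by (meson exp_ge_zero mult_left_mono order_trans)
  also have "\<dots> = 2 * exp (16/7) * 2 ^ DIM('a) * (exp (C * r\<^sup>2 / 4) * exp (C * (2*r)\<^sup>2 / 4)) * u x * I"
    by (simp add: algebra_simps)
  also have "exp (C * r\<^sup>2 / 4) * exp (C * (2*r)\<^sup>2 / 4) = exp (5/4 * (C * r\<^sup>2))"
    by (simp add: power_mult_distrib flip: exp_add)
  also have "2 * exp (16/7) * 2 ^ DIM('a) * exp (5/4 * (C * r\<^sup>2)) * u x * I
      \<le> 2 * exp (16/7) * 2 ^ DIM('a) * exp (2 * C * r\<^sup>2) * u x * I"
  proof -
    have "0 \<le> C * r\<^sup>2" using C by simp
    then have "exp (5/4 * (C * r\<^sup>2)) \<le> exp (2 * C * r\<^sup>2)" by simp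
    moreover have "u x > 0" using pos[of x] r nr by simp
    ultimately show ?thesis using I by (intro mult_right_mono mult_left_mono) auto
  qed
  finally show ?thesis using I by simp
qed

section \<open>Homogeneous functions\<close>

lemma radial_ext_scale: "t > 0 \<Longrightarrow> radial_ext f (t *\<^sub>R x) = radial_ext f x"
  by (simp add: radial_ext_def sgn_scaleR)

lemma radial_ext_unit: "norm w = 1 \<Longrightarrow> radial_ext f w = f w"
  by (simp add: radial_ext_def sgn_div_norm)

lemma sgn_in_cone: "x \<in> cone_over S \<longleftrightarrow> x \<noteq> 0 \<and> sgn x \<in> S"
  by (simp add: cone_over_def sgn_div_norm)

lemma cone_over_scale: "t > 0 \<Longrightarrow> t *\<^sub>R x \<in> cone_over S \<longleftrightarrow> x \<in> cone_over S"
  by (simp add: sgn_in_cone sgn_scaleR)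

lemma open_punctured: "open (- {0::'a::real_normed_vector})"
  by auto

lemma radial_ext_scale_eq:
  fixes f :: "'a::euclidean_space \<Rightarrow> real"
  assumes "t > 0"
  shows "(\<lambda>y. radial_ext f (0 + t *\<^sub>R y)) = radial_ext f"
  using radial_ext_scale[OF assms] by auto

lemma dd_radial_ext_scale:
  fixes f :: "'a::euclidean_space \<Rightarrow> real"
  assumes "t > 0" "radial_ext f differentiable (at (t *\<^sub>R x))"
  shows "radial_ext f differentiable (at x)" "dd v (radial_ext f) x = t * dd v (radial_ext f) (t *\<^sub>R x)"
proof -
  have d: "radial_ext f differentiable (at (0 + t *\<^sub>R x))" using assms by simp
  note * = dd_affine[OF bounded_linear_scaleR_right d, unfolded radial_ext_scale_eq[OF assms(1)]]
  show "radial_ext f differentiable (at x)" by (rule *(1))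
  show "dd v (radial_ext f) x = t * dd v (radial_ext f) (t *\<^sub>R x)"
    using *(2)[of v] linear.scaleR[OF linear_frechet_derivative[OF assms(2)], of t v] by simp
qed

lemma gradient_radial_ext_scale:
  fixes f :: "'a::euclidean_space \<Rightarrow> real"
  assumes "t > 0" "radial_ext f differentiable (at (t *\<^sub>R x))"
  shows "gradient (radial_ext f) x = t *\<^sub>R gradient (radial_ext f) (t *\<^sub>R x)"
  by (rule euclidean_eqI) (simp add: gradient_component dd_radial_ext_scale(2)[OF assms])

lemma laplacian_radial_ext_scale:
  fixes f :: "'a::euclidean_space \<Rightarrow> real"
  assumes "t > 0" "open D" "Ck_on 2 (radial_ext f) D" "t *\<^sub>R x \<in> D"
  shows "laplacian (radial_ext f) x = t\<^sup>2 * laplacian (radial_ext f) (t *\<^sub>R x)"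
  using laplacian_affine[OF bounded_linear_scaleR_right[of t] assms(2,3), of "t\<^sup>2" 0 x] assms(4)
  unfolding radial_ext_scale_eq[OF assms(1)] by auto

lemma dd_radial_ext_radial:
  fixes f :: "'a::euclidean_space \<Rightarrow> real"
  assumes "radial_ext f differentiable (at x)"
  shows "dd x (radial_ext f) x = 0"
proof -
  have "((\<lambda>s. radial_ext f (x + s *\<^sub>R x)) has_real_derivative dd x (radial_ext f) (x + 0 *\<^sub>R x)) (at 0)"
    by (rule line_has_derivative) (use assms in simp)
  moreover have "((\<lambda>s. radial_ext f (x + s *\<^sub>R x)) has_real_derivative 0) (at 0)"
  proof (rule has_field_derivative_transform_within_open[of "\<lambda>_. radial_ext f x" _ _ "{-1<..}"])
    show "radial_ext f x = radial_ext f (x + s *\<^sub>R x)" if "s \<in> {-1<..}" for s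
      using radial_ext_scale[of "1 + s" f x] that by (simp add: algebra_simps)
  qed auto
  ultimately show ?thesis using DERIV_unique by fastforce
qed

lemma gradient_radial_ext_radial:
  fixes f :: "'a::euclidean_space \<Rightarrow> real"
  assumes "radial_ext f differentiable (at x)"
  shows "gradient (radial_ext f) x \<bullet> x = 0"
  using gradient_inner[OF assms] dd_radial_ext_radial[OF assms] by simp

lemma has_derivative_gradient:
  assumes "Ck_on 2 u D" "x \<in> D"
  shows "(gradient u has_derivative (\<lambda>v. \<Sum>b\<in>Basis. dd v (dd b u) x *\<^sub>R b)) (at x)"
  unfolding gradient_def[abs_def]
  by (intro has_derivative_sum has_derivative_scaleR_left
      C2D(2)[OF assms, unfolded frechet_derivative_works])

text \<open>The gradient of the radial extension has degree -1, so its own radial extension is |x|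
  times it. Differentiating the factor |x| contributes only w \<bullet> \<nabla>f, which vanishes
  because the gradient is tangential.\<close>

lemma laplace_beltrami_eq:
  fixes f :: "'a::euclidean_space \<Rightarrow> real"
  assumes f: "Ck_on 2 (radial_ext f) (cone_over S)" and S: "open (cone_over S)"
    and w: "w \<in> S" "norm w = 1"
  shows "laplace_beltrami f w = laplacian (radial_ext f) w"
proof -
  let ?G = "gradient (radial_ext f)"
  have wc: "w \<in> cone_over S" using w by (auto simp: cone_over_def simp del: zero_less_norm_iff)
  have eq: "norm x *\<^sub>R ?G x = radial_ext ?G x" if x: "x \<in> cone_over S" for x
  proof -
    have "norm x > 0" "sgn x \<in> cone_over S"
      using x cone_over_scale[of "inverse (norm x)" x S] by (auto simp: cone_over_def sgn_div_norm)
    then have "?G x = (1 / norm x) *\<^sub>R ?G (sgn x)"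
      using gradient_radial_ext_scale[of "1 / norm x" f x] C2D(1)[OF f]
      by (simp add: sgn_div_norm divide_inverse_commute)
    then show ?thesis using \<open>norm x > 0\<close> by (simp add: radial_ext_def)
  qed
  have "((\<lambda>x. norm x *\<^sub>R ?G x) has_derivative
      (\<lambda>h. norm w *\<^sub>R (\<Sum>b\<in>Basis. dd h (dd b (radial_ext f)) w *\<^sub>R b) + (sgn w \<bullet> h) *\<^sub>R ?G w)) (at w)"
  proof (rule has_derivative_scaleR[OF _ has_derivative_gradient[OF f wc]])
    show "(norm has_derivative (\<lambda>h. sgn w \<bullet> h)) (at w)"
      by (rule has_derivative_eq_rhs[OF has_derivative_norm]) (use w in \<open>auto simp: inner_commute\<close>)
  qed
  then have "(radial_ext ?G has_derivative
      (\<lambda>h. norm w *\<^sub>R (\<Sum>b\<in>Basis. dd h (dd b (radial_ext f)) w *\<^sub>R b) + (sgn w \<bullet> h) *\<^sub>R ?G w)) (at w)"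
    by (rule has_derivative_transform_within_open[OF _ S wc]) (rule eq)
  then have "frechet_derivative (radial_ext ?G) (at w) =
      (\<lambda>h. (\<Sum>b\<in>Basis. dd h (dd b (radial_ext f)) w *\<^sub>R b) + (w \<bullet> h) *\<^sub>R ?G w)"
    using w by (simp add: frechet_derivative_at[symmetric] sgn_div_norm)
  then have "laplace_beltrami f w =
      (\<Sum>c\<in>Basis. dd c (dd c (radial_ext f)) w + (w \<bullet> c) * (?G w \<bullet> c))"
    unfolding laplace_beltrami_def sphere_divergence_def sphere_gradient_def divergence_def
    by (simp add: inner_add_left inner_sum_left inner_Basis if_distrib sum.delta cong: if_cong)
  also have "\<dots> = laplacian (radial_ext f) w + w \<bullet> ?G w"
    by (simp only: sum.distrib laplacian_eq[OF f wc] euclidean_inner[of w "?G w"])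
  finally show ?thesis
    using gradient_radial_ext_radial[OF C2D(1)[OF f wc]] by (simp add: inner_commute)
qed

lemma dd_norm_powr:
  assumes "x \<noteq> (0::'a::euclidean_space)"
  shows "dd v (\<lambda>x. norm x powr a) x = a * norm x powr (a - 2) * (x \<bullet> v)"
proof -
  have "((\<lambda>x. norm x powr a) has_derivative (\<lambda>h. norm x powr a * (sgn x \<bullet> h * a / norm x))) (at x)"
    using assms by (auto intro!: derivative_eq_intros has_derivative_norm simp: inner_commute)
  moreover have e: "norm x powr a = (norm x)\<^sup>2 * norm x powr (a - 2)"
    using assms by (simp add: powr_diff powr_numeral)
  ultimately show ?thesis
    using dd_eq[of "\<lambda>x. norm x powr a" _ x v] assms by (simp add: e sgn_div_norm power2_eq_square)
qed

lemma gradient_norm_powr: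
  assumes "x \<noteq> (0::'a::euclidean_space)"
  shows "gradient (\<lambda>x. norm x powr a) x = (a * norm x powr (a - 2)) *\<^sub>R x"
  by (rule euclidean_eqI) (simp add: gradient_component dd_norm_powr[OF assms])

lemma laplacian_norm_powr:
  assumes x: "x \<noteq> (0::'a::euclidean_space)"
  shows "laplacian (\<lambda>x. norm x powr a) x = a * (a + real DIM('a) - 2) * norm x powr (a - 2)"
proof -
  have xp: "x \<in> -{0}" using x by simp
  have C: "Ck_on 2 (\<lambda>x::'a. norm x powr a) (-{0})" for a by (rule Ck_on_norm_powr)
  have "dd b (dd b (\<lambda>x. norm x powr a)) x =
      a * ((a - 2) * norm x powr (a - 4) * (x \<bullet> b)\<^sup>2 + norm x powr (a - 2))" if b: "b \<in> Basis" for b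
  proof -
    have "dd b (dd b (\<lambda>x. norm x powr a)) x = dd b (\<lambda>x. a * (norm x powr (a - 2) * (x \<bullet> b))) x"
      by (rule fun_cong[OF frechet_derivative_cong_open[OF open_punctured xp]])
        (simp add: dd_norm_powr mult.assoc)
    also have "\<dots> = a * dd b (\<lambda>x. norm x powr (a - 2) * (x \<bullet> b)) x"
      by (intro dd_cmult derivative_intros C2D(1)[OF C xp] C2D(1)[OF Ck_on_inner UNIV_I])
    also have "dd b (\<lambda>x. norm x powr (a - 2) * (x \<bullet> b)) x =
        norm x powr (a - 2) * (b \<bullet> b) + ((a - 2) * norm x powr (a - 2 - 2) * (x \<bullet> b)) * (x \<bullet> b)"
      using dd_mult[OF C2D(1)[OF C[of "a - 2"] xp] C2D(1)[OF Ck_on_inner[of 2 b] UNIV_I], where w=b]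
      by (simp only: dd_norm_powr[OF x] dd_inner)
    finally show ?thesis using b by (simp add: power2_eq_square algebra_simps)
  qed
  then have "laplacian (\<lambda>x. norm x powr a) x =
      (\<Sum>b\<in>Basis. a * ((a - 2) * norm x powr (a - 4) * (x \<bullet> b)\<^sup>2 + norm x powr (a - 2)))"
    by (simp add: laplacian_eq[OF C xp])
  also have "\<dots> = a * ((a - 2) * norm x powr (a - 4) * (\<Sum>b\<in>Basis. (x \<bullet> b)\<^sup>2) + real DIM('a) * norm x powr (a - 2))"
    by (simp only: sum_distrib_left[symmetric] sum.distrib sum_constant)
  also have "(\<Sum>b\<in>Basis. (x \<bullet> b)\<^sup>2) = norm x powr 2"
    using x by (simp add: norm_eq_sqrt_inner euclidean_inner[of x x] power2_eq_square sum_nonneg)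
  also have "(a - 2) * norm x powr (a - 4) * norm x powr 2 = (a - 2) * norm x powr (a - 2)"
    unfolding mult.assoc powr_add[symmetric] by simp
  finally show ?thesis by (simp add: algebra_simps)
qed

text \<open>The cross term of the product rule vanishes: the gradient of a power of |x| is radial,
  that of a radial extension orthogonal to \<open>x\<close>.\<close>

lemma laplacian_homogeneous:
  fixes f :: "'a::euclidean_space \<Rightarrow> real"
  assumes D: "open D" "D \<subseteq> -{0}" and f: "Ck_on 2 (radial_ext f) D" and x: "x \<in> D"
  shows "laplacian (\<lambda>x. norm x powr a * radial_ext f x) x =
    norm x powr (a - 2) * (a * (a + real DIM('a) - 2) * radial_ext f x
      + (norm x)\<^sup>2 * laplacian (radial_ext f) x)"
proof -
  have x0: "x \<noteq> 0" using D x by auto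
  have C: "Ck_on 2 (\<lambda>x::'a. norm x powr a) D" using Ck_on_subset[OF Ck_on_norm_powr D(2)] .
  have "norm x powr a = norm x powr (a - 2) * (norm x)\<^sup>2"
    using x0 by (simp add: powr_diff powr_numeral)
  moreover have "x \<bullet> gradient (radial_ext f) x = 0"
    using gradient_radial_ext_radial[OF C2D(1)[OF f x]] by (simp add: inner_commute)
  ultimately show ?thesis
    unfolding laplacian_mult[OF D(1) C f x] gradient_norm_powr[OF x0] laplacian_norm_powr[OF x0]
    by (simp add: algebra_simps)
qed

section \<open>Polynomials as functions on the sphere\<close>

inductive hom_poly :: "nat \<Rightarrow> ('a::euclidean_space \<Rightarrow> real) \<Rightarrow> bool" where
  const: "hom_poly 0 (\<lambda>x. c)"
| lin: "hom_poly d f \<Longrightarrow> hom_poly (Suc d) (\<lambda>x. (x \<bullet> b) * f x)"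
| add: "hom_poly d f \<Longrightarrow> hom_poly d g \<Longrightarrow> hom_poly d (\<lambda>x. f x + g x)"

lemma hom_poly_Ck: "hom_poly d f \<Longrightarrow> Ck_on k f UNIV"
  by (induction rule: hom_poly.induct)
    (auto intro!: Ck_on_const Ck_on_mult Ck_on_add Ck_on_inner)

lemma hom_poly_scale: "hom_poly d f \<Longrightarrow> f (t *\<^sub>R x) = t ^ d * f x"
  by (induction rule: hom_poly.induct) (auto simp: algebra_simps)

lemma hom_poly_zero: "hom_poly d (\<lambda>x. 0)"
proof (induction d)
  case (Suc d)
  from lin[OF this, of 0] show ?case by simp
qed (rule const)

lemma hom_poly_mult: "hom_poly d f \<Longrightarrow> hom_poly e g \<Longrightarrow> hom_poly (d + e) (\<lambda>x. f x * g x)"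
proof (induction rule: hom_poly.induct)
  case (const c)
  from const show ?case
  proof (induction rule: hom_poly.induct)
    case (lin d f b)
    from hom_poly.lin[OF lin.IH, of b] show ?case by (simp add: algebra_simps)
  next
    case (add d f g)
    from hom_poly.add[OF add.IH] show ?case by (simp add: algebra_simps)
  qed (auto intro: hom_poly.const)
next
  case (lin d f b)
  from hom_poly.lin[OF lin.IH[OF lin.prems], of b] show ?case by (simp add: algebra_simps)
next
  case (add d f g)
  from hom_poly.add[OF add.IH(1)[OF add.prems] add.IH(2)[OF add.prems]]
  show ?case by (simp add: algebra_simps)
qed

text \<open>Subtraction of degrees is truncated: for \<open>d = 0\<close> the degree
  \<open>d - 1\<close> is again 0. The vanishing of the derivative in this case is carried along, as
  the product rule in the linear step would otherwise mix degrees.\<close>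

lemma hom_poly_dd:
  "hom_poly d f \<Longrightarrow> (d = 0 \<longrightarrow> (\<forall>x. dd v f x = 0)) \<and> hom_poly (d - 1) (dd v f)"
proof (induction rule: hom_poly.induct)
  case (const c)
  then show ?case by (auto simp: dd_const intro: hom_poly.const)
next
  case (lin d f b)
  have "dd v (\<lambda>x. (x \<bullet> b) * f x) x = (x \<bullet> b) * dd v f x + (v \<bullet> b) * f x" for x
    using dd_mult[OF C2D(1)[OF Ck_on_inner UNIV_I] C2D(1)[OF hom_poly_Ck[OF lin.hyps] UNIV_I]]
    by (simp add: dd_inner)
  then have eq: "dd v (\<lambda>x. (x \<bullet> b) * f x) = (\<lambda>x. (x \<bullet> b) * dd v f x + (v \<bullet> b) * f x)" by auto
  have "hom_poly d (\<lambda>x. (x \<bullet> b) * dd v f x)"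
  proof (cases d)
    case 0
    with lin.IH have "dd v f x = 0" for x by simp
    then show ?thesis using hom_poly_zero by simp
  next
    case (Suc e)
    then show ?thesis using hom_poly.lin[of e "dd v f" b] lin.IH by simp
  qed
  moreover have "hom_poly d (\<lambda>x. (v \<bullet> b) * f x)"
    using hom_poly_mult[OF hom_poly.const lin.hyps] by simp
  ultimately show ?case unfolding eq using hom_poly.add by simp
next
  case (add d f g)
  have eq: "dd v (\<lambda>x. f x + g x) = (\<lambda>x. dd v f x + dd v g x)"
    using dd_add[OF C2D(1)[OF hom_poly_Ck[OF add.hyps(1)] UNIV_I]
        C2D(1)[OF hom_poly_Ck[OF add.hyps(2)] UNIV_I]] by auto
  have "hom_poly (d - 1) (\<lambda>x. dd v f x + dd v g x)"
    using hom_poly.add add.IH by blast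
  then show ?case using add.IH fun_cong[OF eq] eq by simp
qed

text \<open>The induction rests on \<Delta>((x \<bullet> b) f) = (x \<bullet> b) \<Delta>f + 2 dd b
  f. Vanishing for \<open>d < 2\<close> again compensates for truncated subtraction, and it ends the
  descent in \<open>poly_fun_solve_hom\<close>.\<close>

lemma hom_poly_laplacian:
  "hom_poly d f \<Longrightarrow> (d < 2 \<longrightarrow> laplacian f = (\<lambda>_. 0)) \<and> hom_poly (d - 2) (laplacian f)"
proof (induction rule: hom_poly.induct)
  case (const c)
  have "laplacian (\<lambda>x::'a. c) = (\<lambda>_. 0)" by (rule ext) (rule laplacian_const)
  then show ?case by (simp add: hom_poly.const)
next
  case (lin d f b)
  have C: "Ck_on 2 f UNIV" by (rule hom_poly_Ck[OF lin.hyps])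
  have g: "gradient (\<lambda>y. y \<bullet> b) x = b" for x :: 'a using gradient_inner_shift[of b 0] by simp
  have "laplacian (\<lambda>x. (x \<bullet> b) * f x) x = (x \<bullet> b) * laplacian f x + 2 * dd b f x" for x
    using laplacian_mult[OF open_UNIV Ck_on_inner C UNIV_I, of b x]
    by (simp add: laplacian_inner g gradient_inner[OF C2D(1)[OF C UNIV_I]] inner_commute[of b])
  then have eq: "laplacian (\<lambda>x. (x \<bullet> b) * f x) = (\<lambda>x. (x \<bullet> b) * laplacian f x + 2 * dd b f x)" by auto
  have 1: "hom_poly (d - 1) (\<lambda>x. (x \<bullet> b) * laplacian f x)"
  proof (cases "d < 2")
    case True
    with lin.IH have "laplacian f = (\<lambda>_. 0)" by simp
    then have "laplacian f x = 0" for x by simp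
    then show ?thesis using hom_poly_zero by simp
  next
    case False
    then have "Suc (d - 2) = d - 1" by simp
    then show ?thesis using hom_poly.lin[of "d - 2" "laplacian f" b] lin.IH by simp
  qed
  have 2: "hom_poly (d - 1) (\<lambda>x. 2 * dd b f x)"
    using hom_poly_mult[OF hom_poly.const[of 2]] hom_poly_dd[OF lin.hyps, of b] by fastforce
  have 3: "laplacian f x = 0" "dd b f x = 0" if "Suc d < 2" for x
  proof -
    have "d = 0" using that by simp
    then show "laplacian f x = 0" "dd b f x = 0"
      using lin.IH hom_poly_dd[OF lin.hyps, of b] by simp_all
  qed
  show ?case unfolding eq using hom_poly.add[OF 1 2] 3 by auto
next
  case (add d f g)
  have "laplacian (\<lambda>x. f x + g x) = (\<lambda>x. laplacian f x + laplacian g x)"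
    using laplacian_add[OF open_UNIV hom_poly_Ck[OF add.hyps(1)] hom_poly_Ck[OF add.hyps(2)] UNIV_I]
    by auto
  moreover have "hom_poly (d - 2) (\<lambda>x. laplacian f x + laplacian g x)"
    using hom_poly.add add.IH by blast
  ultimately show ?case using add.IH by simp
qed

text \<open>The summands are kept homogeneous because radial extension multiplies each of them by a
  power of |x| that depends on its degree.\<close>

inductive poly_fun :: "('a::euclidean_space \<Rightarrow> real) \<Rightarrow> bool" where
  hom: "hom_poly d f \<Longrightarrow> poly_fun f"
| add: "poly_fun f \<Longrightarrow> poly_fun g \<Longrightarrow> poly_fun (\<lambda>x. f x + g x)"

lemma poly_fun_mult: "poly_fun f \<Longrightarrow> poly_fun g \<Longrightarrow> poly_fun (\<lambda>x. f x * g x)"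
proof (induction rule: poly_fun.induct)
  case (hom d f)
  from hom(2) show ?case
  proof (induction rule: poly_fun.induct)
    case (hom e g)
    then show ?case using hom_poly_mult[OF \<open>hom_poly d f\<close>] poly_fun.hom by blast
  next
    case (add g h)
    then show ?case using poly_fun.add by (fastforce simp: distrib_left)
  qed
next
  case (add f h)
  then show ?case using poly_fun.add by (fastforce simp: distrib_right)
qed

lemma poly_fun_const: "poly_fun (\<lambda>x. c)"
  by (rule poly_fun.hom[OF hom_poly.const])

lemma poly_fun_cmult: "poly_fun f \<Longrightarrow> poly_fun (\<lambda>x. c * f x)"
  by (rule poly_fun_mult[OF poly_fun_const])

lemma poly_fun_diff: "poly_fun f \<Longrightarrow> poly_fun g \<Longrightarrow> poly_fun (\<lambda>x. f x - g x)"
  using poly_fun.add[OF _ poly_fun_cmult[where c="-1"]] by fastforce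

lemma poly_fun_real_polynomial: "real_polynomial_function p \<Longrightarrow> poly_fun p"
proof (induction rule: real_polynomial_function.induct)
  case (linear f)
  define v where "v = (\<Sum>b\<in>Basis. f b *\<^sub>R b)"
  interpret bounded_linear f by (rule linear)
  have "f x = (x \<bullet> v) * 1" for x
  proof -
    have "f x = f (\<Sum>b\<in>Basis. (x \<bullet> b) *\<^sub>R b)" by (simp add: euclidean_representation)
    also have "\<dots> = (\<Sum>b\<in>Basis. (x \<bullet> b) * f b)" by (simp add: sum scaleR)
    finally show ?thesis by (simp add: v_def inner_sum_right mult.commute)
  qed
  then have "f = (\<lambda>x. (x \<bullet> v) * 1)" by auto
  then show ?case using poly_fun.hom[OF hom_poly.lin[OF hom_poly.const]] by metis
qed (auto intro: poly_fun_const poly_fun.add poly_fun_mult)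

lemma radial_ext_hom_poly:
  assumes "hom_poly d f" "x \<noteq> 0"
  shows "radial_ext f x = norm x powr (- real d) * f x"
proof -
  have "radial_ext f x = inverse (norm x) ^ d * f x"
    using hom_poly_scale[OF assms(1), of "inverse (norm x)" x] by (simp add: radial_ext_def sgn_div_norm)
  then show ?thesis using assms(2) by (simp add: powr_minus powr_realpow power_inverse)
qed

lemma poly_fun_Ck: "poly_fun f \<Longrightarrow> Ck_on k (radial_ext f) (-{0})"
proof (induction rule: poly_fun.induct)
  case (hom d f)
  have "Ck_on k (\<lambda>x. norm x powr (- real d) * f x) (-{0})"
    by (intro Ck_on_mult Ck_on_norm_powr Ck_on_subset[OF hom_poly_Ck[OF hom]]) auto
  then show ?case
    by (rule Ck_on_cong[OF open_punctured, rotated]) (simp add: radial_ext_hom_poly[OF hom])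
next
  case (add f g)
  from Ck_on_add[OF open_punctured add.IH] show ?case by (simp add: radial_ext_def[abs_def])
qed

text \<open>Agrees with \<open>laplace_beltrami\<close> wherever \<open>laplace_beltrami_eq\<close>
  applies, but does not extend the gradient radially a second time.\<close>

definition sph_lap :: "('a::euclidean_space \<Rightarrow> real) \<Rightarrow> 'a \<Rightarrow> real" where
  "sph_lap f = laplacian (radial_ext f)"

lemma sph_lap_add:
  assumes "poly_fun f" "poly_fun g" "norm w = 1"
  shows "sph_lap (\<lambda>x. f x + g x) w = sph_lap f w + sph_lap g w"
proof -
  have "w \<in> -{0}" using assms(3) by auto
  from laplacian_add[OF open_punctured poly_fun_Ck[OF assms(1)] poly_fun_Ck[OF assms(2)] this]
  show ?thesis by (simp add: sph_lap_def radial_ext_def[abs_def])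
qed

lemma sph_lap_cmult:
  assumes "poly_fun f" "norm w = 1"
  shows "sph_lap (\<lambda>x. c * f x) w = c * sph_lap f w"
proof -
  have "w \<in> -{0}" using assms(2) by auto
  from laplacian_cmult[OF open_punctured poly_fun_Ck[OF assms(1)] this]
  show ?thesis by (simp add: sph_lap_def radial_ext_def[abs_def])
qed

lemma sph_lap_diff:
  assumes "poly_fun f" "poly_fun g" "norm w = 1"
  shows "sph_lap (\<lambda>x. f x - g x) w = sph_lap f w - sph_lap g w"
  using sph_lap_add[OF assms(1) poly_fun_cmult[OF assms(2), of "-1"] assms(3)]
    sph_lap_cmult[OF assms(2,3), of "-1"] by simp

lemma sph_lap_const: "sph_lap (\<lambda>x. c) w = 0"
  using laplacian_const by (simp add: sph_lap_def radial_ext_def[abs_def])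

text \<open>Away from 0, \<open>f\<close> is |x|^d times its radial extension, so
  \<open>laplacian_homogeneous\<close> with exponent d can be solved for the spherical part. d (d +
  n - 2) is the eigenvalue of spherical harmonics of degree d.\<close>

lemma sph_lap_hom_poly:
  fixes w :: "'a::euclidean_space"
  assumes "hom_poly d f" "norm w = 1"
  shows "sph_lap f w = laplacian f w - real d * (real d + real DIM('a) - 2) * f w"
proof -
  have w0: "w \<in> -{0}" using assms(2) by auto
  have "laplacian f w = laplacian (\<lambda>x. norm x powr real d * radial_ext f x) w"
    by (rule laplacian_cong_open[OF open_punctured _ Ck_on_subset[OF hom_poly_Ck[OF assms(1)]] w0])
      (auto simp: radial_ext_hom_poly[OF assms(1)] mult.assoc[symmetric] powr_add[symmetric])
  then show ?thesis
    using laplacian_homogeneous[OF open_punctured _ poly_fun_Ck[OF poly_fun.hom[OF assms(1)]] w0, of "real d"]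
      assms(2) radial_ext_unit[OF assms(2), of f] by (simp add: sph_lap_def)
qed

lemma continuous_on_poly_fun:
  assumes "poly_fun f" shows "continuous_on (sphere 0 1) f" "continuous_on (sphere 0 1) (sph_lap f)"
proof -
  have sub: "sphere 0 1 \<subseteq> - {0::'a}" by auto
  have "continuous_on (sphere 0 1) (radial_ext f)"
    using continuous_on_subset[OF C2D(5)[OF poly_fun_Ck[OF assms]] sub] .
  then show "continuous_on (sphere 0 1) f"
    by (rule continuous_on_eq) (simp add: radial_ext_unit)
  show "continuous_on (sphere 0 1) (sph_lap f)"
    unfolding sph_lap_def
    using continuous_on_subset[OF continuous_on_laplacian[OF poly_fun_Ck[OF assms]] sub] .
qed

text \<open>On the sphere \<open>\<Delta>\<^sub>S\<close> maps a homogeneous polynomial \<open>h\<close> of degree \<open>d\<close> to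
  \<open>\<Delta>h - d (d + n - 2) h\<close>, so the equation is solved by descending in the degree.\<close>

lemma poly_fun_solve_hom:
  fixes f :: "'a::euclidean_space \<Rightarrow> real"
  assumes "hom_poly d f" "c > 0" "DIM('a) \<ge> 2"
  shows "\<exists>u. poly_fun u \<and> (\<forall>w. norm w = 1 \<longrightarrow> - sph_lap u w + c * u w = f w)"
  using assms(1)
proof (induction d arbitrary: f rule: less_induct)
  case (less d)
  obtain u0 where u0: "poly_fun u0" "\<And>w. norm w = 1 \<Longrightarrow> - sph_lap u0 w + c * u0 w = laplacian f w"
  proof (cases "d < 2")
    case True
    with hom_poly_laplacian[OF less.prems] have "laplacian f = (\<lambda>_. 0)" by simp
    then have "laplacian f w = 0" for w by simp
    then show ?thesis using that[of "\<lambda>_. 0"] poly_fun_const[of 0] by (simp add: sph_lap_const)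
  next
    case False
    then show ?thesis
      using less.IH[of "d - 2" "laplacian f"] hom_poly_laplacian[OF less.prems] that by auto
  qed
  \<comment> \<open>On the sphere the operator takes \<open>f\<close> to k f - \<Delta>f and
    \<open>u0\<close> to \<Delta>f, hence \<open>f + u0\<close> to k f. Positivity of
    \<open>k\<close> uses n \<ge> 2 and c > 0.\<close>
  define k where "k = real d * (real d + real DIM('a) - 2) + c"
  have "k > 0" unfolding k_def using assms by (intro add_nonneg_pos mult_nonneg_nonneg) auto
  define u where "u = (\<lambda>x. (1/k) * (f x + u0 x))"
  have pf: "poly_fun f" by (rule poly_fun.hom[OF less.prems])
  have "poly_fun u" unfolding u_def by (intro poly_fun_cmult poly_fun.add pf u0(1))
  moreover have "- sph_lap u w + c * u w = f w" if w: "norm w = 1" for w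
  proof -
    have "sph_lap u w = (1/k) * (laplacian f w - (k - c) * f w + sph_lap u0 w)"
      unfolding u_def sph_lap_cmult[OF poly_fun.add[OF pf u0(1)] w] sph_lap_add[OF pf u0(1) w]
        sph_lap_hom_poly[OF less.prems w] by (simp add: k_def)
    moreover have "u w = (1/k) * (f w + u0 w)" by (simp add: u_def)
    ultimately have "k * (- sph_lap u w + c * u w) = (k - c) * f w + c * f w
        + (- sph_lap u0 w + c * u0 w - laplacian f w)"
      using \<open>k > 0\<close> by (simp add: field_simps)
    also have "\<dots> = k * f w" using u0(2)[OF w] by (simp add: algebra_simps)
    finally show ?thesis using \<open>k > 0\<close> by simp
  qed
  ultimately show ?case by blast
qed

lemma poly_fun_solve:
  fixes f :: "'a::euclidean_space \<Rightarrow> real"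
  assumes "poly_fun f" "c > 0" "DIM('a) \<ge> 2"
  shows "\<exists>u. poly_fun u \<and> (\<forall>w. norm w = 1 \<longrightarrow> - sph_lap u w + c * u w = f w)"
  using assms(1)
proof (induction rule: poly_fun.induct)
  case (hom d f)
  then show ?case using poly_fun_solve_hom assms by blast
next
  case (add f g)
  then obtain u v where "poly_fun u" "poly_fun v"
    "\<And>w. norm w = 1 \<Longrightarrow> - sph_lap u w + c * u w = f w"
    "\<And>w. norm w = 1 \<Longrightarrow> - sph_lap v w + c * v w = g w" by blast
  then show ?case
    by (intro exI[of _ "\<lambda>x. u x + v x"])
      (auto intro: poly_fun.add simp: sph_lap_add algebra_simps)
qed

lemma poly_fun_dense:
  assumes "continuous_on (sphere 0 1) f" "e > 0"
  obtains p :: "'a::euclidean_space \<Rightarrow> real" where "poly_fun p" "\<And>w. norm w = 1 \<Longrightarrow> \<bar>f w - p w\<bar> < e"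
  using Stone_Weierstrass_real_polynomial_function[OF compact_sphere assms] poly_fun_real_polynomial
  by (metis mem_sphere_0)

section \<open>The principal eigenvalue of a Schroedinger operator on the sphere\<close>

text \<open>A filter serves two uses: all polynomials at once, through \<open>principal\<close>, and
  a sequence whose local constants hold only eventually. A finite subcover of K makes the constants
  uniform, every point being compared with the same base point.\<close>

lemma harnack_chain:
  fixes P :: "'i \<Rightarrow> 'a::euclidean_space \<Rightarrow> real"
  assumes U: "open U" "connected U" and K: "compact K" "K \<subseteq> U"
    and pos: "\<forall>\<^sub>F i in Fl. \<forall>x\<in>U. 0 < P i x"
    and loc: "\<And>x. x \<in> U \<Longrightarrow> \<exists>r>0. \<exists>H. \<forall>\<^sub>F i in Fl. \<forall>y\<in>ball x r. P i y \<le> H * P i x \<and> P i x \<le> H * P i y"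
  shows "\<exists>H>0. \<forall>\<^sub>F i in Fl. \<forall>x\<in>K. \<forall>y\<in>K. P i x \<le> H * P i y"
proof (cases "U = {}")
  case True
  then show ?thesis using K by (intro exI[of _ 1]) auto
next
  case False
  then obtain x0 where x0: "x0 \<in> U" by blast
  have loc1: "\<exists>r>0. \<exists>H\<ge>1. ball x r \<subseteq> U \<and> (\<forall>\<^sub>F i in Fl. \<forall>y\<in>ball x r. P i y \<le> H * P i x \<and> P i x \<le> H * P i y)"
    if x: "x \<in> U" for x
  proof -
    obtain r H where r: "r > 0" and H: "\<forall>\<^sub>F i in Fl. \<forall>y\<in>ball x r. P i y \<le> H * P i x \<and> P i x \<le> H * P i y"
      using loc[OF x] by blast
    obtain e where e: "e > 0" "ball x e \<subseteq> U" using U(1) x open_contains_ball by blast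
    have "\<forall>\<^sub>F i in Fl. \<forall>y\<in>ball x (min r e). P i y \<le> max H 1 * P i x \<and> P i x \<le> max H 1 * P i y"
      using H pos
    proof eventually_elim
      case (elim i)
      show ?case
      proof
        fix y assume y: "y \<in> ball x (min r e)"
        then have "y \<in> U" using e by auto
        then have "H * P i x \<le> max H 1 * P i x" "H * P i y \<le> max H 1 * P i y"
          using elim(2) x by (auto intro!: mult_right_mono simp: less_imp_le)
        then show "P i y \<le> max H 1 * P i x \<and> P i x \<le> max H 1 * P i y" using elim(1) y by force
      qed
    qed
    then show ?thesis using r e by (intro exI[of _ "min r e"] conjI exI[of _ "max H 1"]) auto
  qed
  \<comment> \<open>Points whose values are eventually comparable with those at \<open>x0\<close>.
    The local hypothesis makes membership constant on small balls, so \<open>A\<close> and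
    \<open>U - A\<close> are open and connectedness gives A = U.\<close>
  define A where "A = {x\<in>U. \<exists>H\<ge>1. \<forall>\<^sub>F i in Fl. P i x \<le> H * P i x0 \<and> P i x0 \<le> H * P i x}"
  have step: "x \<in> A \<longleftrightarrow> y \<in> A"
    if "x \<in> U" "y \<in> U" and H: "H \<ge> 1" "\<forall>\<^sub>F i in Fl. P i y \<le> H * P i x \<and> P i x \<le> H * P i y" for x y H
  proof -
    have *: "b \<in> A" if a: "a \<in> A" and b: "b \<in> U" and H: "\<forall>\<^sub>F i in Fl. P i b \<le> H * P i a \<and> P i a \<le> H * P i b" for a b
    proof -
      obtain G where G: "G \<ge> 1" "\<forall>\<^sub>F i in Fl. P i a \<le> G * P i x0 \<and> P i x0 \<le> G * P i a"
        using a by (auto simp: A_def)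
      have "\<forall>\<^sub>F i in Fl. P i b \<le> (H * G) * P i x0 \<and> P i x0 \<le> (H * G) * P i b"
        using G(2) H
      proof eventually_elim
        case (elim i)
        have "H * P i a \<le> H * (G * P i x0)" "G * P i a \<le> G * (H * P i b)"
          using elim G(1) \<open>H \<ge> 1\<close> by (auto intro!: mult_left_mono)
        then show ?case using elim by (simp add: mult_ac)
      qed
      moreover have "H * G \<ge> 1" using G(1) \<open>H \<ge> 1\<close> mult_mono[of 1 H 1 G] by simp
      ultimately show ?thesis using b by (auto simp: A_def)
    qed
    have H': "\<forall>\<^sub>F i in Fl. P i x \<le> H * P i y \<and> P i y \<le> H * P i x"
      using H(2) by eventually_elim simp
    show ?thesis using *[OF _ that(2) H(2)] *[OF _ that(1) H'] by blast
  qed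
  have nb: "\<exists>r>0. ball x r \<subseteq> U \<and> (\<forall>y\<in>ball x r. y \<in> A \<longleftrightarrow> x \<in> A)" if x: "x \<in> U" for x
  proof -
    obtain r H where r: "r > 0" "H \<ge> 1" "ball x r \<subseteq> U"
      "\<forall>\<^sub>F i in Fl. \<forall>y\<in>ball x r. P i y \<le> H * P i x \<and> P i x \<le> H * P i y" using loc1[OF x] by blast
    have "y \<in> A \<longleftrightarrow> x \<in> A" if y: "y \<in> ball x r" for y
    proof -
      have "\<forall>\<^sub>F i in Fl. P i y \<le> H * P i x \<and> P i x \<le> H * P i y"
        using r(4) by eventually_elim (use y in blast)
      then show ?thesis using step[OF x _ r(2)] r(3) y by blast
    qed
    then show ?thesis using r by blast
  qed
  have AU': "A \<subseteq> U" by (auto simp: A_def)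
  have "open A"
    unfolding open_contains_ball
  proof
    fix a assume "a \<in> A"
    with nb[of a] AU' show "\<exists>e>0. ball a e \<subseteq> A" by blast
  qed
  moreover have "open (U - A)"
    unfolding open_contains_ball
  proof
    fix a assume "a \<in> U - A"
    with nb[of a] show "\<exists>e>0. ball a e \<subseteq> U - A" by blast
  qed
  moreover have "x0 \<in> A" using x0 by (auto simp: A_def intro!: exI[of _ "1::real"])
  ultimately have "U - A = {}"
    using connectedD[OF U(2), of A "U - A"] x0 AU' by blast
  then have AU: "x \<in> A" if "x \<in> U" for x using that by blast
  have unif: "\<exists>r>0. \<exists>H\<ge>1. ball x r \<subseteq> U \<and> (\<forall>\<^sub>F i in Fl. \<forall>y\<in>ball x r. P i y \<le> H * P i x0 \<and> P i x0 \<le> H * P i y)"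
    if x: "x \<in> U" for x
  proof -
    obtain r H where r: "r > 0" "H \<ge> 1" "ball x r \<subseteq> U"
      "\<forall>\<^sub>F i in Fl. \<forall>y\<in>ball x r. P i y \<le> H * P i x \<and> P i x \<le> H * P i y" using loc1[OF x] by blast
    obtain G where G: "G \<ge> 1" "\<forall>\<^sub>F i in Fl. P i x \<le> G * P i x0 \<and> P i x0 \<le> G * P i x"
      using AU[OF x] by (auto simp: A_def)
    have "\<forall>\<^sub>F i in Fl. \<forall>y\<in>ball x r. P i y \<le> (H * G) * P i x0 \<and> P i x0 \<le> (H * G) * P i y"
      using G(2) r(4)
    proof eventually_elim
      case (elim i)
      have "H * P i x \<le> H * (G * P i x0)" using elim r(2) by (auto intro!: mult_left_mono)
      moreover have "G * P i x \<le> G * (H * P i y)" if "y \<in> ball x r" for y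
        using elim G(1) that by (auto intro!: mult_left_mono)
      ultimately show ?case using elim by (fastforce simp: mult_ac)
    qed
    moreover have "H * G \<ge> 1" using G(1) r(2) mult_mono[of 1 H 1 G] by simp
    ultimately show ?thesis using r by blast
  qed
  define Q where "Q = (\<lambda>x r H. r > 0 \<and> H \<ge> (1::real) \<and> ball x r \<subseteq> U \<and>
     (\<forall>\<^sub>F i in Fl. \<forall>y\<in>ball x r. P i y \<le> H * P i x0 \<and> P i x0 \<le> H * P i y))"
  have "\<exists>r H. Q x r H" if "x \<in> U" for x using unif[OF that] unfolding Q_def by blast
  then obtain R H where "\<And>x. x \<in> U \<Longrightarrow> Q x (R x) (H x)" by metis
  then have RH: "\<And>x. x \<in> U \<Longrightarrow> R x > 0 \<and> H x \<ge> (1::real) \<and> ball x (R x) \<subseteq> U \<and>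
     (\<forall>\<^sub>F i in Fl. \<forall>y\<in>ball x (R x). P i y \<le> H x * P i x0 \<and> P i x0 \<le> H x * P i y)"
    by (simp add: Q_def)
  have cov: "K \<subseteq> (\<Union>x\<in>K. ball x (R x))"
  proof
    fix x assume x: "x \<in> K"
    then have "x \<in> ball x (R x)" using RH[of x] K(2) by auto
    then show "x \<in> (\<Union>x\<in>K. ball x (R x))" using x by blast
  qed
  obtain T where T: "finite T" "T \<subseteq> K" "K \<subseteq> (\<Union>x\<in>T. ball x (R x))"
    by (rule compactE_image[OF K(1) open_ball cov]) blast
  define M where "M = (\<Sum>x\<in>T. H x) + 1"
  have M: "H x \<le> M" if "x \<in> T" for x
    using member_le_sum[of x T H] T that RH K(2) by (force simp: M_def)
  have M1: "M \<ge> 1" using RH T K(2) by (auto simp: M_def intro!: sum_nonneg) (meson order_trans subsetD zero_le_one)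
  have "\<forall>\<^sub>F i in Fl. \<forall>x\<in>T. \<forall>y\<in>ball x (R x). P i y \<le> H x * P i x0 \<and> P i x0 \<le> H x * P i y"
    using T(1,2) K(2) RH by (intro eventually_ball_finite) auto
  then have "\<forall>\<^sub>F i in Fl. \<forall>x\<in>K. \<forall>y\<in>K. P i x \<le> (M * M) * P i y"
    using pos
  proof eventually_elim
    case (elim i)
    have b: "P i y \<le> M * P i x0" "P i x0 \<le> M * P i y" if y: "y \<in> K" for y
    proof -
      obtain x where x: "x \<in> T" "y \<in> ball x (R x)" using T(3) y by blast
      have "H x * P i x0 \<le> M * P i x0" "H x * P i y \<le> M * P i y"
        using M[OF x(1)] elim(2) x0 y K(2) by (auto intro!: mult_right_mono simp: less_imp_le subset_eq)
      then show "P i y \<le> M * P i x0" "P i x0 \<le> M * P i y" using elim(1) x by force+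
    qed
    show ?case
    proof (intro ballI)
      fix x y assume "x \<in> K" "y \<in> K"
      then have "P i x \<le> M * P i x0" "M * P i x0 \<le> M * (M * P i y)"
        using b M1 by (auto intro!: mult_left_mono)
      then show "P i x \<le> (M * M) * P i y" by (simp add: mult_ac)
    qed
  qed
  then show ?thesis using M1 by (intro exI[of _ "M * M"]) auto
qed

text \<open>\<open>harnack_local\<close> bounds values near the centre of a ball by the value at the
  centre. The reverse inequality is the same bound centred at \<open>y\<close>; the radius
  \<open>2*R\<close> leaves room for the ball of radius \<open>R\<close> about
  \<open>y\<close>.\<close>

lemma harnack_ball:
  fixes C :: real
  assumes C: "C \<ge> 0" and R: "R > 0"
  obtains r H where "r > 0" "r < R"
    "\<And>(u::'a::euclidean_space \<Rightarrow> real) x y. Ck_on 2 u (ball x (2*R)) \<Longrightarrow>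
      (\<And>y. y \<in> ball x (2*R) \<Longrightarrow> 0 < u y \<and> \<bar>laplacian u y\<bar> \<le> C * u y) \<Longrightarrow> y \<in> ball x r \<Longrightarrow>
      u y \<le> H * u x \<and> u x \<le> H * u y"
proof -
  have n: "real DIM('a) \<ge> 1" using DIM_positive[where 'a='a] by (simp add: Suc_le_eq)
  define r where "r = R / (4 * real DIM('a))"
  have r: "r > 0" "2 * real DIM('a) * r < R" using R n by (auto simp: r_def)
  have rR: "r < R"
  proof -
    have "r * 1 \<le> r * (2 * real DIM('a))" using r(1) n by (intro mult_left_mono) linarith+
    then show ?thesis using r(2) by (simp add: mult_ac)
  qed
  define H where "H = 2 * exp (16/7) * 2 ^ DIM('a) * exp (2 * C * r\<^sup>2)"
  have "u y \<le> H * u x \<and> u x \<le> H * u y"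
    if u: "Ck_on 2 u (ball x (2*R))"
      and p: "\<And>y. y \<in> ball x (2*R) \<Longrightarrow> 0 < u y \<and> \<bar>laplacian u y\<bar> \<le> C * u y" and y: "y \<in> ball x (r/2)"
    for u :: "'a \<Rightarrow> real" and x y
  proof
    have s1: "ball x R \<subseteq> ball x (2*R)" using R by auto
    show "u y \<le> H * u x"
      unfolding H_def
      by (rule harnack_local[OF Ck_on_subset[OF u s1] _ _ C r]) (use p s1 y in auto)
    have s2: "ball y R \<subseteq> ball x (2*R)"
    proof
      fix z assume "z \<in> ball y R"
      then show "z \<in> ball x (2*R)" using dist_triangle[of x z y] y rR r(1) by simp
    qed
    show "u x \<le> H * u y"
      unfolding H_def
      by (rule harnack_local[OF Ck_on_subset[OF u s2] _ _ C r])
        (use p subsetD[OF s2] y in \<open>auto simp: dist_commute[of y x]\<close>)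
  qed
  then show ?thesis using that[of "r/2" H] r(1) rR by simp
qed

lemma radial_ext_laplacian_sgn:
  fixes f :: "'a::euclidean_space \<Rightarrow> real"
  assumes f: "Ck_on 2 (radial_ext f) (cone_over S)" "open (cone_over S)" and x: "x \<in> cone_over S"
  shows "laplacian (radial_ext f) x = laplacian (radial_ext f) (sgn x) / (norm x)\<^sup>2"
proof -
  have x0: "norm x > 0" using x by (simp add: cone_over_def)
  have s: "(1 / norm x) *\<^sub>R x = sgn x" by (simp add: sgn_div_norm divide_inverse)
  have "sgn x \<in> cone_over S" using cone_over_scale[of "1 / norm x" x S] x x0 s by simp
  then show ?thesis
    using laplacian_radial_ext_scale[of "1 / norm x" "cone_over S" f x] f x0 s by (simp add: power_divide)
qed

lemma cone_over_sphere: "cone_over (sphere 0 1) = - {0::'a::euclidean_space}"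
  by (auto simp: cone_over_def)

lemma norm_sgn_eq_1: "x \<noteq> 0 \<Longrightarrow> norm (sgn x :: 'a::euclidean_space) = 1"
  by (simp add: norm_sgn)

lemma laplacian_radial_poly:
  fixes p :: "'a::euclidean_space \<Rightarrow> real"
  assumes "poly_fun p" "x \<noteq> 0"
  shows "laplacian (radial_ext p) x = sph_lap p (sgn x) / (norm x)\<^sup>2"
  using radial_ext_laplacian_sgn[of p "sphere 0 1" x] poly_fun_Ck[OF assms(1)] assms(2)
  unfolding cone_over_sphere sph_lap_def by auto

text \<open>Radial extensions are compared in the punctured space, which is connected because n
  \<ge> 2. On the ball about \<open>x\<close> of radius \<open>2*R\<close> norms are at least
  \<open>2*R\<close>, which turns the bound by C on the sphere into a bound by C / (2R)^2 for the
  Laplacian of the extension.\<close>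

lemma harnack_sphere:
  assumes "DIM('a::euclidean_space) \<ge> 2" "C \<ge> 0"
  obtains H where "H > 0" "\<And>(p::'a \<Rightarrow> real) x y. poly_fun p \<Longrightarrow>
    (\<And>w. norm w = 1 \<Longrightarrow> 0 < p w \<and> \<bar>sph_lap p w\<bar> \<le> C * p w) \<Longrightarrow> norm x = 1 \<Longrightarrow> norm y = 1 \<Longrightarrow> p x \<le> H * p y"
proof -
  define I where "I = {p::'a \<Rightarrow> real. poly_fun p \<and> (\<forall>w. norm w = 1 \<longrightarrow> 0 < p w \<and> \<bar>sph_lap p w\<bar> \<le> C * p w)}"
  have pos: "0 < radial_ext p x" if "p \<in> I" "x \<noteq> 0" for p x
    using that norm_sgn_eq_1[of x] by (auto simp: I_def radial_ext_def)
  have "\<exists>H>0. \<forall>\<^sub>F p in principal I. \<forall>x\<in>sphere 0 1. \<forall>y\<in>sphere 0 1. radial_ext p x \<le> H * radial_ext p y"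
  proof (rule harnack_chain[where U = "-{0}"])
    show "connected (- {0::'a})" using connected_punctured_universe assms(1) by blast
    show "\<forall>\<^sub>F p in principal I. \<forall>x\<in>- {0}. 0 < radial_ext p x"
      using pos by (simp add: eventually_principal)
    fix x :: 'a assume "x \<in> -{0}"
    then have x0: "norm x > 0" by simp
    define R where "R = norm x / 4"
    have R: "R > 0" using x0 by (simp add: R_def)
    have n: "norm y \<ge> 2 * R" if "y \<in> ball x (2*R)" for y
      using that norm_triangle_ineq2[of x y] by (simp add: dist_norm R_def)
    have C': "C / (2*R)\<^sup>2 \<ge> 0" using assms(2) by simp
    obtain r H where rH: "r > 0" "r < R"
      "\<And>(u::'a \<Rightarrow> real) x y. Ck_on 2 u (ball x (2*R)) \<Longrightarrow>
      (\<And>y. y \<in> ball x (2*R) \<Longrightarrow> 0 < u y \<and> \<bar>laplacian u y\<bar> \<le> C / (2*R)\<^sup>2 * u y) \<Longrightarrow> y \<in> ball x r \<Longrightarrow>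
      u y \<le> H * u x \<and> u x \<le> H * u y"
      using harnack_ball[OF C' R] by blast
    have "radial_ext p y \<le> H * radial_ext p x \<and> radial_ext p x \<le> H * radial_ext p y"
      if p: "p \<in> I" and y: "y \<in> ball x r" for p y
    proof (rule rH(3)[OF _ _ y])
      have z0: "z \<noteq> 0" if "z \<in> ball x (2*R)" for z using n[OF that] R by auto
      then have "ball x (2*R) \<subseteq> -{0}" by blast
      then show "Ck_on 2 (radial_ext p) (ball x (2*R))"
        using p poly_fun_Ck Ck_on_subset unfolding I_def by blast
      fix z assume z: "z \<in> ball x (2*R)"
      have "\<bar>sph_lap p (sgn z)\<bar> \<le> C * p (sgn z)" "0 < p (sgn z)"
        using p norm_sgn_eq_1[OF z0[OF z]] by (auto simp: I_def)
      then have "\<bar>sph_lap p (sgn z)\<bar> / (norm z)\<^sup>2 \<le> C * p (sgn z) / (2*R)\<^sup>2"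
        using n[OF z] R by (intro frac_le power_mono) auto
      then show "0 < radial_ext p z \<and> \<bar>laplacian (radial_ext p) z\<bar> \<le> C / (2*R)\<^sup>2 * radial_ext p z"
        using pos[OF p z0[OF z]] laplacian_radial_poly[OF _ z0[OF z], of p] p
        by (simp add: I_def radial_ext_def abs_divide)
    qed
    then show "\<exists>r>0. \<exists>H. \<forall>\<^sub>F p in principal I. \<forall>y\<in>ball x r.
        radial_ext p y \<le> H * radial_ext p x \<and> radial_ext p x \<le> H * radial_ext p y"
      unfolding eventually_principal using rH(1) by blast
  qed auto
  then obtain H where "H > 0" "\<And>p x y. p \<in> I \<Longrightarrow> norm x = 1 \<Longrightarrow> norm y = 1 \<Longrightarrow> radial_ext p x \<le> H * radial_ext p y"
    unfolding eventually_principal by auto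
  then show ?thesis using that[of H] by (simp add: I_def radial_ext_unit)
qed

section \<open>Comparison with positive supersolutions and the continuity method\<close>

lemma sph_lap_nonneg_at_min:
  fixes p :: "'a::euclidean_space \<Rightarrow> real"
  assumes "poly_fun p" "norm w = 1" "\<And>v. norm v = 1 \<Longrightarrow> p w \<le> p v"
  shows "sph_lap p w \<ge> 0"
  unfolding sph_lap_def
proof (rule laplacian_nonneg_at_min[OF open_punctured poly_fun_Ck[OF assms(1)]])
  show "w \<in> -{0}" using assms(2) by auto
  show "radial_ext p w \<le> radial_ext p y" if "y \<in> -{0}" for y
    using assms(3)[of "sgn y"] norm_sgn_eq_1[of y] that radial_ext_unit[OF assms(2), of p]
    by (simp add: radial_ext_def)
qed

lemma sphere_ne: "sphere 0 1 \<noteq> ({} :: 'a::euclidean_space set)"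
  using vector_choose_size[of 1] by fastforce

text \<open>Let m < 0 be the minimum of z/p. Where it is attained, z - m p has its minimum 0, so its
  spherical Laplacian is nonnegative there. The operator then takes z to at most m times its value
  on p, a negative number.\<close>

lemma sph_supersolution_nonneg:
  fixes p z :: "'a::euclidean_space \<Rightarrow> real"
  assumes p: "poly_fun p" "\<And>w. norm w = 1 \<Longrightarrow> 0 < p w" "\<And>w. norm w = 1 \<Longrightarrow> 0 < - sph_lap p w + V w * p w"
    and z: "poly_fun z" "\<And>w. norm w = 1 \<Longrightarrow> 0 \<le> - sph_lap z w + V w * z w" and w: "norm w = 1"
  shows "0 \<le> z w"
proof (rule ccontr)
  assume neg: "\<not> 0 \<le> z w"
  have "continuous_on (sphere 0 1) (\<lambda>w. z w / p w)"
    by (intro continuous_intros continuous_on_poly_fun p z) (use p(2) in force)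
  from continuous_attains_inf[OF compact_sphere sphere_ne this]
  obtain v where v: "v \<in> sphere 0 1" "\<And>w. w \<in> sphere 0 1 \<Longrightarrow> z v / p v \<le> z w / p w"
    by blast
  define m where "m = z v / p v"
  have nv: "norm v = 1" using v by simp
  have "m \<le> z w / p w" using v(2)[of w] w by (simp add: m_def)
  also have "\<dots> < 0" using neg p(2)[OF w] by (simp add: divide_neg_pos)
  finally have m: "m < 0" .
  have zv: "z v = m * p v" using p(2)[OF nv] by (simp add: m_def)
  have "z u \<ge> m * p u" if "norm u = 1" for u
    using v(2)[of u] p(2)[OF that] that by (simp add: m_def pos_le_divide_eq)
  then have "sph_lap (\<lambda>x. z x - m * p x) v \<ge> 0"
    using zv by (intro sph_lap_nonneg_at_min poly_fun_diff poly_fun_cmult p z nv) auto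
  then have "sph_lap z v \<ge> m * sph_lap p v"
    by (simp add: sph_lap_diff[OF z(1) poly_fun_cmult[OF p(1)] nv] sph_lap_cmult[OF p(1) nv])
  then have "- sph_lap z v + V v * z v \<le> m * (- sph_lap p v + V v * p v)"
    by (simp add: zv algebra_simps)
  also have "\<dots> < 0" using m p(3)[OF nv] by (simp add: mult_neg_pos)
  finally show False using z(2)[OF nv] by simp
qed

text \<open>With t = K / \<beta> the operator takes both t p - q and t p + q to nonnegative
  functions, so both are nonnegative.\<close>

lemma sph_supersolution_bound:
  fixes p q :: "'a::euclidean_space \<Rightarrow> real"
  assumes p: "poly_fun p" "\<And>w. norm w = 1 \<Longrightarrow> 0 < p w"
    "\<And>w. norm w = 1 \<Longrightarrow> \<beta> \<le> - sph_lap p w + V w * p w" "\<And>w. norm w = 1 \<Longrightarrow> p w \<le> M" and b: "\<beta> > 0"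
    and q: "poly_fun q" "\<And>w. norm w = 1 \<Longrightarrow> \<bar>- sph_lap q w + V w * q w\<bar> \<le> K" and w: "norm w = 1"
  shows "\<bar>q w\<bar> \<le> M / \<beta> * K"
proof -
  have K: "K \<ge> 0" using q(2)[OF w] by linarith
  define t where "t = K / \<beta>"
  have t: "t \<ge> 0" "t * \<beta> = K" using K b by (auto simp: t_def)
  have p3: "0 < - sph_lap p w + V w * p w" if "norm w = 1" for w using p(3)[OF that] b by linarith
  have tp: "K \<le> t * (- sph_lap p v + V v * p v)" if "norm v = 1" for v
    using mult_left_mono[OF p(3)[OF that] t(1)] t(2) by simp
  have "0 \<le> t * p w - q w"
  proof (rule sph_supersolution_nonneg[OF p(1,2) p3 _ _ w])
    show "poly_fun (\<lambda>w. t * p w - q w)" by (intro poly_fun_diff poly_fun_cmult p q)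
    show "0 \<le> - sph_lap (\<lambda>w. t * p w - q w) v + V v * (t * p v - q v)" if "norm v = 1" for v
      using tp[OF that] q(2)[OF that]
      by (simp add: sph_lap_diff[OF poly_fun_cmult[OF p(1)] q(1) that] sph_lap_cmult[OF p(1) that] algebra_simps)
  qed
  moreover have "0 \<le> t * p w + q w"
  proof (rule sph_supersolution_nonneg[OF p(1,2) p3 _ _ w])
    show "poly_fun (\<lambda>w. t * p w + q w)" by (intro poly_fun.add poly_fun_cmult p q)
    show "0 \<le> - sph_lap (\<lambda>w. t * p w + q w) v + V v * (t * p v + q v)" if "norm v = 1" for v
      using tp[OF that] q(2)[OF that]
      unfolding sph_lap_add[OF poly_fun_cmult[OF p(1)] q(1) that] sph_lap_cmult[OF p(1) that]
      by (simp add: algebra_simps)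
  qed
  moreover have "t * p w \<le> t * M" using p(4)[OF w] t(1) by (rule mult_left_mono)
  moreover have "t * M = M / \<beta> * K" by (simp add: t_def)
  ultimately show ?thesis by linarith
qed

text \<open>Invertibility of the operator with potential \<open>V\<close> in the form available for
  polynomials: every continuous right-hand side is reached up to an arbitrarily small uniform
  error.\<close>

definition dense_range :: "('a::euclidean_space \<Rightarrow> real) \<Rightarrow> bool" where
  "dense_range V \<longleftrightarrow> (\<forall>F e. continuous_on (sphere 0 1) F \<longrightarrow> e > 0 \<longrightarrow>
     (\<exists>q. poly_fun q \<and> (\<forall>w. norm w = 1 \<longrightarrow> \<bar>- sph_lap q w + V w * q w - F w\<bar> \<le> e)))"

lemma dense_range_const:
  assumes "c > 0" "DIM('a::euclidean_space) \<ge> 2"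
  shows "dense_range (\<lambda>w::'a. c)"
  unfolding dense_range_def
proof (intro allI impI)
  fix F :: "'a \<Rightarrow> real" and e :: real assume "continuous_on (sphere 0 1) F" "e > 0"
  then obtain p where p: "poly_fun p" "\<And>w. norm w = 1 \<Longrightarrow> \<bar>F w - p w\<bar> < e" using poly_fun_dense by blast
  obtain u where u: "poly_fun u" "\<And>w. norm w = 1 \<Longrightarrow> - sph_lap u w + c * u w = p w"
    using poly_fun_solve[OF p(1) assms] by blast
  then have "\<bar>- sph_lap u w + c * u w - F w\<bar> \<le> e" if "norm w = 1" for w
    using p(2)[OF that] u(2)[OF that] by (simp add: abs_minus_commute less_imp_le)
  then show "\<exists>q. poly_fun q \<and> (\<forall>w. norm w = 1 \<longrightarrow> \<bar>- sph_lap q w + c * q w - F w\<bar> \<le> e)"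
    using u(1) by blast
qed

text \<open>Successive approximation as in a Neumann series: the a priori bound \<open>B\<close>
  plays the role of the norm of the inverse, and the perturbation is at most half of 1 / B.\<close>

lemma dense_range_step:
  fixes V h :: "'a::euclidean_space \<Rightarrow> real"
  assumes V: "dense_range V" and h: "continuous_on (sphere 0 1) h" "\<And>w. norm w = 1 \<Longrightarrow> \<bar>h w\<bar> \<le> 1 / (2 * B)"
    and Vc: "continuous_on (sphere 0 1) V" and B: "B > 0"
    and bound: "\<And>q K w. poly_fun q \<Longrightarrow> (\<And>w. norm w = 1 \<Longrightarrow> \<bar>- sph_lap q w + V w * q w\<bar> \<le> K) \<Longrightarrow> norm w = 1 \<Longrightarrow> \<bar>q w\<bar> \<le> B * K"
  shows "dense_range (\<lambda>w. V w - h w)"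
  unfolding dense_range_def
proof (intro allI impI)
  fix F :: "'a \<Rightarrow> real" and e :: real assume F: "continuous_on (sphere 0 1) F" and e: "e > 0"
  obtain M where M: "\<And>w. norm w = 1 \<Longrightarrow> \<bar>F w\<bar> \<le> M"
    using compact_imp_bounded[OF compact_continuous_image[OF F compact_sphere]]
    unfolding bounded_iff by (metis image_eqI mem_sphere_0 real_norm_def)
  define M1 where "M1 = \<bar>M\<bar> + 1"
  have M1: "M1 > 0" by (simp add: M1_def)
  have it: "\<exists>q. poly_fun q \<and> (\<forall>w. norm w = 1 \<longrightarrow> \<bar>- sph_lap q w + (V w - h w) * q w - F w\<bar> \<le> (3/4)^k * M1)" for k
  proof (induction k)
    case 0
    show ?case using M by (intro exI[of _ "\<lambda>_. 0"]) (fastforce simp: sph_lap_const M1_def poly_fun_const)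
  next
    case (Suc k)
    define \<rho> where "\<rho> = (3/4)^k * M1"
    have rho: "\<rho> > 0" using M1 by (simp add: \<rho>_def)
    obtain q where q: "poly_fun q" "\<And>w. norm w = 1 \<Longrightarrow> \<bar>- sph_lap q w + (V w - h w) * q w - F w\<bar> \<le> \<rho>"
      using Suc by (auto simp: \<rho>_def)
    define r where "r = (\<lambda>w. F w - (- sph_lap q w + (V w - h w) * q w))"
    have "continuous_on (sphere 0 1) r"
      unfolding r_def by (intro continuous_intros F Vc h continuous_on_poly_fun q)
    \<comment> \<open>\<open>s\<close> corrects the residual for the potential \<open>V\<close>. For
      \<open>V - h\<close> the new residual consists of this error and h s, together at most
      \<rho>/6 + (1 / (2B)) B (7/6) \<rho> = (3/4) \<rho>.\<close>
    then obtain s where s: "poly_fun s" "\<And>w. norm w = 1 \<Longrightarrow> \<bar>- sph_lap s w + V w * s w - r w\<bar> \<le> \<rho> / 6"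
      using V rho unfolding dense_range_def by (meson divide_pos_pos zero_less_numeral)
    have sb: "\<bar>s w\<bar> \<le> B * (7/6 * \<rho>)" if w: "norm w = 1" for w
    proof (rule bound[OF s(1) _ w])
      fix v :: 'a assume v: "norm v = 1"
      have "\<bar>r v\<bar> \<le> \<rho>" using q(2)[OF v] by (simp add: r_def abs_minus_commute)
      then show "\<bar>- sph_lap s v + V v * s v\<bar> \<le> 7/6 * \<rho>" using s(2)[OF v] by linarith
    qed
    have "\<bar>- sph_lap (\<lambda>w. q w + s w) w + (V w - h w) * (q w + s w) - F w\<bar> \<le> (3/4)^(Suc k) * M1"
      if w: "norm w = 1" for w
    proof -
      have "\<bar>h w * s w\<bar> \<le> 1 / (2*B) * (B * (7/6 * \<rho>))"
        unfolding abs_mult using h(2)[OF w] sb[OF w] B by (intro mult_mono) auto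
      also have "\<dots> = 7/12 * \<rho>" using B by simp
      finally have "\<bar>h w * s w\<bar> \<le> 7/12 * \<rho>" .
      moreover have "- sph_lap (\<lambda>w. q w + s w) w + (V w - h w) * (q w + s w) - F w
          = (- sph_lap s w + V w * s w - r w) - h w * s w"
        by (simp add: sph_lap_add[OF q(1) s(1) w] r_def algebra_simps)
      ultimately have "\<bar>- sph_lap (\<lambda>w. q w + s w) w + (V w - h w) * (q w + s w) - F w\<bar> \<le> \<rho> / 6 + 7/12 * \<rho>"
        using s(2)[OF w] by linarith
      moreover have "\<rho> / 6 + 7/12 * \<rho> = (3/4)^(Suc k) * M1" by (simp add: \<rho>_def)
      ultimately show ?thesis by simp
    qed
    then show ?case using poly_fun.add[OF q(1) s(1)] by blast
  qed
  obtain k where "(3/4::real)^k < e / M1" using real_arch_pow_inv[of "e / M1" "3/4"] e M1 by auto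
  then have "(3/4)^k * M1 \<le> e" using M1 by (simp add: field_simps)
  then show "\<exists>q. poly_fun q \<and> (\<forall>w. norm w = 1 \<longrightarrow> \<bar>- sph_lap q w + (V w - h w) * q w - F w\<bar> \<le> e)"
    using it[of k] by (meson order_trans)
qed

text \<open>Continuity method: all potentials between \<open>V\<close> and a constant above it admit
  the same supersolution \<open>p\<close> and hence the same a priori bound, so finitely many steps
  of one size lead from the constant to \<open>V\<close>.\<close>

lemma dense_range_supersolution:
  fixes V p :: "'a::euclidean_space \<Rightarrow> real"
  assumes n: "DIM('a) \<ge> 2" and V: "continuous_on (sphere 0 1) V"
    and p: "poly_fun p" "\<And>w. norm w = 1 \<Longrightarrow> 0 < p w" "\<And>w. norm w = 1 \<Longrightarrow> 0 < - sph_lap p w + V w * p w"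
  shows "dense_range V"
proof -
  have "continuous_on (sphere 0 1) (\<lambda>w. - sph_lap p w + V w * p w)"
    by (intro continuous_intros V continuous_on_poly_fun p)
  from continuous_attains_inf[OF compact_sphere sphere_ne this]
  obtain v where v: "v \<in> sphere 0 1"
    "\<And>w. w \<in> sphere 0 1 \<Longrightarrow> - sph_lap p v + V v * p v \<le> - sph_lap p w + V w * p w"
    by blast
  define \<beta> where "\<beta> = - sph_lap p v + V v * p v"
  have b: "\<beta> > 0" "\<And>w. norm w = 1 \<Longrightarrow> \<beta> \<le> - sph_lap p w + V w * p w"
    using v p(3)[of v] by (auto simp: \<beta>_def)
  obtain m where m: "m \<in> sphere 0 1" "\<And>w. w \<in> sphere 0 1 \<Longrightarrow> p w \<le> p m"
    using continuous_attains_sup[OF compact_sphere sphere_ne continuous_on_poly_fun(1)[OF p(1)]] by metis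
  define B where "B = p m / \<beta>"
  have B: "B > 0" using b(1) m(1) p(2)[of m] by (simp add: B_def)
  obtain x where x: "x \<in> sphere 0 1" "\<And>w. w \<in> sphere 0 1 \<Longrightarrow> V w \<le> V x"
    using continuous_attains_sup[OF compact_sphere sphere_ne V] by metis
  define c where "c = max 1 (V x)"
  have c: "c > 0" "\<And>w. norm w = 1 \<Longrightarrow> V w \<le> c" using x(2) by (simp_all add: c_def le_max_iff_disj)
  obtain y where y: "y \<in> sphere 0 1" "\<And>w. w \<in> sphere 0 1 \<Longrightarrow> V y \<le> V w"
    using continuous_attains_inf[OF compact_sphere sphere_ne V] by metis
  obtain N :: nat where N: "2 * B * (c - V y) + 1 < real N" using reals_Archimedean2 by blast
  have "0 \<le> 2 * B * (c - V y)" using B c(2)[of y] y(1) by simp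
  then have N0: "N > 0" using N by (auto intro!: Nat.gr0I)
  define h where "h = (\<lambda>w. (c - V w) / real N)"
  have hc: "continuous_on (sphere 0 1) h" unfolding h_def by (intro continuous_intros V) (use N0 in auto)
  have h0: "0 \<le> h w" if "norm w = 1" for w using c(2)[OF that] by (simp add: h_def)
  have hb: "\<bar>h w\<bar> \<le> 1 / (2 * B)" if w: "norm w = 1" for w
  proof -
    have "2 * B * (c - V w) \<le> 2 * B * (c - V y)" using y(2)[of w] w B by (intro mult_left_mono) auto
    then have "(c - V w) * (2 * B) \<le> 1 * real N" using N by (simp add: mult_ac)
    then have "h w \<le> 1 / (2 * B)" using N0 B by (simp add: h_def divide_simps mult_ac)
    then show ?thesis using h0[OF w] by simp
  qed
  have "dense_range (\<lambda>w. c - real k * h w)" if "k \<le> N" for k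
    using that
  proof (induction k)
    case 0
    show ?case using dense_range_const[OF c(1) n] by simp
  next
    case (Suc k)
    have Vk: "V w \<le> c - real k * h w" if "norm w = 1" for w
    proof -
      have "real k * h w \<le> real N * h w" using h0[OF that] Suc.prems by (intro mult_right_mono) auto
      then show ?thesis using N0 by (simp add: h_def)
    qed
    have "dense_range (\<lambda>w. (c - real k * h w) - h w)"
    proof (rule dense_range_step[OF _ hc hb _ B])
      show "dense_range (\<lambda>w. c - real k * h w)" using Suc by simp
      show "continuous_on (sphere 0 1) (\<lambda>w. c - real k * h w)" by (intro continuous_intros hc)
      show "\<bar>q w\<bar> \<le> B * K" if "poly_fun q"
        "\<And>w. norm w = 1 \<Longrightarrow> \<bar>- sph_lap q w + (c - real k * h w) * q w\<bar> \<le> K" "norm w = 1" for q K w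
        unfolding B_def
      proof (rule sph_supersolution_bound[OF p(1,2) _ _ b(1) that])
        show "\<beta> \<le> - sph_lap p w + (c - real k * h w) * p w" if "norm w = 1" for w
          using b(2)[OF that] mult_right_mono[OF Vk[OF that], of "p w"] p(2)[OF that] by linarith
        show "p w \<le> p m" if "norm w = 1" for w using m(2) that by simp
      qed
    qed
    then show ?case by (simp add: algebra_simps)
  qed
  from this[of N] have "dense_range (\<lambda>w. c - real N * h w)" by simp
  then show ?thesis using N0 by (simp add: h_def)
qed

text \<open>\<open>\<Lambda>\<close> is the principal eigenvalue of \<open>- \<Delta>\<^sub>S + V\<close> in the form of Barta's supremum. Approximate
  solutions \<open>q\<close> of \<open>(- \<Delta>\<^sub>S + V - l) q = 1\<close> blow up as \<open>l\<close> increases to \<open>\<Lambda>\<close>, and by Harnack's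
  inequality they do so uniformly; after normalisation the right-hand side becomes negligible.\<close>

theorem sph_principal_eigenvalue:
  fixes V :: "'a::euclidean_space \<Rightarrow> real"
  assumes n: "DIM('a) \<ge> 2" and V: "continuous_on (sphere 0 1) V"
  obtains \<Lambda> where "\<And>e. e > 0 \<Longrightarrow> \<exists>p. poly_fun p \<and>
    (\<forall>w. norm w = 1 \<longrightarrow> 0 < p w \<and> \<bar>- sph_lap p w + (V w - \<Lambda>) * p w\<bar> \<le> e * p w)"
proof -
  define L where "L = {l. \<exists>p. poly_fun p \<and> (\<forall>w. norm w = 1 \<longrightarrow> 0 < p w \<and> 0 < - sph_lap p w + (V w - l) * p w)}"
  obtain x where x: "x \<in> sphere 0 1" "\<And>w. w \<in> sphere 0 1 \<Longrightarrow> V w \<le> V x"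
    using continuous_attains_sup[OF compact_sphere sphere_ne V] by metis
  obtain y where y: "y \<in> sphere 0 1" "\<And>w. w \<in> sphere 0 1 \<Longrightarrow> V y \<le> V w"
    using continuous_attains_inf[OF compact_sphere sphere_ne V] by metis
  have Lub: "l \<le> V x" if lL: "l \<in> L" for l
  proof (rule ccontr)
    assume l: "\<not> l \<le> V x"
    obtain p where p: "poly_fun p" "\<And>w. norm w = 1 \<Longrightarrow> 0 < p w" "\<And>w. norm w = 1 \<Longrightarrow> 0 < - sph_lap p w + (V w - l) * p w"
      using lL by (auto simp: L_def)
    obtain m where m: "m \<in> sphere 0 1" "\<And>w. w \<in> sphere 0 1 \<Longrightarrow> p m \<le> p w"
      using continuous_attains_inf[OF compact_sphere sphere_ne continuous_on_poly_fun(1)[OF p(1)]] by metis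
    have "sph_lap p m \<ge> 0" using m by (intro sph_lap_nonneg_at_min p) auto
    moreover have "(V m - l) * p m < 0" using x(2)[OF m(1)] l p(2)[of m] m(1) by (intro mult_neg_pos) auto
    ultimately show False using p(3)[of m] m(1) by simp
  qed
  have "V y - 1 < V w" if "norm w = 1" for w using y(2)[of w] that by simp
  then have "V y - 1 \<in> L"
    by (auto simp: L_def sph_lap_const poly_fun_const intro!: exI[of _ "\<lambda>_. 1"])
  then have Lne: "L \<noteq> {}" by blast
  have bdd: "bdd_above L" using Lub by (auto simp: bdd_above_def)
  define \<Lambda> where "\<Lambda> = Sup L"
  \<comment> \<open>|V - \<Lambda>| is at most C - 2 and later |V - l| at most C - 1; the last unit
    is room for the constant added to \<open>v\<close> before Harnack's inequality is
    applied.\<close>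
  define C where "C = \<bar>V x - \<Lambda>\<bar> + \<bar>V y - \<Lambda>\<bar> + 2"
  have VL: "\<bar>V w - \<Lambda>\<bar> \<le> C - 2" if "norm w = 1" for w
    using x(2)[of w] y(2)[of w] that unfolding C_def by simp
  have C: "C \<ge> 0" by (simp add: C_def)
  obtain H where H: "H > 0" "\<And>(p::'a \<Rightarrow> real) x y. poly_fun p \<Longrightarrow>
    (\<And>w. norm w = 1 \<Longrightarrow> 0 < p w \<and> \<bar>sph_lap p w\<bar> \<le> C * p w) \<Longrightarrow> norm x = 1 \<Longrightarrow> norm y = 1 \<Longrightarrow> p x \<le> H * p y"
    using harnack_sphere[OF n C] by blast
  show thesis
  proof (rule that[of \<Lambda>])
    fix e :: real assume e: "e > 0"
    \<comment> \<open>The three bounds serve |V - l| \<le> C - 1, the absorption of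
      \<open>H * (3 * k)\<close> into 1/2, and the final error
      \<open>k * (6 * H + 1) \<le> e\<close>.\<close>
    define k where "k = Min {1/3, 1 / (6*H), e / (6 * H + 1)}"
    have k: "0 < k" "k \<le> 1/3" "k \<le> 1 / (6*H)" "k \<le> e / (6 * H + 1)"
      unfolding k_def using H(1) e by (simp add: add_pos_pos, simp_all only: min.cobounded1 min.cobounded2 Min_le finite.intros insert_iff simp_thms)
    have "\<Lambda> - k < Sup L" using k by (simp add: \<Lambda>_def)
    then obtain l where l: "l \<in> L" "\<Lambda> - k < l" using less_cSup_iff[OF Lne bdd] by blast
    obtain p where p: "poly_fun p" "\<And>w. norm w = 1 \<Longrightarrow> 0 < p w" "\<And>w. norm w = 1 \<Longrightarrow> 0 < - sph_lap p w + (V w - l) * p w"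
      using l(1) by (auto simp: L_def)
    have "dense_range (\<lambda>w. V w - l)"
      by (rule dense_range_supersolution[OF n _ p]) (intro continuous_intros V)
    then obtain q where q: "poly_fun q" "\<And>w. norm w = 1 \<Longrightarrow> \<bar>- sph_lap q w + (V w - l) * q w - 1\<bar> \<le> 1/4"
      unfolding dense_range_def using continuous_on_const[of "sphere 0 1" "1::real"]
      by (metis zero_less_divide_1_iff zero_less_numeral)
    have q34: "3/4 \<le> - sph_lap q w + (V w - l) * q w" if "norm w = 1" for w using q(2)[OF that] by linarith
    have qn: "q w \<ge> 0" if "norm w = 1" for w
    proof (rule sph_supersolution_nonneg[OF p q(1) _ that])
      show "0 \<le> - sph_lap q w + (V w - l) * q w" if "norm w = 1" for w using q34[OF that] by linarith
    qed
    have qp: "q w > 0" if w: "norm w = 1" for w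
    proof (rule ccontr)
      assume "\<not> q w > 0"
      then have "q w = 0" using qn[OF w] by simp
      then have "sph_lap q w \<ge> 0" using qn by (intro sph_lap_nonneg_at_min q w) auto
      then show False using q34[OF w] \<open>q w = 0\<close> by simp
    qed
    obtain m where m: "m \<in> sphere 0 1" "\<And>w. w \<in> sphere 0 1 \<Longrightarrow> q w \<le> q m"
      using continuous_attains_sup[OF compact_sphere sphere_ne continuous_on_poly_fun(1)[OF q(1)]] by metis
    have nm: "norm m = 1" using m by simp
    \<comment> \<open>\<open>q\<close> itself is a supersolution at this larger parameter: at most
      1/2 is subtracted from at least 3/4. As \<Lambda> is the supremum, the maximum of q is at
      least 1 / (2 (\<Lambda> - l)), which is the blow-up.\<close>
    have "l + 1 / (2 * q m) \<in> L"
    proof -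
      have "0 < - sph_lap q w + (V w - (l + 1 / (2 * q m))) * q w" if w: "norm w = 1" for w
      proof -
        have "1 / (2 * q m) * q w \<le> 1/2" using m(2)[of w] w qp[OF nm] by (simp add: field_simps)
        then show ?thesis using q34[OF w] by (simp add: algebra_simps)
      qed
      then show ?thesis using q(1) qp by (auto simp: L_def)
    qed
    then have "l + 1 / (2 * q m) \<le> \<Lambda>" unfolding \<Lambda>_def by (rule cSup_upper[OF _ bdd])
    then have qm: "1 / q m \<le> 2 * (\<Lambda> - l)" using qp[OF nm] by (simp add: field_simps)
    have lL: "0 < \<Lambda> - l" "\<Lambda> - l < k"
      using \<open>l + 1 / (2 * q m) \<le> \<Lambda>\<close> qp[OF nm] l(2) by (auto simp: less_le_trans) (smt (verit) divide_pos_pos)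
    define v where "v = (\<lambda>w. (1 / q m) * q w)"
    have v: "poly_fun v" "v m = 1" "\<And>w. norm w = 1 \<Longrightarrow> 0 < v w"
      using poly_fun_cmult[OF q(1), of "1 / q m"] qp[OF nm] qp by (simp_all add: v_def)
    have vle: "\<bar>- sph_lap v w + (V w - l) * v w\<bar> \<le> 3 * k" if w: "norm w = 1" for w
    proof -
      have "- sph_lap v w + (V w - l) * v w = (1 / q m) * (- sph_lap q w + (V w - l) * q w)"
        unfolding v_def sph_lap_cmult[OF q(1) w] by (simp add: algebra_simps diff_divide_distrib)
      then have "\<bar>- sph_lap v w + (V w - l) * v w\<bar> = (1 / q m) * \<bar>- sph_lap q w + (V w - l) * q w\<bar>"
        using qp[OF nm] by (simp add: abs_mult)
      also have "\<dots> \<le> (2 * k) * (5/4)"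
      proof (intro mult_mono)
        show "\<bar>- sph_lap q w + (V w - l) * q w\<bar> \<le> 5/4" using q(2)[OF w] by linarith
        show "1 / q m \<le> 2 * k" by (rule order_trans[OF qm]) (use lL(2) in simp)
      qed (use k(1) in auto)
      finally show ?thesis using k(1) by simp
    qed
    have Vl: "\<bar>V w - l\<bar> \<le> C - 1" if "norm w = 1" for w using VL[OF that] lL k by linarith
    \<comment> \<open>\<open>v\<close> solves its equation only up to \<open>3 * k\<close>, so its
      spherical Laplacian need not be bounded by a multiple of \<open>v\<close>. It is bounded by a
      multiple of \<open>v + 3 * k\<close>.\<close>
    define u where "u = (\<lambda>w. v w + 3 * k)"
    have u: "poly_fun u" unfolding u_def by (intro poly_fun.add v poly_fun_const)
    have uH: "u m \<le> H * u w" if w: "norm w = 1" for w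
    proof (rule H(2)[OF u _ nm w])
      fix w :: 'a assume w: "norm w = 1"
      have "\<bar>(V w - l) * v w\<bar> \<le> (C - 1) * v w"
        using Vl[OF w] v(3)[OF w] by (simp add: abs_mult)
      then have "\<bar>sph_lap v w\<bar> \<le> (C - 1) * v w + 3 * k" using vle[OF w] by linarith
      also have "\<dots> \<le> C * u w"
      proof -
        have "0 \<le> C * (3 * k) - 3 * k" using C_def k(1) by (simp add: algebra_simps)
        then show ?thesis using v(3)[OF w] by (simp add: u_def algebra_simps)
      qed
      finally have "\<bar>sph_lap v w\<bar> \<le> C * u w" .
      moreover have "sph_lap u w = sph_lap v w"
        unfolding u_def using sph_lap_add[OF v(1) poly_fun_const w] by (simp add: sph_lap_const)
      ultimately show "0 < u w \<and> \<bar>sph_lap u w\<bar> \<le> C * u w" using v(3)[OF w] k(1) by (simp add: u_def)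
    qed
    have vH: "1 \<le> 2 * H * v w" if w: "norm w = 1" for w
    proof -
      have "1 \<le> H * (v w + 3 * k)" using uH[OF w] v(2) k(1) by (simp add: u_def)
      moreover have "H * (3 * k) \<le> 1/2" using k(3) H(1) by (simp add: field_simps)
      ultimately show ?thesis by (simp add: algebra_simps)
    qed
    have "\<bar>- sph_lap v w + (V w - \<Lambda>) * v w\<bar> \<le> e * v w" if w: "norm w = 1" for w
    proof -
      have "- sph_lap v w + (V w - \<Lambda>) * v w = (- sph_lap v w + (V w - l) * v w) - (\<Lambda> - l) * v w"
        by (simp add: algebra_simps)
      moreover have "\<bar>(\<Lambda> - l) * v w\<bar> \<le> k * v w" using lL v(3)[OF w] by (simp add: abs_mult)
      ultimately have "\<bar>- sph_lap v w + (V w - \<Lambda>) * v w\<bar> \<le> 3 * k * 1 + k * v w" using vle[OF w] by linarith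
      also have "\<dots> \<le> 3 * k * (2 * H * v w) + k * v w"
        using vH[OF w] k(1) by (intro add_mono mult_left_mono) auto
      also have "\<dots> = k * (6 * H + 1) * v w" by (simp add: algebra_simps)
      also have "\<dots> \<le> e * v w"
        using k(4) H(1) v(3)[OF w] by (intro mult_right_mono) (auto simp: pos_le_divide_eq add_pos_pos)
      finally show ?thesis .
    qed
    then show "\<exists>p. poly_fun p \<and> (\<forall>w. norm w = 1 \<longrightarrow> 0 < p w \<and> \<bar>- sph_lap p w + (V w - \<Lambda>) * p w\<bar> \<le> e * p w)"
      using v by blast
  qed
qed

text \<open>Up to the dimension as a factor, this is the integral for the surface measure.\<close>

section \<open>Integration over the sphere\<close>

definition sint :: "('a::euclidean_space \<Rightarrow> real) \<Rightarrow> real" where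
  "sint f = (\<integral>x. indicator (ball 0 1) x * f (sgn x) \<partial>lborel)"

lemma borel_measurable_sgn [measurable]: "(sgn :: 'a::euclidean_space \<Rightarrow> 'a) \<in> borel_measurable borel"
proof -
  have "continuous_on (- {0::'a}) sgn" unfolding sgn_div_norm by (auto intro!: continuous_intros)
  then have "(\<lambda>x::'a. if x \<in> -{0} then sgn x else 0) \<in> borel_measurable borel"
    by (intro borel_measurable_continuous_on_if continuous_on_const) auto
  moreover have "(\<lambda>x::'a. if x \<in> -{0} then sgn x else 0) = sgn" by auto
  ultimately show ?thesis by metis
qed

lemma sgn_continuous: "continuous_on (- {0::'a::euclidean_space}) sgn"
  unfolding sgn_div_norm by (auto intro!: continuous_intros)

lemma sphere_fun_measurable:
  fixes f :: "'a::euclidean_space \<Rightarrow> real"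
  assumes "continuous_on (sphere 0 1) f"
  shows "(\<lambda>x. f (sgn x)) \<in> borel_measurable borel"
proof -
  have "continuous_on (- {0}) (\<lambda>x. f (sgn x))"
    by (rule continuous_on_compose2[OF assms sgn_continuous]) (auto simp: norm_sgn split: if_splits)
  then have "(\<lambda>x. if x \<in> -{0} then f (sgn x) else f 0) \<in> borel_measurable borel"
    by (intro borel_measurable_continuous_on_if continuous_on_const) auto
  moreover have "(\<lambda>x. if x \<in> -{0} then f (sgn x) else f 0) = (\<lambda>x. f (sgn x))" by (auto simp: fun_eq_iff)
  ultimately show ?thesis by metis
qed

lemma sphere_fun_bounded:
  fixes f :: "'a::euclidean_space \<Rightarrow> real"
  assumes "continuous_on (sphere 0 1) f"
  obtains M where "M \<ge> 0" "\<And>x. \<bar>f (sgn x)\<bar> \<le> M"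
proof -
  obtain B where B: "\<And>w. norm w = 1 \<Longrightarrow> \<bar>f w\<bar> \<le> B"
    using compact_imp_bounded[OF compact_continuous_image[OF assms compact_sphere]]
    unfolding bounded_iff by (metis image_eqI mem_sphere_0 real_norm_def)
  have "\<bar>f (sgn x)\<bar> \<le> \<bar>B\<bar> + \<bar>f 0\<bar>" for x
    using B[of "sgn x"] norm_sgn_eq_1[of x] by (cases "x = 0") auto
  then show thesis using that[of "\<bar>B\<bar> + \<bar>f 0\<bar>"] by simp
qed

lemma integrable_bounded_mult:
  fixes f g :: "'a::euclidean_space \<Rightarrow> real"
  assumes "integrable lborel g" "f \<in> borel_measurable borel" "\<And>x. \<bar>f x\<bar> \<le> M"
  shows "integrable lborel (\<lambda>x. g x * f x)"
proof (rule Bochner_Integration.integrable_bound[of _ "\<lambda>x. M * g x"])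
  have [measurable]: "g \<in> borel_measurable borel" using assms(1) by (simp add: borel_measurable_integrable)
  note assms(2)[measurable]
  show "(\<lambda>x. g x * f x) \<in> borel_measurable lborel" by simp
  show "integrable lborel (\<lambda>x. M * g x)" using assms(1) by simp
  have "\<bar>g x\<bar> * \<bar>f x\<bar> \<le> \<bar>M\<bar> * \<bar>g x\<bar>" for x
    using mult_left_mono[OF order_trans[OF assms(3)[of x] abs_ge_self] abs_ge_zero[of "g x"]]
    by (simp add: mult.commute)
  then show "AE x in lborel. norm (g x * f x) \<le> norm (M * g x)" by (simp add: abs_mult)
qed

lemma integrable_ball_indicator: "integrable lborel (indicator (ball (0::'a::euclidean_space) r) :: 'a \<Rightarrow> real)"
  by (rule integrable_real_indicator) (use emeasure_lborel_ball_finite[of "0::'a" r] in auto)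

lemma sint_integrable:
  fixes f :: "'a::euclidean_space \<Rightarrow> real"
  assumes "continuous_on (sphere 0 1) f"
  shows "integrable lborel (\<lambda>x. indicator (ball 0 1) x * f (sgn x))"
proof -
  obtain M where "\<And>x. \<bar>f (sgn x)\<bar> \<le> M" using sphere_fun_bounded[OF assms] by blast
  from integrable_bounded_mult[OF integrable_ball_indicator sphere_fun_measurable[OF assms] this]
  show ?thesis .
qed

lemma sint_add:
  assumes "continuous_on (sphere 0 1) f" "continuous_on (sphere 0 1) g"
  shows "sint (\<lambda>w. f w + g w) = sint f + sint g"
  using sint_integrable[OF assms(1)] sint_integrable[OF assms(2)] by (simp add: sint_def distrib_left)

lemma sint_cmult: "sint (\<lambda>w. c * f w) = c * sint f"
  by (simp add: sint_def mult.left_commute)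

lemma sint_diff:
  assumes "continuous_on (sphere 0 1) f" "continuous_on (sphere 0 1) g"
  shows "sint (\<lambda>w. f w - g w) = sint f - sint g"
  using sint_integrable[OF assms(1)] sint_integrable[OF assms(2)] by (simp add: sint_def right_diff_distrib)

lemma AE_nonzero: "AE x in lborel. x \<noteq> (0::'a::euclidean_space)"
  by (rule AE_lborel_singleton)

lemma sint_mono:
  assumes "continuous_on (sphere 0 1) f" "continuous_on (sphere 0 1) g"
    "\<And>w. norm w = 1 \<Longrightarrow> f w \<le> g w"
  shows "sint f \<le> sint (g :: 'a::euclidean_space \<Rightarrow> real)"
  unfolding sint_def
proof (rule integral_mono_AE[OF sint_integrable[OF assms(1)] sint_integrable[OF assms(2)]])
  show "AE x in lborel. indicator (ball 0 1) x * f (sgn x) \<le> indicator (ball 0 1) x * g (sgn x)"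
    using AE_nonzero by eventually_elim (auto intro!: mult_left_mono assms(3) norm_sgn_eq_1)
qed

lemma sint_cong:
  assumes "\<And>w. norm w = 1 \<Longrightarrow> f w = g w"
    "continuous_on (sphere 0 1) f"
  shows "sint f = sint (g :: 'a::euclidean_space \<Rightarrow> real)"
proof -
  have "continuous_on (sphere 0 1) g"
    using assms continuous_on_cong[of "sphere 0 1" "sphere 0 1" f g] by auto
  then show ?thesis using sint_mono[of f g] sint_mono[of g f] assms by force
qed

lemma sint_pos:
  assumes f: "continuous_on (sphere 0 1) f" "\<And>w. norm w = 1 \<Longrightarrow> 0 \<le> f w"
    and w: "norm w = 1" "f w > 0"
  shows "sint (f :: 'a::euclidean_space \<Rightarrow> real) > 0"
proof -
  let ?g = "\<lambda>x. indicator (ball 0 1) x * f (sgn x)"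
  have nn: "AE x in lborel. 0 \<le> ?g x"
    using AE_nonzero by eventually_elim (auto simp: f(2) norm_sgn_eq_1)
  have "sint f \<ge> 0" unfolding sint_def by (rule integral_nonneg_AE[OF nn])
  moreover have "sint f \<noteq> 0"
  proof
    assume "sint f = 0"
    then have ae: "AE x in lborel. ?g x = 0"
      using integral_nonneg_eq_0_iff_AE[OF sint_integrable[OF f(1)] nn] by (simp add: sint_def)
    have "continuous_on (- {0}) (\<lambda>x. f (sgn x))"
      by (rule continuous_on_compose2[OF f(1) sgn_continuous]) (auto simp: norm_sgn split: if_splits)
    then have "open ((- {0}) \<inter> (\<lambda>x. f (sgn x)) -` {0<..})"
      by (intro continuous_open_preimage) auto
    then have o: "open (ball 0 1 \<inter> ((- {0}) \<inter> (\<lambda>x. f (sgn x)) -` {0<..}))"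
      by (rule open_Int[OF open_ball])
    have "AE x in lborel. x \<notin> ball 0 1 \<inter> ((- {0}) \<inter> (\<lambda>x. f (sgn x)) -` {0<..})"
      using ae by eventually_elim auto
    from AE_notin_open[OF o this] have "(1/2) *\<^sub>R w \<notin> ball 0 1 \<inter> ((- {0}) \<inter> (\<lambda>x. f (sgn x)) -` {0<..})"
      by blast
    moreover have "sgn ((1/2) *\<^sub>R w) = w" using w by (simp add: sgn_div_norm)
    ultimately show False using w by auto
  qed
  ultimately show ?thesis by simp
qed

section \<open>Polar coordinates\<close>

lemma nn_integral_lborel_scale:
  fixes h :: "'a::euclidean_space \<Rightarrow> ennreal"
  assumes [measurable]: "h \<in> borel_measurable borel" and "r > 0"
  shows "(\<integral>\<^sup>+x. h x \<partial>lborel) = ennreal (r ^ DIM('a)) * (\<integral>\<^sup>+x. h (r *\<^sub>R x) \<partial>lborel)"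
  using assms(2) by (subst lborel_affine[of r 0])
    (simp_all add: nn_integral_density nn_integral_distr nn_integral_cmult)

lemma nn_integral_sgn_ball:
  fixes f :: "'a::euclidean_space \<Rightarrow> real"
  assumes fm: "(\<lambda>x. f (sgn x)) \<in> borel_measurable borel" and r: "r > 0"
  shows "(\<integral>\<^sup>+x. ennreal (indicator (ball 0 r) x * f (sgn x)) \<partial>lborel) =
    ennreal (r ^ DIM('a)) * (\<integral>\<^sup>+x. ennreal (indicator (ball 0 1) x * f (sgn x)) \<partial>lborel)"
proof -
  define g where "g = (\<lambda>x. f (sgn x))"
  have [measurable]: "g \<in> borel_measurable borel" using fm by (simp add: g_def)
  have "indicator (ball 0 r) (r *\<^sub>R x) = (indicator (ball 0 1) x :: real)" for x :: 'a
    using r by (auto simp: indicator_def dist_norm)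
  moreover have "g (r *\<^sub>R x) = g x" for x using r by (simp add: g_def sgn_scaleR)
  moreover have hm: "(\<lambda>x. ennreal (indicator (ball 0 r) x * g x)) \<in> borel_measurable borel"
    by (intro measurable_compose[OF _ measurable_ennreal] borel_measurable_times
        borel_measurable_indicator) auto
  ultimately have "(\<integral>\<^sup>+x. ennreal (indicator (ball 0 r) x * g x) \<partial>lborel) =
    ennreal (r ^ DIM('a)) * (\<integral>\<^sup>+x. ennreal (indicator (ball 0 1) x * g x) \<partial>lborel)"
    using nn_integral_lborel_scale[OF hm r] by simp
  then show ?thesis by (simp add: g_def)
qed

text \<open>The two measures on the line agree if they do so on half-lines; the minus sign makes the
  preimage of \<open>{t<..}\<close> a ball of radius - t, of finite measure. Integrals over balls
  scale by r^n with or without the factor f(sgn x), so both sides are r^n times the volume of the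
  unit ball times \<open>sint f\<close>.\<close>

lemma polar_measure_eq:
  fixes f :: "'a::euclidean_space \<Rightarrow> real"
  assumes fm[measurable]: "(\<lambda>x. f (sgn x)) \<in> borel_measurable borel"
    and f0: "\<And>x. 0 \<le> f (sgn x)" and fM: "\<And>x. f (sgn x) \<le> M"
  shows "density (distr (density lborel (\<lambda>x. ennreal (f (sgn x)))) borel (\<lambda>x::'a. - norm x))
      (\<lambda>_. ennreal (measure lborel (ball (0::'a) 1)))
    = density (distr lborel borel (\<lambda>x::'a. - norm x)) (\<lambda>_. ennreal (sint f))"
    (is "?M1 = ?M0")
proof (rule measure_eqI_lessThan)
  define v where "v = measure lborel (ball (0::'a) 1)"
  have v: "ennreal v = emeasure lborel (ball (0::'a) 1)"
    unfolding v_def by (rule emeasure_eq_ennreal_measure[symmetric]) (use emeasure_lborel_ball_finite[of "0::'a" 1] in auto)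
  have abs: "\<bar>f (sgn x)\<bar> \<le> M" for x using f0[of x] fM[of x] by simp
  have i: "integrable lborel (\<lambda>x. indicator (ball 0 1) x * f (sgn x))"
    by (rule integrable_bounded_mult[OF integrable_ball_indicator fm abs])
  have s: "(\<integral>\<^sup>+x. ennreal (indicator (ball 0 1) x * f (sgn x)) \<partial>lborel) = ennreal (sint f)"
    unfolding sint_def by (rule nn_integral_eq_integral[OF i]) (simp add: f0)
  have 1: "emeasure ?M1 {t<..} = ennreal v * (\<integral>\<^sup>+x. ennreal (indicator (ball 0 (-t)) x * f (sgn x)) \<partial>lborel)" for t
  proof -
    have "emeasure (density lborel (\<lambda>x. ennreal (f (sgn x)))) {x::'a. t < - norm x}
      = (\<integral>\<^sup>+x. ennreal (indicator (ball 0 (-t)) x * f (sgn x)) \<partial>lborel)"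
      by (subst emeasure_density) (auto intro!: nn_integral_cong simp: indicator_def)
    then show ?thesis
      by (subst emeasure_density_const) (simp_all add: emeasure_distr v_def vimage_def)
  qed
  have 0: "emeasure ?M0 {t<..} = ennreal (sint f) * (\<integral>\<^sup>+x. ennreal (indicator (ball (0::'a) (-t)) x * 1) \<partial>lborel)" for t
  proof -
    have "emeasure lborel {x::'a. t < - norm x} = (\<integral>\<^sup>+x. ennreal (indicator (ball (0::'a) (-t)) x * 1) \<partial>lborel)"
    proof -
      have "{x::'a. t < - norm x} = ball 0 (-t)" by auto
      then show ?thesis by (simp add: ennreal_indicator)
    qed
    then show ?thesis
      by (subst emeasure_density_const) (simp_all add: emeasure_distr vimage_def)
  qed
  have ball1: "(\<integral>\<^sup>+x. ennreal (indicator (ball (0::'a) 1) x * 1) \<partial>lborel) = ennreal v"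
    unfolding v by (simp add: ennreal_indicator)
  show "emeasure ?M1 {t<..} = emeasure ?M0 {t<..}" for t
  proof (cases "t < 0")
    case True
    then have r: "- t > 0" by simp
    have [measurable]: "(\<lambda>x::'a. (1::real)) \<in> borel_measurable borel" by simp
    show ?thesis
      unfolding 0 1 nn_integral_sgn_ball[OF fm r] s nn_integral_sgn_ball[of "\<lambda>_::'a. 1", OF _ r, simplified] 
      using nn_integral_sgn_ball[of "\<lambda>_::'a. 1", OF _ r] ball1 by (simp add: mult_ac)
  next
    case False
    then have e: "ball (0::'a) (-t) = {}" by simp
    show ?thesis unfolding 0 1 e by simp
  qed
  show "emeasure ?M1 {t<..} < \<infinity>" for t
  proof (cases "t < 0")
    case True
    then show ?thesis unfolding 1 using nn_integral_sgn_ball[OF fm, of "-t"] s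
      by (simp add: ennreal_mult_less_top)
  next
    case False
    then have e: "ball (0::'a) (-t) = {}" by simp
    show ?thesis unfolding 1 e by simp
  qed
qed simp_all

lemma polar_factor_nonneg:
  fixes f :: "'a::euclidean_space \<Rightarrow> real"
  assumes fm[measurable]: "(\<lambda>x. f (sgn x)) \<in> borel_measurable borel"
    and f0: "\<And>x. 0 \<le> f (sgn x)" and fM: "\<And>x. f (sgn x) \<le> M"
    and G[measurable]: "G \<in> borel_measurable borel"
  shows "measure lborel (ball (0::'a) 1) * (\<integral>x. G (norm x) * f (sgn x) \<partial>lborel) =
    sint f * (\<integral>x. G (norm (x::'a)) \<partial>lborel)"
proof -
  have "(\<integral>t. G (- t) \<partial>(density (distr (density lborel (\<lambda>x. ennreal (f (sgn x)))) borel (\<lambda>x::'a. - norm x))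
      (\<lambda>_. ennreal (measure lborel (ball (0::'a) 1)))))
    = measure lborel (ball (0::'a) 1) * (\<integral>x. G (norm x) * f (sgn x) \<partial>lborel)"
    by (subst integral_density) (simp_all add: integral_distr integral_density f0 mult.commute)
  moreover have "sint f \<ge> 0" unfolding sint_def using f0 by (intro integral_nonneg_AE) simp
  then have "(\<integral>t. G (- t) \<partial>(density (distr lborel borel (\<lambda>x::'a. - norm x)) (\<lambda>_. ennreal (sint f))))
    = sint f * (\<integral>x. G (norm (x::'a)) \<partial>lborel)"
    by (subst integral_density) (simp_all add: integral_distr)
  ultimately show ?thesis using polar_measure_eq[OF fm f0 fM] by simp
qed

text \<open>The difference of the formulas of \<open>polar_factor_nonneg\<close> for the nonnegative
  function f + M and for the constant M.\<close>

theorem polar_factor: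
  fixes f :: "'a::euclidean_space \<Rightarrow> real"
  assumes f: "continuous_on (sphere 0 1) f"
    and G: "integrable lborel (\<lambda>x::'a. G (norm x))" and Gm: "G \<in> borel_measurable borel"
  shows "integrable lborel (\<lambda>x. G (norm x) * f (sgn x))"
    "measure lborel (ball (0::'a) 1) * (\<integral>x. G (norm x) * f (sgn x) \<partial>lborel) =
    sint f * (\<integral>x. G (norm (x::'a)) \<partial>lborel)"
proof -
  note fm = sphere_fun_measurable[OF f]
  obtain M where M: "M \<ge> 0" "\<And>x. \<bar>f (sgn x)\<bar> \<le> M" using sphere_fun_bounded[OF f] by blast
  show i: "integrable lborel (\<lambda>x. G (norm x) * f (sgn x))"
    by (rule integrable_bounded_mult[OF G fm M(2)])
  have fM: "continuous_on (sphere 0 1) (\<lambda>w. f w + M)" by (intro continuous_intros f)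
  let ?v = "measure lborel (ball (0::'a) 1)"
  have "?v * (\<integral>x. G (norm x) * (f (sgn x) + M) \<partial>lborel) = sint (\<lambda>w. f w + M) * (\<integral>x. G (norm (x::'a)) \<partial>lborel)"
  proof (rule polar_factor_nonneg[OF sphere_fun_measurable[OF fM] _ _ Gm])
    show "0 \<le> f (sgn x) + M" "f (sgn x) + M \<le> 2 * M" for x using M(2)[of x] by linarith+
  qed
  moreover have "?v * (\<integral>x. G (norm (x::'a)) * M \<partial>lborel) = sint (\<lambda>w::'a. M) * (\<integral>x. G (norm (x::'a)) \<partial>lborel)"
    by (rule polar_factor_nonneg[of "\<lambda>_. M" M]) (use M(1) Gm in auto)
  moreover have "(\<integral>x. G (norm x) * (f (sgn x) + M) \<partial>lborel) =
      (\<integral>x. G (norm x) * f (sgn x) \<partial>lborel) + (\<integral>x. G (norm (x::'a)) * M \<partial>lborel)"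
    using i G by (simp add: distrib_left)
  moreover have "sint (\<lambda>w. f w + M) = sint f + sint (\<lambda>w::'a. M)"
    by (rule sint_add[OF f]) simp
  ultimately have "?v * ((\<integral>x. G (norm x) * f (sgn x) \<partial>lborel) + (\<integral>x. G (norm (x::'a)) * M \<partial>lborel))
      = (sint f + sint (\<lambda>w::'a. M)) * (\<integral>x. G (norm (x::'a)) \<partial>lborel)"
    and "?v * (\<integral>x. G (norm (x::'a)) * M \<partial>lborel) = sint (\<lambda>w::'a. M) * (\<integral>x. G (norm (x::'a)) \<partial>lborel)"
    by metis+
  then show "?v * (\<integral>x. G (norm x) * f (sgn x) \<partial>lborel) = sint f * (\<integral>x. G (norm (x::'a)) \<partial>lborel)"
    unfolding distrib_left distrib_right by linarith
qed

lemma scale_measure_eq_density: "scale_measure c M = density M (\<lambda>_. c)"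
  by (rule measure_eqI) (auto simp: emeasure_density_const)

lemma integral_sphere_measure:
  fixes f :: "'a::euclidean_space \<Rightarrow> real"
  assumes [measurable]: "f \<in> borel_measurable borel"
  shows "(\<integral>w. f w \<partial>sphere_measure) = real DIM('a) * sint f"
proof -
  have "(\<integral>w. f w \<partial>sphere_measure) = (\<integral>w. real DIM('a) * f w \<partial>distr (restrict_space lborel (ball 0 1)) borel (sgn :: 'a \<Rightarrow> 'a))"
    unfolding sphere_measure_def scale_measure_eq_density
    by (simp add: ennreal_of_nat_eq_real_of_nat integral_density)
  also have "\<dots> = real DIM('a) * (\<integral>x. f (sgn x) \<partial>restrict_space lborel (ball 0 1))"
    by (subst integral_distr) (auto intro!: measurable_restrict_space1)
  also have "(\<integral>x. f (sgn x) \<partial>restrict_space lborel (ball 0 1)) = sint f"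
    by (subst integral_restrict_space) (auto simp: sint_def)
  finally show ?thesis .
qed

section \<open>Green's formula and Picone's inequality on the sphere\<close>

lemma integral_pos_open:
  fixes f :: "'a::euclidean_space \<Rightarrow> real"
  assumes i: "integrable lborel f" and nn: "\<And>x. 0 \<le> f x" and o: "open U" "U \<noteq> {}" "\<And>x. x \<in> U \<Longrightarrow> f x > 0"
  shows "(\<integral>x. f x \<partial>lborel) > 0"
proof -
  have "(\<integral>x. f x \<partial>lborel) \<noteq> 0"
  proof
    assume "(\<integral>x. f x \<partial>lborel) = 0"
    then have "AE x in lborel. f x = 0"
      using integral_nonneg_eq_0_iff_AE[OF i] nn by simp
    then have "AE x in lborel. x \<notin> U" by eventually_elim (use o(3) in force)
    then show False using AE_notin_open[OF o(1)] o(2) by blast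
  qed
  moreover have "(\<integral>x. f x \<partial>lborel) \<ge> 0" using nn by (intro integral_nonneg_AE) simp
  ultimately show ?thesis by simp
qed

text \<open>To be taken at s = |x|^2, which is smooth also at the origin: the support is then the
  annulus 1/2 \<le> |x| \<le> 1, where radial extensions are regular.\<close>

definition annulus_wt :: "real \<Rightarrow> real" where
  "annulus_wt s = bump_part 0 (s - 1/4) * bump_part 0 (1 - s)"

lemma Ck_on_annulus_wt: "Ck_on k annulus_wt UNIV"
proof -
  have "Ck_on k (\<lambda>s::real. s - 1/4) UNIV" "Ck_on k (\<lambda>s::real. 1 - s) UNIV"
    by (intro Ck_on_diff Ck_on_const Ck_on_bounded_linear; simp)+
  then show ?thesis unfolding annulus_wt_def[abs_def]
    by (intro Ck_on_mult Ck_on_compose_real[OF open_UNIV _ open_UNIV Ck_on_bump_part]) auto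
qed

lemma annulus_wt_nonneg: "0 \<le> annulus_wt s"
  by (simp add: annulus_wt_def bump_part_nonneg)

lemma annulus_wt_norm_eq_0:
  "x \<notin> cball 0 1 - ball 0 (1/2) \<Longrightarrow> annulus_wt ((norm (x::'a::euclidean_space))\<^sup>2) = 0"
proof -
  assume "x \<notin> cball 0 1 - ball 0 (1/2)"
  then have "norm x < 1/2 \<or> norm x > 1" by auto
  then have "(norm x)\<^sup>2 \<le> (1/2)\<^sup>2 \<or> (norm x)\<^sup>2 \<ge> 1\<^sup>2"
    using power_mono[of "norm x" "1/2" 2] power_mono[of 1 "norm x" 2] by auto
  then show ?thesis by (auto simp: annulus_wt_def bump_part_def power2_eq_square)
qed

lemma compact_annulus: "compact (cball 0 1 - ball (0::'a::euclidean_space) (1/2))"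
  by (intro compact_diff) auto

lemma Ck_on_norm_sq_real: "Ck_on k (\<lambda>x::'a::euclidean_space. (norm x)\<^sup>2) D"
  using Ck_on_dist_sq[of k 0 D] by simp

lemma Ck_on_radial_weight: "Ck_on k (\<lambda>x::'a::euclidean_space. annulus_wt ((norm x)\<^sup>2)) D"
  by (rule Ck_on_subset[OF Ck_on_compose_real[OF open_UNIV Ck_on_norm_sq_real open_UNIV Ck_on_annulus_wt]]) auto

lemma annulus_wt_radial_integral:
  shows "integrable lborel (\<lambda>x::'a::euclidean_space. annulus_wt ((norm x)\<^sup>2) / (norm x)\<^sup>2)"
    "(\<integral>x. annulus_wt ((norm (x::'a))\<^sup>2) / (norm x)\<^sup>2 \<partial>lborel) > 0"
proof -
  let ?K = "cball 0 1 - ball (0::'a) (1/2)"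
  have "Ck_on 0 (\<lambda>x::'a. annulus_wt ((norm x)\<^sup>2) / (norm x)\<^sup>2) (-{0})"
    by (intro Ck_on_divide Ck_on_radial_weight Ck_on_norm_sq_real) auto
  then have "Ck_on 0 (\<lambda>x::'a. annulus_wt ((norm x)\<^sup>2) / (norm x)\<^sup>2) UNIV"
    by (rule Ck_on_extend_zero[OF open_punctured _ compact_annulus]) (use annulus_wt_norm_eq_0 in auto)
  then show i: "integrable lborel (\<lambda>x::'a. annulus_wt ((norm x)\<^sup>2) / (norm x)\<^sup>2)"
    by (intro integrable_compact_support[OF _ compact_annulus]) (use annulus_wt_norm_eq_0 in auto)
  have o: "open {x::'a. 1/2 < norm x \<and> norm x < 1}"
    by (intro open_Collect_conj open_Collect_less continuous_intros)
  obtain v :: 'a where "norm v = 3/4" using vector_choose_size[of "3/4"] by auto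
  then have ne: "{x::'a. 1/2 < norm x \<and> norm x < 1} \<noteq> {}" by (auto intro!: exI[of _ v])
  show "(\<integral>x. annulus_wt ((norm (x::'a))\<^sup>2) / (norm x)\<^sup>2 \<partial>lborel) > 0"
  proof (rule integral_pos_open[OF i _ o ne])
    fix x :: 'a assume "x \<in> {x. 1/2 < norm x \<and> norm x < 1}"
    then have "(1/2)\<^sup>2 < (norm x)\<^sup>2" "(norm x)\<^sup>2 < 1\<^sup>2" "norm x > 0"
      using power_strict_mono[of "1/2" "norm x" 2] power_strict_mono[of "norm x" 1 2] by auto
    then show "0 < annulus_wt ((norm x)\<^sup>2) / (norm x)\<^sup>2"
      by (simp add: annulus_wt_def bump_part_def power2_eq_square)
  qed (simp add: annulus_wt_nonneg)
qed

lemma dd_radial_weight: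
  "dd b (\<lambda>x::'a::euclidean_space. annulus_wt ((norm x)\<^sup>2)) x = 2 * (x \<bullet> b) * dd 1 annulus_wt ((norm x)\<^sup>2)"
  using dd_compose_real[OF C2D(1)[OF Ck_on_norm_sq_real UNIV_I] C2D(1)[OF Ck_on_annulus_wt UNIV_I], where v=b and x=x]
    dd_dist_sq[where b=b and x=0 and y=x] by simp

lemma sgn_scale_inv: "x \<noteq> 0 \<Longrightarrow> (1 / norm x) *\<^sub>R x = sgn (x::'a::euclidean_space)"
  by (simp add: sgn_div_norm divide_inverse)

lemma gradient_radial_ext_sgn:
  fixes f :: "'a::euclidean_space \<Rightarrow> real"
  assumes "x \<noteq> 0" "radial_ext f differentiable (at (sgn x))"
  shows "gradient (radial_ext f) x = (1 / norm x) *\<^sub>R gradient (radial_ext f) (sgn x)"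
  using gradient_radial_ext_scale[of "1 / norm x" f x] assms by (simp add: sgn_scale_inv)

lemma continuous_on_gradient:
  assumes "Ck_on (Suc 0) u D" shows "continuous_on D (gradient u)"
  unfolding gradient_def[abs_def] by (intro continuous_intros C1D(2)[OF assms])

text \<open>The divergence theorem is applied to
  \<open>\<rho>(|x|) q \<nabla>p\<close> with a radial cut-off \<open>\<rho>\<close>, whose gradient is orthogonal to \<open>\<nabla>p\<close>.\<close>

lemma sphere_green:
  fixes p q :: "'a::euclidean_space \<Rightarrow> real"
  assumes p: "Ck_on 2 (radial_ext p) (-{0})" and q: "Ck_on (Suc 0) (radial_ext q) (-{0})"
  shows "sint (\<lambda>w. gradient (radial_ext q) w \<bullet> gradient (radial_ext p) w + radial_ext q w * sph_lap p w) = 0"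
proof -
  let ?P = "radial_ext p" and ?Q = "radial_ext q"
  let ?R = "\<lambda>x::'a. annulus_wt ((norm x)\<^sup>2)"
  let ?K = "cball 0 1 - ball (0::'a) (1/2)"
  define h where "h = (\<lambda>w. gradient ?Q w \<bullet> gradient ?P w + ?Q w * sph_lap p w)"
  have sub: "sphere 0 1 \<subseteq> - {0::'a}" by auto
  have hc: "continuous_on (sphere 0 1) h"
    unfolding h_def sph_lap_def
    by (rule continuous_on_subset[OF _ sub])
      (intro continuous_intros continuous_on_gradient q C2D(6)[OF p] C1D(3)[OF q] continuous_on_laplacian[OF p])
  define f where "f = (\<lambda>b x. ?R x * (?Q x * dd b ?P x))"
  have fC: "Ck_on (Suc 0) (f b) (-{0})" for b
    unfolding f_def by (intro Ck_on_mult Ck_on_radial_weight q C2D(7)[OF p]) auto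
  have f0: "f b x = 0" if "x \<notin> ?K" for b x using annulus_wt_norm_eq_0[OF that] by (simp add: f_def)
  have K: "?K \<subseteq> -{0}" by auto
  note fi = integral_dd_eq_0_compact_support[OF open_punctured fC compact_annulus K f0]
  \<comment> \<open>Both Green terms have degree -2 in x, so they enter through
    \<open>h (sgn x)\<close> and a radial factor. \<open>polar_factor\<close> then splits off
    \<open>sint h\<close> from a positive radial integral.\<close>
  have fd: "(\<Sum>b\<in>Basis. dd b (f b) x) = ?R x / (norm x)\<^sup>2 * h (sgn x)" for x
  proof (cases "x = 0")
    case True
    have "dd b (f b) x = 0" for b
      using frechet_derivative_cong_open[OF open_Compl[OF compact_imp_closed[OF compact_annulus]], of x "f b" "\<lambda>_. 0"] f0 True
      by (simp add: dd_const)
    then show ?thesis using True by simp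
  next
    case False
    then have x: "x \<in> -{0}" and s: "sgn x \<in> -{0}" by (auto simp: sgn_zero_iff)
    have "dd b (f b) x = ?R x * (dd b ?Q x * dd b ?P x + ?Q x * dd b (dd b ?P) x)
        + 2 * dd 1 annulus_wt ((norm x)\<^sup>2) * ?Q x * ((x \<bullet> b) * dd b ?P x)" for b
    proof -
      note d = C2D(1)[OF Ck_on_radial_weight UNIV_I, of x] C1D(1)[OF q x] C2D(2)[OF p x, of b]
      have "(\<lambda>x. ?Q x * dd b ?P x) differentiable (at x)" by (intro derivative_intros d)
      from dd_mult[OF d(1) this, of b] dd_mult[OF d(2,3), of b] show ?thesis
        unfolding f_def by (simp add: dd_radial_weight algebra_simps)
    qed
    then have "(\<Sum>b\<in>Basis. dd b (f b) x) = ?R x * (gradient ?Q x \<bullet> gradient ?P x + ?Q x * laplacian ?P x)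
        + 2 * dd 1 annulus_wt ((norm x)\<^sup>2) * ?Q x * (\<Sum>b\<in>Basis. (x \<bullet> b) * dd b ?P x)"
      by (simp add: sum.distrib gradient_inner_gradient laplacian_eq[OF p x] sum_distrib_left algebra_simps)
    also have "(\<Sum>b\<in>Basis. (x \<bullet> b) * dd b ?P x) = 0"
      using dd_radial_ext_radial[OF C2D(1)[OF p x]] dd_Basis_sum[OF C2D(1)[OF p x], of x] by simp
    also have "gradient ?Q x \<bullet> gradient ?P x = (gradient ?Q (sgn x) \<bullet> gradient ?P (sgn x)) / (norm x)\<^sup>2"
      using gradient_radial_ext_sgn[OF False C1D(1)[OF q s]] gradient_radial_ext_sgn[OF False C2D(1)[OF p s]]
      by (simp add: power2_eq_square)
    also have "laplacian ?P x = laplacian ?P (sgn x) / (norm x)\<^sup>2"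
      using radial_ext_laplacian_sgn[of p "sphere 0 1" x] p x by (simp add: cone_over_sphere open_punctured)
    also have "?Q x = ?Q (sgn x)" using radial_ext_scale[of "1 / norm x" q x] False by (simp add: sgn_scale_inv)
    finally show ?thesis by (simp add: h_def sph_lap_def add_divide_distrib distrib_left)
  qed
  have [measurable]: "annulus_wt \<in> borel_measurable borel"
    using C2D(5)[OF Ck_on_annulus_wt] by (rule borel_measurable_continuous_onI)
  have "0 = (\<Sum>b\<in>Basis. \<integral>x. dd b (f b) x \<partial>lborel)" using fi(2) by simp
  also have "\<dots> = (\<integral>x. (\<Sum>b\<in>Basis. dd b (f b) x) \<partial>lborel)" using fi(1) by simp
  also have "\<dots> = (\<integral>x. ?R x / (norm x)\<^sup>2 * h (sgn x) \<partial>lborel)" unfolding fd ..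
  finally have "sint h * (\<integral>x. ?R x / (norm x)\<^sup>2 \<partial>lborel) = 0"
    using polar_factor(2)[of h "\<lambda>t. annulus_wt (t\<^sup>2) / t\<^sup>2", OF hc annulus_wt_radial_integral(1)] by simp
  then show ?thesis using annulus_wt_radial_integral(2)[where 'a='a] by (simp add: h_def)
qed

lemma sint_gradient_poly:
  fixes p :: "'a::euclidean_space \<Rightarrow> real"
  assumes p: "poly_fun p"
  shows "sint (\<lambda>w. (norm (gradient (radial_ext p) w))\<^sup>2 + p w * sph_lap p w) = 0"
proof -
  have C: "Ck_on 2 (radial_ext p) (-{0})" by (rule poly_fun_Ck[OF p])
  have sub: "sphere 0 1 \<subseteq> - {0::'a}" by auto
  have "continuous_on (sphere 0 1) (\<lambda>w. gradient (radial_ext p) w \<bullet> gradient (radial_ext p) w + radial_ext p w * sph_lap p w)"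
    unfolding sph_lap_def by (rule continuous_on_subset[OF _ sub])
      (intro continuous_intros continuous_on_gradient C2D(6)[OF C] C2D(5)[OF C] continuous_on_laplacian[OF C])
  from sint_cong[OF _ this, of "\<lambda>w. (norm (gradient (radial_ext p) w))\<^sup>2 + p w * sph_lap p w"]
  show ?thesis using sphere_green[OF C C2D(6)[OF C]] by (simp add: radial_ext_unit power2_norm_eq_inner)
qed

text \<open>Differentiating q v = f^2 gives the gradient of q; the difference of the two sides is
  then the squared norm of \<nabla>f - (f / v) \<nabla>v.\<close>

lemma picone_pointwise:
  fixes f v :: "'a::euclidean_space \<Rightarrow> real"
  defines "q \<equiv> \<lambda>x. (f x * f x) / v x"
  assumes D: "open D" "x \<in> D" and v: "\<And>x. x \<in> D \<Longrightarrow> 0 < v x"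
    and d: "f differentiable (at x)" "v differentiable (at x)" "q differentiable (at x)"
  shows "gradient q x \<bullet> gradient v x \<le> (norm (gradient f x))\<^sup>2"
proof -
  have P: "v x > 0" by (rule v[OF D(2)])
  have "gradient (\<lambda>x. q x * v x) x = gradient (\<lambda>x. f x * f x) x"
    by (rule gradient_cong_open[OF D]) (use v in \<open>force simp: q_def\<close>)
  then have "q x *\<^sub>R gradient v x + v x *\<^sub>R gradient q x = (2 * f x) *\<^sub>R gradient f x"
    by (simp add: gradient_mult[OF d(3,2)] gradient_mult[OF d(1,1)] scaleR_left_distrib[symmetric])
  from arg_cong[OF this, of "\<lambda>w. w \<bullet> gradient v x"]
  have "v x * (gradient q x \<bullet> gradient v x) =
      2 * f x * (gradient f x \<bullet> gradient v x) - q x * (gradient v x \<bullet> gradient v x)"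
    by (simp add: inner_add_left)
  then have e: "gradient q x \<bullet> gradient v x =
      2 * (f x / v x) * (gradient f x \<bullet> gradient v x) - (f x / v x)\<^sup>2 * (gradient v x \<bullet> gradient v x)"
    using P by (simp add: q_def field_simps power2_eq_square)
  have "0 \<le> (norm (gradient f x - (f x / v x) *\<^sub>R gradient v x))\<^sup>2" by simp
  also have "\<dots> = (norm (gradient f x))\<^sup>2 - gradient q x \<bullet> gradient v x"
    unfolding e power2_norm_eq_inner
    by (simp add: inner_diff_left inner_diff_right inner_commute power2_eq_square algebra_simps)
  finally show ?thesis by simp
qed

text \<open>A positive supersolution makes the form with potential \<open>- U\<close> nonnegative:
  Green's formula is applied to \<open>p\<close> and f^2 / p, and the gradient term is estimated by
  \<open>picone_pointwise\<close>.\<close>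

lemma sphere_picone:
  fixes p f :: "'a::euclidean_space \<Rightarrow> real"
  assumes p: "poly_fun p" "\<And>w. norm w = 1 \<Longrightarrow> 0 < p w" and f: "Ck_on (Suc 0) (radial_ext f) (-{0})"
    and U: "continuous_on (sphere 0 1) U" "\<And>w. norm w = 1 \<Longrightarrow> U w * p w \<le> - sph_lap p w"
  shows "sint (\<lambda>w. U w * (radial_ext f w)\<^sup>2) \<le> sint (\<lambda>w. (norm (gradient (radial_ext f) w))\<^sup>2)"
proof -
  let ?P = "radial_ext p" and ?F = "radial_ext f"
  have C: "Ck_on 2 ?P (-{0})" by (rule poly_fun_Ck[OF p(1)])
  have Ppos: "?P x > 0" if "x \<in> -{0}" for x
    using that p(2)[of "sgn x"] norm_sgn_eq_1[of x] by (simp add: radial_ext_def)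
  define q where "q = (\<lambda>w. (f w * f w) / p w)"
  have qe: "radial_ext q = (\<lambda>x. (?F x * ?F x) / ?P x)" by (auto simp: radial_ext_def q_def)
  have Q: "Ck_on (Suc 0) (radial_ext q) (-{0})"
    unfolding qe by (intro Ck_on_divide Ck_on_mult f C2D(6)[OF C] Ppos) auto
  have sub: "sphere 0 1 \<subseteq> - {0::'a}" by auto
  let ?h = "\<lambda>w. gradient (radial_ext q) w \<bullet> gradient ?P w + radial_ext q w * sph_lap p w"
  have hc: "continuous_on (sphere 0 1) ?h"
    unfolding sph_lap_def by (rule continuous_on_subset[OF _ sub])
      (intro continuous_intros continuous_on_gradient C2D(6)[OF C] C1D(3)[OF Q] Q continuous_on_laplacian[OF C])
  have gc: "continuous_on (sphere 0 1) (\<lambda>w. (norm (gradient ?F w))\<^sup>2)"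
    by (rule continuous_on_subset[OF _ sub]) (intro continuous_intros continuous_on_gradient f)
  have uc: "continuous_on (sphere 0 1) (\<lambda>w. U w * (?F w)\<^sup>2)"
    by (intro continuous_intros U continuous_on_subset[OF C1D(3)[OF f] sub])
  have le: "U w * (?F w)\<^sup>2 \<le> (norm (gradient ?F w))\<^sup>2 - ?h w" if w: "norm w = 1" for w
  proof -
    have w0: "w \<in> -{0}" using w by auto
    note dF = C1D(1)[OF f w0] and dP = C2D(1)[OF C w0] and dQ = C1D(1)[OF Q w0]
    have P: "?P w > 0" by (rule Ppos[OF w0])
    have 1: "gradient (radial_ext q) w \<bullet> gradient ?P w \<le> (norm (gradient ?F w))\<^sup>2"
      using picone_pointwise[OF open_punctured w0 Ppos dF dP] dQ by (simp add: qe)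
    have pw: "?P w = p w" by (rule radial_ext_unit[OF w])
    have "U w * (?F w)\<^sup>2 = radial_ext q w * (U w * p w)"
      using P pw by (simp add: qe power2_eq_square)
    also have "\<dots> \<le> radial_ext q w * (- sph_lap p w)"
      using U(2)[OF w] P by (intro mult_left_mono) (auto simp: qe)
    finally show ?thesis using 1 by simp
  qed
  have "sint (\<lambda>w. U w * (?F w)\<^sup>2) \<le> sint (\<lambda>w. (norm (gradient ?F w))\<^sup>2 - ?h w)"
    by (rule sint_mono[OF uc _ le]) (intro continuous_on_diff gc hc)
  also have "\<dots> = sint (\<lambda>w. (norm (gradient ?F w))\<^sup>2)"
    using sint_diff[OF gc hc] sphere_green[OF C Q] by simp
  finally show ?thesis .
qed

section \<open>Cones and their cross-sections\<close>

lemma cone_over_eq_vimage: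
  assumes "S = sphere 0 1 \<inter> T"
  shows "cone_over S = {x::'a::euclidean_space. x \<noteq> 0 \<and> sgn x \<in> T}"
  using assms by (auto simp: sgn_in_cone norm_sgn)

lemma cone_over_cone: "x \<in> cone_over S \<Longrightarrow> sgn x \<in> cone_over S"
proof -
  have "sgn (sgn x) = sgn x" by (cases "x = 0") (simp_all add: sgn_div_norm)
  then show "x \<in> cone_over S \<Longrightarrow> sgn x \<in> cone_over S" by (simp add: sgn_in_cone sgn_zero_iff)
qed

lemma sphere_subset_cone: "S \<subseteq> sphere 0 1 \<Longrightarrow> S \<subseteq> cone_over S"
  by (auto simp: cone_over_def)

lemma open_cone_over:
  fixes S :: "'a::euclidean_space set"
  assumes "openin (top_of_set (sphere 0 1)) S"
  shows "open (cone_over S)"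
proof -
  obtain T where T: "open T" "S = sphere 0 1 \<inter> T" using assms by (auto simp: openin_open)
  have "open ((-{0}) \<inter> sgn -` T)"
    by (rule continuous_open_preimage[OF sgn_continuous open_punctured T(1)])
  moreover have "(-{0}) \<inter> sgn -` T = cone_over S" using cone_over_eq_vimage[OF T(2)] by auto
  ultimately show ?thesis by simp
qed

lemma connected_cone_over:
  fixes S :: "'a::euclidean_space set"
  assumes "connected S" "S \<subseteq> sphere 0 1"
  shows "connected (cone_over S)"
proof -
  have "connected ((\<lambda>(t, w). t *\<^sub>R w) ` ({0<..} \<times> S))"
    by (intro connected_continuous_image connected_Times assms(1))
      (auto simp: split_beta intro!: continuous_intros)
  moreover have "(\<lambda>(t, w). t *\<^sub>R w) ` ({0<..} \<times> S) = cone_over S"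
  proof
    show "(\<lambda>(t, w). t *\<^sub>R w) ` ({0<..} \<times> S) \<subseteq> cone_over S"
      using subsetD[OF sphere_subset_cone[OF assms(2)]] by (auto simp: cone_over_scale)
    show "cone_over S \<subseteq> (\<lambda>(t, w). t *\<^sub>R w) ` ({0<..} \<times> S)"
    proof
      fix x assume x: "x \<in> cone_over S"
      then have "x = norm x *\<^sub>R sgn x" "norm x \<in> {0<..}" "sgn x \<in> S"
        by (auto simp: sgn_in_cone sgn_div_norm)
      then show "x \<in> (\<lambda>(t, w). t *\<^sub>R w) ` ({0<..} \<times> S)" by (intro image_eqI[of _ _ "(norm x, sgn x)"]) auto
    qed
  qed
  ultimately show ?thesis by simp
qed

lemma cone_over_scale_image:
  assumes "t > 0" shows "((*\<^sub>R) t) ` cone_over S = cone_over S"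
proof
  show "((*\<^sub>R) t) ` cone_over S \<subseteq> cone_over S" using cone_over_scale[OF assms] by auto
  show "cone_over S \<subseteq> ((*\<^sub>R) t) ` cone_over S"
  proof
    fix x assume "x \<in> cone_over S"
    then have "(1/t) *\<^sub>R x \<in> cone_over S" using cone_over_scale[of "1/t" x S] assms by simp
    then show "x \<in> ((*\<^sub>R) t) ` cone_over S" using assms by (intro image_eqI[of _ _ "(1/t) *\<^sub>R x"]) auto
  qed
qed

lemma frontier_cone_scale:
  assumes "t > 0" "x \<in> frontier (cone_over S)" "open (cone_over S)"
  shows "t *\<^sub>R x \<in> frontier (cone_over S)"
proof -
  have "x \<in> closure (cone_over S)" "x \<notin> cone_over S"
    using assms by (auto simp: frontier_def interior_open)
  then have "t *\<^sub>R x \<in> closure (((*\<^sub>R) t) ` cone_over S)" "t *\<^sub>R x \<notin> cone_over S"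
    using closure_scaleR[of t "cone_over S"] cone_over_scale[OF assms(1)] by auto
  then show ?thesis
    using assms by (auto simp: frontier_def interior_open cone_over_scale_image)
qed

locale cone =
  fixes S :: "'a::euclidean_space set"
  assumes S_ne: "S \<noteq> {}" and S_open: "openin (top_of_set (sphere 0 1)) S" and S_conn: "connected S"
begin

abbreviation "\<Omega> \<equiv> cone_over S"

lemma S_sub: "S \<subseteq> sphere 0 1"
  using S_open openin_imp_subset by blast

lemma S_norm: "w \<in> S \<Longrightarrow> norm w = 1"
  using S_sub by auto

lemma open_cone: "open \<Omega>"
  by (rule open_cone_over[OF S_open])

lemma S_cone: "S \<subseteq> \<Omega>"
  by (rule sphere_subset_cone[OF S_sub])

lemma cone_sub: "\<Omega> \<subseteq> -{0}"
  by (auto simp: cone_over_def)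

lemma cone_ne: "\<Omega> \<noteq> {}" "\<Omega> \<noteq> UNIV"
  using S_ne S_cone cone_sub by auto

text \<open>Since \<open>infdist\<close> to the empty set is 0, the positivity of
  \<open>bdist\<close> in the cone depends on this. The cone is a proper subset of the space because
  it omits 0.\<close>

lemma frontier_ne: "frontier \<Omega> \<noteq> {}"
  using cone_ne frontier_eq_empty by blast

lemma bdist_pos: "x \<in> \<Omega> \<Longrightarrow> bdist \<Omega> x > 0"
  using in_closed_iff_infdist_zero[OF frontier_closed frontier_ne, of x] open_cone
  by (auto simp: bdist_def frontier_def interior_open less_le infdist_nonneg)

lemma bdist_scale_le: "t > 0 \<Longrightarrow> bdist \<Omega> (t *\<^sub>R x) \<le> t * bdist \<Omega> x"
proof -
  assume t: "t > 0"
  obtain y where y: "y \<in> frontier \<Omega>" "infdist x (frontier \<Omega>) = dist x y"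
    using infdist_attains_inf[OF frontier_closed frontier_ne] by blast
  have "infdist (t *\<^sub>R x) (frontier \<Omega>) \<le> dist (t *\<^sub>R x) (t *\<^sub>R y)"
    by (rule infdist_le[OF frontier_cone_scale[OF t y(1) open_cone]])
  moreover have "dist (t *\<^sub>R x) (t *\<^sub>R y) = t * dist x y"
    using t by (simp add: dist_norm flip: scaleR_right_diff_distrib)
  ultimately show ?thesis using y(2) by (simp add: bdist_def)
qed

lemma bdist_scale: "t > 0 \<Longrightarrow> bdist \<Omega> (t *\<^sub>R x) = t * bdist \<Omega> x"
proof -
  assume t: "t > 0"
  have "bdist \<Omega> ((1/t) *\<^sub>R (t *\<^sub>R x)) \<le> (1/t) * bdist \<Omega> (t *\<^sub>R x)"
    using t by (intro bdist_scale_le) simp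
  then have "t * bdist \<Omega> x \<le> bdist \<Omega> (t *\<^sub>R x)" using t by (simp add: field_simps)
  then show ?thesis using bdist_scale_le[OF t] by (intro antisym)
qed

lemma bdist_lipschitz: "\<bar>bdist D x - bdist D y\<bar> \<le> norm (x - y)"
  using infdist_triangle_abs[of x "frontier D" y] by (simp add: bdist_def dist_norm)

lemma continuous_on_bdist: "continuous_on A (bdist D)"
  unfolding bdist_def[abs_def] by (intro continuous_on_infdist continuous_on_id)

lemma hardy_scale: "t > 0 \<Longrightarrow> hardy_potential \<Omega> \<mu> (t *\<^sub>R x) = hardy_potential \<Omega> \<mu> x / t\<^sup>2"
  by (simp add: hardy_potential_def bdist_scale power_mult_distrib mult.commute)

lemma hardy_sgn: "x \<noteq> 0 \<Longrightarrow> hardy_potential \<Omega> \<mu> x = hardy_potential \<Omega> \<mu> (sgn x) / (norm x)\<^sup>2"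
  using hardy_scale[of "norm x" \<mu> "sgn x"] by (simp add: sgn_div_norm)

lemma continuous_on_hardy: "continuous_on \<Omega> (hardy_potential \<Omega> \<mu>)"
  unfolding hardy_potential_def[abs_def]
  using bdist_pos by (intro continuous_intros continuous_on_bdist) force

lemma continuous_on_hardy_S: "continuous_on S (hardy_potential \<Omega> \<mu>)"
  by (rule continuous_on_subset[OF continuous_on_hardy S_cone])

text \<open>The sphere is covered by two relatively open sets, \<open>S\<close> and the complement
  of \<open>K\<close>; the extension is \<open>g\<close> on the first and 0 on the second.\<close>

lemma continuous_on_extend_sphere:
  fixes g :: "'a \<Rightarrow> real"
  assumes g: "continuous_on S g" and K: "compact K" "K \<subseteq> S" and z: "\<And>w. w \<in> S \<Longrightarrow> w \<notin> K \<Longrightarrow> g w = 0"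
  shows "continuous_on (sphere 0 1) (\<lambda>w. if w \<in> S then g w else 0)"
proof -
  let ?h = "\<lambda>w. if w \<in> S then g w else 0"
  have e: "S \<union> (sphere 0 1 - K) = sphere 0 1" using S_sub K by auto
  have "openin (top_of_set (sphere 0 1)) (sphere 0 1 \<inter> (- K))"
    using K(1) compact_imp_closed by (intro openin_open_Int) auto
  moreover have "sphere 0 1 \<inter> (- K) = sphere 0 1 - K" by auto
  ultimately have "continuous_on (S \<union> (sphere 0 1 - K)) ?h"
  proof (intro continuous_on_Un_local_open)
    show "continuous_on S ?h" by (rule continuous_on_eq[OF g]) simp
    show "continuous_on (sphere 0 1 - K) ?h"
      by (rule continuous_on_eq[OF continuous_on_const[of _ 0]]) (simp add: z)
  qed (use S_open e in simp_all)
  then show ?thesis by (simp add: e)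
qed

lemma test_vanish:
  assumes "Ck_on (Suc 0) (radial_ext f) (-{0})" "compact K" "\<And>w. w \<in> sphere 0 1 \<Longrightarrow> w \<notin> K \<Longrightarrow> f w = 0"
    "x \<noteq> 0" "sgn x \<notin> K"
  shows "radial_ext f x = 0" "gradient (radial_ext f) x = 0"
proof -
  have o: "open ((-{0}) \<inter> sgn -` (- K))"
    using assms(2) compact_imp_closed
    by (intro continuous_open_preimage[OF sgn_continuous open_punctured]) auto
  have z: "radial_ext f y = 0" if "y \<in> (-{0}) \<inter> sgn -` (- K)" for y
    using that assms(3)[of "sgn y"] by (auto simp: radial_ext_def norm_sgn)
  show "radial_ext f x = 0" using z assms(4,5) by auto
  have "gradient (radial_ext f) x = gradient (\<lambda>_. 0) x"
    by (rule gradient_cong_open[OF o]) (use z assms(4,5) in auto)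
  then show "gradient (radial_ext f) x = 0" by (simp add: gradient_def dd_const)
qed

text \<open>The potential may be unbounded near the boundary of \<open>S\<close>. Put to 0 outside
  \<open>S\<close>, its product with the square of a test function is continuous on the whole
  sphere, so that \<open>sint\<close> and its rules apply.\<close>

definition wsq :: "('a \<Rightarrow> real) \<Rightarrow> ('a \<Rightarrow> real) \<Rightarrow> 'a \<Rightarrow> real" where
  "wsq V f w = (if w \<in> S then V w * (radial_ext f w)\<^sup>2 else 0)"

lemma sphere_test_functionsD:
  assumes "f \<in> sphere_test_functions S"
  obtains K where "compact K" "K \<subseteq> S" "\<And>w. w \<in> sphere 0 1 \<Longrightarrow> w \<notin> K \<Longrightarrow> f w = 0"
    "\<And>k. Ck_on k (radial_ext f) (-{0})"
  using assms by (auto simp: sphere_test_functions_def smooth_on_def)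

lemma sphere_continuous:
  assumes "Ck_on k u (-{0::'a})" shows "continuous_on (sphere 0 1) u"
  by (rule continuous_on_subset[of "-{0}"]) (use Ck_on_le[OF assms, of 0] in auto)

lemma sphere_gradient_continuous:
  assumes "Ck_on (Suc 0) u (-{0::'a})" shows "continuous_on (sphere 0 1) (\<lambda>w. (norm (gradient u w))\<^sup>2)"
  by (rule continuous_on_subset[of "-{0}"]) (use assms in \<open>auto intro!: continuous_intros continuous_on_gradient\<close>)

lemma wsq_continuous:
  assumes "f \<in> sphere_test_functions S" "continuous_on S V"
  shows "continuous_on (sphere 0 1) (wsq V f)"
proof -
  obtain K where K: "compact K" "K \<subseteq> S" "\<And>w. w \<in> sphere 0 1 \<Longrightarrow> w \<notin> K \<Longrightarrow> f w = 0"
    "\<And>k. Ck_on k (radial_ext f) (-{0})" using sphere_test_functionsD[OF assms(1)] by blast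
  have "continuous_on S (\<lambda>w. V w * (radial_ext f w)\<^sup>2)"
    by (intro continuous_intros assms(2) continuous_on_subset[OF sphere_continuous[OF K(4)] S_sub])
  moreover have "V w * (radial_ext f w)\<^sup>2 = 0" if "w \<in> S" "w \<notin> K" for w
    using K(3)[of w] that S_norm by (simp add: radial_ext_unit)
  ultimately show ?thesis
    unfolding wsq_def[abs_def] by (rule continuous_on_extend_sphere[OF _ K(1,2)])
qed

lemma form_sphere_eq:
  assumes f: "f \<in> sphere_test_functions S" and V: "continuous_on S V"
  shows "form_sphere V S f = real DIM('a) *
    (sint (\<lambda>w. (norm (gradient (radial_ext f) w))\<^sup>2) + sint (wsq V f))"
proof -
  obtain K where K: "compact K" "K \<subseteq> S" "\<And>w. w \<in> sphere 0 1 \<Longrightarrow> w \<notin> K \<Longrightarrow> f w = 0"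
    "\<And>k. Ck_on k (radial_ext f) (-{0})" using sphere_test_functionsD[OF f] by blast
  let ?h = "\<lambda>w. (norm (gradient (radial_ext f) w))\<^sup>2 + wsq V f w"
  have hc: "continuous_on (sphere 0 1) ?h"
    by (intro continuous_on_add sphere_gradient_continuous K(4) wsq_continuous f V)
  have "indicator S w *\<^sub>R ((norm (sphere_gradient f w))\<^sup>2 + V w * (f w)\<^sup>2) =
      (if w \<in> sphere 0 1 then ?h w else 0)" for w
  proof (cases "w \<in> S")
    case True
    then show ?thesis using S_norm by (simp add: sphere_gradient_def wsq_def radial_ext_unit)
  next
    case False
    have "gradient (radial_ext f) w = 0" if w: "norm w = 1"
    proof (rule test_vanish(2)[OF K(4,1,3)])
      show "w \<noteq> 0" using w by auto
      show "sgn w \<notin> K" using False K(2) w by (auto simp: sgn_div_norm)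
    qed
    then show ?thesis using False by (simp add: wsq_def)
  qed
  then have "form_sphere V S f = (\<integral>w. (if w \<in> sphere 0 1 then ?h w else 0) \<partial>sphere_measure)"
    by (simp add: form_sphere_def set_lebesgue_integral_def)
  also have "\<dots> = real DIM('a) * sint (\<lambda>w. if w \<in> sphere 0 1 then ?h w else 0)"
    by (intro integral_sphere_measure borel_measurable_continuous_on_if hc continuous_on_const) auto
  also have "sint (\<lambda>w. if w \<in> sphere 0 1 then ?h w else 0) = sint ?h"
    by (rule sint_cong[symmetric]) (use hc in auto)
  also have "\<dots> = sint (\<lambda>w. (norm (gradient (radial_ext f) w))\<^sup>2) + sint (wsq V f)"
    by (rule sint_add[OF sphere_gradient_continuous[OF K(4)] wsq_continuous[OF f V]])
  finally show ?thesis .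
qed

text \<open>The form of the operator on the cross-section divided by the dimension, the factor
  between \<open>sphere_measure\<close> and \<open>sint\<close>.\<close>

definition sform :: "real \<Rightarrow> ('a \<Rightarrow> real) \<Rightarrow> real" where
  "sform \<mu> f = sint (\<lambda>w. (norm (gradient (radial_ext f) w))\<^sup>2) + sint (wsq (hardy_potential \<Omega> \<mu>) f)"

lemma form_sphere_shift:
  assumes f: "f \<in> sphere_test_functions S"
  shows "form_sphere (\<lambda>x. hardy_potential \<Omega> \<mu> x - l * 1) S f =
    real DIM('a) * (sform \<mu> f - l * sint (\<lambda>w. (radial_ext f w)\<^sup>2))"
proof -
  obtain K where K: "compact K" "K \<subseteq> S" "\<And>w. w \<in> sphere 0 1 \<Longrightarrow> w \<notin> K \<Longrightarrow> f w = 0"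
    "\<And>k. Ck_on k (radial_ext f) (-{0})" using sphere_test_functionsD[OF f] by blast
  let ?V = "\<lambda>x. hardy_potential \<Omega> \<mu> x - l * 1"
  have V: "continuous_on S ?V" by (intro continuous_intros continuous_on_hardy_S)
  have fc: "continuous_on (sphere 0 1) (\<lambda>w. l * (radial_ext f w)\<^sup>2)"
    by (intro continuous_intros sphere_continuous[OF K(4)])
  have "sint (wsq ?V f) = sint (\<lambda>w. wsq (hardy_potential \<Omega> \<mu>) f w - l * (radial_ext f w)\<^sup>2)"
  proof (rule sint_cong[OF _ wsq_continuous[OF f V]])
    fix w :: 'a assume w: "norm w = 1"
    show "wsq ?V f w = wsq (hardy_potential \<Omega> \<mu>) f w - l * (radial_ext f w)\<^sup>2"
    proof (cases "w \<in> S")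
      case False
      then have "f w = 0" using K(2) K(3)[of w] w by auto
      then show ?thesis using False w by (simp add: wsq_def radial_ext_unit)
    qed (simp add: wsq_def algebra_simps)
  qed
  also have "\<dots> = sint (wsq (hardy_potential \<Omega> \<mu>) f) - l * sint (\<lambda>w. (radial_ext f w)\<^sup>2)"
    using sint_diff[OF wsq_continuous[OF f continuous_on_hardy_S] fc] by (simp add: sint_cmult)
  finally show ?thesis unfolding form_sphere_eq[OF f V] sform_def by simp
qed

lemma nonneg_op_sphere_iff:
  "nonneg_op_sphere S (\<lambda>x. hardy_potential \<Omega> \<mu> x - l * 1) \<longleftrightarrow>
    (\<forall>f\<in>sphere_test_functions S. l * sint (\<lambda>w. (radial_ext f w)\<^sup>2) \<le> sform \<mu> f)"
  unfolding nonneg_op_sphere_def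
proof (rule ball_cong[OF refl])
  fix f assume f: "f \<in> sphere_test_functions S"
  show "0 \<le> form_sphere (\<lambda>x. hardy_potential \<Omega> \<mu> x - l * 1) S f \<longleftrightarrow>
      l * sint (\<lambda>w. (radial_ext f w)\<^sup>2) \<le> sform \<mu> f"
    unfolding form_sphere_shift[OF f] by (simp add: zero_le_mult_iff)
qed

text \<open>The function \<open>\<zeta>\<close> arises by composing a step function with a polynomial that approximates
  a multiple of the distance to the complement of the cone.\<close>

lemma cutoff:
  assumes K: "compact K" "K \<subseteq> S"
  obtains \<zeta> K' where "\<And>k. Ck_on k (radial_ext \<zeta>) (-{0})" "\<And>x. 0 \<le> radial_ext \<zeta> x" "\<And>x. radial_ext \<zeta> x \<le> 1"
    "\<And>w. w \<in> K \<Longrightarrow> \<zeta> w = 0" "\<And>w. w \<in> K \<Longrightarrow> gradient (radial_ext \<zeta>) w = 0"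
    "compact K'" "K' \<subseteq> S" "\<And>w. norm w = 1 \<Longrightarrow> w \<notin> K' \<Longrightarrow> \<zeta> w = 1"
proof -
  define d where "d = (\<lambda>w. infdist w (-\<Omega>))"
  have ne: "-\<Omega> \<noteq> {}" using cone_ne by auto
  have cl: "closed (-\<Omega>)" using open_cone by (simp add: closed_Compl)
  have dc: "continuous_on A d" for A unfolding d_def by (intro continuous_on_infdist continuous_on_id)
  have d0: "d w = 0 \<longleftrightarrow> w \<notin> \<Omega>" for w
    using in_closed_iff_infdist_zero[OF cl ne, of w] by (simp add: d_def)
  have dn: "d w \<ge> 0" for w by (simp add: d_def infdist_nonneg)
  have "\<exists>m>0. \<forall>w\<in>K. m \<le> d w"
  proof (cases "K = {}")
    case False
    obtain x where x: "x \<in> K" "\<And>w. w \<in> K \<Longrightarrow> d x \<le> d w"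
      using continuous_attains_inf[OF K(1) False dc] by blast
    have "d x > 0" using d0[of x] dn[of x] x(1) K(2) S_cone by auto
    then show ?thesis using x by blast
  qed (auto intro: exI[of _ 1])
  then obtain m where m: "m > 0" "\<And>w. w \<in> K \<Longrightarrow> m \<le> d w" by blast
  have "continuous_on (sphere 0 1) (\<lambda>w. d w / m)" by (intro continuous_intros dc) (use m in auto)
  then obtain q where q: "poly_fun q" "\<And>w. norm w = 1 \<Longrightarrow> \<bar>d w / m - q w\<bar> < 1/8"
    using poly_fun_dense[of "\<lambda>w. d w / m" "1/8"] by auto
  \<comment> \<open>The thresholds leave room for the error 1/8. On \<open>K\<close> one has q >
    7/8, where the argument of \<open>smooth_step\<close> exceeds 1; this persists nearby, so the
    gradient of \<zeta> vanishes there as well. Where d < m/2, q is at most 5/8 and the argument is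
    at most 0.\<close>
  define \<zeta> where "\<zeta> = (\<lambda>w. 1 - smooth_step (4 * q w - 5/2))"
  have re: "radial_ext \<zeta> = (\<lambda>x. 1 - smooth_step (4 * radial_ext q x - 5/2))"
    by (auto simp: radial_ext_def \<zeta>_def)
  define K' where "K' = {w \<in> sphere 0 1. m / 2 \<le> d w}"
  show thesis
  proof (rule that[of \<zeta> K'])
    show "Ck_on k (radial_ext \<zeta>) (-{0})" for k
      unfolding re
      by (intro Ck_on_diff Ck_on_const Ck_on_cmult poly_fun_Ck[OF q(1)] open_punctured
          Ck_on_compose_real[OF open_punctured _ open_UNIV Ck_on_smooth_step subset_UNIV])
    show "0 \<le> radial_ext \<zeta> x" "radial_ext \<zeta> x \<le> 1" for x
      using smooth_step_bounds by (auto simp: re)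
    show "compact K'"
    proof -
      have "closed {w. m / 2 \<le> d w}" by (intro closed_Collect_le continuous_intros dc)
      moreover have "K' = sphere 0 1 \<inter> {w. m / 2 \<le> d w}" by (auto simp: K'_def)
      ultimately show ?thesis by (metis compact_Int_closed compact_sphere)
    qed
    show "K' \<subseteq> S"
    proof
      fix w assume w: "w \<in> K'"
      then have "w \<in> \<Omega>" using d0[of w] m by (auto simp: K'_def)
      then show "w \<in> S" using w by (auto simp: K'_def cone_over_def)
    qed
    show "\<zeta> w = 1" if "norm w = 1" "w \<notin> K'" for w
    proof -
      have "d w / m < 1/2" using that m by (auto simp: K'_def field_simps)
      then have "q w \<le> 5/8" using q(2)[OF that(1)] by linarith
      then show ?thesis by (simp add: \<zeta>_def smooth_step_eq_0)
    qed
    have q7: "q w > 7/8" if "w \<in> K" for w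
    proof -
      have "1 \<le> d w / m" using m(1) m(2)[OF that] by simp
      moreover have "\<bar>d w / m - q w\<bar> < 1/8" using that K(2) S_norm by (intro q(2)) auto
      ultimately show ?thesis by linarith
    qed
    then show "\<zeta> w = 0" if "w \<in> K" for w
      using that by (force simp: \<zeta>_def intro!: smooth_step_eq_1)
    show "gradient (radial_ext \<zeta>) w = 0" if w: "w \<in> K" for w
    proof -
      have "continuous_on (-{0}) (radial_ext q)" using C2D(5)[OF poly_fun_Ck[OF q(1)]] .
      then have o: "open ((-{0}) \<inter> radial_ext q -` {7/8<..})"
        by (intro continuous_open_preimage) auto
      have nw: "norm w = 1" using w K(2) S_norm by auto
      have "gradient (radial_ext \<zeta>) w = gradient (\<lambda>_. 0) w"
      proof (rule gradient_cong_open[OF o])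
        show "w \<in> (-{0}) \<inter> radial_ext q -` {7/8<..}"
          using q7[OF w] nw radial_ext_unit[OF nw, of q] by auto
        show "radial_ext \<zeta> y = 0" if "y \<in> (-{0}) \<inter> radial_ext q -` {7/8<..}" for y
          using that by (simp add: re smooth_step_eq_1)
      qed
      then show ?thesis by (simp add: gradient_def dd_const)
    qed
  qed
qed

text \<open>The Rayleigh quotient of this function is what bounds \<sigma>(\<mu>) from
  above.\<close>

lemma exists_test_function: "\<exists>f\<in>sphere_test_functions S. sint (\<lambda>w. (radial_ext f w)\<^sup>2) > 0"
proof -
  obtain w where w: "w \<in> S" using S_ne by blast
  obtain \<zeta> K' where z: "\<And>k. Ck_on k (radial_ext \<zeta>) (-{0})" "\<And>v. v \<in> {w} \<Longrightarrow> \<zeta> v = 0"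
    "compact K'" "K' \<subseteq> S" "\<And>w. norm w = 1 \<Longrightarrow> w \<notin> K' \<Longrightarrow> \<zeta> w = 1"
    using cutoff[of "{w}"] w by (metis compact_sing empty_subsetI insert_subset)
  define f where "f = (\<lambda>v. 1 - \<zeta> v)"
  have re: "radial_ext f = (\<lambda>x. 1 - radial_ext \<zeta> x)" by (auto simp: f_def radial_ext_def)
  have C: "Ck_on k (radial_ext f) (-{0})" for k
    unfolding re by (intro Ck_on_diff Ck_on_const z open_punctured)
  have "f v = 0" if "v \<in> sphere 0 1" "v \<notin> K'" for v
    using z(5)[of v] that by (simp add: f_def)
  then have "f \<in> sphere_test_functions S"
    using C z(3,4) by (auto simp: sphere_test_functions_def smooth_on_def)
  moreover have "radial_ext f w = 1" using z(2)[of w] S_norm[OF w] by (simp add: f_def radial_ext_unit)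
  then have "sint (\<lambda>w. (radial_ext f w)\<^sup>2) > 0"
    by (intro sint_pos[of _ w] continuous_intros sphere_continuous[OF C] S_norm[OF w]) auto
  ultimately show ?thesis by blast
qed

text \<open>A lower bound \<open>c\<close> makes the set of admissible \<open>l\<close> nonempty, a
  test function of positive mass bounds it above. The supremum is again admissible because each test
  function imposes a non-strict inequality; for test functions of mass 0 it is the one with
  \<open>c\<close>.\<close>

lemma sigma_const_characterization:
  assumes c: "\<And>f. f \<in> sphere_test_functions S \<Longrightarrow> c * sint (\<lambda>w. (radial_ext f w)\<^sup>2) \<le> sform \<mu> f"
  obtains \<sigma> where "sigma_const S \<mu> = ereal \<sigma>" "c \<le> \<sigma>"
    "\<And>f. f \<in> sphere_test_functions S \<Longrightarrow> \<sigma> * sint (\<lambda>w. (radial_ext f w)\<^sup>2) \<le> sform \<mu> f"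
    "\<And>l. l > \<sigma> \<Longrightarrow> \<exists>f\<in>sphere_test_functions S. sform \<mu> f < l * sint (\<lambda>w. (radial_ext f w)\<^sup>2)"
proof -
  define L where "L = {l. \<forall>f\<in>sphere_test_functions S. l * sint (\<lambda>w. (radial_ext f w)\<^sup>2) \<le> sform \<mu> f}"
  obtain f0 where f0: "f0 \<in> sphere_test_functions S" "sint (\<lambda>w. (radial_ext f0 w)\<^sup>2) > 0"
    using exists_test_function by blast
  have cL: "c \<in> L" using c by (simp add: L_def)
  have ub: "l \<le> sform \<mu> f0 / sint (\<lambda>w. (radial_ext f0 w)\<^sup>2)" if "l \<in> L" for l
    using that f0 by (simp add: L_def pos_le_divide_eq)
  have bdd: "bdd_above L" using ub by (auto simp: bdd_above_def)
  define \<sigma> where "\<sigma> = Sup L"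
  have up: "l \<le> \<sigma>" if "l \<in> L" for l unfolding \<sigma>_def by (rule cSup_upper[OF that bdd])
  have "{ereal l |l. \<forall>f\<in>sphere_test_functions S. l * sint (\<lambda>w. (radial_ext f w)\<^sup>2) \<le> sform \<mu> f} = ereal ` L"
    by (auto simp: L_def)
  then have "sigma_const S \<mu> = Sup (ereal ` L)"
    unfolding sigma_const_def lambda0_def nonneg_op_sphere_iff by simp
  also have "\<dots> = ereal \<sigma>"
  proof (rule Sup_eqI)
    show "y \<le> ereal \<sigma>" if "y \<in> ereal ` L" for y using that up by auto
    fix y assume y: "\<And>z. z \<in> ereal ` L \<Longrightarrow> z \<le> y"
    show "ereal \<sigma> \<le> y"
    proof (cases y)
      case (real r)
      have "l \<le> r" if "l \<in> L" for l using y[of "ereal l"] that real by simp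
      then have "\<sigma> \<le> r" unfolding \<sigma>_def using cL by (intro cSup_least) auto
      then show ?thesis using real by simp
    next
      case MInf
      then show ?thesis using y cL by fastforce
    qed simp
  qed
  finally have s: "sigma_const S \<mu> = ereal \<sigma>" .
  show thesis
  proof (rule that[OF s up[OF cL]])
    fix f assume f: "f \<in> sphere_test_functions S"
    let ?N = "sint (\<lambda>w. (radial_ext f w)\<^sup>2)"
    have N: "?N \<ge> 0" unfolding sint_def by (intro integral_nonneg_AE) simp
    show "\<sigma> * ?N \<le> sform \<mu> f"
    proof (cases "?N = 0")
      case True
      then show ?thesis using c[OF f] by simp
    next
      case False
      then have "\<sigma> \<le> sform \<mu> f / ?N" unfolding \<sigma>_def
        using f N cL by (intro cSup_least) (auto simp: L_def pos_le_divide_eq)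
      then show ?thesis using False N by (simp add: pos_le_divide_eq)
    qed
  next
    fix l assume "l > \<sigma>"
    then have "l \<notin> L" using up by force
    then show "\<exists>f\<in>sphere_test_functions S. sform \<mu> f < l * sint (\<lambda>w. (radial_ext f w)\<^sup>2)"
      by (auto simp: L_def not_le)
  qed
qed

end

section \<open>Lower bound for the form on the cross-section\<close>

lemma continuous_on_extend_zero:
  fixes g :: "'a::euclidean_space \<Rightarrow> real"
  assumes "open D" "continuous_on D g" "compact K" "K \<subseteq> D" "\<And>x. x \<in> D \<Longrightarrow> x \<notin> K \<Longrightarrow> g x = 0"
  shows "continuous_on UNIV (\<lambda>x. if x \<in> D then g x else 0)"
proof -
  have "Ck_on 0 (\<lambda>x. if x \<in> D then g x else 0) D"
    using assms(2) by (auto intro: continuous_on_eq)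
  then have "Ck_on 0 (\<lambda>x. if x \<in> D then g x else 0) UNIV"
    by (rule Ck_on_extend_zero[OF assms(1) _ assms(3,4)]) (use assms(5) in auto)
  then show ?thesis by simp
qed

definition wq :: "'a::euclidean_space set \<Rightarrow> ('a \<Rightarrow> real) \<Rightarrow> ('a \<Rightarrow> real) \<Rightarrow> 'a \<Rightarrow> real" where
  "wq D V f x = (if x \<in> D then V x * (f x)\<^sup>2 else 0)"

lemma test_functionsD:
  assumes "f \<in> test_functions D"
  obtains K where "compact K" "K \<subseteq> D" "\<And>x. x \<notin> K \<Longrightarrow> f x = 0" "\<And>k. Ck_on k f UNIV"
  using assms by (auto simp: test_functions_def smooth_on_def)

lemma gradient_eq_0_outside:
  assumes "compact K" "\<And>x. x \<notin> K \<Longrightarrow> f x = 0" "x \<notin> K"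
  shows "gradient f x = 0"
proof -
  have "gradient f x = gradient (\<lambda>_. 0) x"
    by (rule gradient_cong_open[of "-K"]) (use assms compact_imp_closed in auto)
  then show ?thesis by (simp add: gradient_def dd_const)
qed

lemma form_eq:
  fixes f :: "'a::euclidean_space \<Rightarrow> real"
  assumes f: "f \<in> test_functions D" and D: "open D" and V: "continuous_on D V"
  shows "integrable lborel (\<lambda>x. (norm (gradient f x))\<^sup>2)" "integrable lborel (wq D V f)"
    "form V D f = (\<integral>x. (norm (gradient f x))\<^sup>2 \<partial>lborel) + (\<integral>x. wq D V f x \<partial>lborel)"
proof -
  obtain K where K: "compact K" "K \<subseteq> D" "\<And>x. x \<notin> K \<Longrightarrow> f x = 0" "\<And>k. Ck_on k f UNIV"
    using test_functionsD[OF f] by blast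
  have g0: "gradient f x = 0" if "x \<notin> K" for x
    by (rule gradient_eq_0_outside[OF K(1) _ that]) (rule K(3))
  have "continuous_on UNIV (\<lambda>x. (norm (gradient f x))\<^sup>2)"
    by (intro continuous_intros continuous_on_gradient K(4))
  then show i1: "integrable lborel (\<lambda>x. (norm (gradient f x))\<^sup>2)"
    by (rule integrable_compact_support[OF _ K(1)]) (simp add: g0)
  have fc: "continuous_on D f" using K(4)[of 0] continuous_on_subset by auto
  have "continuous_on UNIV (wq D V f)"
    unfolding wq_def[abs_def]
    by (rule continuous_on_extend_zero[OF D _ K(1,2)])
      (use K(3) in \<open>auto intro!: continuous_intros V fc\<close>)
  then show i2: "integrable lborel (wq D V f)"
    by (rule integrable_compact_support[OF _ K(1)]) (simp add: wq_def K(3))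
  have "indicator D x *\<^sub>R ((norm (gradient f x))\<^sup>2 + V x * (f x)\<^sup>2) =
      (norm (gradient f x))\<^sup>2 + wq D V f x" for x
    using g0[where x=x] K(2) by (auto simp: wq_def)
  then show "form V D f = (\<integral>x. (norm (gradient f x))\<^sup>2 \<partial>lborel) + (\<integral>x. wq D V f x \<partial>lborel)"
    using i1 i2 by (simp add: form_def set_lebesgue_integral_def)
qed

context cone
begin

text \<open>For fixed \<open>f\<close> the form is G - l B with B \<ge> 0. If B > 0, all admissible
  \<open>l\<close> are at most G / B, and so is their supremum; thus the endpoint \<mu> = \<mu>_0 is
  included.\<close>

lemma hardy_const_nonneg:
  assumes mu: "ereal \<mu> \<le> hardy_const \<Omega>" and f: "f \<in> test_functions \<Omega>"
  shows "0 \<le> form (hardy_potential \<Omega> \<mu>) \<Omega> f"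
proof -
  define G where "G = (\<integral>x. (norm (gradient f x))\<^sup>2 \<partial>lborel)"
  define B where "B = (\<integral>x. wq \<Omega> (\<lambda>x. 1 / (bdist \<Omega> x)\<^sup>2) f x \<partial>lborel)"
  have c1: "continuous_on \<Omega> (\<lambda>x. 1 / (bdist \<Omega> x)\<^sup>2)"
    using bdist_pos by (intro continuous_intros continuous_on_bdist) force
  have B: "B \<ge> 0" unfolding B_def by (intro integral_nonneg_AE) (simp add: wq_def)
  have F: "form V \<Omega> f = G - l * B" if "\<And>x. V x = - l * (1 / (bdist \<Omega> x)\<^sup>2)" for V l
  proof -
    have V: "V = (\<lambda>x. - l * (1 / (bdist \<Omega> x)\<^sup>2))" using that by auto
    have "continuous_on \<Omega> V" unfolding V by (intro continuous_intros c1)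
    moreover have "wq \<Omega> V f x = - l * wq \<Omega> (\<lambda>x. 1 / (bdist \<Omega> x)\<^sup>2) f x" for x
      by (simp add: wq_def V)
    then have "(\<integral>x. wq \<Omega> V f x \<partial>lborel) = - l * B" by (simp add: B_def)
    ultimately show ?thesis using form_eq(3)[OF f open_cone, of V] by (simp add: G_def)
  qed
  have "G - \<mu> * B \<ge> 0"
  proof (rule ccontr)
    assume neg: "\<not> G - \<mu> * B \<ge> 0"
    have G: "G \<ge> 0" unfolding G_def by (intro integral_nonneg_AE) simp
    have Bp: "B > 0" using B neg G by (cases "B = 0") auto
    have "hardy_const \<Omega> \<le> ereal (G / B)"
      unfolding hardy_const_def lambda0_def
    proof (rule Sup_least)
      fix y assume "y \<in> {ereal l |l. nonneg_op \<Omega> (\<lambda>x. 0 - l * (1 / (bdist \<Omega> x)\<^sup>2))}"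
      then obtain l where l: "y = ereal l" "nonneg_op \<Omega> (\<lambda>x. 0 - l * (1 / (bdist \<Omega> x)\<^sup>2))" by blast
      have "0 \<le> form (\<lambda>x. 0 - l * (1 / (bdist \<Omega> x)\<^sup>2)) \<Omega> f" using l(2) f by (auto simp: nonneg_op_def)
      also have "\<dots> = G - l * B" by (rule F) simp
      finally show "y \<le> ereal (G / B)" using Bp l(1) by (simp add: pos_le_divide_eq)
    qed
    then have "ereal \<mu> \<le> ereal (G / B)" using mu by (rule order_trans[rotated])
    then show False using neg Bp by (simp add: pos_le_divide_eq)
  qed
  then show ?thesis using F[of "hardy_potential \<Omega> \<mu>" \<mu>] by (simp add: hardy_potential_def)
qed

end

section \<open>Cut-offs on the logarithmic scale\<close>

lemma smooth_step_derivative_bound: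
  obtains M where "M \<ge> 0" "\<And>t. \<bar>dd 1 smooth_step t\<bar> \<le> M"
    "\<And>t. t < 0 \<or> t > 1 \<Longrightarrow> dd 1 smooth_step t = 0"
proof -
  have z: "dd 1 smooth_step t = 0" if "t < 0 \<or> t > 1" for t
  proof (cases "t < 0")
    case True
    have "dd 1 smooth_step t = dd 1 (\<lambda>_. 0) t"
      by (rule fun_cong[OF frechet_derivative_cong_open[of "{..<0}"]]) (use True smooth_step_eq_0 in auto)
    then show ?thesis by (simp add: dd_const)
  next
    case False
    have "dd 1 smooth_step t = dd 1 (\<lambda>_. 1) t"
      by (rule fun_cong[OF frechet_derivative_cong_open[of "{1<..}"]]) (use False that smooth_step_eq_1 in auto)
    then show ?thesis by (simp add: dd_const)
  qed
  have "continuous_on {0..1} (dd 1 smooth_step)"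
    by (rule continuous_on_subset[OF C2D(4)[OF Ck_on_smooth_step]]) simp
  from compact_imp_bounded[OF compact_continuous_image[OF this]]
  obtain B where "\<forall>y\<in>dd 1 smooth_step ` {0..1}. norm y \<le> B"
    unfolding bounded_iff by auto
  then have B: "\<bar>dd 1 smooth_step t\<bar> \<le> B" if "0 \<le> t" "t \<le> 1" for t
    using \<open>0 \<le> t\<close> \<open>t \<le> 1\<close> by simp
  have "\<bar>dd 1 smooth_step t\<bar> \<le> \<bar>B\<bar>" for t
    using B[of t] z[of t] by (cases "t < 0 \<or> t > 1") auto
  then show thesis using that[of "\<bar>B\<bar>"] z by simp
qed

text \<open>A function of t = ln |x|. Both ramps have length 1 for every \<open>N\<close>, so the
  derivative is bounded independently of \<open>N\<close> and lives on a set of bounded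
  length.\<close>

definition plateau :: "nat \<Rightarrow> real \<Rightarrow> real" where
  "plateau N t = smooth_step (t + 1) * smooth_step (real N + 1 - t)"

lemma Ck_on_plateau: "Ck_on k (plateau N) UNIV"
proof -
  have "Ck_on k (\<lambda>t::real. t + 1) UNIV" "Ck_on k (\<lambda>t::real. real N + 1 - t) UNIV"
    by (intro Ck_on_diff Ck_on_add Ck_on_const Ck_on_bounded_linear; simp)+
  then show ?thesis unfolding plateau_def[abs_def]
    by (intro Ck_on_mult Ck_on_compose_real[OF open_UNIV _ open_UNIV Ck_on_smooth_step]) auto
qed

lemma plateau_eq_0: "t \<le> -1 \<or> t \<ge> real N + 1 \<Longrightarrow> plateau N t = 0"
  by (auto simp: plateau_def smooth_step_eq_0)

lemma plateau_eq_1: "0 \<le> t \<Longrightarrow> t \<le> real N \<Longrightarrow> plateau N t = 1"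
  by (auto simp: plateau_def smooth_step_eq_1)

lemma plateau_derivative:
  obtains M where "M \<ge> 0" "\<And>N t. \<bar>dd 1 (plateau N) t\<bar> \<le> M"
    "\<And>N t. dd 1 (plateau N) t \<noteq> 0 \<Longrightarrow> (-1 \<le> t \<and> t \<le> 0) \<or> (real N \<le> t \<and> t \<le> real N + 1)"
proof -
  obtain M where M: "M \<ge> 0" "\<And>t. \<bar>dd 1 smooth_step t\<bar> \<le> M"
    "\<And>t. t < 0 \<or> t > 1 \<Longrightarrow> dd 1 smooth_step t = 0" using smooth_step_derivative_bound by blast
  have s: "(smooth_step has_real_derivative dd 1 smooth_step t) (at t)" for t
    using C2D(1)[OF Ck_on_smooth_step UNIV_I, of t] dd_real[of smooth_step _ t 1]
    by (auto simp: real_differentiable_def)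
  have e: "dd 1 (plateau N) t = dd 1 smooth_step (t + 1) * smooth_step (real N + 1 - t)
      - smooth_step (t + 1) * dd 1 smooth_step (real N + 1 - t)" for N t
  proof -
    have "((\<lambda>t. smooth_step (t + 1)) has_real_derivative dd 1 smooth_step (t + 1) * 1) (at t)"
      by (rule DERIV_chain2[OF s]) (auto intro!: derivative_eq_intros)
    moreover have "((\<lambda>t. smooth_step (real N + 1 - t)) has_real_derivative dd 1 smooth_step (real N + 1 - t) * (- 1)) (at t)"
      by (rule DERIV_chain2[OF s]) (auto intro!: derivative_eq_intros)
    ultimately have "(plateau N has_real_derivative dd 1 smooth_step (t + 1) * smooth_step (real N + 1 - t)
      - smooth_step (t + 1) * dd 1 smooth_step (real N + 1 - t)) (at t)"
      unfolding plateau_def[abs_def] by (rule DERIV_cong[OF DERIV_mult]) simp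
    from dd_real[OF this, of 1] show ?thesis by simp
  qed
  show thesis
  proof (rule that[of "2 * M"])
    fix N t
    have "\<bar>dd 1 smooth_step (t + 1) * smooth_step (real N + 1 - t)\<bar> \<le> M * 1"
      "\<bar>smooth_step (t + 1) * dd 1 smooth_step (real N + 1 - t)\<bar> \<le> 1 * M"
      unfolding abs_mult using M(1,2) smooth_step_bounds by (intro mult_mono; simp)+
    then show "\<bar>dd 1 (plateau N) t\<bar> \<le> 2 * M" unfolding e by linarith
    show "(-1 \<le> t \<and> t \<le> 0) \<or> (real N \<le> t \<and> t \<le> real N + 1)" if "dd 1 (plateau N) t \<noteq> 0"
      using that M(3)[of "t + 1"] M(3)[of "real N + 1 - t"] unfolding e by force
  qed (use M in simp)
qed

text \<open>The measure \<open>|x|\<^sup>-\<^sup>n dx\<close> is invariant under dilations, so all these shells have the same mass.\<close>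

definition shell :: "int \<Rightarrow> 'a::euclidean_space \<Rightarrow> real" where
  "shell j x = norm x powr (- real DIM('a)) * (if real_of_int j \<le> ln (norm x) \<and> ln (norm x) < real_of_int j + 1 then 1 else 0)"

lemma shell_nonneg: "0 \<le> shell j x"
  by (simp add: shell_def)

lemma shell_measurable [measurable]: "(shell j :: 'a::euclidean_space \<Rightarrow> real) \<in> borel_measurable borel"
  unfolding shell_def[abs_def] by measurable

lemma shell_scale:
  assumes "x \<noteq> (0::'a::euclidean_space)"
  shows "shell j (exp (real_of_int j) *\<^sub>R x) = exp (- real_of_int j * real DIM('a)) * shell 0 x"
proof -
  have "ln (exp (real_of_int j) * norm x) = real_of_int j + ln (norm x)"
    using assms by (simp add: ln_mult)
  then show ?thesis using assms by (simp add: shell_def powr_mult exp_powr_real)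
qed

lemma shell_integral:
  "integrable lborel (shell j :: 'a::euclidean_space \<Rightarrow> real)"
  "(\<integral>x. shell j (x::'a) \<partial>lborel) = (\<integral>x. shell 0 (x::'a) \<partial>lborel)"
  "(\<integral>x. shell 0 (x::'a) \<partial>lborel) > 0"
proof -
  show i: "integrable lborel (shell j :: 'a \<Rightarrow> real)" for j
  proof (rule Bochner_Integration.integrable_bound)
    let ?c = "exp (real_of_int j) powr (- real DIM('a))"
    show "integrable lborel (\<lambda>x::'a. ?c * indicator (ball 0 (exp (real_of_int j + 1))) x)"
      by (intro integrable_mult_right integrable_ball_indicator)
    show "AE x in lborel. norm (shell j (x::'a)) \<le> norm (?c * indicator (ball 0 (exp (real_of_int j + 1))) x)"
      using AE_nonzero
    proof eventually_elim
      case (elim x)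
      show ?case
      proof (cases "real_of_int j \<le> ln (norm x) \<and> ln (norm x) < real_of_int j + 1")
        case True
        have n: "norm x > 0" using elim by simp
        have "exp (real_of_int j) \<le> norm x" "norm x < exp (real_of_int j + 1)"
          using True ln_ge_iff[OF n] by (auto simp: not_le[symmetric])
        moreover from this have "norm x powr (- real DIM('a)) \<le> ?c"
          by (intro powr_mono2') auto
        ultimately show ?thesis by (simp add: shell_def)
      next
        case False
        then show ?thesis by (auto simp: shell_def)
      qed
    qed
  qed simp
  have "(\<integral>x. shell j (x::'a) \<partial>lborel) =
      \<bar>exp (real_of_int j)\<bar> ^ DIM('a) * (\<integral>x. shell j (0 + exp (real_of_int j) *\<^sub>R (x::'a)) \<partial>lborel)"
    by (rule lborel_integral_affine) auto
  also have "(\<integral>x. shell j (0 + exp (real_of_int j) *\<^sub>R (x::'a)) \<partial>lborel) =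
      (\<integral>x. exp (- real_of_int j * real DIM('a)) * shell 0 (x::'a) \<partial>lborel)"
    by (rule integral_cong_AE)
      (use AE_nonzero in \<open>auto simp: shell_scale elim: eventually_mono\<close>)
  also have "\<bar>exp (real_of_int j)\<bar> ^ DIM('a) * (\<integral>x. exp (- real_of_int j * real DIM('a)) * shell 0 (x::'a) \<partial>lborel)
      = (exp (real_of_int j) ^ DIM('a) * exp (- real_of_int j * real DIM('a))) * (\<integral>x. shell 0 (x::'a) \<partial>lborel)"
    by simp
  also have "exp (real_of_int j) ^ DIM('a) * exp (- real_of_int j * real DIM('a)) = 1"
    by (simp add: exp_of_nat_mult[symmetric] mult.commute flip: exp_add)
  finally show "(\<integral>x. shell j (x::'a) \<partial>lborel) = (\<integral>x. shell 0 (x::'a) \<partial>lborel)" by simp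
  have o: "open {x::'a. 1 < norm x \<and> norm x < exp 1}"
    by (intro open_Collect_conj open_Collect_less continuous_intros)
  have "(1::real) < 3/2" "3/2 < exp (1::real)" using exp_ge_add_one_self[of "1::real"] by auto
  moreover obtain v :: 'a where "norm v = 3/2" using vector_choose_size[of "3/2"] by auto
  ultimately have ne: "{x::'a. 1 < norm x \<and> norm x < exp 1} \<noteq> {}" by (auto intro!: exI[of _ v])
  show "(\<integral>x. shell 0 (x::'a) \<partial>lborel) > 0"
  proof (rule integral_pos_open[OF i shell_nonneg o ne])
    fix x :: 'a assume x: "x \<in> {x. 1 < norm x \<and> norm x < exp 1}"
    then have "ln (norm x) < ln (exp 1)" by (intro ln_less_cancel_iff[THEN iffD2]) auto
    then show "0 < shell 0 x" using x by (auto simp: shell_def)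
  qed
qed

lemma shell_floor:
  "shell j (x::'a::euclidean_space) = (if j = \<lfloor>ln (norm x)\<rfloor> then norm x powr (- real DIM('a)) else 0)"
  using floor_eq_iff[of "ln (norm x)" j] by (auto simp: shell_def)

lemma sum_shell:
  assumes "finite J"
  shows "(\<Sum>j\<in>J. shell j (x::'a::euclidean_space)) = (if \<lfloor>ln (norm x)\<rfloor> \<in> J then norm x powr (- real DIM('a)) else 0)"
  using assms by (simp add: shell_floor)

lemma plateau_measurable [measurable]:
  "plateau N \<in> borel_measurable borel" "dd 1 (plateau N) \<in> borel_measurable borel"
  by (rule borel_measurable_continuous_onI, rule C2D(5)[OF Ck_on_plateau])
    (rule borel_measurable_continuous_onI, rule C2D(4)[OF Ck_on_plateau])

lemma plateau_bounds: "0 \<le> plateau N t" "plateau N t \<le> 1"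
  using mult_mono[OF smooth_step_bounds(2)[of "t + 1"] smooth_step_bounds(2)[of "real N + 1 - t"]]
    smooth_step_bounds by (auto simp: plateau_def)

lemma Ck_on_ln_norm: "Ck_on k (\<lambda>x::'a::euclidean_space. ln (norm x)) (-{0})"
proof -
  have "Ck_on k (\<lambda>x::'a. (1/2) * ln ((norm x)\<^sup>2)) (-{0})"
    by (intro Ck_on_cmult open_punctured
        Ck_on_compose_real[OF open_punctured Ck_on_norm_sq_real open_greaterThan Ck_on_ln]) auto
  then show ?thesis
    by (rule Ck_on_cong[OF open_punctured, rotated]) (simp add: ln_realpow)
qed

lemma dd_ln_norm:
  assumes "x \<noteq> (0::'a::euclidean_space)"
  shows "dd v (\<lambda>x. ln (norm x)) x = (x \<bullet> v) / (norm x)\<^sup>2"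
proof -
  have "((\<lambda>x. ln (norm x)) has_derivative (\<lambda>h. (sgn x \<bullet> h) / norm x)) (at x)"
    using assms by (auto intro!: derivative_eq_intros has_derivative_norm simp: inner_commute divide_inverse)
  from dd_eq[OF this, of v] show ?thesis
    by (simp add: sgn_div_norm power2_eq_square divide_inverse)
qed

text \<open>The profile \<open>|x| powr ((2 - n) / 2)\<close> is optimal in Hardy's inequality. Its cut-off in the variable \<open>ln |x|\<close>
  costs a bounded amount, while the mass grows linearly in \<open>N\<close>.\<close>

definition trial :: "nat \<Rightarrow> 'a::euclidean_space \<Rightarrow> real" where
  "trial N x = norm x powr (- (real DIM('a) - 2) / 2) * plateau N (ln (norm x))"

lemma Ck_on_trial: "Ck_on k (trial N) (- {0::'a::euclidean_space})"
  unfolding trial_def[abs_def]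
  by (intro Ck_on_mult Ck_on_norm_powr open_punctured
      Ck_on_compose_real[OF open_punctured Ck_on_ln_norm open_UNIV Ck_on_plateau]) auto

lemma gradient_trial:
  fixes x :: "'a::euclidean_space"
  assumes x: "x \<noteq> 0"
  defines "a \<equiv> - (real DIM('a) - 2) / 2"
  shows "gradient (trial N) x = (norm x powr (a - 2) *
    (a * plateau N (ln (norm x)) + dd 1 (plateau N) (ln (norm x)))) *\<^sub>R x"
proof (rule euclidean_eqI)
  fix b :: 'a assume b: "b \<in> Basis"
  have xp: "x \<in> -{0}" using x by simp
  note d1 = C2D(1)[OF Ck_on_norm_powr[of 2 a] xp] and d2 = C2D(1)[OF Ck_on_ln_norm xp]
    and d3 = C2D(1)[OF Ck_on_plateau[of 2 N] UNIV_I]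
  have d4: "(\<lambda>x. plateau N (ln (norm x))) differentiable (at x)"
    using differentiable_chain_at[OF d2 d3] by (simp add: o_def)
  have n2: "norm x powr a / (norm x)\<^sup>2 = norm x powr (a - 2)"
    using x by (simp add: powr_diff powr_numeral)
  have "dd b (trial N) x = norm x powr a * ((x \<bullet> b) / (norm x)\<^sup>2 * dd 1 (plateau N) (ln (norm x)))
      + (a * norm x powr (a - 2) * (x \<bullet> b)) * plateau N (ln (norm x))"
    unfolding trial_def[abs_def] a_def[symmetric] dd_mult[OF d1 d4] dd_compose_real[OF d2 d3]
      dd_ln_norm[OF x] dd_norm_powr[OF x] by simp
  also have "\<dots> = norm x powr (a - 2) * (x \<bullet> b) * dd 1 (plateau N) (ln (norm x))
      + (a * norm x powr (a - 2) * (x \<bullet> b)) * plateau N (ln (norm x))"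
    unfolding n2[symmetric] by simp
  finally show "gradient (trial N) x \<bullet> b = ((norm x powr (a - 2) *
    (a * plateau N (ln (norm x)) + dd 1 (plateau N) (ln (norm x)))) *\<^sub>R x) \<bullet> b"
    using b by (simp add: gradient_component algebra_simps)
qed

text \<open>The weight t^(-n) turns the radial part of Lebesgue measure into d(ln t): the integral
  of \<open>Gp n h (norm x)\<close> is a multiple of the integral of h^2 over the line.\<close>

definition Gp :: "real \<Rightarrow> (real \<Rightarrow> real) \<Rightarrow> real \<Rightarrow> real" where
  "Gp n h t = t powr (- n) * (h (ln t))\<^sup>2"

lemma Gp_measurable [measurable]:
  assumes [measurable]: "h \<in> borel_measurable borel" shows "Gp n h \<in> borel_measurable borel"
  unfolding Gp_def[abs_def] by measurable

lemma Gp_plateau_integrable: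
  "integrable lborel (\<lambda>x::'a::euclidean_space. Gp (real DIM('a)) (plateau N) (norm x))"
proof (rule Bochner_Integration.integrable_bound)
  show "integrable lborel (\<lambda>x::'a. \<Sum>j\<in>{-1..int N + 1}. shell j x)"
    by (intro Bochner_Integration.integrable_sum shell_integral)
  show "AE x in lborel. norm (Gp (real DIM('a)) (plateau N) (norm (x::'a))) \<le> norm (\<Sum>j\<in>{-1..int N + 1}. shell j x)"
  proof (rule AE_I2)
    fix x :: 'a
    let ?t = "ln (norm x)"
    have "Gp (real DIM('a)) (plateau N) (norm x) \<le> (\<Sum>j\<in>{-1..int N + 1}. shell j x)"
    proof (cases "-1 \<le> ?t \<and> ?t \<le> real N + 1")
      case True
      then have "\<lfloor>?t\<rfloor> \<in> {-1..int N + 1}" by (auto simp: le_floor_iff floor_le_iff)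
      moreover have "norm x powr (- real DIM('a)) * (plateau N ?t)\<^sup>2 \<le> norm x powr (- real DIM('a)) * 1"
        using plateau_bounds[of N ?t] by (intro mult_left_mono power_le_one) auto
      ultimately show ?thesis by (simp add: Gp_def sum_shell)
    next
      case False
      then have "plateau N ?t = 0" by (intro plateau_eq_0) auto
      then show ?thesis by (simp add: Gp_def sum_nonneg shell_nonneg)
    qed
    then show "norm (Gp (real DIM('a)) (plateau N) (norm x)) \<le> norm (\<Sum>j\<in>{-1..int N + 1}. shell j x)"
      by (simp add: Gp_def sum_nonneg shell_nonneg)
  qed
qed measurable

text \<open>The plateau function is 1 on the shells 0, ..., N - 1, which all have the same
  mass.\<close>

lemma Gp_plateau_ge:
  "real N * (\<integral>x. shell 0 (x::'a::euclidean_space) \<partial>lborel) \<le> (\<integral>x. Gp (real DIM('a)) (plateau N) (norm (x::'a)) \<partial>lborel)"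
proof -
  define A where "A = (\<integral>x. shell 0 (x::'a) \<partial>lborel)"
  have s: "(\<integral>x. shell j (x::'a) \<partial>lborel) = A" for j unfolding A_def by (rule shell_integral(2))
  have "real N * (\<integral>x. shell 0 (x::'a) \<partial>lborel) = (\<integral>x. (\<Sum>j\<in>{0..<int N}. shell j (x::'a)) \<partial>lborel)"
    by (simp add: s shell_integral(1))
  also have "\<dots> \<le> (\<integral>x. Gp (real DIM('a)) (plateau N) (norm (x::'a)) \<partial>lborel)"
  proof (rule integral_mono[OF _ Gp_plateau_integrable])
    show "integrable lborel (\<lambda>x::'a. \<Sum>j\<in>{0..<int N}. shell j x)"
      by (intro Bochner_Integration.integrable_sum shell_integral)
    fix x :: 'a
    show "(\<Sum>j\<in>{0..<int N}. shell j x) \<le> Gp (real DIM('a)) (plateau N) (norm x)"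
    proof (cases "\<lfloor>ln (norm x)\<rfloor> \<in> {0..<int N}")
      case True
      then have "0 \<le> ln (norm x)" "ln (norm x) \<le> real N" by (auto simp: le_floor_iff floor_less_iff)
      then have "plateau N (ln (norm x)) = 1" by (rule plateau_eq_1)
      then show ?thesis by (simp add: sum_shell Gp_def)
    next
      case False
      then show ?thesis by (auto simp: sum_shell Gp_def)
    qed
  qed
  finally show ?thesis .
qed

lemma Gp_plateau_derivative:
  obtains C where "C \<ge> 0" "\<And>N. integrable lborel (\<lambda>x::'a::euclidean_space. Gp (real DIM('a)) (dd 1 (plateau N)) (norm x))"
    "\<And>N. (\<integral>x. Gp (real DIM('a)) (dd 1 (plateau N)) (norm (x::'a)) \<partial>lborel) \<le> C"
proof -
  obtain M where M: "M \<ge> 0" "\<And>N t. \<bar>dd 1 (plateau N) t\<bar> \<le> M"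
    "\<And>N t. dd 1 (plateau N) t \<noteq> 0 \<Longrightarrow> (-1 \<le> t \<and> t \<le> 0) \<or> (real N \<le> t \<and> t \<le> real N + 1)"
    using plateau_derivative by blast
  let ?A = "\<integral>x. shell 0 (x::'a) \<partial>lborel"
  \<comment> \<open>Two shells for each ramp: the ramps are closed intervals, and at their right
    ends the floor of ln |x| is already 0 or N + 1.\<close>
  define B where "B = (\<lambda>N (x::'a). M\<^sup>2 * (shell (-1) x + shell 0 x + shell (int N) x + shell (int N + 1) x))"
  have Bi: "integrable lborel (B N)" for N unfolding B_def by (intro integrable_mult_right Bochner_Integration.integrable_add shell_integral)
  have BI: "(\<integral>x. B N x \<partial>lborel) = M\<^sup>2 * (4 * ?A)" for N
  proof -
    define A where "A = ?A"
    have "(\<integral>x. shell j (x::'a) \<partial>lborel) = A" for j unfolding A_def by (rule shell_integral(2))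
    then show ?thesis unfolding B_def by (simp add: shell_integral(1))
  qed
  have Bnn: "0 \<le> B N x" for N x unfolding B_def using shell_nonneg by (intro mult_nonneg_nonneg add_nonneg_nonneg) auto
  have le: "Gp (real DIM('a)) (dd 1 (plateau N)) (norm x) \<le> B N x" for N x
  proof (cases "dd 1 (plateau N) (ln (norm x)) = 0")
    case True
    then show ?thesis using Bnn by (simp add: Gp_def)
  next
    case False
    let ?t = "ln (norm x)"
    have "\<lfloor>?t\<rfloor> = -1 \<or> \<lfloor>?t\<rfloor> = 0 \<or> \<lfloor>?t\<rfloor> = int N \<or> \<lfloor>?t\<rfloor> = int N + 1"
      using M(3)[OF False] by (auto simp: floor_eq_iff)
    then have "norm x powr (- real DIM('a)) \<le> shell (-1) x + shell 0 x + shell (int N) x + shell (int N + 1) x"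
      by (auto simp: shell_floor)
    then have "M\<^sup>2 * norm x powr (- real DIM('a)) \<le> B N x" unfolding B_def by (intro mult_left_mono) auto
    moreover have "(dd 1 (plateau N) ?t)\<^sup>2 \<le> M\<^sup>2" using M(2)[of N ?t] by (simp add: abs_le_square_iff[symmetric] M(1))
    then have "norm x powr (- real DIM('a)) * (dd 1 (plateau N) ?t)\<^sup>2 \<le> norm x powr (- real DIM('a)) * M\<^sup>2"
      by (intro mult_left_mono) auto
    ultimately show ?thesis by (simp add: Gp_def mult.commute)
  qed
  have i: "integrable lborel (\<lambda>x::'a. Gp (real DIM('a)) (dd 1 (plateau N)) (norm x))" for N
  proof (rule Bochner_Integration.integrable_bound[OF Bi[of N]])
    show "AE x in lborel. norm (Gp (real DIM('a)) (dd 1 (plateau N)) (norm (x::'a))) \<le> norm (B N x)"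
      using le Bnn by (intro AE_I2) (simp add: Gp_def)
  qed measurable
  show thesis
  proof (rule that[of "M\<^sup>2 * (4 * ?A)"])
    show "M\<^sup>2 * (4 * ?A) \<ge> 0" using shell_integral(3)[where 'a='a] by simp
    show "(\<integral>x. Gp (real DIM('a)) (dd 1 (plateau N)) (norm (x::'a)) \<partial>lborel) \<le> M\<^sup>2 * (4 * ?A)" for N
      using integral_mono[OF i Bi[of N] le] BI by simp
  qed (rule i)
qed

section \<open>The Hardy form on trial functions\<close>

context cone
begin

lemma trial_test_function:
  assumes "f \<in> sphere_test_functions S"
  shows "(\<lambda>x. trial N x * radial_ext f x) \<in> test_functions \<Omega>"
proof -
  obtain K where K: "compact K" "K \<subseteq> S" "\<And>w. w \<in> sphere 0 1 \<Longrightarrow> w \<notin> K \<Longrightarrow> f w = 0"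
    "\<And>k. Ck_on k (radial_ext f) (-{0})" using sphere_test_functionsD[OF assms] by blast
  define KK where "KK = (\<lambda>(t, w). t *\<^sub>R w) ` ({exp (-1)..exp (real N + 1)} \<times> K)"
  have cKK: "compact KK" unfolding KK_def
    by (intro compact_continuous_image compact_Times compact_Icc K(1)) (auto simp: split_beta intro!: continuous_intros)
  have KO: "KK \<subseteq> \<Omega>"
  proof
    fix x assume "x \<in> KK"
    then obtain t w where tw: "x = t *\<^sub>R w" "exp (-1) \<le> t" "w \<in> K" by (auto simp: KK_def)
    have "t > 0" using tw(2) exp_gt_zero[of "-1::real"] by linarith
    then show "x \<in> \<Omega>" using tw K(2) S_cone by (auto simp: cone_over_scale)
  qed
  have z: "trial N x * radial_ext f x = 0" if "x \<notin> KK" for x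
  proof (cases "x = 0")
    case True
    then show ?thesis by (simp add: trial_def)
  next
    case False
    show ?thesis
    proof (cases "sgn x \<in> K")
      case True
      have "norm x \<notin> {exp (-1)..exp (real N + 1)}"
      proof
        assume "norm x \<in> {exp (-1)..exp (real N + 1)}"
        then have "(norm x, sgn x) \<in> {exp (-1)..exp (real N + 1)} \<times> K" using True by auto
        moreover have "x = norm x *\<^sub>R sgn x" using False by (simp add: sgn_div_norm)
        ultimately have "x \<in> KK" unfolding KK_def by (intro image_eqI[of _ _ "(norm x, sgn x)"]) auto
        then show False using that by simp
      qed
      then have "ln (norm x) \<le> -1 \<or> ln (norm x) \<ge> real N + 1"
        using False by (auto simp: ln_ge_iff not_le) (metis less_imp_le ln_exp ln_le_cancel_iff exp_gt_zero zero_less_norm_iff)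
      then show ?thesis by (simp add: trial_def plateau_eq_0)
    next
      case nK: False
      then show ?thesis using test_vanish(1)[OF K(4,1,3) False nK] by simp
    qed
  qed
  have "Ck_on k (\<lambda>x. trial N x * radial_ext f x) (-{0})" for k
    by (intro Ck_on_mult Ck_on_trial K(4) open_punctured)
  then have "Ck_on k (\<lambda>x. trial N x * radial_ext f x) UNIV" for k
    using KO cone_sub by (intro Ck_on_extend_zero[OF open_punctured _ cKK _ z]) auto
  then show ?thesis using cKK KO z unfolding test_functions_def smooth_on_def by blast
qed

text \<open>The gradient of \<open>trial N\<close> is radial and that of the extension of
  \<open>f\<close> tangential, so the squares add without a cross term. By the choice of the
  exponent every term is |x|^(-n) times a function of ln |x| times a function of the direction, and
  \<open>polar_factor\<close> applies.\<close>

lemma trial_form: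
  fixes N :: nat
  assumes f: "f \<in> sphere_test_functions S"
  defines "n \<equiv> real DIM('a)"
  defines "a \<equiv> - (n - 2) / 2"
  defines "G1 \<equiv> Gp n (\<lambda>t. a * plateau N t + dd 1 (plateau N) t)"
  assumes G1: "integrable lborel (\<lambda>x::'a. G1 (norm x))"
  shows "measure lborel (ball (0::'a) 1) * form (hardy_potential \<Omega> \<mu>) \<Omega> (\<lambda>x. trial N x * radial_ext f x) =
    sint (\<lambda>w. (radial_ext f w)\<^sup>2) * (\<integral>x. G1 (norm (x::'a)) \<partial>lborel)
    + sform \<mu> f * (\<integral>x. Gp n (plateau N) (norm (x::'a)) \<partial>lborel)"
proof -
  obtain K where K: "compact K" "K \<subseteq> S" "\<And>w. w \<in> sphere 0 1 \<Longrightarrow> w \<notin> K \<Longrightarrow> f w = 0"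
    "\<And>k. Ck_on k (radial_ext f) (-{0})" using sphere_test_functionsD[OF f] by blast
  let ?F = "radial_ext f" and ?V = "hardy_potential \<Omega> \<mu>" and ?v = "measure lborel (ball (0::'a) 1)"
  let ?G2 = "Gp n (plateau N)"
  have G1m: "G1 \<in> borel_measurable borel" unfolding G1_def by measurable
  have G2: "integrable lborel (\<lambda>x::'a. ?G2 (norm x))" unfolding n_def by (rule Gp_plateau_integrable)
  have G2m: "?G2 \<in> borel_measurable borel" by measurable
  have c1: "continuous_on (sphere 0 1) (\<lambda>w. (?F w)\<^sup>2)" by (intro continuous_intros sphere_continuous[OF K(4)])
  note c2 = sphere_gradient_continuous[OF K(4)] and c3 = wsq_continuous[OF f continuous_on_hardy_S]
  note p1 = polar_factor[OF c1 G1 G1m] and p2 = polar_factor[OF c2 G2 G2m] and p3 = polar_factor[OF c3 G2 G2m]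
  note fe = form_eq[OF trial_test_function[OF f, where N=N] open_cone continuous_on_hardy[where \<mu>=\<mu>]]
  have pw: "norm x powr (a - 2) * norm x powr (a - 2) * (norm x)\<^sup>2 = norm x powr (- n)"
    "norm x powr a * norm x powr a / (norm x)\<^sup>2 = norm x powr (- n)" if "x \<noteq> 0" for x :: 'a
  proof -
    have "(norm x)\<^sup>2 = norm x powr 2" using that by (simp add: powr_numeral)
    then show "norm x powr (a - 2) * norm x powr (a - 2) * (norm x)\<^sup>2 = norm x powr (- n)"
      "norm x powr a * norm x powr a / (norm x)\<^sup>2 = norm x powr (- n)"
      unfolding a_def by (simp_all only: powr_add[symmetric] powr_diff[symmetric])
        (simp_all add: field_simps)
  qed
  have Fs: "?F x = ?F (sgn x)" if "x \<noteq> 0" for x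
    using radial_ext_scale[of "1 / norm x" f x] that by (simp add: sgn_scale_inv)
  have "(\<integral>x. (norm (gradient (\<lambda>x. trial N x * ?F x) x))\<^sup>2 \<partial>lborel) =
      (\<integral>x. G1 (norm x) * (?F (sgn x))\<^sup>2 + ?G2 (norm x) * (norm (gradient ?F (sgn x)))\<^sup>2 \<partial>lborel)"
  proof (rule integral_cong_AE)
    show "AE x in lborel. (norm (gradient (\<lambda>x. trial N x * ?F x) x))\<^sup>2 =
      G1 (norm x) * (?F (sgn x))\<^sup>2 + ?G2 (norm x) * (norm (gradient ?F (sgn x)))\<^sup>2"
      using AE_nonzero
    proof eventually_elim
      case (elim x)
      have x: "x \<in> -{0}" and s: "sgn x \<in> -{0}" using elim by (auto simp: sgn_zero_iff)
      let ?p = "plateau N (ln (norm x))" and ?p' = "dd 1 (plateau N) (ln (norm x))"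
      have gF: "gradient ?F x = (1 / norm x) *\<^sub>R gradient ?F (sgn x)"
        by (rule gradient_radial_ext_sgn[OF elim C1D(1)[OF K(4) s]])
      have gT: "gradient (trial N) x = (norm x powr (a - 2) * (a * ?p + ?p')) *\<^sub>R x"
        using gradient_trial[OF elim, of N] by (simp add: a_def n_def)
      have orth: "gradient ?F x \<bullet> x = 0" by (rule gradient_radial_ext_radial[OF C1D(1)[OF K(4) x]])
      have "gradient (\<lambda>x. trial N x * ?F x) x = trial N x *\<^sub>R gradient ?F x + ?F x *\<^sub>R gradient (trial N) x"
        by (rule gradient_mult[OF C2D(1)[OF Ck_on_trial x] C1D(1)[OF K(4) x]])
      moreover have "orthogonal (trial N x *\<^sub>R gradient ?F x) (?F x *\<^sub>R gradient (trial N) x)"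
        unfolding gT orthogonal_def using orth by simp
      ultimately have "(norm (gradient (\<lambda>x. trial N x * ?F x) x))\<^sup>2 =
          (trial N x)\<^sup>2 * (norm (gradient ?F x))\<^sup>2 + (?F x)\<^sup>2 * (norm (gradient (trial N) x))\<^sup>2"
        by (simp only: norm_add_Pythagorean norm_scaleR power_mult_distrib power2_abs)
      also have "(trial N x)\<^sup>2 * (norm (gradient ?F x))\<^sup>2 =
          (norm x powr a * norm x powr a / (norm x)\<^sup>2) * ?p\<^sup>2 * (norm (gradient ?F (sgn x)))\<^sup>2"
        unfolding gF trial_def a_def n_def by (simp add: power_mult_distrib power_divide power2_eq_square)
      also have "(norm (gradient (trial N) x))\<^sup>2 =
          (norm x powr (a - 2) * norm x powr (a - 2) * (norm x)\<^sup>2) * (a * ?p + ?p')\<^sup>2"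
        unfolding gT by (simp add: power_mult_distrib power2_eq_square)
      finally show ?case
        unfolding pw[OF elim] Fs[OF elim] by (simp add: G1_def Gp_def)
    qed
    show "(\<lambda>x. (norm (gradient (\<lambda>x. trial N x * ?F x) x))\<^sup>2) \<in> borel_measurable lborel"
      using fe(1) by (rule borel_measurable_integrable)
    show "(\<lambda>x. G1 (norm x) * (?F (sgn x))\<^sup>2 + ?G2 (norm x) * (norm (gradient ?F (sgn x)))\<^sup>2) \<in> borel_measurable lborel"
      using p1(1) p2(1) by (intro borel_measurable_integrable Bochner_Integration.integrable_add)
  qed
  also have "\<dots> = (\<integral>x. G1 (norm x) * (?F (sgn x))\<^sup>2 \<partial>lborel) + (\<integral>x. ?G2 (norm x) * (norm (gradient ?F (sgn x)))\<^sup>2 \<partial>lborel)"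
    by (rule Bochner_Integration.integral_add[OF p1(1) p2(1)])
  finally have 1: "?v * (\<integral>x. (norm (gradient (\<lambda>x. trial N x * ?F x) x))\<^sup>2 \<partial>lborel) =
      sint (\<lambda>w. (?F w)\<^sup>2) * (\<integral>x. G1 (norm (x::'a)) \<partial>lborel)
      + sint (\<lambda>w. (norm (gradient ?F w))\<^sup>2) * (\<integral>x. ?G2 (norm (x::'a)) \<partial>lborel)"
    using p1(2) p2(2) by (simp add: distrib_left)
  have "(\<integral>x. wq \<Omega> ?V (\<lambda>x. trial N x * ?F x) x \<partial>lborel) = (\<integral>x. ?G2 (norm x) * wsq ?V f (sgn x) \<partial>lborel)"
  proof (rule integral_cong_AE)
    show "AE x in lborel. wq \<Omega> ?V (\<lambda>x. trial N x * ?F x) x = ?G2 (norm x) * wsq ?V f (sgn x)"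
      using AE_nonzero
    proof eventually_elim
      case (elim x)
      show ?case
      proof (cases "x \<in> \<Omega>")
        case True
        let ?p = "plateau N (ln (norm x))"
        have "wq \<Omega> ?V (\<lambda>x. trial N x * ?F x) x =
            (norm x powr a * norm x powr a / (norm x)\<^sup>2) * ?p\<^sup>2 * (?V (sgn x) * (?F (sgn x))\<^sup>2)"
          unfolding trial_def a_def n_def Fs[OF elim] hardy_sgn[OF elim] using True
          by (simp add: wq_def hardy_sgn[OF elim, of \<mu>] Fs[OF elim, symmetric] power_mult_distrib power2_eq_square)
        then show ?thesis unfolding pw[OF elim] using True by (simp add: wsq_def sgn_in_cone Gp_def)
      next
        case False
        then show ?thesis using elim by (simp add: wq_def wsq_def sgn_in_cone)
      qed
    qed
  qed (use fe(2) p3(1) borel_measurable_integrable in blast)+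
  then have "?v * (\<integral>x. wq \<Omega> ?V (\<lambda>x. trial N x * ?F x) x \<partial>lborel) = sint (wsq ?V f) * (\<integral>x. ?G2 (norm (x::'a)) \<partial>lborel)"
    using p3(2) by simp
  then show ?thesis using 1 unfolding fe(3) by (simp add: sform_def algebra_simps)
qed

text \<open>If the bound failed by \<delta> > 0, the form of the N-th trial function would be at
  most a constant, the cost of the ramps, minus a term that grows like N \<delta>. It would be
  negative for large N, against \<mu> \<le> \<mu>_0.\<close>

lemma sform_lower_bound:
  assumes mu: "ereal \<mu> \<le> hardy_const \<Omega>" and f: "f \<in> sphere_test_functions S"
  shows "- ((real DIM('a) - 2)\<^sup>2 / 4) * sint (\<lambda>w. (radial_ext f w)\<^sup>2) \<le> sform \<mu> f"
proof (rule ccontr)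
  assume neg: "\<not> ?thesis"
  define n where "n = real DIM('a)"
  define a where "a = - (n - 2) / 2"
  have a2: "a\<^sup>2 = (n - 2)\<^sup>2 / 4" by (simp add: a_def power_divide power2_commute)
  define N0 where "N0 = sint (\<lambda>w. (radial_ext f w)\<^sup>2)"
  have N0: "N0 \<ge> 0" unfolding N0_def sint_def by (intro integral_nonneg_AE) simp
  define \<delta> where "\<delta> = - a\<^sup>2 * N0 - sform \<mu> f"
  have dl: "\<delta> > 0" using neg by (simp add: \<delta>_def N0_def a2 n_def)
  \<comment> \<open>Young's inequality separates \<open>a * plateau N t\<close> from the derivative
    of the plateau at the price of a factor 1 + e; with this \<open>e\<close> at most \<delta> / 2
    is lost.\<close>
  define e where "e = \<delta> / (2 * (a\<^sup>2 * N0 + 1))"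
  have aN: "a\<^sup>2 * N0 + 1 > 0" using N0 by (simp add: add_nonneg_pos)
  have e: "e > 0" "e * (a\<^sup>2 * N0) \<le> \<delta> / 2"
  proof -
    show "e > 0" using dl aN by (simp add: e_def)
    then have "e * (a\<^sup>2 * N0) \<le> e * (a\<^sup>2 * N0 + 1)" by (intro mult_left_mono) auto
    also have "\<dots> = \<delta> / 2" using aN unfolding e_def by (metis nonzero_mult_divide_mult_cancel_right2 less_irrefl mult.commute times_divide_eq_left)
    finally show "e * (a\<^sup>2 * N0) \<le> \<delta> / 2" .
  qed
  obtain C where C: "C \<ge> 0" "\<And>N. integrable lborel (\<lambda>x::'a. Gp n (dd 1 (plateau N)) (norm x))"
    "\<And>N. (\<integral>x. Gp n (dd 1 (plateau N)) (norm (x::'a)) \<partial>lborel) \<le> C"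
    unfolding n_def using Gp_plateau_derivative[where 'a='a] by blast
  define A where "A = (\<integral>x. shell 0 (x::'a) \<partial>lborel)"
  have A: "A > 0" unfolding A_def by (rule shell_integral(3))
  have key: "real N * (A * (\<delta> / 2)) \<le> N0 * ((1 + 1/e) * C)" for N
  proof -
    let ?G1 = "Gp n (\<lambda>t. a * plateau N t + dd 1 (plateau N) t)"
    let ?G2 = "Gp n (plateau N)" and ?G3 = "Gp n (dd 1 (plateau N))"
    define I2 where "I2 = (\<integral>x. ?G2 (norm (x::'a)) \<partial>lborel)"
    define I3 where "I3 = (\<integral>x. ?G3 (norm (x::'a)) \<partial>lborel)"
    have G2: "integrable lborel (\<lambda>x::'a. ?G2 (norm x))" unfolding n_def by (rule Gp_plateau_integrable)
    have le: "?G1 t \<le> (1 + e) * a\<^sup>2 * ?G2 t + (1 + 1/e) * ?G3 t" for t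
    proof -
      have "(x + y)\<^sup>2 \<le> (1 + e) * x\<^sup>2 + (1 + 1/e) * y\<^sup>2" for x y :: real
      proof -
        have "0 \<le> (e * x - y)\<^sup>2 / e" using e(1) by simp
        also have "\<dots> = e * x\<^sup>2 - 2 * x * y + y\<^sup>2 / e" using e(1) by (simp add: power2_eq_square field_simps)
        finally show ?thesis by (simp add: power2_eq_square algebra_simps)
      qed
      from this[of "a * plateau N (ln t)" "dd 1 (plateau N) (ln t)"]
      have "(a * plateau N (ln t) + dd 1 (plateau N) (ln t))\<^sup>2 \<le>
          (1 + e) * a\<^sup>2 * (plateau N (ln t))\<^sup>2 + (1 + 1/e) * (dd 1 (plateau N) (ln t))\<^sup>2"
        by (simp add: power_mult_distrib mult.assoc)
      then have "t powr (- n) * (a * plateau N (ln t) + dd 1 (plateau N) (ln t))\<^sup>2 \<le>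
          t powr (- n) * ((1 + e) * a\<^sup>2 * (plateau N (ln t))\<^sup>2 + (1 + 1/e) * (dd 1 (plateau N) (ln t))\<^sup>2)"
        by (intro mult_left_mono) auto
      then show ?thesis unfolding Gp_def by (simp only: distrib_left mult_ac)
    qed
    have ib: "integrable lborel (\<lambda>x::'a. (1 + e) * a\<^sup>2 * ?G2 (norm x) + (1 + 1/e) * ?G3 (norm x))"
      by (intro Bochner_Integration.integrable_add integrable_mult_right G2 C)
    have G1: "integrable lborel (\<lambda>x::'a. ?G1 (norm x))"
    proof (rule Bochner_Integration.integrable_bound[OF ib])
      have nn: "0 \<le> ?G1 t" for t by (simp add: Gp_def)
      show "AE x in lborel. norm (?G1 (norm (x::'a))) \<le> norm ((1 + e) * a\<^sup>2 * ?G2 (norm x) + (1 + 1/e) * ?G3 (norm x))"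
        using order_trans[OF le abs_ge_self] nn by (intro AE_I2) simp
    qed measurable
    have "(\<integral>x. ?G1 (norm (x::'a)) \<partial>lborel) \<le> (\<integral>x. (1 + e) * a\<^sup>2 * ?G2 (norm x) + (1 + 1/e) * ?G3 (norm (x::'a)) \<partial>lborel)"
      by (rule integral_mono[OF G1 ib le])
    also have "\<dots> = (1 + e) * a\<^sup>2 * I2 + (1 + 1/e) * I3" unfolding I2_def I3_def using G2 C(2) by simp
    also have "\<dots> \<le> (1 + e) * a\<^sup>2 * I2 + (1 + 1/e) * C"
      using C(3)[of N] e(1) by (intro add_left_mono mult_left_mono) (auto simp: I3_def)
    finally have I1: "(\<integral>x. ?G1 (norm (x::'a)) \<partial>lborel) \<le> (1 + e) * a\<^sup>2 * I2 + (1 + 1/e) * C" .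
    have "0 \<le> measure lborel (ball (0::'a) 1) * form (hardy_potential \<Omega> \<mu>) \<Omega> (\<lambda>x. trial N x * radial_ext f x)"
      by (intro mult_nonneg_nonneg hardy_const_nonneg[OF mu] trial_test_function f) simp
    also have "\<dots> = N0 * (\<integral>x. ?G1 (norm (x::'a)) \<partial>lborel) + sform \<mu> f * I2"
      using trial_form[OF f, of N] G1 by (simp add: N0_def I2_def n_def a_def)
    also have "\<dots> \<le> N0 * ((1 + e) * a\<^sup>2 * I2 + (1 + 1/e) * C) + sform \<mu> f * I2"
      by (intro add_right_mono mult_left_mono I1 N0)
    also have "\<dots> = N0 * ((1 + 1/e) * C) - I2 * (\<delta> - e * (a\<^sup>2 * N0))"
      by (simp add: \<delta>_def algebra_simps)
    finally have U: "I2 * (\<delta> - e * (a\<^sup>2 * N0)) \<le> N0 * ((1 + 1/e) * C)" by simp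
    have I2N: "real N * A \<le> I2" unfolding A_def I2_def n_def by (rule Gp_plateau_ge)
    have "real N * A * (\<delta> / 2) \<le> I2 * (\<delta> - e * (a\<^sup>2 * N0))"
      using I2N e(2) dl A by (intro mult_mono order_trans[OF _ I2N]) auto
    from order_trans[OF this U] have "real N * A * (\<delta> / 2) \<le> N0 * ((1 + 1/e) * C)" .
    then show ?thesis by (simp only: mult.assoc)
  qed
  obtain N :: nat where "N0 * ((1 + 1/e) * C) / (A * (\<delta> / 2)) < real N" using reals_Archimedean2 by blast
  then have "N0 * ((1 + 1/e) * C) < real N * (A * (\<delta> / 2))" using A dl by (simp add: pos_divide_less_eq)
  then show False using key[of N] by simp
qed

end

section \<open>Approximate eigenfunctions\<close>

text \<open>The reason for localising with 1 - \<zeta>^2 instead of 1 - \<zeta>: its gradient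
  carries the factor \<zeta>. By the Cauchy-Schwarz inequality and (1 - z^2)^2 + z^2 \<le> 1 the
  coefficient of |A|^2 stays exactly 1, where A stands for \<nabla>p and B for p
  \<nabla>\<zeta>.\<close>

lemma cutoff_gradient_bound:
  fixes A B :: "'a::real_inner"
  assumes "0 \<le> z" "z \<le> (1::real)"
  shows "(norm ((1 - z\<^sup>2) *\<^sub>R A - (2 * z) *\<^sub>R B))\<^sup>2 \<le> (norm A)\<^sup>2 + 4 * (norm B)\<^sup>2"
proof -
  let ?c = "1 - z\<^sup>2" and ?a = "norm A" and ?b = "2 * norm B"
  have z2: "z\<^sup>2 \<le> 1" using assms by (simp add: power_le_one)
  have "norm (?c *\<^sub>R A - (2 * z) *\<^sub>R B) \<le> ?c * ?a + z * ?b"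
    using norm_triangle_ineq4[of "?c *\<^sub>R A" "(2 * z) *\<^sub>R B"] assms z2 by (simp add: mult.assoc mult.left_commute)
  then have "(norm (?c *\<^sub>R A - (2 * z) *\<^sub>R B))\<^sup>2 \<le> (?c * ?a + z * ?b)\<^sup>2"
    by (intro power_mono) auto
  also have "\<dots> \<le> (?c\<^sup>2 + z\<^sup>2) * (?a\<^sup>2 + ?b\<^sup>2)"
    using zero_le_power2[of "?c * ?b - z * ?a"] by (simp add: power2_eq_square algebra_simps)
  also have "\<dots> \<le> 1 * (?a\<^sup>2 + ?b\<^sup>2)"
  proof (intro mult_right_mono)
    have "z\<^sup>2 * z\<^sup>2 \<le> 1 * z\<^sup>2" using z2 by (intro mult_right_mono) auto
    then show "?c\<^sup>2 + z\<^sup>2 \<le> 1" by (simp add: power2_eq_square algebra_simps)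
  qed auto
  finally show ?thesis by (simp add: power_mult_distrib)
qed

context cone
begin

text \<open>Localisation with \<open>\<chi> = 1 - \<zeta>\<^sup>2\<close>: the potential is turned into one that is bounded up to the boundary
  of \<open>S\<close> without lowering the form, because \<open>|\<nabla>(\<chi>p)|\<^sup>2 \<le> |\<nabla>p|\<^sup>2 + 4 |\<nabla>\<zeta>|\<^sup>2 p\<^sup>2\<close>.\<close>

lemma penalized_potential:
  assumes K: "compact K" "K \<subseteq> S"
    and \<sigma>: "\<And>f. f \<in> sphere_test_functions S \<Longrightarrow> \<sigma> * sint (\<lambda>w. (radial_ext f w)\<^sup>2) \<le> sform \<mu> f"
  obtains W where "continuous_on (sphere 0 1) W" "\<And>w. w \<in> K \<Longrightarrow> W w = hardy_potential \<Omega> \<mu> w"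
    "\<And>p. poly_fun p \<Longrightarrow> \<sigma> * sint (\<lambda>w. (p w)\<^sup>2) \<le> sint (\<lambda>w. (norm (gradient (radial_ext p) w))\<^sup>2 + W w * (p w)\<^sup>2)"
proof -
  obtain \<zeta> K' where z: "\<And>k. Ck_on k (radial_ext \<zeta>) (-{0})" "\<And>x. 0 \<le> radial_ext \<zeta> x" "\<And>x. radial_ext \<zeta> x \<le> 1"
    "\<And>w. w \<in> K \<Longrightarrow> \<zeta> w = 0" "\<And>w. w \<in> K \<Longrightarrow> gradient (radial_ext \<zeta>) w = 0"
    and K': "compact K'" "K' \<subseteq> S" "\<And>w. norm w = 1 \<Longrightarrow> w \<notin> K' \<Longrightarrow> \<zeta> w = 1"
    using cutoff[OF K] by blast
  let ?V = "hardy_potential \<Omega> \<mu>" and ?z = "radial_ext \<zeta>"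
  define W1 where "W1 w = (if w \<in> S then (1 - (?z w)\<^sup>2)\<^sup>2 * ?V w else 0)" for w
  \<comment> \<open>The integral of \<sigma> p^2 splits into that of \<sigma> (\<chi>p)^2,
    controlled by the form of the test function \<chi>p, and a rest. The middle term of
    \<open>W\<close> pays for the rest, the last one for the gradient of \<zeta>; both vanish on
    \<open>K\<close>.\<close>
  define W where "W w = W1 w + (1 - (1 - (?z w)\<^sup>2)\<^sup>2) * \<sigma> + 4 * (norm (gradient ?z w))\<^sup>2" for w
  have cz: "continuous_on (sphere 0 1) ?z" by (rule sphere_continuous[OF z(1)])
  have cz': "continuous_on S ?z" by (rule continuous_on_subset[OF cz S_sub])
  have K'z: "?z w = 1" if "norm w = 1" "w \<notin> K'" for w
    using K'(3)[OF that] radial_ext_unit[OF that(1)] by metis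
  have cW1: "continuous_on (sphere 0 1) W1" unfolding W1_def[abs_def]
    by (rule continuous_on_extend_sphere[OF _ K'(1,2)])
      (auto intro!: continuous_intros cz' continuous_on_hardy_S simp: K'z S_norm)
  have cW: "continuous_on (sphere 0 1) W" unfolding W_def[abs_def]
    by (intro continuous_intros cW1 cz sphere_gradient_continuous[OF z(1)])
  have WK: "W w = ?V w" if "w \<in> K" for w
    using z(4,5)[OF that] radial_ext_unit[of w \<zeta>] S_norm[of w] K(2) that
    by (auto simp: W_def W1_def)
  have main: "\<sigma> * sint (\<lambda>w. (p w)\<^sup>2) \<le> sint (\<lambda>w. (norm (gradient (radial_ext p) w))\<^sup>2 + W w * (p w)\<^sup>2)"
    if p: "poly_fun p" for p
  proof -
    let ?p = "radial_ext p"
    define g where "g w = (1 - (\<zeta> w)\<^sup>2) * p w" for w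
    have rg: "radial_ext g = (\<lambda>x. (1 - (?z x)\<^sup>2) * ?p x)" by (simp add: radial_ext_def g_def fun_eq_iff)
    have cz2: "Ck_on k (\<lambda>x. 1 - ?z x * ?z x) (-{0})" for k
      by (intro Ck_on_diff Ck_on_const Ck_on_mult z open_punctured)
    have Cg: "Ck_on k (radial_ext g) (-{0})" for k
      unfolding rg power2_eq_square by (intro Ck_on_mult cz2 poly_fun_Ck p open_punctured)
    have g: "g \<in> sphere_test_functions S"
      unfolding sphere_test_functions_def smooth_on_def
      using Cg K' by (auto simp: g_def intro!: exI[of _ K'])
    have cp: "continuous_on (sphere 0 1) p" by (rule continuous_on_poly_fun[OF p])
    have cgp: "continuous_on (sphere 0 1) (\<lambda>w. (norm (gradient ?p w))\<^sup>2)"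
      by (rule sphere_gradient_continuous[OF poly_fun_Ck[OF p]])
    have cgg: "continuous_on (sphere 0 1) (\<lambda>w. (norm (gradient (radial_ext g) w))\<^sup>2)"
      by (rule sphere_gradient_continuous[OF Cg])
    have cw: "continuous_on (sphere 0 1) (wsq ?V g)" by (rule wsq_continuous[OF g continuous_on_hardy_S])
    let ?r = "\<lambda>w. \<sigma> * ((1 - (1 - (?z w)\<^sup>2)\<^sup>2) * (p w)\<^sup>2)"
    have cr: "continuous_on (sphere 0 1) ?r" by (intro continuous_intros cz cp)
    have cg2: "continuous_on (sphere 0 1) (\<lambda>w. (radial_ext g w)\<^sup>2)"
      by (intro continuous_intros sphere_continuous[OF Cg])
    have "\<sigma> * sint (\<lambda>w. (p w)\<^sup>2) = sint (\<lambda>w. \<sigma> * (p w)\<^sup>2)" by (simp add: sint_cmult)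
    also have "\<dots> = sint (\<lambda>w. \<sigma> * (radial_ext g w)\<^sup>2 + ?r w)"
    proof (rule sint_cong)
      show "continuous_on (sphere 0 1) (\<lambda>w. \<sigma> * (p w)\<^sup>2)" by (intro continuous_intros cp)
      fix w :: 'a assume w: "norm w = 1"
      have "\<sigma> * q = \<sigma> * (c * q) + \<sigma> * ((1 - c) * q)" for q c :: real by (simp add: algebra_simps)
      then show "\<sigma> * (p w)\<^sup>2 = \<sigma> * (radial_ext g w)\<^sup>2 + ?r w"
        unfolding rg radial_ext_unit[OF w] power_mult_distrib .
    qed
    also have "\<dots> = \<sigma> * sint (\<lambda>w. (radial_ext g w)\<^sup>2) + sint ?r"
      using sint_add[OF continuous_on_mult_left[OF cg2] cr] by (simp add: sint_cmult)
    also have "\<dots> \<le> sform \<mu> g + sint ?r" by (intro add_right_mono \<sigma> g)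
    also have "\<dots> = sint (\<lambda>w. ((norm (gradient (radial_ext g) w))\<^sup>2 + wsq ?V g w) + ?r w)"
      using sint_add[OF continuous_on_add[OF cgg cw] cr] sint_add[OF cgg cw] by (simp add: sform_def)
    also have "\<dots> \<le> sint (\<lambda>w. (norm (gradient ?p w))\<^sup>2 + W w * (p w)\<^sup>2)"
    proof (rule sint_mono)
      show "continuous_on (sphere 0 1) (\<lambda>w. ((norm (gradient (radial_ext g) w))\<^sup>2 + wsq ?V g w) + ?r w)"
        by (intro continuous_on_add cgg cw cr)
      show "continuous_on (sphere 0 1) (\<lambda>w. (norm (gradient ?p w))\<^sup>2 + W w * (p w)\<^sup>2)"
        by (intro continuous_intros cgp cW cp)
      fix w :: 'a assume w: "norm w = 1"
      then have w0: "w \<in> -{0}" by auto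
      note dz = C1D(1)[OF z(1) w0] and dp = C1D(1)[OF poly_fun_Ck[OF p] w0]
      have "gradient (\<lambda>x. 1 - ?z x * ?z x) w = - (2 * ?z w) *\<^sub>R gradient ?z w"
      proof -
        have d: "(\<lambda>x. ?z x * ?z x) differentiable (at w)" by (intro differentiable_mult dz)
        have "gradient (\<lambda>x. 1 + - 1 * (?z x * ?z x)) w = gradient (\<lambda>x. 1) w + gradient (\<lambda>x. - 1 * (?z x * ?z x)) w"
          by (rule gradient_add) (auto intro!: differentiable_minus d)
        also have "gradient (\<lambda>x. 1::real) w = 0" by (simp add: gradient_def dd_const)
        also have "gradient (\<lambda>x. - 1 * (?z x * ?z x)) w = (- 1) *\<^sub>R gradient (\<lambda>x. ?z x * ?z x) w + (?z w * ?z w) *\<^sub>R gradient (\<lambda>x. - 1) w"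
          by (rule gradient_mult) (auto intro!: d)
        also have "gradient (\<lambda>x. - 1::real) w = 0" by (simp add: gradient_def dd_const)
        also have "gradient (\<lambda>x. ?z x * ?z x) w = ?z w *\<^sub>R gradient ?z w + ?z w *\<^sub>R gradient ?z w"
          by (rule gradient_mult[OF dz dz])
        finally show ?thesis by (simp flip: scaleR_add_left)
      qed
      moreover have "gradient (radial_ext g) w = (1 - ?z w * ?z w) *\<^sub>R gradient ?p w + ?p w *\<^sub>R gradient (\<lambda>x. 1 - ?z x * ?z x) w"
        unfolding rg power2_eq_square by (rule gradient_mult[OF C1D(1)[OF cz2 w0] dp])
      ultimately have "gradient (radial_ext g) w = (1 - (?z w)\<^sup>2) *\<^sub>R gradient ?p w - (2 * ?z w) *\<^sub>R (p w *\<^sub>R gradient ?z w)"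
        using radial_ext_unit[OF w, of p] by (simp add: power2_eq_square mult_ac)
      then have "(norm (gradient (radial_ext g) w))\<^sup>2 \<le> (norm (gradient ?p w))\<^sup>2 + 4 * (norm (p w *\<^sub>R gradient ?z w))\<^sup>2"
        by (simp only: cutoff_gradient_bound[OF z(2,3)])
      moreover have "wsq ?V g w = W1 w * (p w)\<^sup>2"
        by (simp add: wsq_def W1_def rg radial_ext_unit[OF w, of p] power_mult_distrib)
      ultimately show "((norm (gradient (radial_ext g) w))\<^sup>2 + wsq ?V g w) + ?r w \<le> (norm (gradient ?p w))\<^sup>2 + W w * (p w)\<^sup>2"
        by (simp add: W_def power_mult_distrib algebra_simps)
    qed
    finally show ?thesis .
  qed
  show thesis by (rule that[OF cW WK main])
qed

text \<open>\<Lambda> is the principal eigenvalue for the potential of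
  \<open>penalized_potential\<close>. Testing the lower bound for that potential with the
  approximate eigenfunctions gives \<sigma> \<le> \<Lambda>. By Picone's inequality the same
  positive functions give the form bound with \<Lambda> on test functions supported in
  \<open>K\<close>, where the two potentials agree.\<close>

lemma approximate_eigenfunction:
  assumes n: "DIM('a) \<ge> 2" and K: "compact K" "K \<subseteq> S" and e: "e > 0"
    and \<sigma>: "\<And>f. f \<in> sphere_test_functions S \<Longrightarrow> \<sigma> * sint (\<lambda>w. (radial_ext f w)\<^sup>2) \<le> sform \<mu> f"
  obtains \<Lambda> p where "\<sigma> \<le> \<Lambda>" "poly_fun p" "\<And>w. norm w = 1 \<Longrightarrow> 0 < p w"
    "\<And>w. w \<in> K \<Longrightarrow> \<bar>- sph_lap p w + (hardy_potential \<Omega> \<mu> w - \<Lambda>) * p w\<bar> \<le> e * p w"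
    "\<And>f. f \<in> sphere_test_functions S \<Longrightarrow> (\<And>w. w \<in> sphere 0 1 \<Longrightarrow> w \<notin> K \<Longrightarrow> f w = 0) \<Longrightarrow>
      \<Lambda> * sint (\<lambda>w. (radial_ext f w)\<^sup>2) \<le> sform \<mu> f"
proof -
  let ?V = "hardy_potential \<Omega> \<mu>"
  obtain W where W: "continuous_on (sphere 0 1) W" "\<And>w. w \<in> K \<Longrightarrow> W w = ?V w"
    "\<And>p. poly_fun p \<Longrightarrow> \<sigma> * sint (\<lambda>w. (p w)\<^sup>2) \<le> sint (\<lambda>w. (norm (gradient (radial_ext p) w))\<^sup>2 + W w * (p w)\<^sup>2)"
    using penalized_potential[OF K \<sigma>] by blast
  obtain \<Lambda> where L: "\<And>e. e > 0 \<Longrightarrow> \<exists>p. poly_fun p \<and>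
    (\<forall>w. norm w = 1 \<longrightarrow> 0 < p w \<and> \<bar>- sph_lap p w + (W w - \<Lambda>) * p w\<bar> \<le> e * p w)"
    using sph_principal_eigenvalue[OF n W(1)] by blast
  have low: "\<sigma> \<le> \<Lambda> + e" if e: "e > 0" for e
  proof -
    obtain p where p: "poly_fun p" "\<And>w. norm w = 1 \<Longrightarrow> 0 < p w"
      "\<And>w. norm w = 1 \<Longrightarrow> \<bar>- sph_lap p w + (W w - \<Lambda>) * p w\<bar> \<le> e * p w" using L[OF e] by blast
    note cp = continuous_on_poly_fun[OF p(1)]
    have cg: "continuous_on (sphere 0 1) (\<lambda>w. (norm (gradient (radial_ext p) w))\<^sup>2)"
      by (rule sphere_gradient_continuous[OF poly_fun_Ck[OF p(1)]])
    have "\<sigma> * sint (\<lambda>w. (p w)\<^sup>2) \<le> sint (\<lambda>w. (norm (gradient (radial_ext p) w))\<^sup>2 + W w * (p w)\<^sup>2)"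
      by (rule W(3)[OF p(1)])
    \<comment> \<open>This is the approximate eigenvalue equation multiplied by \<open>p\<close>. By
      \<open>sint_gradient_poly\<close> the integral of the first bracket is 0.\<close>
    also have "\<dots> \<le> sint (\<lambda>w. ((norm (gradient (radial_ext p) w))\<^sup>2 + p w * sph_lap p w) + (\<Lambda> + e) * (p w)\<^sup>2)"
    proof (rule sint_mono)
      show "continuous_on (sphere 0 1) (\<lambda>w. (norm (gradient (radial_ext p) w))\<^sup>2 + W w * (p w)\<^sup>2)"
        "continuous_on (sphere 0 1) (\<lambda>w. ((norm (gradient (radial_ext p) w))\<^sup>2 + p w * sph_lap p w) + (\<Lambda> + e) * (p w)\<^sup>2)"
        by (intro continuous_intros cg cp W(1))+
      fix w :: 'a assume w: "norm w = 1"
      have "- sph_lap p w + (W w - \<Lambda>) * p w \<le> e * p w" using p(3)[OF w] by simp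
      then have "p w * (- sph_lap p w + (W w - \<Lambda>) * p w) \<le> p w * (e * p w)"
        using p(2)[OF w] by (intro mult_left_mono) auto
      then show "(norm (gradient (radial_ext p) w))\<^sup>2 + W w * (p w)\<^sup>2
          \<le> ((norm (gradient (radial_ext p) w))\<^sup>2 + p w * sph_lap p w) + (\<Lambda> + e) * (p w)\<^sup>2"
        by (simp add: power2_eq_square algebra_simps)
    qed
    also have "\<dots> = sint (\<lambda>w. (norm (gradient (radial_ext p) w))\<^sup>2 + p w * sph_lap p w) + sint (\<lambda>w. (\<Lambda> + e) * (p w)\<^sup>2)"
      by (rule sint_add) (intro continuous_intros cg cp)+
    also have "\<dots> = (\<Lambda> + e) * sint (\<lambda>w. (p w)\<^sup>2)"
      unfolding sint_gradient_poly[OF p(1)] sint_cmult by simp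
    finally have "\<sigma> * sint (\<lambda>w. (p w)\<^sup>2) \<le> (\<Lambda> + e) * sint (\<lambda>w. (p w)\<^sup>2)" .
    moreover have "sint (\<lambda>w. (p w)\<^sup>2) > 0"
    proof -
      obtain w :: 'a where w: "norm w = 1" using vector_choose_size[of 1] by auto
      show ?thesis by (rule sint_pos[OF _ _ w]) (use p(2)[OF w] in \<open>auto intro!: continuous_intros cp\<close>)
    qed
    ultimately show ?thesis by simp
  qed
  have up: "\<Lambda> * sint (\<lambda>w. (radial_ext f w)\<^sup>2) \<le> sform \<mu> f"
    if f: "f \<in> sphere_test_functions S" and fK: "\<And>w. w \<in> sphere 0 1 \<Longrightarrow> w \<notin> K \<Longrightarrow> f w = 0" for f
  proof (rule field_le_epsilon)
    fix d :: real assume d: "d > 0"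
    let ?I = "sint (\<lambda>w. (radial_ext f w)\<^sup>2)"
    obtain K0 where Cf: "\<And>k. Ck_on k (radial_ext f) (-{0})" using sphere_test_functionsD[OF f] by blast
    have I: "?I \<ge> 0" unfolding sint_def by (intro integral_nonneg_AE) simp
    define e where "e = d / (?I + 1)"
    have e: "e > 0" "e * ?I \<le> d"
    proof -
      show "e > 0" using d I by (simp add: e_def)
      then have "e * ?I \<le> e * (?I + 1)" by (intro mult_left_mono) auto
      then show "e * ?I \<le> d" using I by (simp add: e_def)
    qed
    obtain p where p: "poly_fun p" "\<And>w. norm w = 1 \<Longrightarrow> 0 < p w"
      "\<And>w. norm w = 1 \<Longrightarrow> \<bar>- sph_lap p w + (W w - \<Lambda>) * p w\<bar> \<le> e * p w" using L[OF e(1)] by blast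
    have cf: "continuous_on (sphere 0 1) (\<lambda>w. (radial_ext f w)\<^sup>2)"
      by (intro continuous_intros sphere_continuous[OF Cf])
    have cw: "continuous_on (sphere 0 1) (wsq ?V f)" by (rule wsq_continuous[OF f continuous_on_hardy_S])
    have pw: "(\<Lambda> - e - W w) * p w \<le> - sph_lap p w" if "norm w = 1" for w
      using p(3)[OF that] by (simp add: algebra_simps abs_le_iff)
    have "(\<Lambda> - e) * ?I - sint (wsq ?V f) = sint (\<lambda>w. (\<Lambda> - e) * (radial_ext f w)\<^sup>2 - wsq ?V f w)"
      using sint_diff[OF continuous_on_mult_left[OF cf] cw] by (simp add: sint_cmult)
    also have "\<dots> = sint (\<lambda>w. (\<Lambda> - e - W w) * (radial_ext f w)\<^sup>2)"
    proof (rule sint_cong)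
      show "continuous_on (sphere 0 1) (\<lambda>w. (\<Lambda> - e) * (radial_ext f w)\<^sup>2 - wsq ?V f w)"
        by (intro continuous_intros cf cw)
      fix w :: 'a assume w: "norm w = 1"
      show "(\<Lambda> - e) * (radial_ext f w)\<^sup>2 - wsq ?V f w = (\<Lambda> - e - W w) * (radial_ext f w)\<^sup>2"
        using W(2)[of w] fK[of w] K(2) w radial_ext_unit[OF w, of f]
        by (cases "w \<in> K") (auto simp: wsq_def algebra_simps)
    qed
    also have "\<dots> \<le> sint (\<lambda>w. (norm (gradient (radial_ext f) w))\<^sup>2)"
      by (rule sphere_picone[OF p(1) _ Cf _ pw]) (auto intro!: continuous_intros W(1) p(2))
    finally show "\<Lambda> * ?I \<le> sform \<mu> f + d" using e(2) by (simp add: sform_def algebra_simps)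
  qed
  have "\<sigma> \<le> \<Lambda>" by (rule field_le_epsilon) (rule low)
  moreover obtain p where p: "poly_fun p" "\<And>w. norm w = 1 \<Longrightarrow> 0 < p w"
      "\<And>w. norm w = 1 \<Longrightarrow> \<bar>- sph_lap p w + (W w - \<Lambda>) * p w\<bar> \<le> e * p w" using L[OF e] by blast
  moreover have "\<bar>- sph_lap p w + (?V w - \<Lambda>) * p w\<bar> \<le> e * p w" if "w \<in> K" for w
    using p(3)[of w] W(2)[OF that] S_norm[of w] K(2) that by auto
  ultimately show thesis using up that by blast
qed

end

section \<open>The eigenfunction of the cross-section\<close>

text \<open>Convergence at the points of a finite net of mesh e / (3 (L + 1)) controls all points,
  since the functions and their limit share the Lipschitz constant L.\<close>

lemma uniform_limit_of_pointwise:
  fixes P :: "nat \<Rightarrow> 'a::euclidean_space \<Rightarrow> real"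
  assumes B: "compact B" and L: "L \<ge> 0"
    and lip: "\<forall>\<^sub>F i in sequentially. \<forall>y\<in>B. \<forall>z\<in>B. \<bar>P i y - P i z\<bar> \<le> L * norm (y - z)"
    and lim: "\<And>y. y \<in> B \<Longrightarrow> (\<lambda>i. P i y) \<longlonglongrightarrow> u y"
  shows "\<And>y z. y \<in> B \<Longrightarrow> z \<in> B \<Longrightarrow> \<bar>u y - u z\<bar> \<le> L * norm (y - z)"
    "uniform_limit B P u sequentially"
proof -
  show ul: "\<bar>u y - u z\<bar> \<le> L * norm (y - z)" if "y \<in> B" "z \<in> B" for y z
  proof (rule tendsto_upperbound)
    show "(\<lambda>i. \<bar>P i y - P i z\<bar>) \<longlonglongrightarrow> \<bar>u y - u z\<bar>"
      by (intro tendsto_intros lim that)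
    show "\<forall>\<^sub>F i in sequentially. \<bar>P i y - P i z\<bar> \<le> L * norm (y - z)"
      using lip by eventually_elim (use that in auto)
  qed simp
  show "uniform_limit B P u sequentially"
    unfolding uniform_limit_iff
  proof (intro allI impI)
    fix e :: real assume e: "e > 0"
    define d where "d = e / (3 * (L + 1))"
    have d: "d > 0" using e L by (simp add: d_def)
    have Ld: "L * d \<le> e / 3"
    proof -
      have "L * d \<le> (L + 1) * d" using d by (intro mult_right_mono) auto
      moreover have "(L + 1) * d = e / 3" using L unfolding d_def by (simp add: divide_simps)
      ultimately show ?thesis by simp
    qed
    obtain C where C: "C \<subseteq> B" "finite C" "B \<subseteq> (\<Union>c\<in>C. ball c d)"
      by (rule compactE_image[OF B, of B "\<lambda>c. ball c d"]) (use d in auto)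
    have "\<forall>\<^sub>F i in sequentially. \<forall>c\<in>C. dist (P i c) (u c) < e / 3"
    proof (rule eventually_ball_finite[OF C(2)], rule ballI)
      fix c assume "c \<in> C"
      then show "\<forall>\<^sub>F i in sequentially. dist (P i c) (u c) < e / 3"
        using C(1) e by (intro tendstoD[OF lim]) auto
    qed
    with lip show "\<forall>\<^sub>F i in sequentially. \<forall>x\<in>B. dist (P i x) (u x) < e"
    proof eventually_elim
      case (elim i)
      show ?case
      proof
        fix x assume x: "x \<in> B"
        then obtain c where c: "c \<in> C" "dist c x < d" using C(3) by auto
        have cB: "c \<in> B" using c(1) C(1) by blast
        have "L * norm (x - c) \<le> L * d"
          using c(2) L by (intro mult_left_mono) (auto simp: dist_norm norm_minus_commute)
        then have "\<bar>P i x - P i c\<bar> \<le> e / 3" "\<bar>u x - u c\<bar> \<le> e / 3"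
          using elim(1) ul[OF x cB] x cB Ld by fastforce+
        moreover have "\<bar>P i c - u c\<bar> < e / 3" using elim(2) c(1) by (auto simp: dist_real_def)
        ultimately show "dist (P i x) (u x) < e" unfolding dist_real_def by linarith
      qed
    qed
  qed
qed

text \<open>A local form of the Arzela-Ascoli theorem: a diagonal sequence converges on a countable
  dense set, and the local Lipschitz bounds carry the convergence over to all of U.\<close>

lemma locally_lipschitz_subsequence:
  fixes P :: "nat \<Rightarrow> 'a::euclidean_space \<Rightarrow> real"
  assumes U: "open U"
    and loc: "\<And>x. x \<in> U \<Longrightarrow> \<exists>r>0. \<exists>A. \<exists>L\<ge>0. cball x r \<subseteq> U \<and>
      (\<forall>\<^sub>F i in sequentially. (\<forall>y\<in>cball x r. \<bar>P i y\<bar> \<le> A) \<and> (\<forall>y\<in>cball x r. \<forall>z\<in>cball x r. \<bar>P i y - P i z\<bar> \<le> L * norm (y - z)))"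
  obtains k u where "strict_mono (k :: nat \<Rightarrow> nat)"
    "\<And>x. x \<in> U \<Longrightarrow> \<exists>r>0. \<exists>L. cball x r \<subseteq> U \<and> uniform_limit (cball x r) (\<lambda>i. P (k i)) u sequentially
      \<and> (\<forall>y\<in>cball x r. \<forall>z\<in>cball x r. \<bar>u y - u z\<bar> \<le> L * norm (y - z))"
proof -
  obtain R where R: "countable R" "R \<subseteq> U" "U \<subseteq> closure R" using separable by blast
  have "\<exists>K>0. \<forall>i. \<bar>P i x\<bar> \<le> K" if "x \<in> U" for x
  proof -
    obtain r A L where "r > 0" "\<forall>\<^sub>F i in sequentially. (\<forall>y\<in>cball x r. \<bar>P i y\<bar> \<le> A) \<and>
      (\<forall>y\<in>cball x r. \<forall>z\<in>cball x r. \<bar>P i y - P i z\<bar> \<le> L * norm (y - z))"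
      using loc[OF \<open>x \<in> U\<close>] by blast
    then have "\<forall>\<^sub>F i in sequentially. norm (P i x) \<le> A" by (auto elim: eventually_mono)
    then have "Bseq (\<lambda>i. P i x)" by (rule BfunI)
    then obtain K where "K > 0" "\<forall>i. norm (P i x) \<le> K" by (rule BseqE) blast
    then show ?thesis by auto
  qed
  then obtain K where K: "\<And>x. x \<in> U \<Longrightarrow> K x > 0" "\<And>x i. x \<in> U \<Longrightarrow> \<bar>P i x\<bar> \<le> K x" by metis
  \<comment> \<open>The diagonal argument works with one bound common to all points, hence the
    division by the bound at each point.\<close>
  have K1: "norm (P i x / K x) \<le> 1" if "x \<in> R" for i x
    using K(1)[of x] K(2)[of x i] R(2) that by auto
  obtain k where k: "strict_mono (k :: nat \<Rightarrow> nat)" "\<And>x. x \<in> R \<Longrightarrow> \<exists>l. (\<lambda>i. P (k i) x / K x) \<longlonglongrightarrow> l"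
    using function_convergent_subsequence[OF R(1), of "\<lambda>i x. P i x / K x" 1] K1 by metis
  have convR: "convergent (\<lambda>i. P (k i) x)" if "x \<in> R" for x
  proof -
    obtain l where "(\<lambda>i. P (k i) x / K x) \<longlonglongrightarrow> l" using k(2)[OF \<open>x \<in> R\<close>] by blast
    then have "(\<lambda>i. K x * (P (k i) x / K x)) \<longlonglongrightarrow> K x * l" by (intro tendsto_intros)
    moreover have "K x \<noteq> 0" using K(1)[of x] R(2) \<open>x \<in> R\<close> by auto
    ultimately show ?thesis by (auto simp: convergent_def)
  qed
  have lock: "\<exists>r>0. \<exists>L\<ge>0. cball x r \<subseteq> U \<and>
      (\<forall>\<^sub>F i in sequentially. \<forall>y\<in>cball x r. \<forall>z\<in>cball x r. \<bar>P (k i) y - P (k i) z\<bar> \<le> L * norm (y - z))"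
    if x: "x \<in> U" for x
  proof -
    obtain r A L where r: "r > 0" "L \<ge> 0" "cball x r \<subseteq> U"
      and ev: "\<forall>\<^sub>F i in sequentially. (\<forall>y\<in>cball x r. \<bar>P i y\<bar> \<le> A) \<and>
      (\<forall>y\<in>cball x r. \<forall>z\<in>cball x r. \<bar>P i y - P i z\<bar> \<le> L * norm (y - z))"
      using loc[OF x] by blast
    have "\<forall>\<^sub>F i in sequentially. (\<forall>y\<in>cball x r. \<bar>P (k i) y\<bar> \<le> A) \<and>
      (\<forall>y\<in>cball x r. \<forall>z\<in>cball x r. \<bar>P (k i) y - P (k i) z\<bar> \<le> L * norm (y - z))"
      by (rule eventually_subseq[OF k(1) ev])
    then have "\<forall>\<^sub>F i in sequentially. \<forall>y\<in>cball x r. \<forall>z\<in>cball x r. \<bar>P (k i) y - P (k i) z\<bar> \<le> L * norm (y - z)"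
      by (auto elim: eventually_mono)
    then show ?thesis using r by blast
  qed
  have conv: "convergent (\<lambda>i. P (k i) x)" if x: "x \<in> U" for x
  proof (rule Cauchy_convergent, rule metric_CauchyI)
    fix e :: real assume e: "e > 0"
    obtain r L where r: "r > 0" "L \<ge> 0" "cball x r \<subseteq> U"
      and ev: "\<forall>\<^sub>F i in sequentially. \<forall>y\<in>cball x r. \<forall>z\<in>cball x r. \<bar>P (k i) y - P (k i) z\<bar> \<le> L * norm (y - z)"
      using lock[OF x] by blast
    define d where "d = min r (e / (3 * (L + 1)))"
    have d: "d > 0" "d \<le> r" "d \<le> e / (3 * (L + 1))" using e r by (auto simp: d_def)
    obtain z where z: "z \<in> R" "dist z x < d" using closure_approachable x R(3) d(1) by blast
    have "L * norm (x - z) \<le> (L + 1) * (e / (3 * (L + 1)))"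
      using z(2) d(3) r(2) by (intro mult_mono) (auto simp: dist_norm norm_minus_commute)
    moreover have "(L + 1) * (e / (3 * (L + 1))) = e / 3" using r(2) by (simp add: divide_simps)
    ultimately have Lz: "L * norm (x - z) \<le> e / 3" by linarith
    have zb: "z \<in> cball x r" using z(2) d(2) by (auto simp: dist_commute)
    obtain M where M: "\<And>i. i \<ge> M \<Longrightarrow> \<forall>y\<in>cball x r. \<forall>z\<in>cball x r. \<bar>P (k i) y - P (k i) z\<bar> \<le> L * norm (y - z)"
      using ev unfolding eventually_sequentially by blast
    have "Cauchy (\<lambda>i. P (k i) z)" by (rule convergent_Cauchy[OF convR[OF z(1)]])
    then obtain M' where M': "\<forall>m\<ge>M'. \<forall>n\<ge>M'. dist (P (k m) z) (P (k n) z) < e / 3"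
      using e metric_CauchyD[of "\<lambda>i. P (k i) z" "e/3"] by auto
    have "dist (P (k m) x) (P (k n) x) < e" if mn: "m \<ge> max M M'" "n \<ge> max M M'" for m n
    proof -
      have xb: "x \<in> cball x r" using r(1) by simp
      have "\<bar>P (k m) x - P (k m) z\<bar> \<le> e / 3" "\<bar>P (k n) x - P (k n) z\<bar> \<le> e / 3"
        using M[of m] M[of n] mn xb zb Lz by fastforce+
      moreover have "\<bar>P (k m) z - P (k n) z\<bar> < e / 3" using M' mn by (auto simp: dist_real_def)
      ultimately show ?thesis unfolding dist_real_def by linarith
    qed
    then show "\<exists>M. \<forall>m\<ge>M. \<forall>n\<ge>M. dist (P (k m) x) (P (k n) x) < e" by blast
  qed
  define u where "u x = lim (\<lambda>i. P (k i) x)" for x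
  have lim: "(\<lambda>i. P (k i) x) \<longlonglongrightarrow> u x" if "x \<in> U" for x
    using conv[OF that] by (simp add: u_def convergent_LIMSEQ_iff)
  show thesis
  proof (rule that[OF k(1)])
    fix x assume x: "x \<in> U"
    obtain r L where r: "r > 0" "L \<ge> 0" "cball x r \<subseteq> U"
      and ev: "\<forall>\<^sub>F i in sequentially. \<forall>y\<in>cball x r. \<forall>z\<in>cball x r. \<bar>P (k i) y - P (k i) z\<bar> \<le> L * norm (y - z)"
      using lock[OF x] by blast
    have lx: "(\<lambda>i. P (k i) y) \<longlonglongrightarrow> u y" if "y \<in> cball x r" for y using lim r(3) that by blast
    note ul = uniform_limit_of_pointwise[OF compact_cball r(2) ev lx]
    show "\<exists>r>0. \<exists>L. cball x r \<subseteq> U \<and> uniform_limit (cball x r) (\<lambda>i. P (k i)) u sequentially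
      \<and> (\<forall>y\<in>cball x r. \<forall>z\<in>cball x r. \<bar>u y - u z\<bar> \<le> L * norm (y - z))"
      using r ul by blast
  qed
qed

text \<open>For the Hardy potential and for |x|^(-2) alike: \<open>bdist\<close> and
  \<open>norm\<close> both have Lipschitz constant 1.\<close>

lemma lipschitz_inverse_square:
  fixes d :: "'a::real_normed_vector \<Rightarrow> real"
  assumes m: "m > 0" "\<And>y. y \<in> B \<Longrightarrow> m \<le> d y" and d: "\<And>y z. \<bar>d y - d z\<bar> \<le> norm (y - z)"
    and yz: "y \<in> B" "z \<in> B"
  shows "\<bar>1 / (d y)\<^sup>2 - 1 / (d z)\<^sup>2\<bar> \<le> 2 / m ^ 3 * norm (y - z)"
proof -
  let ?s = "d y" and ?t = "d z"
  have p: "m \<le> ?s" "m \<le> ?t" "?s > 0" "?t > 0" using m(1) m(2)[OF yz(1)] m(2)[OF yz(2)] by auto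
  have e: "1 / ?s\<^sup>2 - 1 / ?t\<^sup>2 = (?t - ?s) * (1 / (?s\<^sup>2 * ?t) + 1 / (?s * ?t\<^sup>2))"
    using p by (simp add: field_simps power2_eq_square)
  have b: "1 / (?s\<^sup>2 * ?t) \<le> 1 / m ^ 3" "1 / (?s * ?t\<^sup>2) \<le> 1 / m ^ 3"
  proof -
    have "m\<^sup>2 * m \<le> ?s\<^sup>2 * ?t" "m * m\<^sup>2 \<le> ?s * ?t\<^sup>2"
      using p m by (intro mult_mono power_mono; simp)+
    then have "m ^ 3 \<le> ?s\<^sup>2 * ?t" "m ^ 3 \<le> ?s * ?t\<^sup>2" by (simp_all add: power2_eq_square power3_eq_cube)
    then show "1 / (?s\<^sup>2 * ?t) \<le> 1 / m ^ 3" "1 / (?s * ?t\<^sup>2) \<le> 1 / m ^ 3"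
      using m(1) p by (auto intro!: divide_left_mono)
  qed
  have "\<bar>1 / ?s\<^sup>2 - 1 / ?t\<^sup>2\<bar> = \<bar>?t - ?s\<bar> * (1 / (?s\<^sup>2 * ?t) + 1 / (?s * ?t\<^sup>2))"
    unfolding e abs_mult using p by simp
  also have "\<dots> \<le> norm (y - z) * (1 / m ^ 3 + 1 / m ^ 3)"
    using d[of z y] b p by (intro mult_mono add_mono) (auto simp: norm_minus_commute)
  finally show ?thesis by (simp add: mult.commute)
qed

lemma lipschitz_product:
  fixes f g :: "'a::real_normed_vector \<Rightarrow> real"
  assumes "\<And>y z. y \<in> B \<Longrightarrow> z \<in> B \<Longrightarrow> \<bar>f y - f z\<bar> \<le> L * norm (y - z)"
    "\<And>y z. y \<in> B \<Longrightarrow> z \<in> B \<Longrightarrow> \<bar>g y - g z\<bar> \<le> M * norm (y - z)"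
    "\<And>y. y \<in> B \<Longrightarrow> \<bar>f y\<bar> \<le> A" "\<And>y. y \<in> B \<Longrightarrow> \<bar>g y\<bar> \<le> C" "y \<in> B" "z \<in> B" "0 \<le> A" "0 \<le> C"
  shows "\<bar>f y * g y - f z * g z\<bar> \<le> (A * M + L * C) * norm (y - z)"
proof -
  have "\<bar>f y * g y - f z * g z\<bar> = \<bar>f y * (g y - g z) + (f y - f z) * g z\<bar>" by (simp add: algebra_simps)
  also have "\<dots> \<le> \<bar>f y\<bar> * \<bar>g y - g z\<bar> + \<bar>f y - f z\<bar> * \<bar>g z\<bar>"
    using abs_triangle_ineq[of "f y * (g y - g z)" "(f y - f z) * g z"] by (simp add: abs_mult)
  also have "\<dots> \<le> A * (M * norm (y - z)) + (L * norm (y - z)) * C"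
    using assms order_trans[OF abs_ge_zero assms(1)[OF assms(5,6)]]
    by (intro add_mono mult_mono) auto
  finally show ?thesis by (simp add: algebra_simps)
qed

lemma lipschitz_of_partials:
  fixes u :: "'a::euclidean_space \<Rightarrow> real"
  assumes d: "\<And>x. x \<in> cball c r \<Longrightarrow> u differentiable (at x)"
    and G: "\<And>x b. x \<in> cball c r \<Longrightarrow> b \<in> Basis \<Longrightarrow> \<bar>dd b u x\<bar> \<le> G"
    and yz: "y \<in> cball c r" "z \<in> cball c r"
  shows "\<bar>u y - u z\<bar> \<le> real DIM('a) * G * norm (y - z)"
proof -
  have "norm (u y - u z) \<le> (real DIM('a) * G) * norm (y - z)"
  proof (rule differentiable_bound[OF convex_cball])
    fix x assume x: "x \<in> cball c r"
    have "(u has_derivative frechet_derivative u (at x)) (at x)"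
      using d[OF x] frechet_derivative_works by blast
    then show "(u has_derivative frechet_derivative u (at x)) (at x within cball c r)"
      by (rule has_derivative_at_withinI)
    show "onorm (frechet_derivative u (at x)) \<le> real DIM('a) * G"
    proof (rule onorm_le)
      fix h :: 'a
      have "\<bar>dd h u x\<bar> \<le> norm h * (\<Sum>b\<in>Basis. \<bar>dd b u x\<bar>)"
        unfolding dd_Basis_sum[OF d[OF x], of h] by (rule abs_sum_inner_le)
      also have "\<dots> \<le> norm h * (\<Sum>b\<in>(Basis::'a set). G)" by (intro mult_left_mono sum_mono G x) auto
      finally show "norm (dd h u x) \<le> real DIM('a) * G * norm h" by (simp add: mult_ac)
    qed
  qed (use yz in auto)
  then show ?thesis by simp
qed

text \<open>The error bound has the shape that arises from an equation whose right-hand side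
  contains the solution itself: a null sequence plus a multiple of the distance to the
  limit.\<close>

lemma uniform_limit_dominated:
  fixes f g :: "nat \<Rightarrow> 'a \<Rightarrow> real"
  assumes h: "uniform_limit B h u sequentially" and a: "a \<longlonglongrightarrow> 0" and c: "(c::real) \<ge> 0"
    and bd: "\<forall>\<^sub>F i in sequentially. \<forall>y\<in>B. \<bar>f i y - F y\<bar> \<le> a i + c * \<bar>h i y - u y\<bar>"
  shows "uniform_limit B f F sequentially"
  unfolding uniform_limit_iff
proof (intro allI impI)
  fix e :: real assume e: "e > 0"
  have "\<forall>\<^sub>F i in sequentially. a i < e / 2" using order_tendstoD(2)[OF a, of "e / 2"] e by simp
  moreover have "\<forall>\<^sub>F i in sequentially. \<forall>y\<in>B. dist (h i y) (u y) < e / (2 * (c + 1))"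
    using e c by (intro uniform_limitD[OF h]) auto
  ultimately show "\<forall>\<^sub>F i in sequentially. \<forall>y\<in>B. dist (f i y) (F y) < e"
    using bd
  proof eventually_elim
    case (elim i)
    show ?case
    proof
      fix y assume y: "y \<in> B"
      have "c * \<bar>h i y - u y\<bar> \<le> (c + 1) * (e / (2 * (c + 1)))"
        using elim(2) y c by (intro mult_mono) (auto simp: dist_real_def less_imp_le)
      moreover have "(c + 1) * (e / (2 * (c + 1))) = e / 2" using c by (simp add: divide_simps)
      moreover have "\<bar>f i y - F y\<bar> \<le> a i + c * \<bar>h i y - u y\<bar>" using elim(3) y by blast
      ultimately show "dist (f i y) (F y) < e" using elim(1) unfolding dist_real_def by linarith
    qed
  qed
qed

lemma continuous_on_compact_bound:
  fixes g :: "'a::topological_space \<Rightarrow> real"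
  assumes "compact B" "continuous_on B g"
  obtains C where "C \<ge> 0" "\<And>y. y \<in> B \<Longrightarrow> \<bar>g y\<bar> \<le> C"
proof -
  obtain C where "\<forall>y\<in>g ` B. norm y \<le> C"
    using compact_imp_bounded[OF compact_continuous_image[OF assms(2,1)]] unfolding bounded_iff by blast
  then have "\<bar>g y\<bar> \<le> \<bar>C\<bar>" if "y \<in> B" for y using that by fastforce
  then show thesis using that[of "\<bar>C\<bar>"] by auto
qed

section \<open>Compactness of the approximate eigenfunctions\<close>

context cone
begin

definition exhaust :: "nat \<Rightarrow> 'a set" where
  "exhaust i = {w \<in> sphere 0 1. inverse (real (Suc i)) \<le> infdist w (- \<Omega>)}"

lemma exhaust_compact: "compact (exhaust i)"
proof -
  have "exhaust i = sphere 0 1 \<inter> {w. inverse (real (Suc i)) \<le> infdist w (- \<Omega>)}" by (auto simp: exhaust_def)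
  then show ?thesis
    by (auto intro!: compact_Int_closed closed_Collect_le continuous_on_infdist continuous_intros)
qed

lemma exhaust_sub: "exhaust i \<subseteq> S"
proof
  fix w assume w: "w \<in> exhaust i"
  have "infdist w (- \<Omega>) > 0" using w by (auto simp: exhaust_def intro: less_le_trans[rotated])
  then have "w \<in> \<Omega>" by (cases "w \<in> \<Omega>") (auto simp: infdist_zero)
  then show "w \<in> S" using w by (auto simp: sgn_in_cone exhaust_def sgn_div_norm)
qed

text \<open>The distance to the complement of the open cone has a positive minimum on
  \<open>K\<close>, which exceeds 1 / (i + 1) for large \<open>i\<close>.\<close>

lemma exhaust_eventually:
  assumes K: "compact K" "K \<subseteq> S"
  shows "\<forall>\<^sub>F i in sequentially. K \<subseteq> exhaust i"
proof (cases "K = {}")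
  case False
  have c: "continuous_on K (\<lambda>w. infdist w (- \<Omega>))" by (intro continuous_on_infdist continuous_on_id)
  obtain w0 where w0: "w0 \<in> K" "\<And>w. w \<in> K \<Longrightarrow> infdist w0 (- \<Omega>) \<le> infdist w (- \<Omega>)"
    using continuous_attains_inf[OF K(1) False c] by blast
  have "w0 \<notin> - \<Omega>" using w0(1) K(2) S_cone by auto
  moreover have "closed (- \<Omega>)" "- \<Omega> \<noteq> {}" using open_cone cone_ne by (auto simp: closed_Compl)
  ultimately have "infdist w0 (- \<Omega>) > 0"
    using in_closed_iff_infdist_zero[of "- \<Omega>" w0] infdist_nonneg[of w0 "- \<Omega>"] by force
  from order_tendstoD(2)[OF LIMSEQ_inverse_real_of_nat this]
  show ?thesis
  proof eventually_elim
    case (elim i)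
    show ?case
    proof
      fix w assume w: "w \<in> K"
      then have "inverse (real (Suc i)) \<le> infdist w (- \<Omega>)" using w0(2)[OF w] elim by linarith
      then show "w \<in> exhaust i" using w K(2) S_sub by (auto simp: exhaust_def)
    qed
  qed
qed simp

text \<open>The i-th function belongs to \<open>exhaust i\<close> and the error 1 / (i + 1),
  normalised at \<open>w0\<close>. Its eigenvalue is at least \<sigma>; a test function whose
  Rayleigh quotient lies below l > \<sigma> is supported in \<open>exhaust i\<close> for large
  \<open>i\<close>, which forces \<open>\<Lambda> i < l\<close>.\<close>

lemma approximating_sequence:
  assumes n: "DIM('a) \<ge> 2" and w0: "w0 \<in> S"
    and \<sigma>: "\<And>f. f \<in> sphere_test_functions S \<Longrightarrow> \<sigma> * sint (\<lambda>w. (radial_ext f w)\<^sup>2) \<le> sform \<mu> f"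
    and \<sigma>': "\<And>l. l > \<sigma> \<Longrightarrow> \<exists>f\<in>sphere_test_functions S. sform \<mu> f < l * sint (\<lambda>w. (radial_ext f w)\<^sup>2)"
  obtains P \<Lambda> where "\<Lambda> \<longlonglongrightarrow> \<sigma>" "\<And>i k. Ck_on k (P i) (-{0})" "\<And>i x. x \<noteq> 0 \<Longrightarrow> 0 < P i x"
    "\<And>i x. P i (sgn x) = P i x" "\<And>i. P i w0 = 1"
    "\<And>B. compact B \<Longrightarrow> B \<subseteq> \<Omega> \<Longrightarrow> \<forall>\<^sub>F i in sequentially. \<forall>x\<in>B.
      \<bar>laplacian (P i) x - (hardy_potential \<Omega> \<mu> x - \<Lambda> i / (norm x)\<^sup>2) * P i x\<bar> \<le> inverse (real (Suc i)) / (norm x)\<^sup>2 * P i x"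
proof -
  let ?V = "hardy_potential \<Omega> \<mu>" and ?e = "\<lambda>i. inverse (real (Suc i))"
  define Q where "Q i \<Lambda> p \<longleftrightarrow> \<sigma> \<le> \<Lambda> \<and> poly_fun p \<and> (\<forall>w. norm w = 1 \<longrightarrow> 0 < p w) \<and>
    (\<forall>w\<in>exhaust i. \<bar>- sph_lap p w + (?V w - \<Lambda>) * p w\<bar> \<le> ?e i * p w) \<and>
    (\<forall>f\<in>sphere_test_functions S. (\<forall>w\<in>sphere 0 1. w \<notin> exhaust i \<longrightarrow> f w = 0) \<longrightarrow>
      \<Lambda> * sint (\<lambda>w. (radial_ext f w)\<^sup>2) \<le> sform \<mu> f)" for i \<Lambda> p
  have "\<exists>\<Lambda> p. Q i \<Lambda> p" for i
  proof -
    have e: "?e i > 0" by simp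
    show ?thesis
    proof (rule approximate_eigenfunction[OF n exhaust_compact[of i] exhaust_sub[of i] e \<sigma>])
      fix \<Lambda> p
      assume H: "\<sigma> \<le> \<Lambda>" "poly_fun p" "\<And>w. norm w = 1 \<Longrightarrow> 0 < p w"
        "\<And>w. w \<in> exhaust i \<Longrightarrow> \<bar>- sph_lap p w + (?V w - \<Lambda>) * p w\<bar> \<le> ?e i * p w"
        "\<And>f. f \<in> sphere_test_functions S \<Longrightarrow> (\<And>w. w \<in> sphere 0 1 \<Longrightarrow> w \<notin> exhaust i \<Longrightarrow> f w = 0) \<Longrightarrow>
          \<Lambda> * sint (\<lambda>w. (radial_ext f w)\<^sup>2) \<le> sform \<mu> f"
      show ?thesis
        unfolding Q_def
        by (intro exI[of _ \<Lambda>] exI[of _ p] conjI allI ballI impI, fact H(1), fact H(2), erule H(3), erule H(4))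
          (erule H(5), simp)
    qed
  qed
  then obtain \<Lambda> p where Q: "\<And>i. Q i (\<Lambda> i) (p i)" by metis
  have L: "\<sigma> \<le> \<Lambda> i" for i using Q[of i] by (simp only: Q_def)
  have p: "poly_fun (p i)" "norm w = 1 \<Longrightarrow> 0 < p i w" for i w using Q[of i] by (simp_all only: Q_def)
  have eq: "\<bar>- sph_lap (p i) w + (?V w - \<Lambda> i) * p i w\<bar> \<le> ?e i * p i w" if "w \<in> exhaust i" for i w
    using Q[of i] that by (simp only: Q_def)
  have up: "\<Lambda> i * sint (\<lambda>w. (radial_ext f w)\<^sup>2) \<le> sform \<mu> f"
    if "f \<in> sphere_test_functions S" "\<forall>w\<in>sphere 0 1. w \<notin> exhaust i \<longrightarrow> f w = 0" for i f
    using Q[of i] that by (simp only: Q_def)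
  have lim: "\<Lambda> \<longlonglongrightarrow> \<sigma>"
  proof (rule order_tendstoI)
    fix l assume "l < \<sigma>"
    then have "l < \<Lambda> i" for i using L[of i] by linarith
    then show "\<forall>\<^sub>F i in sequentially. l < \<Lambda> i" by simp
  next
    fix l assume "\<sigma> < l"
    then obtain f where f: "f \<in> sphere_test_functions S" "sform \<mu> f < l * sint (\<lambda>w. (radial_ext f w)\<^sup>2)"
      using \<sigma>' by blast
    obtain K where K: "compact K" "K \<subseteq> S" "\<And>w. w \<in> sphere 0 1 \<Longrightarrow> w \<notin> K \<Longrightarrow> f w = 0"
      "\<And>k. Ck_on k (radial_ext f) (-{0})" using sphere_test_functionsD[OF f(1)] by blast
    have I: "0 \<le> sint (\<lambda>w. (radial_ext f w)\<^sup>2)" unfolding sint_def by (intro integral_nonneg_AE) simp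
    from exhaust_eventually[OF K(1,2)] show "\<forall>\<^sub>F i in sequentially. \<Lambda> i < l"
    proof eventually_elim
      case (elim i)
      have "\<Lambda> i * sint (\<lambda>w. (radial_ext f w)\<^sup>2) \<le> sform \<mu> f"
        by (rule up[OF f(1)]) (use elim K(3) in blast)
      then have "\<Lambda> i * sint (\<lambda>w. (radial_ext f w)\<^sup>2) < l * sint (\<lambda>w. (radial_ext f w)\<^sup>2)" using f(2) by linarith
      then show ?case using I by (rule mult_right_less_imp_less)
    qed
  qed
  define q where "q i = (\<lambda>x. inverse (p i w0) * p i x)" for i
  have q: "poly_fun (q i)" for i unfolding q_def by (rule poly_fun_cmult[OF p(1)])
  have c: "inverse (p i w0) > 0" for i using p(2)[OF S_norm[OF w0]] by simp
  have Ck: "Ck_on k (radial_ext (q i)) (-{0})" for i k by (rule poly_fun_Ck[OF q])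
  have sl: "sph_lap (q i) w = inverse (p i w0) * sph_lap (p i) w" if "norm w = 1" for i w
    unfolding q_def using sph_lap_cmult[OF p(1)] that by auto
  have eqq: "\<bar>sph_lap (q i) w - (?V w - \<Lambda> i) * q i w\<bar> \<le> ?e i * q i w" if w: "w \<in> exhaust i" for i w
  proof -
    have n: "norm w = 1" using w by (simp add: exhaust_def)
    let ?t = "- sph_lap (p i) w + (?V w - \<Lambda> i) * p i w"
    have "sph_lap (q i) w - (?V w - \<Lambda> i) * q i w = inverse (p i w0) * - ?t"
      unfolding sl[OF n] by (simp add: q_def algebra_simps)
    then have "\<bar>sph_lap (q i) w - (?V w - \<Lambda> i) * q i w\<bar> = inverse (p i w0) * \<bar>?t\<bar>"
      using c[of i] by (simp only: abs_mult abs_of_pos abs_minus_cancel)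
    also have "\<dots> \<le> inverse (p i w0) * (?e i * p i w)" using c[of i] by (intro mult_left_mono eq w) auto
    finally show ?thesis by (simp add: q_def mult_ac)
  qed
  show thesis
  proof (rule that[OF lim, of "\<lambda>i. radial_ext (q i)"])
    show "Ck_on k (radial_ext (q i)) (-{0})" for i k by (rule Ck)
    show "0 < radial_ext (q i) x" if "x \<noteq> 0" for i x
      using c[of i] p(2)[OF norm_sgn_eq_1[OF that]] by (simp add: radial_ext_def q_def)
    show "radial_ext (q i) (sgn x) = radial_ext (q i) x" for i x
      by (cases "x = 0") (simp_all add: radial_ext_def sgn_div_norm)
    show "radial_ext (q i) w0 = 1" for i
      unfolding radial_ext_unit[OF S_norm[OF w0]] q_def using c[of i] by simp
    fix B assume B: "compact B" "B \<subseteq> \<Omega>"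
    have "compact (sgn ` B)"
      using B cone_sub by (intro compact_continuous_image continuous_intros) auto
    moreover have "sgn ` B \<subseteq> S" using B(2) by (auto simp: sgn_in_cone)
    ultimately have "\<forall>\<^sub>F i in sequentially. sgn ` B \<subseteq> exhaust i" by (rule exhaust_eventually)
    then show "\<forall>\<^sub>F i in sequentially. \<forall>x\<in>B.
      \<bar>laplacian (radial_ext (q i)) x - (?V x - \<Lambda> i / (norm x)\<^sup>2) * radial_ext (q i) x\<bar>
        \<le> ?e i / (norm x)\<^sup>2 * radial_ext (q i) x"
    proof eventually_elim
      case (elim i)
      show ?case
      proof
        fix x assume x: "x \<in> B"
        then have x0: "x \<noteq> 0" and xC: "x \<in> cone_over (sphere 0 1)" using B(2) cone_sub by (auto simp: cone_over_sphere)
        have s: "sgn x \<in> exhaust i" using elim x by blast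
        have l: "laplacian (radial_ext (q i)) x = sph_lap (q i) (sgn x) / (norm x)\<^sup>2"
          unfolding sph_lap_def
          by (rule radial_ext_laplacian_sgn[OF _ _ xC]) (simp_all only: cone_over_sphere Ck open_punctured)
        have r: "radial_ext (q i) x = q i (sgn x)" by (simp add: radial_ext_def)
        have "laplacian (radial_ext (q i)) x - (?V x - \<Lambda> i / (norm x)\<^sup>2) * radial_ext (q i) x =
            (sph_lap (q i) (sgn x) - (?V (sgn x) - \<Lambda> i) * q i (sgn x)) / (norm x)\<^sup>2"
          unfolding l r hardy_sgn[OF x0, of \<mu>] by (simp add: diff_divide_distrib left_diff_distrib)
        then have "\<bar>laplacian (radial_ext (q i)) x - (?V x - \<Lambda> i / (norm x)\<^sup>2) * radial_ext (q i) x\<bar> =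
            \<bar>sph_lap (q i) (sgn x) - (?V (sgn x) - \<Lambda> i) * q i (sgn x)\<bar> / (norm x)\<^sup>2" by simp
        also have "\<dots> \<le> (?e i * q i (sgn x)) / (norm x)\<^sup>2" by (intro divide_right_mono eqq s) simp
        finally show "\<bar>laplacian (radial_ext (q i)) x - (?V x - \<Lambda> i / (norm x)\<^sup>2) * radial_ext (q i) x\<bar>
          \<le> ?e i / (norm x)\<^sup>2 * radial_ext (q i) x" by (simp add: r)
      qed
    qed
  qed
qed

end

context cone
begin

text \<open>Harnack's inequality bounds the normalised functions also away from 0 on compact sets,
  so the limit is positive. \<open>conv_pair_regularity\<close> applies because the potential is
  locally Lipschitz in the cone, which makes the right-hand side of the limit equation
  Lipschitz.\<close>

lemma ground_state:
  assumes n: "DIM('a) \<ge> 2"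
    and \<sigma>: "\<And>f. f \<in> sphere_test_functions S \<Longrightarrow> \<sigma> * sint (\<lambda>w. (radial_ext f w)\<^sup>2) \<le> sform \<mu> f"
    and \<sigma>': "\<And>l. l > \<sigma> \<Longrightarrow> \<exists>f\<in>sphere_test_functions S. sform \<mu> f < l * sint (\<lambda>w. (radial_ext f w)\<^sup>2)"
  obtains \<phi> where "Ck_on 2 (radial_ext \<phi>) \<Omega>" "\<And>x. x \<in> \<Omega> \<Longrightarrow> 0 < radial_ext \<phi> x"
    "\<And>x. x \<in> \<Omega> \<Longrightarrow> laplacian (radial_ext \<phi>) x = (hardy_potential \<Omega> \<mu> x - \<sigma> / (norm x)\<^sup>2) * radial_ext \<phi> x"
proof -
  let ?V = "hardy_potential \<Omega> \<mu>" and ?e = "\<lambda>i. inverse (real (Suc i))"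
  obtain w0 where w0: "w0 \<in> S" using S_ne by blast
  show thesis
  proof (rule approximating_sequence[OF n w0 \<sigma> \<sigma>'])
    fix P \<Lambda>
    assume L: "\<Lambda> \<longlonglongrightarrow> \<sigma>" and Ck: "\<And>i k. Ck_on k (P i) (-{0})" and pos: "\<And>i x. x \<noteq> 0 \<Longrightarrow> 0 < P i x"
      and sgnP: "\<And>i x. P i (sgn x) = P i x" and P1: "\<And>i. P i w0 = 1"
      and lap: "\<And>B. compact B \<Longrightarrow> B \<subseteq> \<Omega> \<Longrightarrow> \<forall>\<^sub>F i in sequentially. \<forall>x\<in>B.
        \<bar>laplacian (P i) x - (?V x - \<Lambda> i / (norm x)\<^sup>2) * P i x\<bar> \<le> ?e i / (norm x)\<^sup>2 * P i x"
    have w0C: "w0 \<in> \<Omega>" using w0 S_cone by blast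
    have x0: "x \<noteq> 0" if "x \<in> \<Omega>" for x using cone_sub that by auto
    have CkB: "Ck_on k (P i) B" if "B \<subseteq> \<Omega>" for k i B
      by (rule Ck_on_subset[OF Ck]) (use cone_sub that in blast)
    have LB: "\<forall>\<^sub>F i in sequentially. \<bar>\<Lambda> i\<bar> < \<bar>\<sigma>\<bar> + 1"
      by (rule order_tendstoD(2)[OF tendsto_rabs[OF L]]) simp
    have cV: "continuous_on B ?V" if "B \<subseteq> \<Omega>" for B by (rule continuous_on_subset[OF continuous_on_hardy that])
    have cn: "continuous_on B (\<lambda>x. 1 / (norm x)\<^sup>2)" if "B \<subseteq> \<Omega>" for B
      using x0 that by (intro continuous_intros) auto
    have lapP: "\<exists>C\<ge>0. \<forall>\<^sub>F i in sequentially. \<forall>x\<in>B. \<bar>laplacian (P i) x\<bar> \<le> C * P i x"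
      if B: "compact B" "B \<subseteq> \<Omega>" for B
    proof -
      obtain C0 where C0: "C0 \<ge> 0" "\<And>y. y \<in> B \<Longrightarrow> \<bar>?V y\<bar> \<le> C0"
        using continuous_on_compact_bound[OF B(1) cV[OF B(2)]] by blast
      obtain C1 where C1: "C1 \<ge> 0" "\<And>y. y \<in> B \<Longrightarrow> \<bar>1 / (norm y)\<^sup>2\<bar> \<le> C1"
        using continuous_on_compact_bound[OF B(1) cn[OF B(2)]] by blast
      let ?C = "C0 + (\<bar>\<sigma>\<bar> + 1) * C1 + C1"
      have "\<forall>\<^sub>F i in sequentially. \<forall>x\<in>B. \<bar>laplacian (P i) x\<bar> \<le> ?C * P i x"
        using lap[OF B] LB
      proof eventually_elim
        case (elim i)
        show ?case
        proof
          fix x assume x: "x \<in> B"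
          have p: "0 < P i x" using pos x B(2) x0 by blast
          have "\<bar>?V x - \<Lambda> i / (norm x)\<^sup>2\<bar> \<le> \<bar>?V x\<bar> + \<bar>\<Lambda> i\<bar> * \<bar>1 / (norm x)\<^sup>2\<bar>"
            using abs_triangle_ineq4[of "?V x" "\<Lambda> i / (norm x)\<^sup>2"] by (simp add: abs_mult[symmetric])
          also have "\<dots> \<le> C0 + (\<bar>\<sigma>\<bar> + 1) * C1"
            using C0(2)[OF x] C1(2)[OF x] elim(2) by (intro add_mono mult_mono) auto
          finally have 1: "\<bar>?V x - \<Lambda> i / (norm x)\<^sup>2\<bar> * P i x \<le> (C0 + (\<bar>\<sigma>\<bar> + 1) * C1) * P i x"
            using p by (intro mult_right_mono) auto
          have "?e i * (1 / (norm x)\<^sup>2) \<le> 1 * C1"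
            using C1(2)[OF x] by (intro mult_mono) (auto simp: field_simps)
          then have 2: "?e i / (norm x)\<^sup>2 * P i x \<le> C1 * P i x"
            using p by (intro mult_right_mono) auto
          have "\<bar>laplacian (P i) x\<bar> \<le> \<bar>(?V x - \<Lambda> i / (norm x)\<^sup>2) * P i x\<bar> + ?e i / (norm x)\<^sup>2 * P i x"
            using bspec[OF elim(1) x] by linarith
          also have "\<dots> = \<bar>?V x - \<Lambda> i / (norm x)\<^sup>2\<bar> * P i x + ?e i / (norm x)\<^sup>2 * P i x"
            using p by (simp add: abs_mult)
          also have "\<dots> \<le> (C0 + (\<bar>\<sigma>\<bar> + 1) * C1) * P i x + C1 * P i x" by (intro add_mono 1 2)
          finally show "\<bar>laplacian (P i) x\<bar> \<le> ?C * P i x" by (simp only: distrib_right)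
        qed
      qed
      moreover have "?C \<ge> 0" using C0(1) C1(1) by simp
      ultimately show ?thesis by blast
    qed
    have har: "\<exists>H>0. \<forall>\<^sub>F i in sequentially. \<forall>x\<in>B. \<forall>y\<in>B. P i x \<le> H * P i y"
      if B: "compact B" "B \<subseteq> \<Omega>" for B
    proof (rule harnack_chain[OF open_cone _ B])
      show "connected \<Omega>" by (rule connected_cone_over[OF S_conn S_sub])
      show "\<forall>\<^sub>F i in sequentially. \<forall>x\<in>\<Omega>. 0 < P i x" using pos x0 by simp
      fix x assume x: "x \<in> \<Omega>"
      obtain d where d: "d > 0" "cball x d \<subseteq> \<Omega>" using open_cone x open_contains_cball by blast
      obtain C where C: "C \<ge> 0" "\<forall>\<^sub>F i in sequentially. \<forall>y\<in>cball x d. \<bar>laplacian (P i) y\<bar> \<le> C * P i y"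
        using lapP[OF compact_cball d(2)] by blast
      have d2: "d / 2 > 0" using d(1) by simp
      obtain r H where r: "r > 0" "r < d / 2"
        and H: "\<And>(u::'a \<Rightarrow> real) x y. Ck_on 2 u (ball x (2*(d / 2))) \<Longrightarrow>
        (\<And>y. y \<in> ball x (2*(d / 2)) \<Longrightarrow> 0 < u y \<and> \<bar>laplacian u y\<bar> \<le> C * u y) \<Longrightarrow> y \<in> ball x r \<Longrightarrow>
        u y \<le> H * u x \<and> u x \<le> H * u y"
        using harnack_ball[OF C(1) d2] by metis
      have bs: "ball x (2*(d/2)) \<subseteq> cball x d" by auto
      have "\<forall>\<^sub>F i in sequentially. \<forall>y\<in>ball x r. P i y \<le> H * P i x \<and> P i x \<le> H * P i y"
        using C(2)
      proof eventually_elim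
        case (elim i)
        show ?case
        proof
          fix y assume y: "y \<in> ball x r"
          show "P i y \<le> H * P i x \<and> P i x \<le> H * P i y"
          proof (rule H[OF _ _ y])
            show "Ck_on 2 (P i) (ball x (2*(d/2)))" by (rule CkB) (use bs d(2) in blast)
            show "0 < P i y \<and> \<bar>laplacian (P i) y\<bar> \<le> C * P i y" if "y \<in> ball x (2*(d/2))" for y
            proof -
              have "y \<in> cball x d" using that bs by blast
              then show ?thesis using elim pos[of y i] x0[of y] d(2) by blast
            qed
          qed
        qed
      qed
      then show "\<exists>r>0. \<exists>H. \<forall>\<^sub>F i in sequentially. \<forall>y\<in>ball x r. P i y \<le> H * P i x \<and> P i x \<le> H * P i y"
        using r(1) by blast
    qed
    have bd: "\<exists>H>0. \<forall>\<^sub>F i in sequentially. \<forall>x\<in>B. P i x \<le> H \<and> 1 \<le> H * P i x"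
      if B: "compact B" "B \<subseteq> \<Omega>" for B
    proof -
      \<comment> \<open>Joining \<open>w0\<close> to the compact set turns comparability of values
        into bounds from both sides, because \<open>P i w0 = 1\<close>.\<close>
      have "compact (insert w0 B)" "insert w0 B \<subseteq> \<Omega>" using B w0C by auto
      from har[OF this] obtain H where H: "H > 0" "\<forall>\<^sub>F i in sequentially. \<forall>x\<in>insert w0 B. \<forall>y\<in>insert w0 B. P i x \<le> H * P i y" by blast
      from H(2) have "\<forall>\<^sub>F i in sequentially. \<forall>x\<in>B. P i x \<le> H \<and> 1 \<le> H * P i x"
      proof eventually_elim
        case (elim i)
        show ?case
        proof
          fix x assume "x \<in> B"
          then have "P i x \<le> H * P i w0" "P i w0 \<le> H * P i x" using elim by blast+
          then show "P i x \<le> H \<and> 1 \<le> H * P i x" by (simp add: P1)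
        qed
      qed
      then show ?thesis using H(1) by blast
    qed
    have loc: "\<exists>r>0. \<exists>A. \<exists>L\<ge>0. cball x r \<subseteq> \<Omega> \<and>
        (\<forall>\<^sub>F i in sequentially. (\<forall>y\<in>cball x r. \<bar>P i y\<bar> \<le> A) \<and> (\<forall>y\<in>cball x r. \<forall>z\<in>cball x r. \<bar>P i y - P i z\<bar> \<le> L * norm (y - z)))"
      if x: "x \<in> \<Omega>" for x
    proof -
      obtain d where d: "d > 0" "cball x d \<subseteq> \<Omega>" using open_cone x open_contains_cball by blast
      obtain C where C: "C \<ge> 0" "\<forall>\<^sub>F i in sequentially. \<forall>y\<in>cball x d. \<bar>laplacian (P i) y\<bar> \<le> C * P i y"
        using lapP[OF compact_cball d(2)] by blast
      obtain H where H: "H > 0" "\<forall>\<^sub>F i in sequentially. \<forall>y\<in>cball x d. P i y \<le> H \<and> 1 \<le> H * P i y"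
        using bd[OF compact_cball d(2)] by blast
      have d2: "d / 2 > 0" using d(1) by simp
      have sub: "cball y (d/2) \<subseteq> cball x d" if "y \<in> cball x (d/2)" for y
      proof
        fix z assume "z \<in> cball y (d/2)"
        then show "z \<in> cball x d" using that dist_triangle[of x z y] by simp
      qed
      \<comment> \<open>The value of \<open>gradient_bound\<close> for |P i| \<le> H and |\<Delta>(P
        i)| \<le> C H on balls of radius d/2; these stay in \<open>cball x d\<close> when centred in
        \<open>cball x (d/2)\<close>.\<close>
      define G where "G = real DIM('a) * H / (d/2) + C * H * (d/2)"
      have G: "G \<ge> 0" using d(1) H(1) C(1) by (simp add: G_def)
      have "\<forall>\<^sub>F i in sequentially. (\<forall>y\<in>cball x (d/2). \<bar>P i y\<bar> \<le> H) \<and>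
        (\<forall>y\<in>cball x (d/2). \<forall>z\<in>cball x (d/2). \<bar>P i y - P i z\<bar> \<le> (real DIM('a) * G) * norm (y - z))"
        using C(2) H(2)
      proof eventually_elim
        case (elim i)
        have A: "\<bar>P i y\<bar> \<le> H" "\<bar>laplacian (P i) y\<bar> \<le> C * H" if y: "y \<in> cball x d" for y
        proof -
          have p: "0 < P i y" "P i y \<le> H" using pos[of y i] x0[of y] d(2) y elim(2) by blast+
          then show "\<bar>P i y\<bar> \<le> H" by simp
          have "\<bar>laplacian (P i) y\<bar> \<le> C * P i y" using elim(1) y by blast
          also have "\<dots> \<le> C * H" using p C(1) by (intro mult_left_mono)
          finally show "\<bar>laplacian (P i) y\<bar> \<le> C * H" .
        qed
        have dG: "\<bar>dd b (P i) y\<bar> \<le> G" if y: "y \<in> cball x (d/2)" and b: "b \<in> Basis" for y b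
          unfolding G_def
        proof (rule gradient_bound[OF open_cone CkB[OF subset_refl] _ d2 _ _ b])
          show "cball y (d/2) \<subseteq> \<Omega>" using sub[OF y] d(2) by blast
          show "\<bar>P i z\<bar> \<le> H" "\<bar>laplacian (P i) z\<bar> \<le> C * H" if "z \<in> cball y (d/2)" for z
            using A[of z] sub[OF y] that by blast+
        qed
        have df: "P i differentiable (at y)" if "y \<in> cball x (d/2)" for y
        proof -
          have "y \<in> cball x d" using that d(1) by auto
          then have "y \<in> -{0}" using d(2) cone_sub by blast
          then show ?thesis by (rule C2D(1)[OF Ck])
        qed
        have "\<bar>P i y - P i z\<bar> \<le> (real DIM('a) * G) * norm (y - z)"
          if "y \<in> cball x (d/2)" "z \<in> cball x (d/2)" for y z
          by (rule lipschitz_of_partials[OF df dG that])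
        moreover have "\<bar>P i y\<bar> \<le> H" if "y \<in> cball x (d/2)" for y using A(1)[of y] that d(1) by auto
        ultimately show ?case by blast
      qed
      moreover have "cball x (d/2) \<subseteq> \<Omega>" by (rule order_trans[OF _ d(2)]) (use d(1) in auto)
      moreover have "real DIM('a) * G \<ge> 0" using G by simp
      ultimately show ?thesis using d2 by blast
    qed
    obtain k u where k: "strict_mono (k :: nat \<Rightarrow> nat)"
      and u: "\<And>x. x \<in> \<Omega> \<Longrightarrow> \<exists>r>0. \<exists>L. cball x r \<subseteq> \<Omega> \<and> uniform_limit (cball x r) (\<lambda>i. P (k i)) u sequentially
        \<and> (\<forall>y\<in>cball x r. \<forall>z\<in>cball x r. \<bar>u y - u z\<bar> \<le> L * norm (y - z))"
      by (rule locally_lipschitz_subsequence[OF open_cone, of P]) (use loc in \<open>blast+\<close>)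
    have ulim: "(\<lambda>i. P (k i) x) \<longlonglongrightarrow> u x" if x: "x \<in> \<Omega>" for x
    proof -
      obtain r where "r > 0" "uniform_limit (cball x r) (\<lambda>i. P (k i)) u sequentially" using u[OF x] by blast
      then show ?thesis by (auto intro: tendsto_uniform_limitI)
    qed
    have ub: "\<exists>H>0. (\<forall>y\<in>B. u y \<le> H \<and> 1 \<le> H * u y) \<and> (\<forall>\<^sub>F i in sequentially. \<forall>y\<in>B. P (k i) y \<le> H)"
      if B: "compact B" "B \<subseteq> \<Omega>" for B
    proof -
      obtain H where H: "H > 0" "\<forall>\<^sub>F i in sequentially. \<forall>y\<in>B. P i y \<le> H \<and> 1 \<le> H * P i y" using bd[OF B] by blast
      from eventually_subseq[OF k H(2)]
      have ev: "\<forall>\<^sub>F i in sequentially. \<forall>y\<in>B. P (k i) y \<le> H \<and> 1 \<le> H * P (k i) y" .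
      have "u y \<le> H \<and> 1 \<le> H * u y" if y: "y \<in> B" for y
      proof
        have l: "(\<lambda>i. P (k i) y) \<longlonglongrightarrow> u y" using ulim y B(2) by blast
        show "u y \<le> H" by (rule tendsto_upperbound[OF l]) (use ev y in \<open>auto elim: eventually_mono\<close>)
        show "1 \<le> H * u y" by (rule tendsto_lowerbound[OF tendsto_mult_left[OF l]]) (use ev y in \<open>auto elim: eventually_mono\<close>)
      qed
      moreover have "\<forall>\<^sub>F i in sequentially. \<forall>y\<in>B. P (k i) y \<le> H" using ev by (auto elim: eventually_mono)
      ultimately show ?thesis using H(1) by blast
    qed
    have upos: "u x > 0" if x: "x \<in> \<Omega>" for x
    proof -
      obtain H where "H > 0" "1 \<le> H * u x" using ub[of "{x}"] x by auto
      then show ?thesis by (metis less_le_trans zero_less_mult_pos zero_less_one)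
    qed
    define F where "F x = (?V x - \<sigma> / (norm x)\<^sup>2) * u x" for x
    have reg: "\<exists>V us L. open V \<and> x \<in> V \<and> conv_pair us u F V \<and> (\<forall>y\<in>V. \<forall>z\<in>V. \<bar>F y - F z\<bar> \<le> L * norm (y - z))"
      if x: "x \<in> \<Omega>" for x
    proof -
      obtain r Lu where r: "r > 0" "cball x r \<subseteq> \<Omega>" and ul: "uniform_limit (cball x r) (\<lambda>i. P (k i)) u sequentially"
        and Lu: "\<And>y z. y \<in> cball x r \<Longrightarrow> z \<in> cball x r \<Longrightarrow> \<bar>u y - u z\<bar> \<le> Lu * norm (y - z)" using u[OF x] by blast
      let ?B = "cball x r"
      obtain C0 where C0: "C0 \<ge> 0" "\<And>y. y \<in> ?B \<Longrightarrow> \<bar>?V y\<bar> \<le> C0"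
        using continuous_on_compact_bound[OF compact_cball cV[OF r(2)]] by blast
      obtain C1 where C1: "C1 \<ge> 0" "\<And>y. y \<in> ?B \<Longrightarrow> \<bar>1 / (norm y)\<^sup>2\<bar> \<le> C1"
        using continuous_on_compact_bound[OF compact_cball cn[OF r(2)]] by blast
      obtain H where H: "H > 0" "\<And>y. y \<in> ?B \<Longrightarrow> u y \<le> H" "\<forall>\<^sub>F i in sequentially. \<forall>y\<in>?B. P (k i) y \<le> H"
        using ub[OF compact_cball r(2)] by blast
      have V0: "\<bar>?V y - \<sigma> * (1 / (norm y)\<^sup>2)\<bar> \<le> C0 + \<bar>\<sigma>\<bar> * C1" if "y \<in> ?B" for y
      proof -
        have "\<bar>\<sigma> * (1 / (norm y)\<^sup>2)\<bar> \<le> \<bar>\<sigma>\<bar> * C1" unfolding abs_mult using C1(2)[OF that] by (intro mult_left_mono) auto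
        then show ?thesis using C0(2)[OF that] by linarith
      qed
      define a where "a i = (?e (k i) + \<bar>\<Lambda> (k i) - \<sigma>\<bar>) * C1 * H" for i
      have "(\<lambda>i. (?e (k i) + \<bar>\<Lambda> (k i) - \<sigma>\<bar>) * C1 * H) \<longlonglongrightarrow> (0 + \<bar>\<sigma> - \<sigma>\<bar>) * C1 * H"
        by (intro tendsto_intros LIMSEQ_subseq_LIMSEQ[OF LIMSEQ_inverse_real_of_nat k, unfolded o_def]
            LIMSEQ_subseq_LIMSEQ[OF L k, unfolded o_def])
      then have a: "a \<longlonglongrightarrow> 0" by (simp add: a_def[abs_def])
      have ev: "\<forall>\<^sub>F i in sequentially. \<forall>y\<in>?B. \<bar>laplacian (P (k i)) y - F y\<bar> \<le> a i + (C0 + \<bar>\<sigma>\<bar> * C1) * \<bar>P (k i) y - u y\<bar>"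
        using eventually_subseq[OF k lap[OF compact_cball r(2)]] H(3)
      proof eventually_elim
        case (elim i)
        show ?case
        proof
          fix y assume y: "y \<in> ?B"
          let ?s = "1 / (norm y)\<^sup>2" and ?p = "P (k i) y" and ?l = "laplacian (P (k i)) y"
          have p: "0 < ?p" "?p \<le> H" using pos x0 r(2) y elim(2) by blast+
          have s: "0 \<le> ?s" "?s \<le> C1" using C1(2)[OF y] by auto
          have sp: "?s * ?p \<le> C1 * H" using s p C1(1) by (intro mult_mono) auto
          have 1: "\<bar>?l - (?V y - \<Lambda> (k i) * ?s) * ?p\<bar> \<le> ?e (k i) * (?s * ?p)"
            using bspec[OF elim(1) y] by simp
          also have "\<dots> \<le> ?e (k i) * (C1 * H)" by (intro mult_left_mono sp) simp
          finally have 1: "\<bar>?l - (?V y - \<Lambda> (k i) * ?s) * ?p\<bar> \<le> ?e (k i) * (C1 * H)" .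
          have 2: "\<bar>(\<Lambda> (k i) - \<sigma>) * (?s * ?p)\<bar> \<le> \<bar>\<Lambda> (k i) - \<sigma>\<bar> * (C1 * H)"
          proof -
            have "\<bar>?s * ?p\<bar> \<le> C1 * H" using sp s p by (simp add: abs_mult)
            then show ?thesis unfolding abs_mult[of "\<Lambda> (k i) - \<sigma>"] by (intro mult_left_mono) auto
          qed
          have 3: "\<bar>(?V y - \<sigma> * ?s) * (?p - u y)\<bar> \<le> (C0 + \<bar>\<sigma>\<bar> * C1) * \<bar>?p - u y\<bar>"
            unfolding abs_mult by (intro mult_right_mono V0 y) simp
          \<comment> \<open>Three errors: the defect in the approximate eigenvalue equation, the
            distance of the eigenvalue from \<sigma>, and the distance of the function from its
            limit. The first two make up \<open>a i\<close>.\<close>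
          have e: "?l - F y = (?l - (?V y - \<Lambda> (k i) * ?s) * ?p) - (\<Lambda> (k i) - \<sigma>) * (?s * ?p) + (?V y - \<sigma> * ?s) * (?p - u y)"
            unfolding F_def by (simp add: algebra_simps diff_divide_distrib)
          have ae: "a i = ?e (k i) * (C1 * H) + \<bar>\<Lambda> (k i) - \<sigma>\<bar> * (C1 * H)" by (simp add: a_def algebra_simps)
          show "\<bar>?l - F y\<bar> \<le> a i + (C0 + \<bar>\<sigma>\<bar> * C1) * \<bar>?p - u y\<bar>"
          proof -
            have "\<bar>a - b + c\<bar> \<le> A + B + C" if "\<bar>a\<bar> \<le> A" "\<bar>b\<bar> \<le> B" "\<bar>c\<bar> \<le> C" for a b c A B C :: real
              using that by linarith
            then show ?thesis unfolding e ae using 1 2 3 by blast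
          qed
        qed
      qed
      have c0: "C0 + \<bar>\<sigma>\<bar> * C1 \<ge> 0" using C0(1) C1(1) by simp
      have ulF: "uniform_limit ?B (\<lambda>i. laplacian (P (k i))) F sequentially"
        by (rule uniform_limit_dominated[OF ul a c0 ev])
      have cp: "conv_pair (\<lambda>i. P (k i)) u F (ball x r)"
        unfolding conv_pair_def
      proof (intro conjI allI)
        show "Ck_on 2 (P (k i)) (ball x r)" for i by (rule CkB) (use r(2) ball_subset_cball in blast)
        show "uniform_limit (ball x r) (\<lambda>i. P (k i)) u sequentially"
          "uniform_limit (ball x r) (\<lambda>i. laplacian (P (k i))) F sequentially"
          by (rule uniform_limit_on_subset[OF ul ball_subset_cball], rule uniform_limit_on_subset[OF ulF ball_subset_cball])
      qed
      obtain m where m: "m > 0" "\<And>y. y \<in> ?B \<Longrightarrow> m \<le> bdist \<Omega> y" "\<And>y. y \<in> ?B \<Longrightarrow> m \<le> norm y"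
      proof -
        have ne: "?B \<noteq> {}" using r(1) by simp
        obtain y1 where y1: "y1 \<in> ?B" "\<And>y. y \<in> ?B \<Longrightarrow> bdist \<Omega> y1 \<le> bdist \<Omega> y"
          using continuous_attains_inf[OF compact_cball ne continuous_on_bdist, of \<Omega>] by blast
        obtain y2 where y2: "y2 \<in> ?B" "\<And>y. y \<in> ?B \<Longrightarrow> norm y2 \<le> norm y"
          using continuous_attains_inf[OF compact_cball ne continuous_on_norm_id] by blast
        have y12: "y1 \<in> \<Omega>" "y2 \<in> \<Omega>" using y1(1) y2(1) r(2) by blast+
        show thesis
          by (rule that[of "min (bdist \<Omega> y1) (norm y2)"])
            (use bdist_pos[OF y12(1)] x0[OF y12(2)] y1(2) y2(2) in \<open>auto intro: min.coboundedI1 min.coboundedI2\<close>)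
      qed
      have lV: "\<bar>(?V y - \<sigma> * (1 / (norm y)\<^sup>2)) - (?V z - \<sigma> * (1 / (norm z)\<^sup>2))\<bar> \<le> ((\<bar>\<mu>\<bar> + \<bar>\<sigma>\<bar>) * (2 / m ^ 3)) * norm (y - z)"
        if y: "y \<in> ?B" and z: "z \<in> ?B" for y z
      proof -
        let ?b = "1 / (bdist \<Omega> y)\<^sup>2 - 1 / (bdist \<Omega> z)\<^sup>2" and ?c = "1 / (norm y)\<^sup>2 - 1 / (norm z)\<^sup>2"
        have b: "\<bar>?b\<bar> \<le> 2 / m ^ 3 * norm (y - z)"
          by (rule lipschitz_inverse_square[OF m(1,2) bdist_lipschitz y z])
        have c: "\<bar>?c\<bar> \<le> 2 / m ^ 3 * norm (y - z)"
          by (rule lipschitz_inverse_square[OF m(1,3) norm_triangle_ineq3 y z])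
        have "\<bar>\<mu> * ?b\<bar> \<le> \<bar>\<mu>\<bar> * (2 / m ^ 3 * norm (y - z))" "\<bar>\<sigma> * ?c\<bar> \<le> \<bar>\<sigma>\<bar> * (2 / m ^ 3 * norm (y - z))"
          unfolding abs_mult[of \<mu>] abs_mult[of \<sigma>] by (intro mult_left_mono b c; simp)+
        moreover have "(?V y - \<sigma> * (1 / (norm y)\<^sup>2)) - (?V z - \<sigma> * (1 / (norm z)\<^sup>2)) = - (\<mu> * ?b) - \<sigma> * ?c"
          by (simp add: hardy_potential_def right_diff_distrib)
        moreover have "((\<bar>\<mu>\<bar> + \<bar>\<sigma>\<bar>) * (2 / m ^ 3)) * norm (y - z) = \<bar>\<mu>\<bar> * (2 / m ^ 3 * norm (y - z)) + \<bar>\<sigma>\<bar> * (2 / m ^ 3 * norm (y - z))"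
          by (simp only: distrib_right mult.assoc)
        ultimately show ?thesis by linarith
      qed
      have uH: "\<bar>u y\<bar> \<le> H" if "y \<in> ?B" for y
        using H(2)[OF that] upos[of y] r(2) that by (simp add: subset_iff)
      have "\<bar>F y - F z\<bar> \<le> ((C0 + \<bar>\<sigma>\<bar> * C1) * Lu + ((\<bar>\<mu>\<bar> + \<bar>\<sigma>\<bar>) * (2 / m ^ 3)) * H) * norm (y - z)"
        if "y \<in> ball x r" "z \<in> ball x r" for y z
      proof -
        have yz: "y \<in> ?B" "z \<in> ?B" using that ball_subset_cball by blast+
        have "F y = (?V y - \<sigma> * (1 / (norm y)\<^sup>2)) * u y" "F z = (?V z - \<sigma> * (1 / (norm z)\<^sup>2)) * u z"
          by (simp_all add: F_def)
        then show ?thesis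
          using lipschitz_product[OF lV Lu V0 uH yz c0] H(1) by simp
      qed
      then show ?thesis using r(1) cp by (intro exI[of _ "ball x r"]) (auto intro!: exI)
    qed
    note R = conv_pair_regularity[where U=\<Omega>, OF reg, simplified]
    \<comment> \<open>Constancy along rays passes to the limit, so on the cone \<open>u\<close> is
      its own radial extension and can serve as \<phi>.\<close>
    have us: "radial_ext u x = u x" if x: "x \<in> \<Omega>" for x
    proof -
      have "(\<lambda>i. P (k i) (sgn x)) \<longlonglongrightarrow> u (sgn x)" by (rule ulim[OF cone_over_cone[OF x]])
      then show ?thesis using LIMSEQ_unique[OF ulim[OF x]] by (simp add: sgnP radial_ext_def)
    qed
    show thesis
    proof (rule that[of u])
      show "Ck_on 2 (radial_ext u) \<Omega>" by (rule Ck_on_cong[OF open_cone _ R(1)]) (use us in auto)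
      show "0 < radial_ext u x" if "x \<in> \<Omega>" for x using upos[OF that] us[OF that] by simp
      show "laplacian (radial_ext u) x = (?V x - \<sigma> / (norm x)\<^sup>2) * radial_ext u x" if x: "x \<in> \<Omega>" for x
      proof -
        have "laplacian (radial_ext u) x = laplacian u x" 
          using laplacian_cong_open[OF open_cone us[symmetric] R(1) x] by simp
        then show ?thesis using R(2)[OF x] us[OF x] by (simp add: F_def)
      qed
    qed
  qed
qed

end

section \<open>Subcriticality\<close>

text \<open>The divergence of (f^2 / v) \<nabla>v has integral 0; pointwise it is - U f^2 plus the
  product of gradients estimated by \<open>picone_pointwise\<close>.\<close>

lemma picone:
  fixes v f :: "'a::euclidean_space \<Rightarrow> real"
  assumes D: "open D" and v: "Ck_on 2 v D" "\<And>x. x \<in> D \<Longrightarrow> 0 < v x"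
    and U: "continuous_on D U" "\<And>x. x \<in> D \<Longrightarrow> laplacian v x = - U x * v x" and f: "f \<in> test_functions D"
  shows "(\<integral>x. wq D U f x \<partial>lborel) \<le> (\<integral>x. (norm (gradient f x))\<^sup>2 \<partial>lborel)"
proof -
  obtain K where K: "compact K" "K \<subseteq> D" "\<And>x. x \<notin> K \<Longrightarrow> f x = 0" "\<And>k. Ck_on k f UNIV"
    using test_functionsD[OF f] by blast
  note fe = form_eq[OF f D U(1)]
  define q where "q = (\<lambda>x. (f x * f x) / v x)"
  have fD: "Ck_on k f D" for k by (rule Ck_on_subset[OF K(4)]) simp
  have qC: "Ck_on (Suc 0) q D"
    unfolding q_def by (intro Ck_on_divide Ck_on_mult fD C2D(6)[OF v(1)] v(2) D)
  define X where "X b = (\<lambda>x. q x * dd b v x)" for b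
  have XC: "Ck_on (Suc 0) (X b) D" for b
    unfolding X_def by (intro Ck_on_mult D qC C2D(7)[OF v(1)])
  have Xz: "X b x = 0" if "x \<notin> K" for b x using K(3)[OF that] by (simp add: X_def q_def)
  note dX = integral_dd_eq_0_compact_support[OF D XC K(1,2) Xz]
  have dX0: "dd b (X b) x = 0" if "x \<notin> K" for b x
  proof -
    have "dd b (X b) x = dd b (\<lambda>_. 0) x"
      by (rule fun_cong[OF frechet_derivative_cong_open[of "-K"]]) (use that K(1) Xz compact_imp_closed in auto)
    then show ?thesis by (simp add: dd_const)
  qed
  have le: "wq D U f x + (\<Sum>b\<in>Basis. dd b (X b) x) \<le> (norm (gradient f x))\<^sup>2" for x
  proof (cases "x \<in> D")
    case True
    note dv = C2D(1)[OF v(1) True] and dq = C1D(1)[OF qC True] and ddv = C2D(2)[OF v(1) True]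
    have "(\<Sum>b\<in>Basis. dd b (X b) x) = (\<Sum>b\<in>Basis. q x * dd b (dd b v) x + dd b q x * dd b v x)"
      unfolding X_def by (rule sum.cong[OF refl]) (rule dd_mult[OF dq ddv])
    also have "\<dots> = q x * laplacian v x + gradient q x \<bullet> gradient v x"
      unfolding laplacian_eq[OF v(1) True] gradient_inner_gradient by (simp add: sum.distrib sum_distrib_left)
    also have "q x * laplacian v x = - wq D U f x"
      unfolding U(2)[OF True] using True v(2)[OF True] by (simp add: q_def wq_def power2_eq_square)
    finally show ?thesis
      using picone_pointwise[OF D True v(2) C1D(1)[OF fD True] dv] dq by (simp add: q_def)
  next
    case False
    then have "x \<notin> K" using K(2) by blast
    then show ?thesis using False by (simp add: dX0 wq_def)
  qed
  have i: "integrable lborel (\<lambda>x. \<Sum>b\<in>Basis. dd b (X b) x)"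
    by (intro Bochner_Integration.integrable_sum dX)
  have "(\<integral>x. wq D U f x \<partial>lborel) = (\<integral>x. wq D U f x + (\<Sum>b\<in>Basis. dd b (X b) x) \<partial>lborel)"
    using fe(2) i dX by (simp add: Bochner_Integration.integral_sum)
  also have "\<dots> \<le> (\<integral>x. (norm (gradient f x))\<^sup>2 \<partial>lborel)"
    by (rule integral_mono[OF Bochner_Integration.integrable_add[OF fe(2) i] fe(1) le])
  finally show ?thesis .
qed

text \<open>\<open>v\<close> is a positive solution for the potential V - W. Picone's inequality
  with W - V then says that the form of \<open>V\<close> dominates the integral of W f^2.\<close>

lemma subcriticalI:
  fixes v :: "'a::euclidean_space \<Rightarrow> real"
  assumes D: "open D" "D \<noteq> {}" and v: "Ck_on 2 v D" "\<And>x. x \<in> D \<Longrightarrow> 0 < v x"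
    and V: "continuous_on D V" and W: "continuous_on D W" "\<And>x. x \<in> D \<Longrightarrow> 0 < W x"
    and eq: "\<And>x. x \<in> D \<Longrightarrow> laplacian v x = (V x - W x) * v x"
  shows "subcritical D V"
proof -
  have le: "(\<integral>x. wq D W f x \<partial>lborel) \<le> form V D f" "integrable lborel (wq D W f)"
    if f: "f \<in> test_functions D" for f
  proof -
    have c: "continuous_on D (\<lambda>x. W x - V x)" by (intro continuous_intros V W)
    note iV = form_eq[OF f D(1) V] and iW = form_eq[OF f D(1) W(1)]
    have "wq D (\<lambda>x. W x - V x) f x = wq D W f x - wq D V f x" for x
      by (simp add: wq_def left_diff_distrib)
    then have "(\<integral>x. wq D (\<lambda>x. W x - V x) f x \<partial>lborel) = (\<integral>x. wq D W f x \<partial>lborel) - (\<integral>x. wq D V f x \<partial>lborel)"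
      using iV(2) iW(2) by simp
    moreover have "(\<integral>x. wq D (\<lambda>x. W x - V x) f x \<partial>lborel) \<le> (\<integral>x. (norm (gradient f x))\<^sup>2 \<partial>lborel)"
      by (rule picone[OF D(1) v c _ f]) (simp_all add: eq)
    ultimately show "(\<integral>x. wq D W f x \<partial>lborel) \<le> form V D f" using iV(3) by simp
    show "integrable lborel (wq D W f)" by (rule iW(2))
  qed
  have wi: "(\<lambda>x. indicator D x *\<^sub>R (W x * (f x)\<^sup>2)) = wq D W f" for f by (simp add: wq_def fun_eq_iff)
  have nn: "0 \<le> (\<integral>x. wq D W f x \<partial>lborel)" for f
    using W(2) by (intro integral_nonneg_AE AE_I2) (auto simp: wq_def less_imp_le)
  have "set_borel_measurable lborel D W"
    using borel_measurable_continuous_on_indicator[OF _ W(1)] D(1)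
    by (simp add: set_borel_measurable_def)
  moreover have "\<not> (AE x in lborel. x \<in> D \<longrightarrow> W x = 0)"
  proof
    assume "AE x in lborel. x \<in> D \<longrightarrow> W x = 0"
    then have "AE x in lborel. x \<notin> D" by eventually_elim (use W(2) in force)
    then show False using AE_notin_open[OF D(1)] D(2) by blast
  qed
  ultimately show ?thesis
    using le nn unfolding subcritical_def nonneg_op_def set_integrable_def set_lebesgue_integral_def wi[symmetric]
    by (intro conjI exI[of _ W] ballI) (blast intro: order_trans less_imp_le[OF W(2)])+
qed

section \<open>Solutions of power type in the cone\<close>

context cone
begin

text \<open>The exponent is left free: for the two roots of a (a + n - 2) = \<sigma> the correction
  to the potential drops out, and for other exponents it is an inverse-square term whose sign can be
  read off.\<close>

lemma laplacian_power_solution: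
  assumes \<phi>: "Ck_on 2 (radial_ext \<phi>) \<Omega>"
    and eq: "\<And>x. x \<in> \<Omega> \<Longrightarrow> laplacian (radial_ext \<phi>) x = (V x - \<sigma> / (norm x)\<^sup>2) * radial_ext \<phi> x"
    and x: "x \<in> \<Omega>"
  shows "laplacian (\<lambda>x. norm x powr a * radial_ext \<phi> x) x =
    (V x - (\<sigma> - a * (a + real DIM('a) - 2)) / (norm x)\<^sup>2) * (norm x powr a * radial_ext \<phi> x)"
proof -
  have x0: "norm x > 0" using x cone_sub by auto
  have "norm x powr a = norm x powr (a - 2) * (norm x)\<^sup>2"
    using x0 by (simp add: powr_diff powr_numeral)
  then show ?thesis
    unfolding laplacian_homogeneous[OF open_cone cone_sub \<phi> x] eq[OF x] using x0 by (simp add: field_simps)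
qed

lemma Ck_on_power_solution:
  assumes "Ck_on 2 (radial_ext \<phi>) \<Omega>"
  shows "Ck_on 2 (\<lambda>x. norm x powr a * radial_ext \<phi> x) \<Omega>"
  by (intro Ck_on_mult open_cone assms Ck_on_subset[OF Ck_on_norm_powr cone_sub])

end

theorem theorem3p1:
  fixes S \<Omega> :: "(real ^ 'n) set" and \<mu> :: real and n :: nat
  assumes "n = CARD('n)" and "n \<ge> 2"
    and "lipschitz_domain_in_sphere S"
    and "\<Omega> = cone_over S"
    and "ereal \<mu> \<le> hardy_const \<Omega>"
  shows "sigma_const S \<mu> > - \<infinity> \<and>
    (\<exists>\<sigma> \<gamma>p \<gamma>m :: real. \<exists>\<phi> up um :: real ^ 'n \<Rightarrow> real.
       sigma_const S \<mu> = ereal \<sigma> \<and>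
       - ((real n - 2)\<^sup>2 / 4) \<le> \<sigma> \<and>
       \<gamma>p = (2 - real n + sqrt ((real n - 2)\<^sup>2 + 4 * \<sigma>)) / 2 \<and>
       \<gamma>m = (2 - real n - sqrt ((real n - 2)\<^sup>2 + 4 * \<sigma>)) / 2 \<and>
       sphere_C2_on \<phi> S \<and>
       (\<forall>w\<in>S. \<phi> w > 0) \<and>
       (\<forall>w\<in>S. schroedinger_sphere (hardy_potential \<Omega> \<mu>) \<phi> w = \<sigma> * \<phi> w) \<and>
       up = (\<lambda>x. norm x powr \<gamma>p * \<phi> (x /\<^sub>R norm x)) \<and>
       um = (\<lambda>x. norm x powr \<gamma>m * \<phi> (x /\<^sub>R norm x)) \<and>
       positive_solution \<Omega> (hardy_potential \<Omega> \<mu>) up \<and>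
       positive_solution \<Omega> (hardy_potential \<Omega> \<mu>) um \<and>
       (\<sigma> > - ((real n - 2)\<^sup>2 / 4) \<longrightarrow>
          (\<forall>a b. (\<forall>x\<in>\<Omega>. a * up x + b * um x = 0) \<longrightarrow> a = 0 \<and> b = 0) \<and>
          subcritical \<Omega> (hardy_potential \<Omega> \<mu>)))"
proof -
  interpret cone S
    using assms(3) by unfold_locales (auto simp: lipschitz_domain_in_sphere_def)
  have dim: "DIM(real^'n) = n" using assms(1) by simp
  let ?V = "hardy_potential \<Omega> \<mu>" and ?m = "real n - 2"
  have low: "- (?m\<^sup>2 / 4) * sint (\<lambda>w. (radial_ext f w)\<^sup>2) \<le> sform \<mu> f" if "f \<in> sphere_test_functions S" for f
    using sform_lower_bound[OF _ that, of \<mu>] assms(4,5) unfolding dim by simp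
  obtain \<sigma> where \<sigma>: "sigma_const S \<mu> = ereal \<sigma>" "- (?m\<^sup>2 / 4) \<le> \<sigma>"
    and s1: "\<And>f. f \<in> sphere_test_functions S \<Longrightarrow> \<sigma> * sint (\<lambda>w. (radial_ext f w)\<^sup>2) \<le> sform \<mu> f"
    and s2: "\<And>l. l > \<sigma> \<Longrightarrow> \<exists>f\<in>sphere_test_functions S. sform \<mu> f < l * sint (\<lambda>w. (radial_ext f w)\<^sup>2)"
    using sigma_const_characterization[OF low] by blast
  have "DIM(real^'n) \<ge> 2" using assms(2) unfolding dim .
  from ground_state[OF this s1 s2]
  obtain \<phi> where \<phi>: "Ck_on 2 (radial_ext \<phi>) \<Omega>" "\<And>x. x \<in> \<Omega> \<Longrightarrow> 0 < radial_ext \<phi> x"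
    and eq: "\<And>x. x \<in> \<Omega> \<Longrightarrow> laplacian (radial_ext \<phi>) x = (?V x - \<sigma> / (norm x)\<^sup>2) * radial_ext \<phi> x"
    unfolding assms(4) by metis
  define s where "s = sqrt (?m\<^sup>2 + 4 * \<sigma>)"
  have s: "s\<^sup>2 = ?m\<^sup>2 + 4 * \<sigma>" "s \<ge> 0" using \<sigma>(2) by (simp_all add: s_def)
  define u where "u a = (\<lambda>x. norm x powr a * radial_ext \<phi> x)" for a
  define \<gamma>p where "\<gamma>p = (2 - real n + s) / 2"
  define \<gamma>m where "\<gamma>m = (2 - real n - s) / 2"
  have g: "a * (a + ?m) = \<sigma>" if "a = \<gamma>p \<or> a = \<gamma>m" for a
  proof -
    \<comment> \<open>Completing the square with m = n - 2 and t = \<plusminus>s: \<gamma> = (t - m)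
      / 2 and \<gamma> + m = (t + m) / 2.\<close>
    have h: "(t - m) / 2 * ((t - m) / 2 + m) = (t\<^sup>2 - m\<^sup>2) / 4" for t m :: real
      by (simp add: power2_eq_square field_simps)
    have "\<gamma>p = (s - ?m) / 2" "\<gamma>m = (- s - ?m) / 2" by (simp_all add: \<gamma>p_def \<gamma>m_def)
    then have "a * (a + ?m) = (s\<^sup>2 - ?m\<^sup>2) / 4"
      using that h[of s ?m] h[of "- s" ?m] by (metis power2_minus)
    then show ?thesis using s(1) by simp
  qed
  have om: "open \<Omega>" "S \<subseteq> \<Omega>" using open_cone S_cone assms(4) by auto
  have \<phi>S: "radial_ext \<phi> w = \<phi> w" if "w \<in> S" for w by (rule radial_ext_unit[OF S_norm[OF that]])
  have lapu: "laplacian (u a) x = (?V x - (\<sigma> - a * (a + ?m)) / (norm x)\<^sup>2) * u a x" if "x \<in> \<Omega>" for a x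
    using laplacian_power_solution[of \<phi> ?V \<sigma> x a] \<phi>(1) eq that
    unfolding u_def assms(4) dim by (simp add: algebra_simps)
  have Cu: "Ck_on 2 (u a) \<Omega>" for a
    using Ck_on_power_solution[of \<phi> a] \<phi>(1) unfolding u_def assms(4) by blast
  have n0: "norm x > 0" if "x \<in> \<Omega>" for x using that cone_sub assms(4) by auto
  have upos: "0 < u a x" if "x \<in> \<Omega>" for a x
    using \<phi>(2)[OF that] n0[OF that] by (simp add: u_def)
  have sol: "positive_solution \<Omega> ?V (u a)" if "a = \<gamma>p \<or> a = \<gamma>m" for a
    unfolding positive_solution_def schroedinger_def
    using Cu upos lapu[of _ a] g[OF that] by simp
  have sph: "schroedinger_sphere ?V \<phi> w = \<sigma> * \<phi> w" if w: "w \<in> S" for w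
  proof -
    have "laplace_beltrami \<phi> w = laplacian (radial_ext \<phi>) w"
      by (rule laplace_beltrami_eq[OF _ _ w S_norm[OF w]]) (use \<phi>(1) om assms(4) in auto)
    also have "\<dots> = (?V w - \<sigma>) * \<phi> w"
      using eq[of w] w om(2) S_norm[OF w] \<phi>S[OF w] by auto
    finally show ?thesis by (simp add: schroedinger_sphere_def algebra_simps)
  qed
  have indep: "a = 0 \<and> b = 0"
    if pos: "\<sigma> > - (?m\<^sup>2 / 4)" and ab: "\<forall>x\<in>\<Omega>. a * u \<gamma>p x + b * u \<gamma>m x = 0" for a b
  proof -
    have "s > 0" unfolding s_def using pos by simp
    then have gg: "\<gamma>m < \<gamma>p" by (simp add: \<gamma>p_def \<gamma>m_def)
    obtain w where w: "w \<in> S" using S_ne by blast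
    \<comment> \<open>On the ray through \<open>w\<close> the two solutions are powers of the radius
      times the same positive number; the radii 1 and 2 already separate distinct exponents.\<close>
    have w2: "2 *\<^sub>R w \<in> \<Omega>" "w \<in> \<Omega>" using cone_over_scale[of 2 w S] om(2) w assms(4) by auto
    have e: "a * u \<gamma>p w + b * u \<gamma>m w = 0" "a * u \<gamma>p (2 *\<^sub>R w) + b * u \<gamma>m (2 *\<^sub>R w) = 0" using ab w2 by blast+
    have p: "\<phi> w > 0" using \<phi>(2)[OF w2(2)] \<phi>S[OF w] by simp
    have "(a + b) * \<phi> w = 0" using e(1) by (simp add: u_def S_norm[OF w] \<phi>S[OF w] algebra_simps)
    then have ab0: "b = - a" using p by simp
    have "(a * 2 powr \<gamma>p + b * 2 powr \<gamma>m) * \<phi> w = 0"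
      using e(2) by (simp add: u_def S_norm[OF w] \<phi>S[OF w] radial_ext_scale algebra_simps)
    then have "a * (2 powr \<gamma>p - 2 powr \<gamma>m) = 0" using p ab0 by (simp add: algebra_simps)
    moreover have "2 powr \<gamma>m < 2 powr \<gamma>p" using gg by simp
    ultimately show ?thesis using ab0 by simp
  qed
  have sub: "subcritical \<Omega> ?V" if pos: "\<sigma> > - (?m\<^sup>2 / 4)"
  proof (rule subcriticalI[OF om(1) _ Cu upos])
    \<comment> \<open>The midpoint of \<gamma>p and \<gamma>m, which maximises \<sigma> - a (a + n -
      2), the numerator of the Hardy weight.\<close>
    let ?a = "- ?m / 2"
    show "\<Omega> \<noteq> {}" using om(2) S_ne by blast
    show "continuous_on \<Omega> ?V" using continuous_on_hardy assms(4) by simp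
    show "continuous_on \<Omega> (\<lambda>x. (\<sigma> + ?m\<^sup>2 / 4) / (norm x)\<^sup>2)"
      using n0 by (intro continuous_intros) auto
    show "0 < (\<sigma> + ?m\<^sup>2 / 4) / (norm x)\<^sup>2" if "x \<in> \<Omega>" for x using n0[OF that] pos by simp
    have "\<sigma> - ?a * (?a + ?m) = \<sigma> + ?m\<^sup>2 / 4" by (simp add: power2_eq_square field_simps)
    then show "laplacian (u ?a) x = (?V x - (\<sigma> + ?m\<^sup>2 / 4) / (norm x)\<^sup>2) * u ?a x" if "x \<in> \<Omega>" for x
      using lapu[OF that, of ?a] by simp
  qed
  have ue: "u a = (\<lambda>x. norm x powr a * \<phi> (x /\<^sub>R norm x))" for a
    by (simp add: u_def radial_ext_def sgn_div_norm)
  have C2: "sphere_C2_on \<phi> S" using \<phi>(1) assms(4) by (simp add: sphere_C2_on_def)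
  have \<phi>pos: "\<phi> w > 0" if "w \<in> S" for w
    using \<phi>(2)[of w] \<phi>S[OF that] om(2) that by auto
  show ?thesis
  proof (rule conjI, simp add: \<sigma>(1), rule exI[of _ \<sigma>], rule exI[of _ \<gamma>p], rule exI[of _ \<gamma>m],
      rule exI[of _ \<phi>], rule exI[of _ "u \<gamma>p"], rule exI[of _ "u \<gamma>m"], intro conjI impI ballI allI)
    show "\<gamma>p = (2 - real n + sqrt (?m\<^sup>2 + 4 * \<sigma>)) / 2" "\<gamma>m = (2 - real n - sqrt (?m\<^sup>2 + 4 * \<sigma>)) / 2"
      by (simp_all only: \<gamma>p_def \<gamma>m_def s_def)
  qed (use \<sigma> C2 \<phi>pos sph sub ue indep sol in blast)+
qed

end
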